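(* Let $\vec U\in L^2_{loc}(\mathbb{R}^3)$ be a weak solution of the stationary Navier–Stokes equations $$-\Delta \vec U+(\vec U\cdot\nabla)\vec U+\nabla P=0,\qquad \operatorname{div}\vec U=0\quad\text{in }\mathbb{R}^3 .$$ If $\vec U\in L^{9/2,q}(\mathbb{R}^3)$ for some $q$ with $9/2\le q<+\infty$, then $\vec U=0$.
   Context: A weak solution is a pair $(\vec U,P)\in L^2_{loc}(\mathbb{R}^3)^3\times\mathcal D'(\mathbb{R}^3)$ satisfying the equations in the sense of distributions. For a measurable $f$ on $\mathbb{R}^3$, let $d_f(\alpha)=|\{x:|f(x)|>\alpha\}|$ (Lebesgue measure). For $1\le r<\infty$, $1\le q<\infty$, the Lorentz space $L^{r,q}(\mathbb{R}^3)$ consists of measurable $f$ with $\|f\|_{L^{r,q}}=r^{1/q}\left(\int_0^\infty(\alpha\, d_f(\alpha)^{1/r})^q\,\frac{d\alpha}{\alpha}\right)^{1/q}<\infty$; for $q=\infty$, $\|f\|_{L^{r,\infty}}=\sup_{\alpha>0}\alpha\, d_f(\alpha)^{1/r}$. For vector fields the norm is applied to $|\vec U|$. *)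

theory Defs
  imports "HOL-Analysis.Analysis"
begin

type_synonym R3 = "real^3"

definition pd :: "3 \<Rightarrow> (R3 \<Rightarrow> real) \<Rightarrow> (R3 \<Rightarrow> real)" where
  "pd i f = (\<lambda>x. frechet_derivative f (at x) (axis i 1))"

fun dpow :: "3 list \<Rightarrow> (R3 \<Rightarrow> real) \<Rightarrow> (R3 \<Rightarrow> real)" where
  "dpow [] f = f"
| "dpow (i # is) f = pd i (dpow is f)"

definition smooth_fun :: "(R3 \<Rightarrow> real) \<Rightarrow> bool" where
  "smooth_fun f \<longleftrightarrow> (\<forall>is x. dpow is f differentiable (at x))"

definition tsupport :: "(R3 \<Rightarrow> real) \<Rightarrow> R3 set" where
  "tsupport f = closure {x. f x \<noteq> 0}"

definition test_fun :: "(R3 \<Rightarrow> real) \<Rightarrow> bool" where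
  "test_fun f \<longleftrightarrow> smooth_fun f \<and> compact (tsupport f)"

definition laplacian :: "(R3 \<Rightarrow> real) \<Rightarrow> (R3 \<Rightarrow> real)" where
  "laplacian f = (\<lambda>x. \<Sum>i\<in>UNIV. dpow [i, i] f x)"

definition distribution :: "((R3 \<Rightarrow> real) \<Rightarrow> real) \<Rightarrow> bool" where
  "distribution T \<longleftrightarrow>
     (\<forall>\<phi> \<psi> a b. test_fun \<phi> \<longrightarrow> test_fun \<psi> \<longrightarrow>
        T (\<lambda>x. a * \<phi> x + b * \<psi> x) = a * T \<phi> + b * T \<psi>) \<and>
     (\<forall>K. compact K \<longrightarrow> (\<exists>C N. \<forall>\<phi>. test_fun \<phi> \<longrightarrow> tsupport \<phi> \<subseteq> K \<longrightarrow>
        \<bar>T \<phi>\<bar> \<le> C * (\<Sum>is\<in>{is. length is \<le> N}. (SUP x. \<bar>dpow is \<phi> x\<bar>))))"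

definition L2_loc :: "(R3 \<Rightarrow> R3) \<Rightarrow> bool" where
  "L2_loc U \<longleftrightarrow> U \<in> borel_measurable lebesgue \<and>
     (\<forall>K. compact K \<longrightarrow> set_integrable lebesgue K (\<lambda>x. (norm (U x))\<^sup>2))"

text \<open>Weak (distributional) solution of the stationary Navier--Stokes equations
  -\<Delta>U + (U.\<nabla>)U + \<nabla>P = 0, div U = 0, where (U.\<nabla>)U is understood as div(U \<otimes> U).\<close>
definition stationary_NS_weak :: "(R3 \<Rightarrow> R3) \<Rightarrow> ((R3 \<Rightarrow> real) \<Rightarrow> real) \<Rightarrow> bool" where
  "stationary_NS_weak U P \<longleftrightarrow> L2_loc U \<and> distribution P \<and>
     (\<forall>\<phi>. test_fun \<phi> \<longrightarrow>
        (\<forall>j. (\<integral>x. U x $ j * (- laplacian \<phi> x) \<partial>lebesgue)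
              - (\<Sum>i\<in>UNIV. \<integral>x. U x $ i * U x $ j * pd i \<phi> x \<partial>lebesgue)
              - P (pd j \<phi>) = 0) \<and>
        (\<Sum>i\<in>UNIV. \<integral>x. U x $ i * pd i \<phi> x \<partial>lebesgue) = 0)"

definition distfun :: "(R3 \<Rightarrow> R3) \<Rightarrow> real \<Rightarrow> ennreal" where
  "distfun U \<alpha> = emeasure lebesgue {x. norm (U x) > \<alpha>}"

text \<open>Membership in the Lorentz space L^{r,q}(R^3), 1 \<le> r, q < \<infinity>: finiteness of
  r^{1/q} (\<integral>_0^\<infinity> (\<alpha> d(\<alpha>)^{1/r})^q d\<alpha>/\<alpha>)^{1/q}; the positive factor r^{1/q}
  and the outer power do not affect finiteness.\<close>
definition lorentz :: "real \<Rightarrow> real \<Rightarrow> (R3 \<Rightarrow> R3) \<Rightarrow> bool" where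
  "lorentz r q U \<longleftrightarrow> U \<in> borel_measurable lebesgue \<and>
     (\<forall>\<alpha>>0. distfun U \<alpha> < \<infinity>) \<and>
     (\<integral>\<^sup>+\<alpha>\<in>{0<..}. ennreal ((\<alpha> * (enn2real (distfun U \<alpha>)) powr (1/r)) powr q / \<alpha>) \<partial>lborel) < \<infinity>"

end

theory Submission
  imports Defs
begin

text \<open>
  The Lorentz hypothesis is used only through \<open>\<integral>\<^bsub>|x| < R\<^esub> |U|\<^sup>4 = o(R\<^bsup>1/3\<^esup>)\<close>, a consequence of
  \<open>\<alpha>\<^bsup>9/2\<^esup> |{|U| > \<alpha>}| \<rightarrow> 0\<close> as \<open>\<alpha> \<rightarrow> 0\<close>, which holds because \<open>q\<close> is finite. Since \<open>9/2 > 4\<close>, everything can be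
  done with square integrals, and neither regularity theory nor pressure estimates are needed.

  On the unit scale, mollify to \<open>u = \<eta> * U\<close>. Let \<open>K\<close> be a regularised multiple of \<open>x |x|\<^sup>-\<^sup>3\<close> with
  \<open>div K = \<eta>\<close>. The antisymmetric potential \<open>a\<^sub>k\<^sub>j = K\<^sub>k * U\<^sub>j - K\<^sub>j * U\<^sub>k\<close> (formed after cutting \<open>U\<close> off)
  satisfies \<open>\<Sum>\<^sub>k \<partial>\<^sub>k a\<^sub>k\<^sub>j = u\<^sub>j\<close> up to a harmless error, and \<open>\<parallel>\<nabla>a\<parallel>\<^sub>2 \<le> C \<parallel>U\<parallel>\<^sub>2\<close> by a Caccioppoli inequality, because
  \<open>K\<close> is curl free. Testing with the divergence free field \<open>\<Sum>\<^sub>k \<partial>\<^sub>k (\<theta>\<^sup>4 a\<^sub>k\<^sub>j)\<close> eliminates the pressure.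
  The commutator \<open>\<eta> * (U\<^sub>i U\<^sub>j) - u\<^sub>i u\<^sub>j\<close> vanishes in the limit in the square mean, since \<open>U\<close> is in \<open>L\<^sup>4\<close>
  locally. This bounds \<open>\<integral>|\<nabla>U|\<^sup>2\<close> on the unit ball by \<open>\<parallel>U\<parallel>\<^sub>2\<^sup>2\<close> and \<open>\<parallel>U\<parallel>\<^sub>4\<^sup>4\<close> on a larger ball. Applied to
  \<open>\<lambda> U(\<lambda> x)\<close> with \<open>\<lambda> \<rightarrow> \<infinity>\<close> it shows \<open>\<nabla>U = 0\<close>, and the growth bound forces the constant to be zero.
\<close>

section \<open>Calculus of smooth functions\<close>

text \<open>The exponent 9/2 enters through a count of powers. For \<open>l = n^3\<close> the
  rescaled field \<open>V(x) = l U(l x)\<close> has fourth-power mass \<open>o(n^4)\<close>, hence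
  square mass \<open>o(n^2)\<close>, on a fixed ball. The convective term leaves cubic expressions
  in the local estimate; Young's inequality splits them into \<open>|V|^2 / mu\<close> and
  \<open>mu |V|^4\<close>, and \<open>mu = 1/n\<close> makes both \<open>o(n^3) = o(l)\<close>. By
  scaling, the integral of \<open>|grad V|^2\<close> over the unit ball is \<open>l\<close> times
  that of \<open>|grad U|^2\<close> over the ball of radius \<open>l\<close>, so the latter tends to
  zero. The obstacle is that a weak solution has no gradient a priori. The local estimate is
  therefore phrased by duality, as a bound on the pairing of \<open>U\<close> with derivatives of
  test functions, and is derived from mollifications with constants independent of the radius
  \<open>\<delta>\<close>. This is why the mollifier is built as the divergence of a kernel bounded
  by a fixed multiple of \<open>|x|^-2\<close> for every \<open>\<delta>\<close>.\<close>

text \<open>A class of differentiable functions closed under \<open>pd\<close> contains all iterated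
  partial derivatives of its members. Every closure property of smooth functions below is proved by
  exhibiting such a class.\<close>

lemma smooth_fun_coinduct:
  assumes "f \<in> S" "\<And>g x. g \<in> S \<Longrightarrow> g differentiable (at x)" "\<And>g i. g \<in> S \<Longrightarrow> pd i g \<in> S"
  shows "smooth_fun f"
proof -
  have "dpow is f \<in> S" for "is" by (induction "is") (auto intro: assms)
  then show ?thesis unfolding smooth_fun_def using assms(2) by blast
qed

lemma dpow_append: "dpow (is @ js) f = dpow is (dpow js f)"
  by (induction "is") auto

lemma smooth_fun_pd: "smooth_fun f \<Longrightarrow> smooth_fun (pd i f)"
  unfolding smooth_fun_def by (metis dpow.simps dpow_append)

lemma smooth_fun_differentiable: "smooth_fun f \<Longrightarrow> f differentiable (at x)"
  unfolding smooth_fun_def by (metis dpow.simps(1))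

lemma pd_eqI: "(f has_derivative f') (at x) \<Longrightarrow> pd i f x = f' (axis i 1)"
  unfolding pd_def using frechet_derivative_at by metis

lemma has_derivative_pd:
  assumes "f differentiable (at x)"
  shows "(f has_derivative (\<lambda>h. \<Sum>i\<in>UNIV. h $ i * pd i f x)) (at x)"
proof -
  have d: "(f has_derivative frechet_derivative f (at x)) (at x)"
    using assms frechet_derivative_works by blast
  then interpret D: linear "frechet_derivative f (at x)" by (rule has_derivative_linear)
  have "frechet_derivative f (at x) h = (\<Sum>i\<in>UNIV. h $ i * pd i f x)" for h :: R3
  proof -
    have "frechet_derivative f (at x) h = frechet_derivative f (at x) (\<Sum>i\<in>UNIV. (h $ i) *s axis i 1)"
      by (simp add: basis_expansion)
    also have "\<dots> = (\<Sum>i\<in>UNIV. h $ i * pd i f x)"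
      unfolding D.sum pd_def by (simp add: D.scale scalar_mult_eq_scaleR)
    finally show ?thesis .
  qed
  then have "frechet_derivative f (at x) = (\<lambda>h. \<Sum>i\<in>UNIV. h $ i * pd i f x)" by (rule ext)
  then show ?thesis using d by simp
qed

lemma smooth_has_derivative:
  "smooth_fun f \<Longrightarrow> (f has_derivative (\<lambda>h. \<Sum>i\<in>UNIV. h $ i * pd i f x)) (at x)"
  by (simp add: has_derivative_pd smooth_fun_differentiable)

lemma smooth_fun_continuous: "smooth_fun f \<Longrightarrow> continuous_on S f"
  by (meson smooth_has_derivative continuous_at_imp_continuous_on has_derivative_continuous)

lemma smooth_fun_measurable: "smooth_fun f \<Longrightarrow> f \<in> borel_measurable borel"
  using smooth_fun_continuous[of f UNIV] by (rule borel_measurable_continuous_onI)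

text \<open>\<open>pd\<close> takes whatever \<open>frechet_derivative\<close> selects. The two
  functions have the same candidate derivatives at \<open>x\<close>, so the selections agree even
  where neither function is differentiable.\<close>

lemma pd_cong_open:
  assumes "open S" "x \<in> S" "\<And>y. y \<in> S \<Longrightarrow> f y = g y"
  shows "pd i f x = pd i g x"
proof -
  have "(f has_derivative D) (at x) \<longleftrightarrow> (g has_derivative D) (at x)" for D
    using has_derivative_transform_within_open[OF _ assms(1,2), where f=f and f'=D and g=g]
      has_derivative_transform_within_open[OF _ assms(1,2), where f=g and f'=D and g=f] assms(3) by auto
  then show ?thesis unfolding pd_def frechet_derivative_def by simp
qed

lemma axis_sum: "(\<Sum>i\<in>UNIV. axis j (1::real) $ i * c i) = c (j::3)"
proof -
  have "(\<Sum>i\<in>UNIV. axis j (1::real) $ i * c i) = (\<Sum>i\<in>UNIV. if i = j then c i else 0)"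
    by (rule sum.cong) (auto simp: axis_def)
  then show ?thesis by simp
qed

lemma pd_const [simp]: "pd i (\<lambda>x. c) = (\<lambda>x. 0)"
  by (rule ext, subst pd_eqI[OF has_derivative_const]) auto

lemma smooth_const [simp]: "smooth_fun (\<lambda>x. c)"
  by (rule smooth_fun_coinduct[where S="range (\<lambda>c x. c)"]) auto

lemma pd_add:
  assumes "f differentiable (at x)" "g differentiable (at x)"
  shows "pd i (\<lambda>x. f x + g x) x = pd i f x + pd i g x"
  by (subst pd_eqI[OF has_derivative_add[OF has_derivative_pd has_derivative_pd]])
    (use assms axis_sum in auto)

lemma pd_mult:
  assumes "f differentiable (at x)" "g differentiable (at x)"
  shows "pd i (\<lambda>x. f x * g x) x = pd i f x * g x + f x * pd i g x"
  by (subst pd_eqI[OF has_derivative_mult[OF has_derivative_pd has_derivative_pd]])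
    (use assms axis_sum in auto)

lemma smooth_add [intro]:
  assumes "smooth_fun f" "smooth_fun g" shows "smooth_fun (\<lambda>x. f x + g x)"
proof (rule smooth_fun_coinduct)
  let ?S = "{\<lambda>x. f x + g x |f g. smooth_fun f \<and> smooth_fun g}"
  show "(\<lambda>x. f x + g x) \<in> ?S" using assms by auto
  show "g differentiable (at x)" if "g \<in> ?S" for g x
    using that by (auto intro!: differentiable_add intro: smooth_fun_differentiable)
  show "pd i h \<in> ?S" if "h \<in> ?S" for h i
  proof -
    obtain f g where h: "h = (\<lambda>x. f x + g x)" "smooth_fun f" "smooth_fun g"
      using \<open>h \<in> ?S\<close> unfolding mem_Collect_eq by (elim exE conjE)
    have "pd i h = (\<lambda>x. pd i f x + pd i g x)"
      unfolding h(1) by (rule ext, rule pd_add) (auto intro: h smooth_fun_differentiable)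
    then show ?thesis using h smooth_fun_pd by auto
  qed
qed

text \<open>Plain products are not stable under \<open>pd\<close>, because the product rule yields a
  sum; closing under sums gives a class fit for the coinduction.\<close>

inductive_set prods :: "(R3 \<Rightarrow> real) set" where
  base: "smooth_fun f \<Longrightarrow> smooth_fun g \<Longrightarrow> (\<lambda>x. f x * g x) \<in> prods"
| plus: "f \<in> prods \<Longrightarrow> g \<in> prods \<Longrightarrow> (\<lambda>x. f x + g x) \<in> prods"

lemma smooth_mult [intro]:
  assumes "smooth_fun f" "smooth_fun g" shows "smooth_fun (\<lambda>x. f x * g x)"
proof (rule smooth_fun_coinduct)
  show "(\<lambda>x. f x * g x) \<in> prods" using assms by (rule prods.base)
  show d: "g differentiable (at x)" if "g \<in> prods" for g x
    using that by induction (auto intro!: differentiable_add differentiable_mult intro: smooth_fun_differentiable)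
  show "pd i h \<in> prods" if "h \<in> prods" for h i
    using that
  proof induction
    case (base f g)
    have "pd i (\<lambda>x. f x * g x) = (\<lambda>x. pd i f x * g x + f x * pd i g x)"
      by (rule ext, rule pd_mult) (auto intro: base smooth_fun_differentiable)
    then show ?case using base by (auto intro!: prods.intros smooth_fun_pd)
  next
    case (plus f g)
    have "pd i (\<lambda>x. f x + g x) = (\<lambda>x. pd i f x + pd i g x)"
      by (rule ext, rule pd_add) (auto intro: plus d)
    then show ?case using plus by (auto intro!: prods.intros)
  qed
qed

lemma smooth_sum [intro]:
  "(\<And>k. k \<in> A \<Longrightarrow> smooth_fun (f k)) \<Longrightarrow> smooth_fun (\<lambda>x. \<Sum>k\<in>A. f k x)"
  by (induction A rule: infinite_finite_induct) auto

lemma smooth_cmult: "smooth_fun f \<Longrightarrow> smooth_fun (\<lambda>x. c * f x)" by (rule smooth_mult) auto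
lemma smooth_minus [intro]: "smooth_fun f \<Longrightarrow> smooth_fun (\<lambda>x. - f x)"
  using smooth_cmult[of f "-1"] by simp
lemma smooth_diff [intro]: "smooth_fun f \<Longrightarrow> smooth_fun g \<Longrightarrow> smooth_fun (\<lambda>x. f x - g x)"
  using smooth_add[of f "\<lambda>x. - g x"] by auto
lemma smooth_power [intro]: "smooth_fun f \<Longrightarrow> smooth_fun (\<lambda>x. f x ^ n)"
  by (induction n) auto

lemma smooth_divide: "smooth_fun f \<Longrightarrow> smooth_fun (\<lambda>x. f x / c)"
  using smooth_cmult[of f "1 / c"] by simp

lemma pd_smooth_add: "smooth_fun f \<Longrightarrow> smooth_fun g \<Longrightarrow> pd i (\<lambda>x. f x + g x) = (\<lambda>x. pd i f x + pd i g x)"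
  by (rule ext, rule pd_add) (auto intro: smooth_fun_differentiable)
lemma pd_smooth_mult: "smooth_fun f \<Longrightarrow> smooth_fun g \<Longrightarrow> pd i (\<lambda>x. f x * g x) = (\<lambda>x. pd i f x * g x + f x * pd i g x)"
  by (rule ext, rule pd_mult) (auto intro: smooth_fun_differentiable)
lemma pd_smooth_cmult: "smooth_fun f \<Longrightarrow> pd i (\<lambda>x. c * f x) = (\<lambda>x. c * pd i f x)"
  by (subst pd_smooth_mult) auto
lemma pd_smooth_minus: "smooth_fun f \<Longrightarrow> pd i (\<lambda>x. - f x) = (\<lambda>x. - pd i f x)"
  using pd_smooth_cmult[of f i "-1"] by simp
lemma pd_smooth_diff: "smooth_fun f \<Longrightarrow> smooth_fun g \<Longrightarrow> pd i (\<lambda>x. f x - g x) = (\<lambda>x. pd i f x - pd i g x)"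
  using pd_smooth_add[of f "\<lambda>x. - g x" i] by (simp add: pd_smooth_minus smooth_minus)
lemma pd_smooth_sum:
  "(\<And>k. k \<in> A \<Longrightarrow> smooth_fun (f k)) \<Longrightarrow> pd i (\<lambda>x. \<Sum>k\<in>A. f k x) = (\<lambda>x. \<Sum>k\<in>A. pd i (f k) x)"
  by (induction A rule: infinite_finite_induct) (auto simp: pd_smooth_add smooth_sum)

lemma pd_smooth_power:
  "smooth_fun f \<Longrightarrow> pd i (\<lambda>x. f x ^ Suc n) = (\<lambda>x. real (Suc n) * f x ^ n * pd i f x)"
proof (induction n)
  case (Suc n)
  have "pd i (\<lambda>x. f x * f x ^ Suc n) = (\<lambda>x. real (Suc (Suc n)) * f x ^ Suc n * pd i f x)"
    by (subst pd_smooth_mult) (use Suc in \<open>auto simp: algebra_simps smooth_power\<close>)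
  then show ?case by simp
qed auto

lemma pd_affine:
  assumes "smooth_fun f"
  shows "pd i (\<lambda>x. a * f (c *\<^sub>R x + b)) = (\<lambda>x. a * c * pd i f (c *\<^sub>R x + b))"
proof
  fix x
  have "((\<lambda>x. a * f (c *\<^sub>R x + b)) has_derivative
      (\<lambda>h. a * (\<Sum>j\<in>UNIV. (c *\<^sub>R h) $ j * pd j f (c *\<^sub>R x + b)))) (at x)"
    by (rule has_derivative_mult_right, rule has_derivative_compose[OF _ smooth_has_derivative[OF assms]])
      (auto intro!: derivative_eq_intros)
  then have "pd i (\<lambda>x. a * f (c *\<^sub>R x + b)) x
      = a * (\<Sum>j\<in>UNIV. axis i 1 $ j * (c * pd j f (c *\<^sub>R x + b)))"
    by (subst pd_eqI, assumption) (simp add: mult_ac)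
  then show "pd i (\<lambda>x. a * f (c *\<^sub>R x + b)) x = a * c * pd i f (c *\<^sub>R x + b)"
    unfolding axis_sum by simp
qed

lemma smooth_affine:
  assumes "smooth_fun f" shows "smooth_fun (\<lambda>x. a * f (c *\<^sub>R x + b))"
proof (rule smooth_fun_coinduct)
  let ?S = "{\<lambda>x. a * f (c *\<^sub>R x + b) |f a. smooth_fun f}"
  show "(\<lambda>x. a * f (c *\<^sub>R x + b)) \<in> ?S" using assms by auto
  show "g differentiable (at x)" if "g \<in> ?S" for g x
  proof -
    obtain f a where g: "g = (\<lambda>x. a * f (c *\<^sub>R x + b))" and f: "smooth_fun f"
      using \<open>g \<in> ?S\<close> unfolding mem_Collect_eq by (elim exE conjE)
    have "((\<lambda>x. a * f (c *\<^sub>R x + b)) has_derivative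
      (\<lambda>h. a * (\<Sum>j\<in>UNIV. (c *\<^sub>R h) $ j * pd j f (c *\<^sub>R x + b)))) (at x)"
      by (rule has_derivative_mult_right, rule has_derivative_compose[OF _ smooth_has_derivative[OF f]])
      (auto intro!: derivative_eq_intros)
    then show ?thesis unfolding g differentiable_def by blast
  qed
  show "pd i h \<in> ?S" if "h \<in> ?S" for h i
    using that by (fastforce simp: pd_affine intro: smooth_fun_pd)
qed

lemma smooth_reflect: "smooth_fun f \<Longrightarrow> smooth_fun (\<lambda>y. f (x - y))"
  using smooth_affine[of f 1 "-1" x] by simp
lemma pd_reflect: "smooth_fun f \<Longrightarrow> pd i (\<lambda>y. f (x - y)) = (\<lambda>y. - pd i f (x - y))"
  using pd_affine[of f i 1 "-1" x] by simp

lemma smooth_component [simp]: "smooth_fun (\<lambda>x. x $ j)"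
  and pd_component: "pd i (\<lambda>x. x $ j) = (\<lambda>x. if i = j then 1 else 0)"
proof -
  have d: "((\<lambda>x. x $ j) has_derivative (\<lambda>h. h $ j)) (at x)" for x :: R3
    by (rule bounded_linear_imp_has_derivative) (rule bounded_linear_vec_nth)
  show p: "pd i (\<lambda>x. x $ j) = (\<lambda>x. if i = j then 1 else 0)" for i
    by (rule ext, subst pd_eqI[OF d]) (auto simp: axis_def)
  show "smooth_fun (\<lambda>x. x $ j)"
    by (rule smooth_fun_coinduct[where S="insert (\<lambda>x. x $ j) (range (\<lambda>c x. c))"])
      (use d in \<open>auto simp: p intro: differentiableI\<close>)
qed

section \<open>Smooth functions of one variable and composition with them\<close>

text \<open>Smoothness as membership in some class stable under differentiation, so that no iterated
  derivative has to be named.\<close>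

definition smooth1 :: "(real \<Rightarrow> real) \<Rightarrow> bool" where
  "smooth1 h \<longleftrightarrow> (\<exists>S. h \<in> S \<and> (\<forall>f\<in>S. \<exists>f'\<in>S. \<forall>x. (f has_real_derivative f' x) (at x)))"

lemma smooth1_coinduct:
  "h \<in> S \<Longrightarrow> (\<And>f. f \<in> S \<Longrightarrow> \<exists>f'\<in>S. \<forall>x. (f has_real_derivative f' x) (at x)) \<Longrightarrow> smooth1 h"
  unfolding smooth1_def by blast

lemma smooth1_deriv: assumes "smooth1 h"
  shows "(h has_real_derivative deriv h x) (at x)" "smooth1 (deriv h)"
proof -
  obtain S f' where S: "h \<in> S" "\<forall>f\<in>S. \<exists>f'\<in>S. \<forall>x. (f has_real_derivative f' x) (at x)"
    and f': "f' \<in> S" "\<And>x. (h has_real_derivative f' x) (at x)"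
    using assms unfolding smooth1_def by blast
  have e: "deriv h = f'" using f'(2) DERIV_imp_deriv by blast
  show "(h has_real_derivative deriv h x) (at x)" using f' e by simp
  show "smooth1 (deriv h)" unfolding e smooth1_def using S f' by blast
qed

lemma smooth1_step: "(\<And>x. (h has_real_derivative h' x) (at x)) \<Longrightarrow> smooth1 h' \<Longrightarrow> smooth1 h"
  by (rule smooth1_coinduct[where S="insert h (Collect smooth1)"]) (use smooth1_deriv in blast)+

lemma smooth1_mult:
  assumes "smooth1 f" "smooth1 g" shows "smooth1 (\<lambda>x. f x * g x)"
proof -
  \<comment> \<open>Differentiating a sum of \<open>n\<close> products gives \<open>2n\<close>
    products: below, the first \<open>n\<close> indices carry the derivative on the left factor and
    the last \<open>n\<close> on the right one.\<close>
  define S where "S = {\<lambda>x. \<Sum>k<n. F k x * G k x |(n::nat) F G. \<forall>k. smooth1 (F k) \<and> smooth1 (G k)}"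
  show ?thesis
  proof (rule smooth1_coinduct[where S=S])
    show "(\<lambda>x. f x * g x) \<in> S" unfolding S_def
      by (rule CollectI, rule exI[of _ 1], rule exI[of _ "\<lambda>_. f"], rule exI[of _ "\<lambda>_. g"]) (use assms in auto)
    fix h assume "h \<in> S"
    then obtain n and F G :: "nat \<Rightarrow> real \<Rightarrow> real"
      where h: "h = (\<lambda>x. \<Sum>k<n. F k x * G k x)" "\<And>k. smooth1 (F k)" "\<And>k. smooth1 (G k)"
      unfolding S_def by auto
    define F' where "F' k = (if k < n then deriv (F k) else F (k - n))" for k
    define G' where "G' k = (if k < n then G k else deriv (G (k - n)))" for k
    have e: "(\<Sum>k<n+n. F' k x * G' k x) = (\<Sum>k<n. deriv (F k) x * G k x) + (\<Sum>k<n. F k x * deriv (G k) x)" for x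
    proof -
      have "{..<n+n} = {..<n} \<union> {n..<n+n}" by auto
      then have "(\<Sum>k<n+n. F' k x * G' k x) = (\<Sum>k<n. F' k x * G' k x) + (\<Sum>k=n..<n+n. F' k x * G' k x)"
        by (simp add: sum.union_disjoint ivl_disj_int)
      also have "(\<Sum>k=n..<n+n. F' k x * G' k x) = (\<Sum>k<n. F' (k+n) x * G' (k+n) x)"
        using sum.shift_bounds_nat_ivl[of "\<lambda>k. F' k x * G' k x" 0 n n] by (simp add: atLeast0LessThan)
      finally show ?thesis by (simp add: F'_def G'_def)
    qed
    have "(\<lambda>x. \<Sum>k<n+n. F' k x * G' k x) \<in> S"
      unfolding S_def mem_Collect_eq
      by (intro exI[of _ "n + n"] exI[of _ F'] exI[of _ G']) (use h smooth1_deriv(2) in \<open>auto simp: F'_def G'_def\<close>)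
    moreover have "(h has_real_derivative (\<Sum>k<n+n. F' k x * G' k x)) (at x)" for x
      unfolding e h(1) sum.distrib[symmetric]
      by (rule DERIV_sum) (auto intro!: derivative_eq_intros smooth1_deriv(1) h)
    ultimately show "\<exists>f'\<in>S. \<forall>x. (h has_real_derivative f' x) (at x)"
      by (auto intro!: bexI[of _ "\<lambda>x. \<Sum>k<n+n. F' k x * G' k x"])
  qed
qed

lemma smooth1_const: "smooth1 (\<lambda>x. c)"
  by (rule smooth1_coinduct[where S="range (\<lambda>c x. c)"]) (auto intro!: derivative_eq_intros)

lemma smooth1_affine: assumes "smooth1 f" shows "smooth1 (\<lambda>x. f (a * x + b))"
proof (rule smooth1_coinduct[where S="{\<lambda>x. c * f (a * x + b) |c f. smooth1 f}"])
  show "(\<lambda>x. f (a * x + b)) \<in> {\<lambda>x. c * f (a * x + b) |c f. smooth1 f}"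
    using assms by (auto intro!: exI[of _ 1] exI[of _ f])
  fix h assume "h \<in> {\<lambda>x. c * f (a * x + b) |c f. smooth1 f}"
  then obtain c f where h: "h = (\<lambda>x. c * f (a * x + b))" "smooth1 f" by auto
  have "(h has_real_derivative (c * a) * deriv f (a * x + b)) (at x)" for x
    unfolding h by (auto intro!: derivative_eq_intros DERIV_chain2[OF smooth1_deriv(1)[OF h(2)]])
  moreover have "(\<lambda>x. (c * a) * deriv f (a * x + b)) \<in> {\<lambda>x. c * f (a * x + b) |c f. smooth1 f}"
    using smooth1_deriv(2)[OF h(2)] by blast
  ultimately show "\<exists>f'\<in>{\<lambda>x. c * f (a * x + b) |c f. smooth1 f}. \<forall>x. (h has_real_derivative f' x) (at x)"
    by (intro bexI[of _ "\<lambda>x. (c * a) * deriv f (a * x + b)"]) auto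
qed

text \<open>The chain rule replaces \<open>h\<close> by its derivative and multiplies the inner
  derivative into \<open>g\<close>, so the outer function has to vary within the class too.\<close>

inductive_set comps :: "(R3 \<Rightarrow> real) set" where
  base: "smooth1 h \<Longrightarrow> smooth_fun f \<Longrightarrow> smooth_fun g \<Longrightarrow> (\<lambda>x. h (f x) * g x) \<in> comps"
| plus: "f \<in> comps \<Longrightarrow> g \<in> comps \<Longrightarrow> (\<lambda>x. f x + g x) \<in> comps"

lemma differentiable_smooth1_compose:
  assumes "smooth1 h" "smooth_fun f"
  shows "((\<lambda>x. h (f x)) has_derivative (\<lambda>d. deriv h (f x) * (\<Sum>i\<in>UNIV. d $ i * pd i f x))) (at x)"
  using has_derivative_compose[OF smooth_has_derivative[OF assms(2)]
      smooth1_deriv(1)[OF assms(1), unfolded has_field_derivative_def]] by simp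

lemma pd_compose:
  assumes "smooth1 h" "smooth_fun f"
  shows "pd i (\<lambda>x. h (f x)) = (\<lambda>x. deriv h (f x) * pd i f x)"
  by (rule ext, subst pd_eqI[OF differentiable_smooth1_compose[OF assms]]) (simp add: axis_sum)

lemma smooth_compose:
  assumes "smooth1 h" "smooth_fun f" shows "smooth_fun (\<lambda>x. h (f x))"
proof (rule smooth_fun_coinduct)
  show "(\<lambda>x. h (f x)) \<in> comps" using comps.base[OF assms smooth_const[of 1]] by simp
  have b: "(\<lambda>x. h (f x)) differentiable (at x)" if "smooth1 h" "smooth_fun f" for h f x
    using differentiable_smooth1_compose[OF that] unfolding differentiable_def by blast
  show d: "g differentiable (at x)" if "g \<in> comps" for g x
    using that by induction (auto intro!: differentiable_add differentiable_mult intro: b smooth_fun_differentiable)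
  show "pd i h \<in> comps" if "h \<in> comps" for h i
    using that
  proof induction
    case (base h f g)
    have "pd i (\<lambda>x. h (f x) * g x) = (\<lambda>x. deriv h (f x) * (pd i f x * g x) + h (f x) * pd i g x)"
      by (rule ext, subst pd_mult) (auto intro: base smooth_fun_differentiable b simp: pd_compose base)
    also have "\<dots> \<in> comps"
      by (rule comps.plus; rule comps.base) (use base smooth1_deriv(2) in \<open>auto intro: smooth_fun_pd smooth_mult\<close>)
    finally show ?case .
  next
    case (plus f g)
    have "pd i (\<lambda>x. f x + g x) = (\<lambda>x. pd i f x + pd i g x)"
      by (rule ext, rule pd_add) (auto intro: plus d)
    then show ?case using plus by (auto intro!: comps.intros)
  qed
qed

lemma norm_sq_sum: "(norm (x::R3))\<^sup>2 = (\<Sum>i\<in>UNIV. (x $ i)\<^sup>2)"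
  by (simp add: norm_vec_def L2_set_def sum_nonneg)

lemma smooth_norm_sq [simp]: "smooth_fun (\<lambda>x. (norm x)\<^sup>2)"
  unfolding norm_sq_sum by (auto intro!: smooth_sum smooth_power)

lemma pd_norm_sq: "pd i (\<lambda>x. (norm x)\<^sup>2) = (\<lambda>x. 2 * x $ i)"
proof -
  have "pd i (\<lambda>x. (norm x)\<^sup>2) = (\<lambda>x. \<Sum>k\<in>UNIV. pd i (\<lambda>x. (x $ k) ^ Suc 1) x)"
    unfolding norm_sq_sum by (subst pd_smooth_sum) (auto intro!: smooth_power simp: numeral_2_eq_2)
  also have "\<dots> = (\<lambda>x. \<Sum>k\<in>UNIV. if k = i then 2 * x $ i else 0)"
    unfolding pd_smooth_power[OF smooth_component] pd_component
    by (intro ext sum.cong) auto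
  finally show ?thesis by simp
qed

section \<open>Symmetry of second partial derivatives\<close>

lemma has_real_derivative_line:
  assumes "smooth_fun f"
  shows "((\<lambda>t. f (x + t *\<^sub>R axis i 1)) has_real_derivative pd i f (x + t *\<^sub>R axis i 1)) (at t)"
proof -
  have "((\<lambda>t. f (x + t *\<^sub>R axis i 1)) has_derivative
     (\<lambda>d. \<Sum>j\<in>UNIV. (d *\<^sub>R axis i 1) $ j * pd j f (x + t *\<^sub>R axis i 1))) (at t)"
    by (rule has_derivative_compose[OF _ smooth_has_derivative[OF assms]]) (auto intro!: derivative_eq_intros)
  moreover have "(\<Sum>j\<in>UNIV. (d *\<^sub>R axis i 1) $ j * pd j f (x + t *\<^sub>R axis i 1)) = d * pd i f (x + t *\<^sub>R axis i 1)" for d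
    using axis_sum[of i "\<lambda>j. pd j f (x + t *\<^sub>R axis i 1)"]
    by (simp add: mult.assoc sum_distrib_left[symmetric])
  moreover have "(*) (pd i f (x + t *\<^sub>R axis i 1)) = (\<lambda>d. d * pd i f (x + t *\<^sub>R axis i 1))"
    by (auto simp: fun_eq_iff)
  ultimately show ?thesis
    unfolding has_field_derivative_def by simp
qed

text \<open>Both mixed derivatives are limits of the same second difference quotient, by applying the
  mean value theorem in the two orders.\<close>
lemma second_difference:
  assumes f: "smooth_fun f" and h: "h > 0"
  shows "\<exists>y. norm (y - x) \<le> 2 * h \<and>
    f (x + h *\<^sub>R axis i 1 + h *\<^sub>R axis j 1) - f (x + h *\<^sub>R axis i 1) - f (x + h *\<^sub>R axis j 1) + f x
      = h * h * pd j (pd i f) y"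
proof -
  define g where "g t = f (x + h *\<^sub>R axis j 1 + t *\<^sub>R axis i 1) - f (x + t *\<^sub>R axis i 1)" for t
  have "\<exists>s. 0 < s \<and> s < h \<and> g h - g 0 = (h - 0) * (pd i f (x + h *\<^sub>R axis j 1 + s *\<^sub>R axis i 1) - pd i f (x + s *\<^sub>R axis i 1))"
    unfolding g_def by (rule MVT2[OF h]) (intro DERIV_diff has_real_derivative_line f)
  then obtain s where s: "0 < s" "s < h"
    "g h - g 0 = h * (pd i f (x + s *\<^sub>R axis i 1 + h *\<^sub>R axis j 1) - pd i f (x + s *\<^sub>R axis i 1))"
    by (auto simp: algebra_simps)
  have "\<exists>t. 0 < t \<and> t < h \<and> pd i f (x + s *\<^sub>R axis i 1 + h *\<^sub>R axis j 1) - pd i f (x + s *\<^sub>R axis i 1 + 0 *\<^sub>R axis j 1)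
     = (h - 0) * pd j (pd i f) (x + s *\<^sub>R axis i 1 + t *\<^sub>R axis j 1)"
    by (rule MVT2[OF h]) (intro has_real_derivative_line smooth_fun_pd f)
  then obtain t where t: "0 < t" "t < h" "pd i f (x + s *\<^sub>R axis i 1 + h *\<^sub>R axis j 1) - pd i f (x + s *\<^sub>R axis i 1)
     = h * pd j (pd i f) (x + s *\<^sub>R axis i 1 + t *\<^sub>R axis j 1)" by auto
  show ?thesis
  proof (rule exI[of _ "x + s *\<^sub>R axis i 1 + t *\<^sub>R axis j 1"], intro conjI)
    have "norm (s *\<^sub>R axis i (1::real) + t *\<^sub>R axis j 1 :: R3) \<le> s + t"
      by (rule norm_triangle_le) (use s t in \<open>simp add: norm_axis_1\<close>)
    then show "norm (x + s *\<^sub>R axis i 1 + t *\<^sub>R axis j 1 - x) \<le> 2 * h" using s t by (simp add: add.assoc)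
    show "f (x + h *\<^sub>R axis i 1 + h *\<^sub>R axis j 1) - f (x + h *\<^sub>R axis i 1) - f (x + h *\<^sub>R axis j 1) + f x
      = h * h * pd j (pd i f) (x + s *\<^sub>R axis i 1 + t *\<^sub>R axis j 1)"
      using s(3) unfolding t(3) by (simp add: g_def algebra_simps)
  qed
qed

lemma pd_commute:
  assumes "smooth_fun f" shows "pd i (pd j f) = pd j (pd i f)"
proof
  fix x
  define h where "h n = 1 / real (Suc n)" for n
  have hp: "h n > 0" for n by (simp add: h_def)
  have h0: "h \<longlonglongrightarrow> 0" unfolding h_def by (rule LIMSEQ_Suc, rule lim_1_over_n)
  define D where "D n = (f (x + h n *\<^sub>R axis i 1 + h n *\<^sub>R axis j 1) - f (x + h n *\<^sub>R axis i 1) - f (x + h n *\<^sub>R axis j 1) + f x)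
     / (h n * h n)" for n
  \<comment> \<open>The second difference is unchanged when \<open>i\<close> and \<open>j\<close>
    are swapped, so a single sequence has both mixed derivatives as its limit.\<close>
  have lim: "D \<longlonglongrightarrow> pd b (pd a f) x" if "a = i \<and> b = j \<or> a = j \<and> b = i" for a b
  proof -
    have "\<exists>y. norm (y - x) \<le> 2 * h n \<and> D n = pd b (pd a f) y" for n
      using second_difference[OF assms hp[of n], of x a b] that hp[of n]
      by (auto simp: D_def field_simps add.commute add.left_commute)
    then obtain y where y: "\<And>n. norm (y n - x) \<le> 2 * h n" "\<And>n. D n = pd b (pd a f) (y n)" by metis
    have "(\<lambda>n. y n - x) \<longlonglongrightarrow> 0"
      by (rule Lim_null_comparison[where g="\<lambda>n. 2 * h n"]) (use y h0 in \<open>auto intro: tendsto_mult_right_zero\<close>)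
    then have "y \<longlonglongrightarrow> x" by (simp add: LIM_zero_iff)
    moreover have "isCont (pd b (pd a f)) x"
      using smooth_fun_continuous[of "pd b (pd a f)" UNIV] assms
      by (simp add: smooth_fun_pd continuous_on_eq_continuous_at)
    ultimately show ?thesis unfolding y(2) by (rule isCont_tendsto_compose[rotated])
  qed
  show "pd i (pd j f) x = pd j (pd i f) x"
    using LIMSEQ_unique[OF lim[of i j] lim[of j i]] by simp
qed

section \<open>Functions of bounded support\<close>

lemma test_funI:
  assumes "smooth_fun f" "\<And>x. norm x > r \<Longrightarrow> f x = 0" shows "test_fun f"
proof -
  have "{x. f x \<noteq> 0} \<subseteq> cball 0 r" using assms(2) by (force simp: not_le[symmetric])
  then have "bounded {x. f x \<noteq> 0}" using bounded_cball bounded_subset by blast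
  then show ?thesis unfolding test_fun_def tsupport_def
    using assms(1) by (simp add: compact_closure)
qed

lemma test_fun_bounded_support:
  assumes "test_fun f" obtains r where "r > 0" "\<And>x. norm x > r \<Longrightarrow> f x = 0"
proof -
  have "bounded (closure {x. f x \<noteq> 0})"
    using assms unfolding test_fun_def tsupport_def by (simp add: compact_imp_bounded)
  then obtain r where "r > 0" "\<forall>x\<in>closure {x. f x \<noteq> 0}. norm x \<le> r" using bounded_pos by blast
  then show ?thesis using that[of r] closure_subset by (metis (mono_tags, lifting) mem_Collect_eq not_le subsetD)
qed

lemma pd_outside:
  assumes "\<And>x. norm x > r \<Longrightarrow> f x = 0" "norm x > r" shows "pd i f x = 0"
proof -
  have "pd i f x = pd i (\<lambda>x. 0) x"
    by (rule pd_cong_open[where S="- cball 0 r"]) (use assms in auto)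
  then show ?thesis by simp
qed

section \<open>Integration by parts and convolution\<close>

lemma nn_integral_affine:
  assumes [measurable]: "(f :: R3 \<Rightarrow> ennreal) \<in> borel_measurable borel" and c: "c \<noteq> 0"
  shows "(\<integral>\<^sup>+x. f x \<partial>lborel) = ennreal (\<bar>c\<bar> ^ 3) * (\<integral>\<^sup>+x. f (t + c *\<^sub>R x) \<partial>lborel)"
proof -
  have "(\<integral>\<^sup>+x. f x \<partial>lborel)
      = (\<integral>\<^sup>+x. f x \<partial>density (distr lborel borel (\<lambda>x. t + c *\<^sub>R x)) (\<lambda>_. ennreal (\<bar>c\<bar> ^ 3)))"
    by (subst lborel_affine[OF c, of t]) (simp add: ennreal_power)
  then show ?thesis
    by (simp add: nn_integral_density nn_integral_distr nn_integral_cmult)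
qed

lemma integrable_affine:
  assumes f: "(f :: R3 \<Rightarrow> real) \<in> borel_measurable borel" and c: "c \<noteq> 0"
  shows "integrable lborel (\<lambda>x. f (t + c *\<^sub>R x)) \<longleftrightarrow> integrable lborel f"
proof -
  note [measurable] = f
  have "ennreal (\<bar>c\<bar> ^ 3) \<noteq> 0" "ennreal (\<bar>c\<bar> ^ 3) \<noteq> top" using c by auto
  then show ?thesis
    unfolding integrable_iff_bounded
    using nn_integral_affine[OF _ c, of "\<lambda>x. ennreal (norm (f x))" t]
    by (auto simp: ennreal_mult_less_top top.not_eq_extremum ennreal_zero_less_mult_iff)
qed

lemma integral_affine:
  assumes f: "(f :: R3 \<Rightarrow> real) \<in> borel_measurable borel" and c: "c \<noteq> 0"
  shows "(\<integral>x. f x \<partial>lborel) = \<bar>c\<bar> ^ 3 * (\<integral>x. f (t + c *\<^sub>R x) \<partial>lborel)"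
proof -
  note [measurable] = f
  have "(\<integral>x. f x \<partial>lborel)
      = (\<integral>x. f x \<partial>density (distr lborel borel (\<lambda>x. t + c *\<^sub>R x)) (\<lambda>_. ennreal (\<bar>c\<bar> ^ 3)))"
    by (subst lborel_affine[OF c, of t]) (simp add: ennreal_power)
  then show ?thesis
    by (simp add: integral_density integral_distr)
qed

lemma integrable_continuous_bounded_support:
  assumes "continuous_on UNIV f" "\<And>x. norm x > r \<Longrightarrow> f x = 0"
  shows "integrable lborel (f :: R3 \<Rightarrow> real)"
proof -
  have "integrable lborel (\<lambda>x. indicator (cball 0 r) x *\<^sub>R f x)"
    by (rule borel_integrable_compact) (use assms continuous_on_subset[OF assms(1)] in auto)
  moreover have "(\<lambda>x. indicator (cball 0 r) x *\<^sub>R f x) = f"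
    using assms(2) by (auto simp: indicator_def fun_eq_iff not_le)
  ultimately show ?thesis by simp
qed

text \<open>Partial derivatives are bounded on the compact ball, and its convexity turns this into a
  Lipschitz bound by the mean value inequality. One constant for all three purposes supplies the
  domination when convolutions are differentiated.\<close>

lemma smooth_bounds:
  assumes "smooth_fun f"
  shows "\<exists>L\<ge>0. (\<forall>a\<in>cball 0 r. \<bar>f a\<bar> \<le> L) \<and> (\<forall>a\<in>cball 0 r. \<forall>h. \<bar>\<Sum>i\<in>UNIV. h $ i * pd i f a\<bar> \<le> L * norm h) \<and>
    (\<forall>a\<in>cball 0 r. \<forall>b\<in>cball 0 r. \<bar>f b - f a\<bar> \<le> L * norm (b - a))"
proof -
  have "\<exists>M. \<forall>a\<in>cball 0 r. \<bar>g a\<bar> \<le> M" if "continuous_on UNIV g" for g :: "R3 \<Rightarrow> real"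
  proof -
    have "compact (g ` cball 0 r)"
      by (rule compact_continuous_image) (use continuous_on_subset[OF that] in auto)
    then have "bounded (g ` cball 0 r)" by (rule compact_imp_bounded)
    then show ?thesis unfolding bounded_iff by auto
  qed
  note bd = this[OF smooth_fun_continuous]
  obtain M0 where M0: "\<And>a. a \<in> cball 0 r \<Longrightarrow> \<bar>f a\<bar> \<le> M0" using bd[OF assms] by blast
  obtain M where M: "\<And>i a. a \<in> cball 0 r \<Longrightarrow> \<bar>pd i f a\<bar> \<le> M i"
    using bd[OF smooth_fun_pd[OF assms]] by metis
  define L where "L = \<bar>M0\<bar> + (\<Sum>i\<in>UNIV. \<bar>M i\<bar>)"
  have L: "\<bar>\<Sum>i\<in>UNIV. h $ i * pd i f a\<bar> \<le> L * norm h" if a: "a \<in> cball 0 r" for a h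
  proof -
    have "\<bar>\<Sum>i\<in>UNIV. h $ i * pd i f a\<bar> \<le> (\<Sum>i\<in>UNIV. norm h * \<bar>M i\<bar>)"
      by (rule sum_norm_le[of UNIV "\<lambda>i. h $ i * pd i f a", simplified])
        (auto simp: abs_mult intro!: mult_mono component_le_norm_cart order_trans[OF M[OF a]])
    also have "\<dots> \<le> L * norm h" by (simp add: L_def sum_distrib_left[symmetric] algebra_simps)
    finally show ?thesis .
  qed
  have "\<bar>f b - f a\<bar> \<le> L * norm (b - a)" if "a \<in> cball 0 r" "b \<in> cball 0 r" for a b
  proof -
    have "norm (f b - f a) \<le> L * norm (b - a)"
    proof (rule differentiable_bound[OF convex_cball _ _ that(2,1)])
      show "(f has_derivative (\<lambda>h. \<Sum>i\<in>UNIV. h $ i * pd i f x)) (at x within cball 0 r)" for x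
        using smooth_has_derivative[OF assms] has_derivative_at_withinI by blast
      show "onorm (\<lambda>h. \<Sum>i\<in>UNIV. h $ i * pd i f x) \<le> L" if "x \<in> cball 0 r" for x
        by (rule onorm_le) (use L[OF that] in auto)
    qed
    then show ?thesis by simp
  qed
  moreover have "0 \<le> L" "M0 \<le> L" unfolding L_def by (auto intro!: add_nonneg_nonneg sum_nonneg add_increasing2)
  ultimately show ?thesis using L M0 by (intro exI[of _ L]) force
qed

section \<open>Convolution with a smooth kernel\<close>

definition conv :: "(R3 \<Rightarrow> real) \<Rightarrow> (R3 \<Rightarrow> real) \<Rightarrow> R3 \<Rightarrow> real" where
  "conv K g x = (\<integral>y. K (x - y) * g y \<partial>lborel)"

text \<open>For fixed \<open>x\<close> the kernel is only evaluated in the ball of radius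
  \<open>norm x + r\<close>, where continuity bounds it. So kernels without bounded support, such as
  the Newtonian field, are covered.\<close>

lemma integrable_conv:
  fixes K g :: "R3 \<Rightarrow> real"
  assumes K: "continuous_on UNIV K" and g: "integrable lborel g" "\<And>y. norm y > r \<Longrightarrow> g y = 0"
  shows "integrable lborel (\<lambda>y. K (x - y) * g y)"
proof -
  have K': "K \<in> borel_measurable borel" by (rule borel_measurable_continuous_onI[OF K])
  note [measurable] = K' borel_measurable_integrable[OF g(1), simplified]
  have "compact (K ` cball 0 (norm x + r))"
    by (rule compact_continuous_image) (use continuous_on_subset[OF K] in auto)
  then obtain M where M: "\<forall>a\<in>cball 0 (norm x + r). \<bar>K a\<bar> \<le> M"
    using compact_imp_bounded[of "K ` cball 0 (norm x + r)"] unfolding bounded_iff by auto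
  show ?thesis
  proof (rule Bochner_Integration.integrable_bound[OF integrable_norm[OF integrable_mult_right[OF g(1), of M]]])
    show "AE y in lborel. norm (K (x - y) * g y) \<le> norm (norm (M * g y))"
    proof (rule AE_I2)
      fix y
      show "norm (K (x - y) * g y) \<le> norm (norm (M * g y))"
      proof (cases "norm y > r")
        case False
        then have "x - y \<in> cball 0 (norm x + r)" using norm_triangle_ineq4[of x y] by auto
        from M[rule_format, OF this] show ?thesis by (auto simp: abs_mult intro!: mult_right_mono)
      qed (simp add: g)
    qed
  qed simp
qed

text \<open>Differentiation under the integral sign along a sequence; the dominating function is a
  Lipschitz constant of the kernel on a ball containing all shifted arguments.\<close>
lemma conv_has_derivative:
  assumes K: "smooth_fun K" and g: "integrable lborel g" "\<And>y. norm y > r \<Longrightarrow> g y = 0" and r: "r \<ge> 0"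
  shows "(conv K g has_derivative (\<lambda>h. \<Sum>i\<in>UNIV. h $ i * conv (pd i K) g x)) (at x)"
  unfolding has_derivative_iff_norm
proof (intro conjI)
  note i0 = integrable_conv[OF smooth_fun_continuous[OF K] g]
  note i1 = integrable_conv[OF smooth_fun_continuous[OF smooth_fun_pd[OF K]] g]
  note [measurable] = smooth_fun_measurable[OF K] smooth_fun_measurable[OF smooth_fun_pd[OF K]]
     borel_measurable_integrable[OF g(1), simplified]
  show "bounded_linear (\<lambda>h::R3. \<Sum>i\<in>UNIV. h $ i * conv (pd i K) g x)"
    by (intro bounded_linear_sum bounded_linear_mult_const bounded_linear_vec_nth)
  show "((\<lambda>y. norm (conv K g y - conv K g x - (\<Sum>i\<in>UNIV. (y - x) $ i * conv (pd i K) g x)) / norm (y - x))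
     \<longlongrightarrow> 0) (at x)"
    unfolding tendsto_at_iff_sequentially comp_def
  proof (intro allI impI)
    fix X :: "nat \<Rightarrow> R3" assume X: "\<forall>n. X n \<in> UNIV - {x}" "X \<longlonglongrightarrow> x"
    \<comment> \<open>The first-order Taylor remainder of \<open>K\<close> at \<open>x - z\<close>;
      divided by the norm of \<open>h\<close> it tends to zero pointwise and stays below
      \<open>2 * L\<close>.\<close>
    define Q where "Q h z = K (x + h - z) - K (x - z) - (\<Sum>i\<in>UNIV. h $ i * pd i K (x - z))" for h z
    have [measurable]: "Q h \<in> borel_measurable borel" for h unfolding Q_def by measurable
    have "Bseq X" using X(2) convergentI convergent_imp_Bseq by blast
    then obtain B where B: "B > 0" "\<And>n. norm (X n) \<le> B" by (auto elim: BseqE)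
    \<comment> \<open>Large enough to contain \<open>X n - z\<close> and \<open>x - z\<close> for
      every \<open>n\<close> and every \<open>z\<close> in the support ball of
      \<open>g\<close>.\<close>
    define \<rho> where "\<rho> = B + norm x + r"
    obtain L where L: "L \<ge> 0" "\<And>a h. a \<in> cball 0 \<rho> \<Longrightarrow> \<bar>\<Sum>i\<in>UNIV. h $ i * pd i K a\<bar> \<le> L * norm h"
      "\<And>a b. a \<in> cball 0 \<rho> \<Longrightarrow> b \<in> cball 0 \<rho> \<Longrightarrow> \<bar>K b - K a\<bar> \<le> L * norm (b - a)"
      using smooth_bounds[OF K, of \<rho>] by blast
    have Qb: "\<bar>Q (X n - x) z\<bar> \<le> 2 * L * norm (X n - x)" if "norm z \<le> r" for n z
    proof -
      have m: "X n - z \<in> cball 0 \<rho>" "x - z \<in> cball 0 \<rho>"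
        using norm_triangle_ineq4[of "X n" z] norm_triangle_ineq4[of x z] B(2)[of n] B(1) that
          norm_ge_zero[of x]
        unfolding \<rho>_def mem_cball_0 by linarith+
      have "\<bar>Q (X n - x) z\<bar> \<le> \<bar>K (X n - z) - K (x - z)\<bar> + \<bar>\<Sum>i\<in>UNIV. (X n - x) $ i * pd i K (x - z)\<bar>"
        unfolding Q_def by (simp add: abs_triangle_ineq4)
      also have "\<dots> \<le> L * norm (X n - x) + L * norm (X n - x)"
        by (rule add_mono) (use L(3)[OF m(2,1)] L(2)[OF m(2), of "X n - x"] in auto)
      finally show ?thesis by simp
    qed
    have "(\<lambda>n. \<integral>z. \<bar>Q (X n - x) z\<bar> / norm (X n - x) * \<bar>g z\<bar> \<partial>lborel) \<longlonglongrightarrow> (\<integral>z. 0 \<partial>(lborel :: R3 measure))"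
    proof (rule integral_dominated_convergence[where w="\<lambda>z. 2 * L * \<bar>g z\<bar>"])
      show "integrable lborel (\<lambda>z. 2 * L * \<bar>g z\<bar>)" using g(1) by auto
      show "AE z in lborel. (\<lambda>n. \<bar>Q (X n - x) z\<bar> / norm (X n - x) * \<bar>g z\<bar>) \<longlonglongrightarrow> 0"
      proof (rule AE_I2, rule tendsto_mult_left_zero)
        fix z
        have "((\<lambda>y. norm (K y - K (x - z) - (\<Sum>i\<in>UNIV. (y - (x - z)) $ i * pd i K (x - z))) / norm (y - (x - z))) \<longlongrightarrow> 0) (at (x - z))"
          using smooth_has_derivative[OF K, of "x - z"] unfolding has_derivative_iff_norm by blast
        moreover have "\<forall>n. X n - z \<in> UNIV - {x - z}" "(\<lambda>n. X n - z) \<longlonglongrightarrow> x - z"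
          using X by (auto intro: tendsto_intros)
        ultimately have "(\<lambda>n. norm (K (X n - z) - K (x - z) - (\<Sum>i\<in>UNIV. (X n - z - (x - z)) $ i * pd i K (x - z))) / norm (X n - z - (x - z))) \<longlonglongrightarrow> 0"
          unfolding tendsto_at_iff_sequentially comp_def by (elim allE[of _ "\<lambda>n. X n - z"]) simp
        then show "(\<lambda>n. \<bar>Q (X n - x) z\<bar> / norm (X n - x)) \<longlonglongrightarrow> 0"
          by (simp add: Q_def)
      qed
      show "AE z in lborel. norm (\<bar>Q (X n - x) z\<bar> / norm (X n - x) * \<bar>g z\<bar>) \<le> 2 * L * \<bar>g z\<bar>" for n
      proof (rule AE_I2)
        fix z
        show "norm (\<bar>Q (X n - x) z\<bar> / norm (X n - x) * \<bar>g z\<bar>) \<le> 2 * L * \<bar>g z\<bar>"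
        proof (cases "norm z > r")
          case False
          then have "\<bar>Q (X n - x) z\<bar> / norm (X n - x) \<le> 2 * L"
            using Qb[of z n] X(1) by (simp add: divide_le_eq)
          from mult_right_mono[OF this, of "\<bar>g z\<bar>"] show ?thesis by (simp add: abs_mult)
        qed (simp add: g)
      qed
    qed auto
    then have lim: "(\<lambda>n. \<integral>z. \<bar>Q (X n - x) z\<bar> / norm (X n - x) * \<bar>g z\<bar> \<partial>lborel) \<longlonglongrightarrow> 0" by simp
    have bound: "norm (conv K g (X n) - conv K g x - (\<Sum>i\<in>UNIV. (X n - x) $ i * conv (pd i K) g x)) / norm (X n - x)
       \<le> (\<integral>z. \<bar>Q (X n - x) z\<bar> / norm (X n - x) * \<bar>g z\<bar> \<partial>lborel)" for n
    proof -
      have "conv K g (X n) - conv K g x - (\<Sum>i\<in>UNIV. (X n - x) $ i * conv (pd i K) g x)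
          = (\<integral>z. K (X n - z) * g z - K (x - z) * g z - (\<Sum>i\<in>UNIV. (X n - x) $ i * (pd i K (x - z) * g z)) \<partial>lborel)"
        unfolding conv_def
        by (subst Bochner_Integration.integral_diff)
          (auto intro!: Bochner_Integration.integrable_diff Bochner_Integration.integrable_sum integrable_mult_right i0 i1
            simp: Bochner_Integration.integral_sum Bochner_Integration.integral_diff i0 i1)
      also have "\<dots> = (\<integral>z. Q (X n - x) z * g z \<partial>lborel)"
        by (rule Bochner_Integration.integral_cong) (auto simp: Q_def algebra_simps sum_distrib_left)
      finally have e: "conv K g (X n) - conv K g x - (\<Sum>i\<in>UNIV. (X n - x) $ i * conv (pd i K) g x)
        = (\<integral>z. Q (X n - x) z * g z \<partial>lborel)" .
      have "norm (\<integral>z. Q (X n - x) z * g z \<partial>lborel) \<le> (\<integral>z. \<bar>Q (X n - x) z\<bar> * \<bar>g z\<bar> \<partial>lborel)"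
        using integral_norm_bound[of lborel "\<lambda>z. Q (X n - x) z * g z"] by (simp add: abs_mult)
      then show ?thesis unfolding e
        by (simp add: divide_right_mono)
    qed
    show "(\<lambda>n. norm (conv K g (X n) - conv K g x - (\<Sum>i\<in>UNIV. (X n - x) $ i * conv (pd i K) g x)) / norm (X n - x)) \<longlonglongrightarrow> 0"
      by (rule Lim_null_comparison[OF _ lim]) (use bound in auto)
  qed
qed

lemma pd_conv:
  assumes "smooth_fun K" "integrable lborel g" "\<And>y. norm y > r \<Longrightarrow> g y = 0"
  shows "pd i (conv K g) = conv (pd i K) g"
proof
  fix x
  have "\<And>y. norm y > max r 0 \<Longrightarrow> g y = 0" using assms by auto
  then have "(conv K g has_derivative (\<lambda>h. \<Sum>i\<in>UNIV. h $ i * conv (pd i K) g x)) (at x)"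
    using conv_has_derivative[OF assms(1,2), of "max r 0" x] by simp
  from pd_eqI[OF this, of i]
  show "pd i (conv K g) x = conv (pd i K) g x" by (simp add: axis_sum)
qed

lemma smooth_conv:
  assumes "smooth_fun K" "integrable lborel g" "\<And>y. norm y > r \<Longrightarrow> g y = 0"
  shows "smooth_fun (conv K g)"
proof (rule smooth_fun_coinduct)
  show "conv K g \<in> {conv K g |K. smooth_fun K}" using assms by auto
  have g0: "\<And>y. norm y > max r 0 \<Longrightarrow> g y = 0" using assms by auto
  show "h differentiable (at x)" if "h \<in> {conv K g |K. smooth_fun K}" for h x
    using that conv_has_derivative[OF _ assms(2) g0] unfolding differentiable_def by fastforce
  show "pd i h \<in> {conv K g |K. smooth_fun K}" if "h \<in> {conv K g |K. smooth_fun K}" for h i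
    using that pd_conv[OF _ assms(2,3)] smooth_fun_pd by fastforce
qed

text \<open>Convolve \<open>f\<close> with the indicator of a large ball: near the origin this is the constant
  \<open>\<integral>f\<close> by translation invariance, so its derivative there vanishes.\<close>
lemma integral_pd_zero:
  assumes f: "smooth_fun f" "\<And>x. norm x > r \<Longrightarrow> f x = 0"
  shows "(\<integral>x. pd i f x \<partial>lborel) = 0"
proof -
  \<comment> \<open>The extra 1 makes the indicator equal to 1 on the support of
    \<open>h (x - y)\<close> for every \<open>x\<close> in the open unit ball.\<close>
  define R where "R = \<bar>r\<bar> + 1"
  define g where "g = (indicator (cball 0 R) :: R3 \<Rightarrow> real)"
  have g: "integrable lborel g" unfolding g_def
    by (rule integrable_real_indicator) (use emeasure_lborel_cball_finite[of "0::R3" R] in auto)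
  have g0: "\<And>y. norm y > R \<Longrightarrow> g y = 0" by (auto simp: g_def)
  have e: "conv h g x = (\<integral>y. h y \<partial>lborel)"
    if "h \<in> borel_measurable borel" "\<And>x. norm x > r \<Longrightarrow> h x = 0" "x \<in> ball 0 1" for h x
  proof -
    have "conv h g x = (\<integral>y. h (x - y) \<partial>lborel)"
      unfolding conv_def
    proof (rule Bochner_Integration.integral_cong)
      fix y
      show "h (x - y) * g y = h (x - y)"
      proof (cases "norm y \<le> R")
        case False
        then have "norm (x - y) > r"
          using that(3) norm_triangle_ineq4[of y x] norm_triangle_ineq2[of y x]
          by (auto simp: R_def norm_minus_commute)
        then show ?thesis using that by simp
      qed (auto simp: g_def)
    qed simp
    also have "\<dots> = (\<integral>y. h y \<partial>lborel)"
      using integral_affine[OF that(1), of "-1" x] by simp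
    finally show ?thesis .
  qed
  have "pd i (conv f g) 0 = pd i (\<lambda>x. \<integral>y. f y \<partial>lborel) 0"
    by (rule pd_cong_open[where S="ball 0 1"]) (use e[OF smooth_fun_measurable[OF f(1)] f(2)] in auto)
  then have "conv (pd i f) g 0 = 0" by (simp add: pd_conv[OF f(1) g g0])
  then show ?thesis
    using e[OF smooth_fun_measurable[OF smooth_fun_pd[OF f(1)]] pd_outside[of r f _ i], of 0] f(2) by simp
qed

text \<open>Outside the ball one of the factors is zero at each point. Where one of them is nonzero
  it stays so nearby, hence the other vanishes on a neighbourhood together with its derivative; so
  both integrands have bounded support although each function alone may not.\<close>

lemma integral_by_parts:
  assumes f: "smooth_fun f" and g: "smooth_fun g" and "\<And>x. norm x > r \<Longrightarrow> f x = 0 \<or> g x = 0"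
  shows "(\<integral>x. pd i f x * g x \<partial>lborel) = - (\<integral>x. f x * pd i g x \<partial>lborel)"
proof -
  have z: "f x * g x = 0" if "norm x > r" for x using assms(3) that by auto
  have zz: "pd i f x * g x = 0 \<and> f x * pd i g x = 0" if x: "norm x > r" for x
  proof -
    have op: "open (- {x. f x = 0})" "open (- {x. g x = 0})"
      by (auto intro!: open_Compl closed_Collect_eq smooth_fun_continuous f g)
    have "g x \<noteq> 0 \<Longrightarrow> pd i f x = 0"
    proof -
      assume gx: "g x \<noteq> 0"
      have "pd i f x = pd i (\<lambda>x. 0) x"
        by (rule pd_cong_open[where S="(- {x. g x = 0}) \<inter> (- cball 0 r)"])
          (use op gx x assms(3) in \<open>auto simp: not_le\<close>)
      then show ?thesis by simp
    qed
    moreover have "f x \<noteq> 0 \<Longrightarrow> pd i g x = 0"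
    proof -
      assume fx: "f x \<noteq> 0"
      have "pd i g x = pd i (\<lambda>x. 0) x"
        by (rule pd_cong_open[where S="(- {x. f x = 0}) \<inter> (- cball 0 r)"])
          (use op fx x assms(3) in \<open>auto simp: not_le\<close>)
      then show ?thesis by simp
    qed
    ultimately show ?thesis by auto
  qed
  have "(\<integral>x. pd i (\<lambda>x. f x * g x) x \<partial>lborel) = 0"
    by (rule integral_pd_zero[where r=r]) (use f g z in auto)
  moreover have "integrable lborel (\<lambda>x. pd i f x * g x)" "integrable lborel (\<lambda>x. f x * pd i g x)"
    by (rule integrable_continuous_bounded_support[where r=r];
        use zz in \<open>auto intro!: continuous_on_mult smooth_fun_continuous smooth_fun_pd f g\<close>)+
  ultimately show ?thesis by (simp add: pd_smooth_mult[OF f g])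
qed

section \<open>Inequalities for convolutions of nonnegative functions\<close>

lemma young_nn:
  assumes [measurable]: "k \<in> borel_measurable borel" "G \<in> borel_measurable borel"
  shows "(\<integral>\<^sup>+x. \<integral>\<^sup>+y. k (x - y) * G y \<partial>lborel \<partial>lborel) = (\<integral>\<^sup>+x. k x \<partial>lborel) * (\<integral>\<^sup>+x. G (x::R3) \<partial>lborel)"
proof -
  have "(\<integral>\<^sup>+x. \<integral>\<^sup>+y. k (x - y) * G y \<partial>lborel \<partial>lborel) = (\<integral>\<^sup>+y. \<integral>\<^sup>+x. k (x - y) * G y \<partial>lborel \<partial>lborel)"
    by (rule lborel_pair.Fubini') (simp add: case_prod_unfold)
  also have "\<dots> = (\<integral>\<^sup>+y. (\<integral>\<^sup>+x. k x \<partial>lborel) * G y \<partial>lborel)"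
  proof (rule nn_integral_cong)
    fix y
    have "(\<integral>\<^sup>+x. k (x - y) \<partial>lborel) = (\<integral>\<^sup>+x. k x \<partial>lborel)"
      using nn_integral_affine[of k 1 "-y"] by simp
    then show "(\<integral>\<^sup>+x. k (x - y) * G y \<partial>lborel) = (\<integral>\<^sup>+x. k x \<partial>lborel) * G y"
      by (simp add: nn_integral_multc)
  qed
  also have "\<dots> = (\<integral>\<^sup>+x. k x \<partial>lborel) * (\<integral>\<^sup>+x. G x \<partial>lborel)" by (simp add: nn_integral_cmult)
  finally show ?thesis .
qed

text \<open>Cauchy-Schwarz after writing the integrand as \<open>sqrt k\<close> times
  \<open>sqrt k * G\<close>.\<close>

lemma conv_nn_sq:
  assumes [measurable]: "k \<in> borel_measurable borel" "G \<in> borel_measurable borel"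
    and k: "\<And>x. 0 \<le> k x" and G: "\<And>x. 0 \<le> G x"
  shows "(\<integral>\<^sup>+y. ennreal (k (x - y) * G y) \<partial>lborel)\<^sup>2
      \<le> (\<integral>\<^sup>+y. ennreal (k y) \<partial>lborel) * (\<integral>\<^sup>+y. ennreal (k (x - y) * (G (y::R3))\<^sup>2) \<partial>lborel)"
proof -
  have "(\<integral>\<^sup>+y. ennreal (k (x - y) * G y) \<partial>lborel)
     = (\<integral>\<^sup>+y. ennreal (sqrt (k (x - y))) * ennreal (sqrt (k (x - y)) * G y) \<partial>lborel)"
    by (rule nn_integral_cong) (simp add: k G ennreal_mult'[symmetric] mult.assoc[symmetric])
  also have "\<dots>\<^sup>2 \<le> (\<integral>\<^sup>+y. (ennreal (sqrt (k (x - y))))\<^sup>2 \<partial>lborel) * (\<integral>\<^sup>+y. (ennreal (sqrt (k (x - y)) * G y))\<^sup>2 \<partial>lborel)"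
    by (rule Cauchy_Schwarz_nn_integral) measurable
  also have "(\<integral>\<^sup>+y. (ennreal (sqrt (k (x - y))))\<^sup>2 \<partial>lborel) = (\<integral>\<^sup>+y. ennreal (k (x - y)) \<partial>lborel)"
    by (simp add: k ennreal_power)
  also have "\<dots> = (\<integral>\<^sup>+y. ennreal (k y) \<partial>lborel)"
    using nn_integral_affine[of "\<lambda>y. ennreal (k y)" "-1" x] by simp
  also have "(\<integral>\<^sup>+y. (ennreal (sqrt (k (x - y)) * G y))\<^sup>2 \<partial>lborel) = (\<integral>\<^sup>+y. ennreal (k (x - y) * (G y)\<^sup>2) \<partial>lborel)"
    by (simp add: k G ennreal_power power_mult_distrib)
  finally show ?thesis .
qed

section \<open>Cutoff functions and the regularised Newtonian field\<close>

text \<open>The flat function \<open>exp (- 1 / x)\<close>, extended by zero, times a power of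
  \<open>1 / x\<close>. The powers are carried along because differentiation produces them.\<close>

definition exp_mono :: "nat \<Rightarrow> real \<Rightarrow> real \<Rightarrow> real" where
  "exp_mono n c x = (if x \<le> 0 then 0 else c * (1 / x) ^ n * exp (- (1 / x)))"

lemma exp_mono_tendsto_right: "((\<lambda>x. c * (1 / x) ^ n * exp (- (1 / x))) \<longlongrightarrow> 0) (at_right (0::real))"
proof -
  have "((\<lambda>y. c * (y ^ n / exp y)) \<longlongrightarrow> c * 0) (at_top :: real filter)"
    by (intro tendsto_intros tendsto_power_div_exp_0)
  from filterlim_compose[OF this filterlim_inverse_at_top_right]
  show ?thesis by (simp add: exp_minus field_simps)
qed

lemma exp_mono_has_derivative:
  "(exp_mono n c has_real_derivative exp_mono (Suc n) (- c * n) x + exp_mono (n + 2) c x) (at x)"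
proof -
  consider "x > 0" | "x < 0" | "x = 0" by linarith
  then show ?thesis
  proof cases
    case 1
    have d: "((\<lambda>x. c * (1 / x) ^ n * exp (- (1 / x))) has_real_derivative
       exp_mono (Suc n) (- c * n) x + exp_mono (n + 2) c x) (at x)"
    proof -
      have i: "((\<lambda>x. 1 / x) has_real_derivative - ((1 / x) * (1 / x))) (at x)"
        using 1 by (auto intro!: derivative_eq_intros)
      have p: "((\<lambda>x. (1 / x) ^ n) has_real_derivative - (n * (1 / x) ^ Suc n)) (at x)"
        by (rule DERIV_cong[OF DERIV_power[OF i]]) (cases n; simp add: field_simps)
      have e: "((\<lambda>x. exp (- (1 / x))) has_real_derivative (1 / x) * (1 / x) * exp (- (1 / x))) (at x)"
        by (rule DERIV_cong[OF DERIV_chain2[OF DERIV_exp DERIV_minus[OF i]]]) simp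
      show ?thesis
        by (rule DERIV_cong[OF DERIV_mult[OF DERIV_cmult[OF p, of c] e]])
          (use 1 in \<open>simp add: exp_mono_def algebra_simps\<close>)
    qed
    show ?thesis
      by (rule has_field_derivative_transform_within_open[OF d, where S="{0<..}"])
        (use 1 in \<open>auto simp: exp_mono_def\<close>)
  next
    case 2
    have "((\<lambda>x. 0) has_real_derivative exp_mono (Suc n) (- c * n) x + exp_mono (n + 2) c x) (at x)"
      using 2 by (simp add: exp_mono_def)
    then show ?thesis
      by (rule has_field_derivative_transform_within_open[where S="{..<0}"])
        (use 2 in \<open>auto simp: exp_mono_def\<close>)
  next
    case 3
    have "((\<lambda>y. (exp_mono n c y - exp_mono n c 0) / (y - 0)) \<longlongrightarrow> 0) (at 0)"
    proof (rule filterlim_split_at)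
      show "((\<lambda>y. (exp_mono n c y - exp_mono n c 0) / (y - 0)) \<longlongrightarrow> 0) (at_left 0)"
        by (rule tendsto_eventually) (auto simp: eventually_at_left_field exp_mono_def intro!: exI[of _ "-1"])
      \<comment> \<open>For positive \<open>y\<close> the difference quotient at 0 is the same
        expression with \<open>n\<close> raised by one.\<close>
      show "((\<lambda>y. (exp_mono n c y - exp_mono n c 0) / (y - 0)) \<longlongrightarrow> 0) (at_right 0)"
        by (rule Lim_transform_eventually[OF exp_mono_tendsto_right[of c "Suc n"]])
          (auto simp: eventually_at_right_field exp_mono_def intro!: exI[of _ "1"])
    qed
    then show ?thesis using 3 unfolding has_field_derivative_iff by (simp add: exp_mono_def)
  qed
qed

inductive_set exp_monos :: "(real \<Rightarrow> real) set" where
  base: "exp_mono n c \<in> exp_monos"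
| plus: "f \<in> exp_monos \<Longrightarrow> g \<in> exp_monos \<Longrightarrow> (\<lambda>x. f x + g x) \<in> exp_monos"

lemma smooth1_exp_mono: "smooth1 (exp_mono n c)"
proof (rule smooth1_coinduct[OF exp_monos.base])
  fix f assume "f \<in> exp_monos"
  then show "\<exists>f'\<in>exp_monos. \<forall>x. (f has_real_derivative f' x) (at x)"
  proof induction
    case (base n c)
    have "(\<lambda>x. exp_mono (Suc n) (- c * n) x + exp_mono (n + 2) c x) \<in> exp_monos"
      by (intro exp_monos.intros)
    then show ?case using exp_mono_has_derivative[of n c]
      by (intro bexI[of _ "\<lambda>x. exp_mono (Suc n) (- c * n) x + exp_mono (n + 2) c x"]) auto
  next
    case (plus f g)
    then obtain f' g' where "f' \<in> exp_monos" "g' \<in> exp_monos"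
      "\<forall>x. (f has_real_derivative f' x) (at x)" "\<forall>x. (g has_real_derivative g' x) (at x)" by blast
    then have "(\<lambda>x. f' x + g' x) \<in> exp_monos"
      "\<forall>x. ((\<lambda>x. f x + g x) has_real_derivative f' x + g' x) (at x)"
      by (auto intro: exp_monos.plus DERIV_add)
    then show ?case by (intro bexI[of _ "\<lambda>x. f' x + g' x"])
  qed
qed

lemma smooth1_continuous: "smooth1 f \<Longrightarrow> continuous_on S f"
  by (meson smooth1_deriv(1) DERIV_isCont continuous_at_imp_continuous_on)

section \<open>A smooth step and radial cutoffs\<close>

text \<open>The thresholds 1/4 and 1 are the squares of 1/2 and 1, since the step is applied to
  squared norms, which stay smooth at the origin. Monotonicity is recorded because it makes the
  mollifier nonnegative.\<close>

lemma smooth_step_exists: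
  "\<exists>\<tau>. smooth1 \<tau> \<and> (\<forall>s\<le>1/4. \<tau> s = 0) \<and> (\<forall>s\<ge>1. \<tau> s = 1) \<and> (\<forall>s. 0 \<le> \<tau> s \<and> \<tau> s \<le> 1) \<and> (\<forall>s. 0 \<le> deriv \<tau> s)"
proof -
  \<comment> \<open>A smooth bump, positive exactly between 1/4 and 1; the step is its primitive
    divided by the total mass.\<close>
  define \<beta> where "\<beta> s = exp_mono 0 1 (1 * s + (- (1/4))) * exp_mono 0 1 ((-1) * s + 1)" for s
  have sm: "smooth1 \<beta>" unfolding \<beta>_def
    by (intro smooth1_mult smooth1_affine smooth1_exp_mono)
  note cont = smooth1_continuous[OF sm]
  have \<beta>0: "\<beta> s \<ge> 0" for s by (simp add: \<beta>_def exp_mono_def)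
  have \<beta>z: "s \<le> 1/4 \<or> s \<ge> 1 \<Longrightarrow> \<beta> s = 0" for s by (auto simp: \<beta>_def exp_mono_def)
  have \<beta>p: "1/4 < s \<Longrightarrow> s < 1 \<Longrightarrow> \<beta> s > 0" for s by (auto simp: \<beta>_def exp_mono_def)
  \<comment> \<open>For negative \<open>s\<close> the interval is empty, so \<open>F\<close> is zero
    there as well.\<close>
  define F where "F s = integral {0..s} \<beta>" for s
  have F0: "F s = 0" if "s \<le> 1/4" for s
    unfolding F_def using that \<beta>z by (intro integral_unique has_integral_is_0) auto
  have FD: "(F has_real_derivative \<beta> s) (at s)" for s
  proof (cases "s < 1/4")
    case True
    have "((\<lambda>x. 0) has_real_derivative \<beta> s) (at s)" using \<beta>z True by simp
    then show ?thesis
      by (rule has_field_derivative_transform_within_open[where S="{..<1/4}"]) (use True F0 in auto)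
  next
    case False
    have "((\<lambda>u. integral {0..u} \<beta>) has_real_derivative \<beta> s) (at s within {0..s+1})"
      by (rule integral_has_real_derivative) (use cont False in auto)
    then have "((\<lambda>u. integral {0..u} \<beta>) has_real_derivative \<beta> s) (at s)"
      using at_within_Icc_at[of 0 s "s+1"] False by simp
    then show ?thesis unfolding F_def[abs_def] .
  qed
  have mono: "F a \<le> F b" if "a \<le> b" for a b
    by (rule DERIV_nonneg_imp_nondecreasing[OF that, of F]) (use FD \<beta>0 in blast)
  have contF: "continuous_on S F" for S
    using FD by (meson DERIV_isCont continuous_at_imp_continuous_on)
  have "F (1/4) < F 1"
  proof (rule DERIV_pos_imp_increasing_open[of "1/4" 1 F])
    show "\<exists>y. (F has_real_derivative y) (at x) \<and> y > 0" if "1/4 < x" "x < 1" for x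
      using FD[of x] \<beta>p[OF that] by blast
  qed (auto intro: contF)
  then have Z: "F 1 > 0" using F0[of "1/4"] by simp
  have F1: "F s = F 1" if "s \<ge> 1" for s
  proof -
    have "F s \<le> F 1"
      by (rule DERIV_nonpos_imp_nonincreasing[OF that, of F]) (use FD \<beta>z in force)
    then show ?thesis using mono[OF that] by simp
  qed
  define \<tau> where "\<tau> s = F s / F 1" for s
  have D: "(\<tau> has_real_derivative \<beta> s * (1 / F 1)) (at s)" for s
    unfolding \<tau>_def using DERIV_cmult_right[OF FD[of s], of "1 / F 1"] by simp
  show ?thesis
  proof (intro exI[of _ \<tau>] conjI allI impI)
    show "smooth1 \<tau>" by (rule smooth1_step[OF D]) (intro smooth1_mult sm smooth1_const)
    show "\<tau> s = 0" if "s \<le> 1/4" for s using F0[OF that] by (simp add: \<tau>_def)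
    show "\<tau> s = 1" if "s \<ge> 1" for s using F1[OF that] Z by (simp add: \<tau>_def)
    show "0 \<le> \<tau> s" for s using mono[of "min s 0" s] F0[of "min s 0"] Z by (simp add: \<tau>_def)
    show "\<tau> s \<le> 1" for s using mono[of s "max s 1"] F1[of "max s 1"] Z by (simp add: \<tau>_def)
    show "0 \<le> deriv \<tau> s" for s using DERIV_imp_deriv[OF D[of s]] \<beta>0[of s] Z by simp
  qed
qed

definition smooth_step :: "real \<Rightarrow> real" where
  "smooth_step = (SOME \<tau>. smooth1 \<tau> \<and> (\<forall>s\<le>1/4. \<tau> s = 0) \<and> (\<forall>s\<ge>1. \<tau> s = 1) \<and>
     (\<forall>s. 0 \<le> \<tau> s \<and> \<tau> s \<le> 1) \<and> (\<forall>s. 0 \<le> deriv \<tau> s))"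

lemma smooth_step:
  shows smooth1_smooth_step: "smooth1 smooth_step"
    and smooth_step_0: "s \<le> 1/4 \<Longrightarrow> smooth_step s = 0"
    and smooth_step_1: "s \<ge> 1 \<Longrightarrow> smooth_step s = 1"
    and smooth_step_ge_0: "0 \<le> smooth_step s"
    and smooth_step_le_1: "smooth_step s \<le> 1"
    and deriv_smooth_step_nonneg: "0 \<le> deriv smooth_step s"
  using someI_ex[OF smooth_step_exists] unfolding smooth_step_def[symmetric] by auto

definition cutoff :: "real \<Rightarrow> R3 \<Rightarrow> real" where
  "cutoff r x = 1 - smooth_step ((norm x)\<^sup>2 / r\<^sup>2)"

lemma smooth_cutoff: "smooth_fun (cutoff r)"
proof -
  have "smooth_fun (\<lambda>x. (1 / r\<^sup>2) * (norm x)\<^sup>2)" by (intro smooth_mult) auto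
  then have "smooth_fun (\<lambda>x. smooth_step ((1 / r\<^sup>2) * (norm x)\<^sup>2))"
    by (rule smooth_compose[OF smooth1_smooth_step])
  then show ?thesis unfolding cutoff_def[abs_def] by (intro smooth_diff) auto
qed

lemma cutoff_range: "0 \<le> cutoff r x" "cutoff r x \<le> 1"
  using smooth_step_ge_0 smooth_step_le_1 by (auto simp: cutoff_def)

lemma cutoff_eq_1: assumes "norm x \<le> r / 2" "r > 0" shows "cutoff r x = 1"
proof -
  have "(norm x)\<^sup>2 \<le> (r / 2)\<^sup>2" using assms by (intro power_mono) auto
  then have "(norm x)\<^sup>2 / r\<^sup>2 \<le> 1/4" using assms by (simp add: field_simps power2_eq_square)
  then show ?thesis by (simp add: cutoff_def smooth_step_0)
qed

lemma cutoff_eq_0: assumes "norm x \<ge> r" "r > 0" shows "cutoff r x = 0"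
proof -
  have "r\<^sup>2 \<le> (norm x)\<^sup>2" using assms by (intro power_mono) auto
  then show ?thesis using assms by (simp add: cutoff_def smooth_step_1)
qed

text \<open>A real power is singular at the origin. Since \<open>t\<close> vanishes below 1/4, the
  switch at 1/8 lies inside the zero region and creates no corner. The exponent is arbitrary because
  each differentiation lowers it by one.\<close>

inductive_set powr_steps :: "(real \<Rightarrow> real) set" where
  base: "smooth1 t \<Longrightarrow> (\<And>s. s < 1/4 \<Longrightarrow> t s = 0) \<Longrightarrow> (\<lambda>s. if s \<le> 1/8 then 0 else s powr p * t s) \<in> powr_steps"
| plus: "f \<in> powr_steps \<Longrightarrow> g \<in> powr_steps \<Longrightarrow> (\<lambda>x. f x + g x) \<in> powr_steps"

lemma deriv_zero_left:
  assumes "\<And>s. s < a \<Longrightarrow> t s = (0::real)" "s < (a::real)" shows "deriv t s = 0"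
proof -
  have "(t has_real_derivative 0) (at s)"
    by (rule has_field_derivative_transform_within_open[where S="{..<a}" and f="\<lambda>_. 0"])
      (use assms in auto)
  then show ?thesis by (rule DERIV_imp_deriv)
qed

lemma powr_step_has_derivative:
  assumes t: "smooth1 t" "\<And>s. s < 1/4 \<Longrightarrow> t s = 0"
  shows "((\<lambda>s. if s \<le> 1/8 then 0 else s powr p * t s) has_real_derivative
     (if s \<le> 1/8 then 0 else s powr (p - 1) * (p * t s)) + (if s \<le> 1/8 then 0 else s powr p * deriv t s)) (at s)"
proof (cases "s < 1/4")
  case True
  have "((\<lambda>s. 0) has_real_derivative (if s \<le> 1/8 then 0 else s powr (p - 1) * (p * t s)) + (if s \<le> 1/8 then 0 else s powr p * deriv t s)) (at s)"
    using t(2) deriv_zero_left[OF t(2) True] True by simp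
  then show ?thesis
    by (rule has_field_derivative_transform_within_open[where S="{..<1/4}"]) (use True t(2) in auto)
next
  case False
  have pd: "((\<lambda>s. s powr p) has_real_derivative p * s powr (p - 1)) (at s)"
    using False by (intro has_real_derivative_powr) simp
  have "((\<lambda>s. s powr p * t s) has_real_derivative (if s \<le> 1/8 then 0 else s powr (p - 1) * (p * t s)) + (if s \<le> 1/8 then 0 else s powr p * deriv t s)) (at s)"
    by (rule DERIV_cong[OF DERIV_mult[OF pd smooth1_deriv(1)[OF t(1)]]]) (use False in simp)
  then show ?thesis
    by (rule has_field_derivative_transform_within_open[where S="{1/8<..}"]) (use False in auto)
qed

lemma smooth1_powr_step:
  assumes t: "smooth1 t" "\<And>s. s < 1/4 \<Longrightarrow> t s = 0"
  shows "smooth1 (\<lambda>s. if s \<le> 1/8 then 0 else s powr p * t s)"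
proof (rule smooth1_coinduct[OF powr_steps.base[OF t]])
  fix f assume "f \<in> powr_steps"
  then show "\<exists>f'\<in>powr_steps. \<forall>x. (f has_real_derivative f' x) (at x)"
  proof induction
    case (base t p)
    define D where "D = (\<lambda>s. (if s \<le> 1/8 then 0 else s powr (p - 1) * (p * t s))
      + (if s \<le> 1/8 then 0 else s powr p * deriv t s))"
    have "D \<in> powr_steps"
      unfolding D_def
      by (intro powr_steps.intros smooth1_mult smooth1_const base(1) smooth1_deriv(2)[OF base(1)]
          deriv_zero_left[of "1/4" t]) (auto simp: base(2))
    moreover have "\<forall>x. ((\<lambda>s. if s \<le> 1/8 then 0 else s powr p * t s) has_real_derivative D x) (at x)"
      unfolding D_def by (intro allI powr_step_has_derivative base)
    ultimately show ?case by blast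
  next
    case (plus f g)
    then obtain f' g' where "f' \<in> powr_steps" "g' \<in> powr_steps"
      "\<forall>x. (f has_real_derivative f' x) (at x)" "\<forall>x. (g has_real_derivative g' x) (at x)" by blast
    then have "(\<lambda>x. f' x + g' x) \<in> powr_steps"
      "\<forall>x. ((\<lambda>x. f x + g x) has_real_derivative f' x + g' x) (at x)"
      by (auto intro: powr_steps.plus DERIV_add)
    then show ?case by (intro bexI[of _ "\<lambda>x. f' x + g' x"])
  qed
qed

text \<open>The field \<open>x |x|\<^sup>-\<^sup>3\<close> (a multiple of the gradient of the Newtonian potential), smoothly
  switched off near the origin. It is radial, hence curl free, and its divergence is the
  nonnegative bump \<open>2 \<tau>'(|x|\<^sup>2) / |x|\<close>.\<close>
definition newton_profile :: "real \<Rightarrow> real" where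
  "newton_profile s = (if s \<le> 1/8 then 0 else s powr (-3/2) * smooth_step s)"

definition newton_field :: "3 \<Rightarrow> R3 \<Rightarrow> real" where
  "newton_field j x = x $ j * newton_profile ((norm x)\<^sup>2)"

definition newton_div :: "R3 \<Rightarrow> real" where
  "newton_div x = (\<Sum>j\<in>UNIV. pd j (newton_field j) x)"

lemma smooth1_newton_profile: "smooth1 newton_profile"
  unfolding newton_profile_def[abs_def]
  by (rule smooth1_powr_step) (auto simp: smooth1_smooth_step smooth_step_0)

lemma smooth_newton_field: "smooth_fun (newton_field j)"
  unfolding newton_field_def[abs_def]
  by (intro smooth_mult smooth_compose[OF smooth1_newton_profile]) auto

lemma smooth_newton_div: "smooth_fun newton_div"
  unfolding newton_div_def[abs_def] by (intro smooth_sum smooth_fun_pd smooth_newton_field)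

lemma pd_newton_field:
  "pd i (newton_field j) x = (if i = j then newton_profile ((norm x)\<^sup>2) else 0)
     + 2 * x $ i * x $ j * deriv newton_profile ((norm x)\<^sup>2)"
proof -
  have "smooth_fun (\<lambda>x. newton_profile ((norm x)\<^sup>2))"
    by (rule smooth_compose[OF smooth1_newton_profile]) simp
  then show ?thesis
    unfolding newton_field_def[abs_def]
    by (subst pd_smooth_mult) (auto simp: pd_component pd_compose[OF smooth1_newton_profile] pd_norm_sq)
qed

lemma newton_field_curl_free: "pd i (newton_field j) = pd j (newton_field i)"
  by (auto simp: fun_eq_iff pd_newton_field)

text \<open>With \<open>s\<close> the squared norm and \<open>k\<close> the profile, the divergence
  is \<open>3 k + 2 s k'\<close>. For \<open>k = s powr (-3/2)\<close> these terms cancel, as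
  \<open>x |x|^-3\<close> is divergence free off the origin, so only the derivative of the step
  survives.\<close>

lemma newton_div_eq:
  "newton_div x = (if norm x \<le> 1/4 then 0 else 2 * (norm x)\<^sup>2 powr (-1/2) * deriv smooth_step ((norm x)\<^sup>2))"
proof -
  define s where "s = (norm x)\<^sup>2"
  have s: "(\<Sum>j\<in>UNIV. (x $ j)\<^sup>2) = s" by (simp add: s_def norm_sq_sum)
  have "newton_div x = 3 * newton_profile s + 2 * s * deriv newton_profile s"
    by (simp add: newton_div_def pd_newton_field s_def[symmetric] sum.distrib)
      (simp add: s[symmetric] sum_distrib_left sum_distrib_right power2_eq_square mult.assoc)
  moreover have "((\<lambda>s. if s \<le> 1/8 then 0 else s powr (-3/2) * smooth_step s) has_real_derivative
     (if s \<le> 1/8 then 0 else s powr (-3/2 - 1) * (-3/2 * smooth_step s)) + (if s \<le> 1/8 then 0 else s powr (-3/2) * deriv smooth_step s)) (at s)"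
    by (rule powr_step_has_derivative) (auto simp: smooth1_smooth_step smooth_step_0)
  then have "deriv newton_profile s = (if s \<le> 1/8 then 0 else s powr (-3/2 - 1) * (-3/2 * smooth_step s)) + (if s \<le> 1/8 then 0 else s powr (-3/2) * deriv smooth_step s)"
    unfolding newton_profile_def[abs_def] by (rule DERIV_imp_deriv)
  ultimately have e: "newton_div x = (if s \<le> 1/8 then 0 else 2 * (s * s powr (-3/2)) * deriv smooth_step s
      + 3 * (s powr (-3/2) - s * s powr (-3/2 - 1)) * smooth_step s)"
    by (simp add: newton_profile_def algebra_simps)
  have pw: "s * s powr (-3/2) = s powr (-1/2)" "s * s powr (-3/2 - 1) = s powr (-3/2)" if "s > 1/8"
    using that powr_mult_base[of s "-3/2"] powr_mult_base[of s "-3/2 - 1"] by auto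
  have e': "newton_div x = (if s \<le> 1/8 then 0 else 2 * s powr (-1/2) * deriv smooth_step s)"
    using e pw by auto
  show ?thesis
  proof (cases "s \<le> 1/8")
    case True
    \<comment> \<open>The cases 1/8 for \<open>s\<close> and 1/4 for the norm do not match, but the
      step has zero derivative in the gap between them.\<close>
    have "deriv smooth_step s = 0"
      by (rule deriv_zero_left[where a="1/4"]) (use True smooth_step_0 in auto)
    then show ?thesis using True e' by (simp add: s_def)
  next
    case False
    then have "\<not> norm x \<le> 1/4"
      using power_mono[of "norm x" "1/4" 2] by (auto simp: s_def power2_eq_square)
    then show ?thesis using False e' by (simp add: s_def)
  qed
qed

lemma newton_div_nonneg: "0 \<le> newton_div x"
  unfolding newton_div_eq by (simp add: deriv_smooth_step_nonneg)

lemma newton_div_outside: assumes "norm x > 1" shows "newton_div x = 0"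
proof -
  have s: "(norm x)\<^sup>2 > 1" using assms by (simp add: one_less_power)
  have "(smooth_step has_real_derivative 0) (at ((norm x)\<^sup>2))"
    by (rule has_field_derivative_transform_within_open[where S="{1<..}" and f="\<lambda>_. 1"])
      (use s smooth_step_1 in auto)
  then show ?thesis by (simp add: newton_div_eq DERIV_imp_deriv)
qed

text \<open>The mean value theorem gives a radius at which the step has positive derivative. A
  nonnegative continuous function that is positive somewhere has positive integral, because a
  nonempty open set is not negligible.\<close>

lemma newton_div_integral_pos: "0 < (\<integral>x. newton_div x \<partial>lborel)"
proof -
  have "\<exists>s. 1/4 < s \<and> s < 1 \<and> smooth_step 1 - smooth_step (1/4) = (1 - 1/4) * deriv smooth_step s"
    by (rule MVT2) (auto intro: smooth1_deriv(1) smooth1_smooth_step)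
  then obtain s where s: "1/4 < s" "s < 1" "deriv smooth_step s > 0"
    by (auto simp: smooth_step_0 smooth_step_1)
  define x where "x = sqrt s *\<^sub>R (axis 1 1 :: R3)"
  have "(1/4)\<^sup>2 < s" using s by (simp add: power2_eq_square)
  then have "norm x > 1/4" using s real_less_rsqrt[of "1/4" s] by (simp add: x_def)
  moreover have "(norm x)\<^sup>2 = s" using s by (simp add: x_def)
  ultimately have x: "newton_div x > 0" using s by (auto simp: newton_div_eq)
  have cont: "continuous_on UNIV newton_div" by (rule smooth_fun_continuous[OF smooth_newton_div])
  have int: "integrable lborel newton_div"
    by (rule integrable_continuous_bounded_support[OF cont newton_div_outside])
  have "(\<integral>x. newton_div x \<partial>lborel) \<noteq> 0"
  proof
    assume "(\<integral>x. newton_div x \<partial>lborel) = 0"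
    then have "AE x in lborel. newton_div x = 0"
      using integral_nonneg_eq_0_iff_AE[OF int] newton_div_nonneg by simp
    then have ae: "AE x in lebesgue. x \<notin> {x. newton_div x \<noteq> 0}" by (auto dest: AE_completion)
    have op: "open {x. newton_div x \<noteq> 0}"
      using open_Collect_neq[OF cont continuous_on_const] .
    then have "{x. newton_div x \<noteq> 0} \<in> null_sets lebesgue"
      by (subst AE_iff_null_sets[OF lebesgue_openin[of UNIV, simplified]]) (use ae in auto)
    moreover note op
    ultimately show False
      using open_not_negligible[of "{x. newton_div x \<noteq> 0}"] x
      unfolding negligible_iff_null_sets by (metis (mono_tags) empty_iff less_irrefl mem_Collect_eq)
  qed
  then show ?thesis using Bochner_Integration.integral_nonneg[of lborel newton_div] newton_div_nonneg by (simp add: less_le)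
qed

text \<open>The decay \<open>|x|^-2\<close>, written as a product so that the origin is included.
  The bound is scale invariant and thus survives rescaling with the same constant.\<close>

lemma newton_field_bound: "\<bar>newton_field j x\<bar> * (norm x)\<^sup>2 \<le> 1"
proof (cases "(norm x)\<^sup>2 \<le> 1/8")
  case False
  then have nx: "norm x > 0" by auto
  have "newton_profile ((norm x)\<^sup>2) \<le> (norm x)\<^sup>2 powr (-3/2)"
    using False smooth_step_le_1 by (simp add: newton_profile_def mult_left_le)
  also have "(norm x)\<^sup>2 powr (-3/2) = norm x powr (-3)"
  proof -
    have "(norm x)\<^sup>2 = norm x powr 2" using nx by simp
    then show ?thesis by (simp only: powr_powr) simp
  qed
  also have "\<dots> = 1 / norm x ^ 3" using nx by (simp add: powr_minus_divide powr_numeral)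
  finally have k: "newton_profile ((norm x)\<^sup>2) \<le> 1 / norm x ^ 3" .
  have k0: "newton_profile ((norm x)\<^sup>2) \<ge> 0" by (simp add: newton_profile_def smooth_step_ge_0)
  have "\<bar>newton_field j x\<bar> * (norm x)\<^sup>2 = \<bar>x $ j\<bar> * newton_profile ((norm x)\<^sup>2) * (norm x)\<^sup>2"
    using k0 by (simp add: newton_field_def abs_mult)
  also have "\<dots> \<le> norm x * (1 / norm x ^ 3) * (norm x)\<^sup>2"
    by (intro mult_mono k k0 component_le_norm_cart) auto
  also have "\<dots> = 1" using nx by (simp add: field_simps power2_eq_square power3_eq_cube)
  finally show ?thesis .
qed (simp add: newton_field_def newton_profile_def)

section \<open>Rescaled kernels and the mollifier\<close>

definition newton_const :: real where "newton_const = 1 / (\<integral>x. newton_div x \<partial>lborel)"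

text \<open>The amplitude \<open>\<delta>^-2\<close> keeps the bound by a multiple of
  \<open>|x|^-2\<close> independent of \<open>\<delta>\<close>. Its divergence then carries
  \<open>\<delta>^-3\<close>, the scaling of an approximate identity, so \<open>moll\<close> is the
  divergence of \<open>ker\<close>.\<close>

definition ker :: "real \<Rightarrow> 3 \<Rightarrow> R3 \<Rightarrow> real" where
  "ker \<delta> j x = newton_const * (1 / \<delta>)\<^sup>2 * newton_field j ((1 / \<delta>) *\<^sub>R x)"

definition moll :: "real \<Rightarrow> R3 \<Rightarrow> real" where
  "moll \<delta> x = newton_const * (1 / \<delta>) ^ 3 * newton_div ((1 / \<delta>) *\<^sub>R x)"

lemma newton_const_pos: "newton_const > 0" using newton_div_integral_pos by (simp add: newton_const_def)

lemma smooth_ker: "smooth_fun (ker \<delta> j)"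
  unfolding ker_def[abs_def] using smooth_affine[OF smooth_newton_field, of "newton_const * (1 / \<delta>)\<^sup>2" j "1 / \<delta>" 0]
  by (simp only: add_0_right)

lemma smooth_moll: "smooth_fun (moll \<delta>)"
  unfolding moll_def[abs_def] using smooth_affine[OF smooth_newton_div, of "newton_const * (1 / \<delta>) ^ 3" "1 / \<delta>" 0]
  by (simp only: add_0_right)

lemma pd_ker: "pd i (ker \<delta> j) = (\<lambda>x. newton_const * (1 / \<delta>) ^ 3 * pd i (newton_field j) ((1 / \<delta>) *\<^sub>R x))"
  unfolding ker_def[abs_def] using pd_affine[OF smooth_newton_field, of i "newton_const * (1 / \<delta>)\<^sup>2" j "1 / \<delta>" 0]
  by (simp only: add_0_right power2_eq_square power3_eq_cube mult.assoc)

lemma ker_curl_free: "pd i (ker \<delta> j) = pd j (ker \<delta> i)"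
  by (simp add: pd_ker newton_field_curl_free[of i])

lemma ker_div: "(\<Sum>j\<in>UNIV. pd j (ker \<delta> j) x) = moll \<delta> x"
  by (simp add: pd_ker moll_def newton_div_def sum_distrib_left)

lemma moll_nonneg: "\<delta> > 0 \<Longrightarrow> 0 \<le> moll \<delta> x"
  using newton_const_pos by (simp add: moll_def newton_div_nonneg)

lemma moll_outside: "\<delta> > 0 \<Longrightarrow> norm x > \<delta> \<Longrightarrow> moll \<delta> x = 0"
  by (simp add: moll_def newton_div_outside field_simps)

lemma integral_moll: assumes "\<delta> > 0" shows "(\<integral>x. moll \<delta> x \<partial>lborel) = 1"
proof -
  have "(\<integral>x. moll \<delta> x \<partial>lborel) = newton_const * ((1 / \<delta>) ^ 3 * (\<integral>x. newton_div ((1 / \<delta>) *\<^sub>R x) \<partial>lborel))"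
    by (simp add: moll_def)
  also have "(1 / \<delta>) ^ 3 * (\<integral>x. newton_div ((1 / \<delta>) *\<^sub>R x) \<partial>lborel) = (\<integral>x. newton_div x \<partial>lborel)"
    using integral_affine[OF smooth_fun_measurable[OF smooth_newton_div], of "1/\<delta>" 0] assms by simp
  finally show ?thesis using newton_div_integral_pos by (simp add: newton_const_def)
qed

lemma nn_integral_moll: assumes "\<delta> > 0" shows "(\<integral>\<^sup>+x. ennreal (moll \<delta> x) \<partial>lborel) = 1"
proof -
  have "integrable lborel (moll \<delta>)"
    by (rule integrable_continuous_bounded_support[OF smooth_fun_continuous[OF smooth_moll] moll_outside[OF assms]])
  then show ?thesis using nn_integral_eq_integral[of lborel "moll \<delta>"] moll_nonneg[OF assms] integral_moll[OF assms] by simp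
qed

lemma ker_bound: assumes "\<delta> > 0" shows "\<bar>ker \<delta> j x\<bar> * (norm x)\<^sup>2 \<le> newton_const"
proof -
  have "\<bar>ker \<delta> j x\<bar> * (norm x)\<^sup>2 = newton_const * (\<bar>newton_field j ((1 / \<delta>) *\<^sub>R x)\<bar> * (norm ((1 / \<delta>) *\<^sub>R x))\<^sup>2)"
    using newton_const_pos assms by (simp add: ker_def abs_mult power_mult_distrib power_divide)
  also have "\<dots> \<le> newton_const * 1"
    using newton_const_pos by (intro mult_left_mono newton_field_bound) auto
  finally show ?thesis by simp
qed

lemma ker_at_0: "ker \<delta> j 0 = 0" by (simp add: ker_def newton_field_def)

text \<open>On the shell where the norm lies between \<open>\<rho> / 2^(n+1)\<close> and
  \<open>\<rho> / 2^n\<close> the integrand is at most \<open>4^(n+1) / \<rho>^2\<close>, while the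
  ball of the larger radius has volume of order \<open>\<rho>^3 / 8^n\<close>. The series is
  geometric with ratio 1/2.\<close>

lemma inverse_square_locally_integrable:
  assumes \<rho>: "\<rho> > 0"
  shows "(\<integral>\<^sup>+x. ennreal (indicator (cball 0 \<rho>) (x::R3) / (norm x)\<^sup>2) \<partial>lborel) < \<infinity>"
proof -
  define B where "B n = cball (0::R3) (\<rho> / 2 ^ n)" for n
  have [measurable]: "B n \<in> sets borel" for n by (simp add: B_def)
  define c where "c n = 4 ^ Suc n / \<rho>\<^sup>2" for n
  have c0: "c n \<ge> 0" for n by (simp add: c_def)
  have pw: "ennreal (indicator (cball 0 \<rho>) x / (norm x)\<^sup>2) \<le> (\<Sum>n. ennreal (c n) * indicator (B n) x)" for x :: R3
  proof (cases "x \<in> cball 0 \<rho> \<and> x \<noteq> 0")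
    case True
    define P where "P n \<longleftrightarrow> \<rho> / 2 ^ Suc n < norm x" for n
    have "\<exists>n. P n"
    proof -
      have "(\<lambda>n. \<rho> * (1/2) ^ n) \<longlonglongrightarrow> \<rho> * 0" by (intro tendsto_intros LIMSEQ_power_zero) auto
      then have "eventually (\<lambda>n. \<rho> * (1/2) ^ n < norm x) sequentially"
        using True by (intro order_tendstoD) auto
      then obtain n where "\<rho> * (1/2) ^ n < norm x" by (auto simp: eventually_sequentially)
      then have "\<rho> / 2 ^ n < norm x" by (simp add: power_divide)
      moreover have "\<rho> / 2 ^ Suc n \<le> \<rho> / 2 ^ n" using \<rho> by (intro divide_left_mono) auto
      ultimately show ?thesis unfolding P_def by (auto intro!: exI[of _ n])
    qed
    \<comment> \<open>The least such index selects the shell of \<open>x\<close>: minimality, or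
      membership in the full ball when the index is 0, puts \<open>x\<close> into
      \<open>B n\<close>.\<close>
    define n where "n = (LEAST n. P n)"
    have n: "P n" unfolding n_def by (rule LeastI_ex[OF \<open>\<exists>n. P n\<close>])
    have xB: "x \<in> B n"
    proof (cases n)
      case 0 then show ?thesis using True by (simp add: B_def)
    next
      case (Suc m)
      then have "\<not> P m" using not_less_Least[of m P] by (simp add: n_def)
      then show ?thesis by (simp add: B_def P_def Suc not_less)
    qed
    have "(\<rho> / 2 ^ Suc n)\<^sup>2 \<le> (norm x)\<^sup>2" using n \<rho> unfolding P_def by (intro power_mono) auto
    then have "1 / (norm x)\<^sup>2 \<le> 1 / (\<rho> / 2 ^ Suc n)\<^sup>2" using \<rho> True by (intro divide_left_mono) auto
    also have "\<dots> = c n" by (simp add: c_def power_divide power2_eq_square power_mult_distrib[symmetric])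
    finally have "ennreal (indicator (cball 0 \<rho>) x / (norm x)\<^sup>2) \<le> ennreal (c n)"
      using True by (simp add: ennreal_leI)
    also have "\<dots> = ennreal (c n) * indicator (B n) x" using xB by simp
    also have "\<dots> \<le> (\<Sum>n. ennreal (c n) * indicator (B n) x)"
    proof -
      define f where "f n = ennreal (c n) * indicator (B n) x" for n
      have "sum f {n} \<le> suminf f" by (rule sum_le_suminf) auto
      then have "f n \<le> suminf f" by simp
      then show ?thesis unfolding f_def .
    qed
    finally show ?thesis .
  qed (auto simp: indicator_def)
  have "(\<integral>\<^sup>+x. ennreal (indicator (cball 0 \<rho>) (x::R3) / (norm x)\<^sup>2) \<partial>lborel)
      \<le> (\<integral>\<^sup>+x. (\<Sum>n. ennreal (c n) * indicator (B n) x) \<partial>lborel)"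
    by (rule nn_integral_mono) (rule pw)
  also have "\<dots> = (\<Sum>n. \<integral>\<^sup>+x. ennreal (c n) * indicator (B n) x \<partial>lborel)"
    by (rule nn_integral_suminf) measurable
  also have "\<dots> = (\<Sum>n. ennreal (4 * unit_ball_vol 3 * \<rho> * (1/2) ^ n))"
  proof (rule suminf_cong)
    fix n
    have "(\<integral>\<^sup>+x. ennreal (c n) * indicator (B n) x \<partial>lborel) = ennreal (c n) * emeasure lborel (B n)"
      by (subst nn_integral_cmult_indicator) (auto simp: B_def)
    also have "emeasure lborel (B n) = ennreal (unit_ball_vol 3 * (\<rho> / 2 ^ n) ^ 3)"
      unfolding B_def using \<rho> by (subst emeasure_cball) auto
    also have "ennreal (c n) * \<dots> = ennreal (c n * (unit_ball_vol 3 * (\<rho> / 2 ^ n) ^ 3))"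
      by (rule ennreal_mult'[symmetric]) (rule c0)
    also have "c n * (unit_ball_vol 3 * (\<rho> / 2 ^ n) ^ 3) = 4 * unit_ball_vol 3 * \<rho> * (1/2) ^ n"
    proof -
      have "(4::real) ^ n = 2 ^ n * 2 ^ n" by (simp add: power_mult_distrib[symmetric])
      then show ?thesis
        using \<rho> by (simp add: c_def power_divide field_simps power2_eq_square power3_eq_cube)
    qed
    finally show "(\<integral>\<^sup>+x. ennreal (c n) * indicator (B n) x \<partial>lborel) = ennreal (4 * unit_ball_vol 3 * \<rho> * (1/2) ^ n)" .
  qed
  also have "\<dots> < \<infinity>"
  proof -
    have "summable (\<lambda>n. 4 * unit_ball_vol 3 * \<rho> * (1/2::real) ^ n)" by (intro summable_mult summable_geometric) auto
    then have "(\<Sum>n. ennreal (4 * unit_ball_vol 3 * \<rho> * (1/2) ^ n)) = ennreal (\<Sum>n. 4 * unit_ball_vol 3 * \<rho> * (1/2) ^ n)"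
      using \<rho> by (intro suminf_ennreal2) (auto simp: unit_ball_vol_nonneg)
    then show ?thesis by simp
  qed
  finally show ?thesis .
qed

text \<open>All rescaled kernels lie below the same multiple of \<open>|x|^-2\<close>, which is why
  a single \<open>A\<close> serves every \<open>\<delta>\<close>.\<close>

lemma ker_local_L1:
  assumes \<rho>: "\<rho> > 0"
  shows "\<exists>A\<ge>0. \<forall>\<delta>>0. \<forall>j. (\<integral>\<^sup>+x. ennreal (indicator (cball 0 \<rho>) x * \<bar>ker \<delta> j x\<bar>) \<partial>lborel) \<le> ennreal A"
proof -
  define I where "I = (\<integral>\<^sup>+x. ennreal (indicator (cball 0 \<rho>) (x::R3) / (norm x)\<^sup>2) \<partial>lborel)"
  have I: "I < \<infinity>" unfolding I_def by (rule inverse_square_locally_integrable[OF \<rho>])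
  show ?thesis
  proof (intro exI[of _ "newton_const * enn2real I"] conjI allI impI)
    show "0 \<le> newton_const * enn2real I" using newton_const_pos by simp
    fix \<delta> :: real and j assume \<delta>: "\<delta> > 0"
    have "(\<integral>\<^sup>+x. ennreal (indicator (cball 0 \<rho>) x * \<bar>ker \<delta> j x\<bar>) \<partial>lborel)
      \<le> (\<integral>\<^sup>+x. ennreal newton_const * ennreal (indicator (cball 0 \<rho>) (x::R3) / (norm x)\<^sup>2) \<partial>lborel)"
    proof (rule nn_integral_mono)
      fix x :: R3
      show "ennreal (indicator (cball 0 \<rho>) x * \<bar>ker \<delta> j x\<bar>)
         \<le> ennreal newton_const * ennreal (indicator (cball 0 \<rho>) (x::R3) / (norm x)\<^sup>2)"
      proof (cases "x = 0")
        case False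
        then have "\<bar>ker \<delta> j x\<bar> \<le> newton_const / (norm x)\<^sup>2"
          using ker_bound[OF \<delta>, of j x] by (simp add: pos_le_divide_eq)
        then show ?thesis using newton_const_pos
          by (subst ennreal_mult'[symmetric]) (auto simp: indicator_def intro!: ennreal_leI)
      qed (simp add: ker_at_0)
    qed
    also have "\<dots> = ennreal newton_const * I" unfolding I_def
      by (rule nn_integral_cmult) (auto intro!: measurable_compose[OF _ measurable_ennreal] borel_measurable_divide
        borel_measurable_indicator borel_measurable_power borel_measurable_norm)
    also have "\<dots> = ennreal (newton_const * enn2real I)"
      using I newton_const_pos by (simp add: ennreal_mult' ennreal_enn2real)
    finally show "(\<integral>\<^sup>+x. ennreal (indicator (cball 0 \<rho>) x * \<bar>ker \<delta> j x\<bar>) \<partial>lborel) \<le> ennreal (newton_const * enn2real I)" .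
  qed
qed

section \<open>Square integrable estimates\<close>

definition L2_supp :: "real \<Rightarrow> (R3 \<Rightarrow> real) \<Rightarrow> bool" where
  "L2_supp r g \<longleftrightarrow> g \<in> borel_measurable borel \<and> integrable lborel (\<lambda>x. (g x)\<^sup>2) \<and> (\<forall>x. norm x > r \<longrightarrow> g x = 0)"

lemma L2_suppD:
  assumes "L2_supp r g"
  shows "g \<in> borel_measurable borel" "integrable lborel (\<lambda>x. (g x)\<^sup>2)" "\<And>x. norm x > r \<Longrightarrow> g x = 0"
    "integrable lborel g"
proof -
  show m: "g \<in> borel_measurable borel" "integrable lborel (\<lambda>x. (g x)\<^sup>2)" and z: "\<And>x. norm x > r \<Longrightarrow> g x = 0"
    using assms unfolding L2_supp_def by auto
  note [measurable] = m(1)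
  have "integrable lborel (\<lambda>x. indicator (cball 0 r) (x::R3) + (g x)\<^sup>2)"
    using emeasure_lborel_cball_finite[of "0::R3" r] m(2) by (intro Bochner_Integration.integrable_add integrable_real_indicator) auto
  then show "integrable lborel g"
  proof (rule Bochner_Integration.integrable_bound)
    show "AE x in lborel. norm (g x) \<le> norm (indicator (cball 0 r) x + (g x)\<^sup>2)"
    proof (rule AE_I2)
      fix x
      have "\<bar>g x\<bar> \<le> 1 + (g x)\<^sup>2"
        using sum_squares_bound[of "\<bar>g x\<bar>" 1] by (simp add: power2_eq_square)
      then show "norm (g x) \<le> norm (indicator (cball 0 r) x + (g x)\<^sup>2)"
        using z[of x] by (cases "norm x > r") (auto simp: indicator_def)
    qed
  qed simp
qed

lemma integral_moll_reflect: assumes "\<delta> > 0" shows "(\<integral>y. moll \<delta> (x - y) \<partial>lborel) = 1"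
  using integral_affine[OF smooth_fun_measurable[OF smooth_moll], of "-1" \<delta> x] integral_moll[OF assms] by simp

lemma integrable_moll_reflect: assumes "\<delta> > 0" shows "integrable lborel (\<lambda>y. moll \<delta> (x - y))"
proof (rule integrable_continuous_bounded_support)
  show "continuous_on UNIV (\<lambda>y. moll \<delta> (x - y))"
    by (rule smooth_fun_continuous[OF smooth_reflect[OF smooth_moll]])
  show "moll \<delta> (x - y) = 0" if "norm y > norm x + \<delta>" for y
    by (rule moll_outside[OF assms]) (use that norm_triangle_ineq2[of y x] in \<open>auto simp: norm_minus_commute\<close>)
qed

section \<open>Contraction properties of mollification\<close>

text \<open>Jensen's inequality: \<open>y \<mapsto> moll \<delta> (x - y)\<close> is a probability
  density, and the variance of \<open>g\<close> under it is nonnegative.\<close>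

lemma conv_moll_square_le:
  assumes g: "L2_supp r g" and \<delta>: "\<delta> > 0"
  shows "(conv (moll \<delta>) g x)\<^sup>2 \<le> conv (moll \<delta>) (\<lambda>y. (g y)\<^sup>2) x"
proof -
  note D = L2_suppD[OF g]
  have i: "integrable lborel (\<lambda>y. moll \<delta> (x - y) * g y)"
    by (rule integrable_conv[OF smooth_fun_continuous[OF smooth_moll] D(4,3)])
  have i2: "integrable lborel (\<lambda>y. moll \<delta> (x - y) * (g y)\<^sup>2)"
    by (rule integrable_conv[OF smooth_fun_continuous[OF smooth_moll] D(2), where r=r]) (use D(3) in auto)
  define c where "c = conv (moll \<delta>) g x"
  have "0 \<le> (\<integral>y. moll \<delta> (x - y) * (g y - c)\<^sup>2 \<partial>lborel)"
    by (rule Bochner_Integration.integral_nonneg) (simp add: moll_nonneg[OF \<delta>])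
  also have "\<dots> = (\<integral>y. moll \<delta> (x - y) * (g y)\<^sup>2 - 2 * c * (moll \<delta> (x - y) * g y) + c\<^sup>2 * moll \<delta> (x - y) \<partial>lborel)"
    by (rule Bochner_Integration.integral_cong) (auto simp: power2_eq_square algebra_simps)
  also have "\<dots> = conv (moll \<delta>) (\<lambda>y. (g y)\<^sup>2) x - 2 * c * c + c\<^sup>2"
    using i i2 integrable_moll_reflect[OF \<delta>, of x]
    by (simp add: conv_def c_def integral_moll_reflect[OF \<delta>])
  finally show ?thesis by (simp add: c_def power2_eq_square)
qed

lemma conv_moll_outside:
  assumes \<delta>: "\<delta> > 0" and g: "\<And>y. norm y > r \<Longrightarrow> g y = 0" and x: "norm x > r + \<delta>"
  shows "conv (moll \<delta>) g x = 0"
proof -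
  have "moll \<delta> (x - y) * g y = 0" for y
  proof (cases "norm y > r")
    case False
    then have "norm (x - y) > \<delta>" using norm_triangle_ineq2[of x y] x by simp
    then show ?thesis using moll_outside[OF \<delta>] by simp
  qed (simp add: g)
  then have "(\<lambda>y. moll \<delta> (x - y) * g y) = (\<lambda>y. 0)" by (rule ext)
  then show ?thesis unfolding conv_def by simp
qed

text \<open>Nonnegativity of \<open>h\<close> allows Tonelli's theorem in place of an integrability
  check on the product space; the mollifier has mass one.\<close>

lemma integral_conv_moll:
  assumes h: "integrable lborel h" "\<And>y. norm y > r \<Longrightarrow> h y = 0" "\<And>y. h y \<ge> 0" and \<delta>: "\<delta> > 0"
  shows "integrable lborel (conv (moll \<delta>) h)" "(\<integral>x. conv (moll \<delta>) h x \<partial>lborel) = (\<integral>x. h x \<partial>lborel)"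
proof -
  note [measurable] = borel_measurable_integrable[OF h(1), simplified] smooth_fun_measurable[OF smooth_moll]
  show i: "integrable lborel (conv (moll \<delta>) h)"
    by (rule integrable_continuous_bounded_support[where r="r + \<delta>"])
      (auto intro: smooth_fun_continuous smooth_conv[OF smooth_moll h(1,2)] conv_moll_outside[OF \<delta> h(2)])
  have c0: "conv (moll \<delta>) h x \<ge> 0" for x unfolding conv_def
    by (rule Bochner_Integration.integral_nonneg) (simp add: moll_nonneg[OF \<delta>] h)
  have e: "ennreal (conv (moll \<delta>) h x) = (\<integral>\<^sup>+y. ennreal (moll \<delta> (x - y)) * ennreal (h y) \<partial>lborel)" for x
    unfolding conv_def
    using nn_integral_eq_integral[OF integrable_conv[OF smooth_fun_continuous[OF smooth_moll[of \<delta>]] h(1,2), where x=x]]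
    by (simp add: moll_nonneg[OF \<delta>] h ennreal_mult')
  have "ennreal (\<integral>x. conv (moll \<delta>) h x \<partial>lborel) = (\<integral>\<^sup>+x. ennreal (conv (moll \<delta>) h x) \<partial>lborel)"
    using nn_integral_eq_integral[OF i] c0 by simp
  also have "\<dots> = (\<integral>\<^sup>+x. ennreal (moll \<delta> x) \<partial>lborel) * (\<integral>\<^sup>+x. ennreal (h x) \<partial>lborel)"
    unfolding e by (rule young_nn) auto
  also have "\<dots> = ennreal (\<integral>x. h x \<partial>lborel)"
    using nn_integral_eq_integral[OF h(1)] h(3) by (simp add: nn_integral_moll[OF \<delta>])
  finally show "(\<integral>x. conv (moll \<delta>) h x \<partial>lborel) = (\<integral>x. h x \<partial>lborel)"
    using c0 h(3) by (simp add: Bochner_Integration.integral_nonneg)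
qed

lemma conv_moll_L2:
  assumes g: "L2_supp r g" and \<delta>: "\<delta> > 0"
  shows "integrable lborel (\<lambda>x. (conv (moll \<delta>) g x)\<^sup>2)"
    "(\<integral>x. (conv (moll \<delta>) g x)\<^sup>2 \<partial>lborel) \<le> (\<integral>x. (g x)\<^sup>2 \<partial>lborel)"
proof -
  note D = L2_suppD[OF g]
  have z: "\<And>y. norm y > r \<Longrightarrow> (g y)\<^sup>2 = 0" using D(3) by simp
  show i: "integrable lborel (\<lambda>x. (conv (moll \<delta>) g x)\<^sup>2)"
    by (rule integrable_continuous_bounded_support[where r="r + \<delta>"])
      (auto intro!: continuous_intros smooth_fun_continuous smooth_conv[OF smooth_moll D(4,3)] conv_moll_outside[OF \<delta> D(3)])
  have "(\<integral>x. (conv (moll \<delta>) g x)\<^sup>2 \<partial>lborel) \<le> (\<integral>x. conv (moll \<delta>) (\<lambda>y. (g y)\<^sup>2) x \<partial>lborel)"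
    by (rule integral_mono[OF i integral_conv_moll(1)[OF D(2) z _ \<delta>]]) (use conv_moll_square_le[OF g \<delta>] in auto)
  then show "(\<integral>x. (conv (moll \<delta>) g x)\<^sup>2 \<partial>lborel) \<le> (\<integral>x. (g x)\<^sup>2 \<partial>lborel)"
    using integral_conv_moll(2)[OF D(2) z _ \<delta>] by simp
qed

text \<open>Jensen's inequality bounds the fourth power by the square of the mollified square, and
  the square integrable contraction applies to that.\<close>

lemma conv_moll_L4:
  assumes g: "L2_supp r g" and g2: "L2_supp r (\<lambda>x. (g x)\<^sup>2)" and \<delta>: "\<delta> > 0"
  shows "integrable lborel (\<lambda>x. (conv (moll \<delta>) g x) ^ 4)"
    "(\<integral>x. (conv (moll \<delta>) g x) ^ 4 \<partial>lborel) \<le> (\<integral>x. (g x) ^ 4 \<partial>lborel)"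
proof -
  note D = L2_suppD[OF g]
  show i: "integrable lborel (\<lambda>x. (conv (moll \<delta>) g x) ^ 4)"
    by (rule integrable_continuous_bounded_support[where r="r + \<delta>"])
      (auto intro!: continuous_intros smooth_fun_continuous smooth_conv[OF smooth_moll D(4,3)] conv_moll_outside[OF \<delta> D(3)])
  have "(\<integral>x. (conv (moll \<delta>) g x) ^ 4 \<partial>lborel) \<le> (\<integral>x. (conv (moll \<delta>) (\<lambda>y. (g y)\<^sup>2) x)\<^sup>2 \<partial>lborel)"
  proof (rule integral_mono[OF i conv_moll_L2(1)[OF g2 \<delta>]])
    fix x
    have "((conv (moll \<delta>) g x)\<^sup>2)\<^sup>2 \<le> (conv (moll \<delta>) (\<lambda>y. (g y)\<^sup>2) x)\<^sup>2"
      by (rule power_mono[OF conv_moll_square_le[OF g \<delta>]]) simp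
    then show "(conv (moll \<delta>) g x) ^ 4 \<le> (conv (moll \<delta>) (\<lambda>y. (g y)\<^sup>2) x)\<^sup>2" by simp
  qed
  also have "\<dots> \<le> (\<integral>x. ((g x)\<^sup>2)\<^sup>2 \<partial>lborel)" by (rule conv_moll_L2(2)[OF g2 \<delta>])
  finally show "(\<integral>x. (conv (moll \<delta>) g x) ^ 4 \<partial>lborel) \<le> (\<integral>x. (g x) ^ 4 \<partial>lborel)" by simp
qed

text \<open>Young's inequality, localised: for \<open>x\<close> in the ball of radius
  \<open>R\<close> and \<open>y\<close> in the support of \<open>g\<close>, only values of
  \<open>K\<close> on the ball of radius \<open>R + r\<close> occur. This suits the kernels
  \<open>ker\<close>, whose decay \<open>|x|^-2\<close> gives no global integrability.\<close>

lemma conv_local_L2: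
  assumes K: "smooth_fun K" and g: "L2_supp r g" and A: "A \<ge> 0"
    "(\<integral>\<^sup>+x. ennreal (indicator (cball 0 (R + r)) x * \<bar>K x\<bar>) \<partial>lborel) \<le> ennreal A"
  shows "(\<integral>x. indicator (cball 0 R) x * (conv K g x)\<^sup>2 \<partial>lborel) \<le> A\<^sup>2 * (\<integral>x. (g x)\<^sup>2 \<partial>lborel)"
proof -
  note D = L2_suppD[OF g]
  define k where "k x = indicator (cball 0 (R + r)) x * \<bar>K x\<bar>" for x
  have kb: "k \<in> borel_measurable borel" unfolding k_def
    using smooth_fun_measurable[OF K] by (intro borel_measurable_times borel_measurable_indicator borel_measurable_abs) auto
  note [measurable] = D(1) kb smooth_fun_measurable[OF K]
  have k0: "k x \<ge> 0" for x by (simp add: k_def)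
  have pw: "ennreal (indicator (cball 0 R) x * (conv K g x)\<^sup>2)
     \<le> ennreal A * (\<integral>\<^sup>+y. ennreal (k (x - y)) * ennreal ((g y)\<^sup>2) \<partial>lborel)" for x
  proof (cases "x \<in> cball 0 R")
    case True
    have e: "\<bar>K (x - y) * g y\<bar> = k (x - y) * \<bar>g y\<bar>" for y
    proof (cases "norm y > r")
      case False
      then have "x - y \<in> cball 0 (R + r)" using True norm_triangle_ineq4[of x y] by simp
      then show ?thesis by (simp add: k_def abs_mult)
    qed (simp add: D)
    have i: "integrable lborel (\<lambda>y. K (x - y) * g y)"
      by (rule integrable_conv[OF smooth_fun_continuous[OF K] D(4,3)])
    have "ennreal \<bar>conv K g x\<bar> \<le> (\<integral>\<^sup>+y. ennreal (k (x - y) * \<bar>g y\<bar>) \<partial>lborel)"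
      using integral_norm_bound_ennreal[OF i] by (simp add: conv_def e)
    then have "(ennreal \<bar>conv K g x\<bar>)\<^sup>2 \<le> (\<integral>\<^sup>+y. ennreal (k (x - y) * \<bar>g y\<bar>) \<partial>lborel)\<^sup>2"
      by (rule power_mono) simp
    also have "\<dots> \<le> (\<integral>\<^sup>+y. ennreal (k y) \<partial>lborel) * (\<integral>\<^sup>+y. ennreal (k (x - y) * (\<bar>g y\<bar>)\<^sup>2) \<partial>lborel)"
      by (rule conv_nn_sq) (auto simp: k0)
    also have "\<dots> \<le> ennreal A * (\<integral>\<^sup>+y. ennreal (k (x - y) * (\<bar>g y\<bar>)\<^sup>2) \<partial>lborel)"
      using A(2) by (intro mult_right_mono) (auto simp: k_def)
    finally show ?thesis using True by (simp add: ennreal_power k0 ennreal_mult')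
  qed simp
  have "(\<integral>\<^sup>+x. ennreal (indicator (cball 0 R) x * (conv K g x)\<^sup>2) \<partial>lborel)
      \<le> (\<integral>\<^sup>+x. ennreal A * (\<integral>\<^sup>+y. ennreal (k (x - y)) * ennreal ((g y)\<^sup>2) \<partial>lborel) \<partial>lborel)"
    by (rule nn_integral_mono) (rule pw)
  also have "\<dots> = ennreal A * (\<integral>\<^sup>+x. (\<integral>\<^sup>+y. ennreal (k (x - y)) * ennreal ((g y)\<^sup>2) \<partial>lborel) \<partial>lborel)"
    by (rule nn_integral_cmult) measurable
  also have "\<dots> = ennreal A * ((\<integral>\<^sup>+x. ennreal (k x) \<partial>lborel) * (\<integral>\<^sup>+x. ennreal ((g x)\<^sup>2) \<partial>lborel))"
    by (subst young_nn) auto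
  also have "\<dots> \<le> ennreal A * (ennreal A * ennreal (\<integral>x. (g x)\<^sup>2 \<partial>lborel))"
    using A(2) nn_integral_eq_integral[OF D(2)] by (intro mult_left_mono mult_mono) (auto simp: k_def)
  also have "\<dots> = ennreal (A\<^sup>2 * (\<integral>x. (g x)\<^sup>2 \<partial>lborel))"
    using A(1) by (simp add: ennreal_mult'[symmetric] power2_eq_square mult.assoc Bochner_Integration.integral_nonneg)
  finally have "(\<integral>\<^sup>+x. ennreal (indicator (cball 0 R) x * (conv K g x)\<^sup>2) \<partial>lborel) \<le> ennreal (A\<^sup>2 * (\<integral>x. (g x)\<^sup>2 \<partial>lborel))" .
  moreover have "integrable lborel (\<lambda>x. indicator (cball 0 R) x *\<^sub>R (conv K g x)\<^sup>2)"
    by (rule borel_integrable_compact) (auto intro!: continuous_intros smooth_fun_continuous smooth_conv[OF K D(4,3)])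
  ultimately show ?thesis
    using nn_integral_eq_integral[of lborel "\<lambda>x. indicator (cball 0 R) x * (conv K g x)\<^sup>2"]
    by (simp add: Bochner_Integration.integral_nonneg)
qed

lemma integrable_ind_cont:
  "continuous_on UNIV f \<Longrightarrow> integrable lborel (\<lambda>x. indicator (cball 0 R) x * f (x::R3) :: real)"
  using borel_integrable_compact[of "cball 0 R" f] continuous_on_subset[of UNIV f "cball 0 R"] by simp

lemma smooth_bound_on_ball:
  assumes "smooth_fun f" shows "\<exists>C\<ge>0. \<forall>x\<in>cball 0 r. \<bar>f x\<bar> \<le> C"
  using smooth_bounds[OF assms, of r] by blast

text \<open>For a curl free field, \<open>\<Sum>\<^sub>i\<^sub>j (\<partial>\<^sub>i f\<^sub>j)\<^sup>2 = \<Sum>\<^sub>i\<^sub>j \<partial>\<^sub>i f\<^sub>j \<partial>\<^sub>j f\<^sub>i\<close>, which equals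
  \<open>(div f)\<^sup>2\<close> up to divergences; the divergences meet the gradient of the cutoff.\<close>
lemma caccioppoli_curl_free:
  fixes f :: "3 \<Rightarrow> R3 \<Rightarrow> real"
  assumes f: "\<And>j. smooth_fun (f j)" and curl: "\<And>i j. pd i (f j) = pd j (f i)"
    and \<xi>: "smooth_fun \<xi>" "\<And>x. norm x > 4 \<Longrightarrow> \<xi> x = 0" "\<And>x. norm x \<le> 2 \<Longrightarrow> \<xi> x = 1"
      "\<And>x. 0 \<le> \<xi> x" "\<And>x. \<xi> x \<le> 1"
    and C: "C \<ge> 0" "\<And>i x. x \<in> cball 0 4 \<Longrightarrow> \<bar>pd i \<xi> x\<bar> \<le> C"
  shows "(\<integral>x. indicator (cball 0 2) x * (\<Sum>i\<in>UNIV. \<Sum>j\<in>UNIV. (pd i (f j) x)\<^sup>2) \<partial>lborel)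
    \<le> (\<integral>x. indicator (cball 0 4) x * (14 * C\<^sup>2 * (\<Sum>j\<in>UNIV. (f j x)\<^sup>2) + 8 * (\<Sum>j\<in>UNIV. pd j (f j) x)\<^sup>2) \<partial>lborel)"
proof -
  define D where "D x = (\<Sum>j\<in>UNIV. pd j (f j) x)" for x
  define E where "E x = (\<xi> x)\<^sup>2 * (\<Sum>i\<in>UNIV. \<Sum>j\<in>UNIV. (pd i (f j) x)\<^sup>2)" for x
  define R where "R x = (\<Sum>i\<in>UNIV. \<Sum>j\<in>UNIV. - (f j x * (2 * \<xi> x * pd i \<xi> x) * pd j (f i) x))
     + (\<xi> x)\<^sup>2 * (D x)\<^sup>2 + (\<Sum>j\<in>UNIV. f j x * (2 * \<xi> x * pd j \<xi> x) * D x)" for x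
  have sD: "smooth_fun D" unfolding D_def[abs_def] by (intro smooth_sum smooth_fun_pd f)
  have pD: "pd i D x = (\<Sum>j\<in>UNIV. pd i (pd j (f j)) x)" for i x
    unfolding D_def[abs_def] by (subst pd_smooth_sum) (auto intro: smooth_fun_pd f)
  have sx2: "smooth_fun (\<lambda>x. (\<xi> x)\<^sup>2)" by (intro smooth_power \<xi>)
  have px2: "pd i (\<lambda>x. (\<xi> x)\<^sup>2) = (\<lambda>x. 2 * \<xi> x * pd i \<xi> x)" for i
    using pd_smooth_power[OF \<xi>(1), of i 1] by (simp add: numeral_2_eq_2)
  note sm = smooth_mult smooth_fun_pd f \<xi>(1) sD sx2 smooth_power smooth_sum smooth_cmult smooth_minus smooth_add
  have io: "integrable lborel h" if "smooth_fun h" "\<And>x. norm x > 4 \<Longrightarrow> h x = 0" for h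
    using integrable_continuous_bounded_support[OF smooth_fun_continuous[OF that(1)] that(2)] .
  have s1: "(\<integral>x. (\<xi> x)\<^sup>2 * (pd i (f j) x * pd j (f i) x) \<partial>lborel)
     = (\<integral>x. - (f j x * (2 * \<xi> x * pd i \<xi> x) * pd j (f i) x) \<partial>lborel) - (\<integral>x. (f j x * (\<xi> x)\<^sup>2) * pd i (pd j (f i)) x \<partial>lborel)" for i j
  proof -
    have "(\<integral>x. (\<xi> x)\<^sup>2 * (pd i (f j) x * pd j (f i) x) \<partial>lborel) = (\<integral>x. pd i (f j) x * ((\<xi> x)\<^sup>2 * pd j (f i) x) \<partial>lborel)"
      by (simp add: mult_ac)
    also have "\<dots> = - (\<integral>x. f j x * pd i (\<lambda>x. (\<xi> x)\<^sup>2 * pd j (f i) x) x \<partial>lborel)"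
      by (rule integral_by_parts[where r=4]) (auto intro!: sm simp: \<xi>(2))
    also have "\<dots> = (\<integral>x. - (f j x * (2 * \<xi> x * pd i \<xi> x) * pd j (f i) x) - (f j x * (\<xi> x)\<^sup>2) * pd i (pd j (f i)) x \<partial>lborel)"
      unfolding pd_smooth_mult[OF sx2 smooth_fun_pd[OF f]] px2
      by (subst Bochner_Integration.integral_minus[symmetric]) (auto intro!: Bochner_Integration.integral_cong simp: algebra_simps)
    also have "\<dots> = (\<integral>x. - (f j x * (2 * \<xi> x * pd i \<xi> x) * pd j (f i) x) \<partial>lborel) - (\<integral>x. (f j x * (\<xi> x)\<^sup>2) * pd i (pd j (f i)) x \<partial>lborel)"
      by (rule Bochner_Integration.integral_diff) (auto intro!: io sm simp: \<xi>(2))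
    finally show ?thesis .
  qed
  \<comment> \<open>Since partial derivatives commute, summing over \<open>i\<close> turns the
    second derivatives into \<open>pd j D\<close>; integrating by parts again moves
    \<open>pd j\<close> back and produces the square of the divergence.\<close>
  have s2: "(\<Sum>i\<in>UNIV. \<integral>x. (f j x * (\<xi> x)\<^sup>2) * pd i (pd j (f i)) x \<partial>lborel)
     = - (\<integral>x. (\<xi> x)\<^sup>2 * (pd j (f j) x * D x) \<partial>lborel) - (\<integral>x. f j x * (2 * \<xi> x * pd j \<xi> x) * D x \<partial>lborel)" for j
  proof -
    have "(\<Sum>i\<in>UNIV. \<integral>x. (f j x * (\<xi> x)\<^sup>2) * pd i (pd j (f i)) x \<partial>lborel)
        = (\<integral>x. (\<Sum>i\<in>UNIV. (f j x * (\<xi> x)\<^sup>2) * pd i (pd j (f i)) x) \<partial>lborel)"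
      by (rule Bochner_Integration.integral_sum[symmetric]) (auto intro!: io sm simp: \<xi>(2))
    also have "\<dots> = (\<integral>x. (f j x * (\<xi> x)\<^sup>2) * pd j D x \<partial>lborel)"
      by (simp add: pD sum_distrib_left pd_commute[OF f, of _ j])
    also have "\<dots> = - (\<integral>x. pd j (\<lambda>x. f j x * (\<xi> x)\<^sup>2) x * D x \<partial>lborel)"
      by (subst integral_by_parts[where r=4]) (auto intro!: sm simp: \<xi>(2))
    also have "\<dots> = - (\<integral>x. (\<xi> x)\<^sup>2 * (pd j (f j) x * D x) + f j x * (2 * \<xi> x * pd j \<xi> x) * D x \<partial>lborel)"
      unfolding pd_smooth_mult[OF f sx2] px2 by (simp add: algebra_simps)
    also have "\<dots> = - ((\<integral>x. (\<xi> x)\<^sup>2 * (pd j (f j) x * D x) \<partial>lborel) + (\<integral>x. f j x * (2 * \<xi> x * pd j \<xi> x) * D x \<partial>lborel))"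
      by (subst Bochner_Integration.integral_add) (auto intro!: io sm simp: \<xi>(2))
    finally show ?thesis by simp
  qed
  have "(\<integral>x. E x \<partial>lborel) = (\<integral>x. (\<Sum>i\<in>UNIV. \<Sum>j\<in>UNIV. (\<xi> x)\<^sup>2 * (pd i (f j) x * pd j (f i) x)) \<partial>lborel)"
  proof (rule Bochner_Integration.integral_cong)
    fix x
    have "(pd i (f j) x)\<^sup>2 = pd i (f j) x * pd j (f i) x" for i j
      by (simp add: power2_eq_square) (metis curl)
    then show "E x = (\<Sum>i\<in>UNIV. \<Sum>j\<in>UNIV. (\<xi> x)\<^sup>2 * (pd i (f j) x * pd j (f i) x))"
      by (simp add: E_def sum_distrib_left)
  qed simp
  also have "\<dots> = (\<Sum>i\<in>UNIV. \<Sum>j\<in>UNIV. (\<integral>x. (\<xi> x)\<^sup>2 * (pd i (f j) x * pd j (f i) x) \<partial>lborel))"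
    by (subst Bochner_Integration.integral_sum | auto intro!: io sm sum.neutral Bochner_Integration.integrable_sum simp: \<xi>(2))+
  also have "\<dots> = (\<Sum>i\<in>UNIV. \<Sum>j\<in>UNIV. (\<integral>x. - (f j x * (2 * \<xi> x * pd i \<xi> x) * pd j (f i) x) \<partial>lborel))
     - (\<Sum>j\<in>UNIV. \<Sum>i\<in>UNIV. (\<integral>x. (f j x * (\<xi> x)\<^sup>2) * pd i (pd j (f i)) x \<partial>lborel))"
    unfolding s1 sum_subtractf by (subst sum.swap[of "\<lambda>j i. \<integral>x. (f j x * (\<xi> x)\<^sup>2) * pd i (pd j (f i)) x \<partial>lborel"]) simp
  also have "\<dots> = (\<Sum>i\<in>UNIV. \<Sum>j\<in>UNIV. (\<integral>x. - (f j x * (2 * \<xi> x * pd i \<xi> x) * pd j (f i) x) \<partial>lborel))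
     + (\<Sum>j\<in>UNIV. \<integral>x. (\<xi> x)\<^sup>2 * (pd j (f j) x * D x) \<partial>lborel) + (\<Sum>j\<in>UNIV. \<integral>x. f j x * (2 * \<xi> x * pd j \<xi> x) * D x \<partial>lborel)"
    unfolding s2 by (simp add: sum_subtractf sum_negf)
  also have "(\<Sum>j\<in>UNIV. \<integral>x. (\<xi> x)\<^sup>2 * (pd j (f j) x * D x) \<partial>lborel) = (\<integral>x. (\<xi> x)\<^sup>2 * (D x)\<^sup>2 \<partial>lborel)"
  proof -
    have "(\<Sum>j\<in>UNIV. \<integral>x. (\<xi> x)\<^sup>2 * (pd j (f j) x * D x) \<partial>lborel) = (\<integral>x. (\<Sum>j\<in>UNIV. (\<xi> x)\<^sup>2 * (pd j (f j) x * D x)) \<partial>lborel)"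
      by (rule Bochner_Integration.integral_sum[symmetric]) (auto intro!: io sm simp: \<xi>(2))
    also have "(\<lambda>x. \<Sum>j\<in>UNIV. (\<xi> x)\<^sup>2 * (pd j (f j) x * D x)) = (\<lambda>x. (\<xi> x)\<^sup>2 * (D x)\<^sup>2)"
      by (simp add: fun_eq_iff sum_distrib_left[symmetric] sum_distrib_right[symmetric] D_def[symmetric] power2_eq_square)
    finally show ?thesis .
  qed
  also have "(\<Sum>i\<in>UNIV. \<Sum>j\<in>UNIV. (\<integral>x. - (f j x * (2 * \<xi> x * pd i \<xi> x) * pd j (f i) x) \<partial>lborel))
      = (\<integral>x. (\<Sum>i\<in>UNIV. \<Sum>j\<in>UNIV. - (f j x * (2 * \<xi> x * pd i \<xi> x) * pd j (f i) x)) \<partial>lborel)"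
    by (subst Bochner_Integration.integral_sum | auto intro!: io sm sum.neutral Bochner_Integration.integrable_sum simp: \<xi>(2))+
  also have "(\<Sum>j\<in>UNIV. \<integral>x. f j x * (2 * \<xi> x * pd j \<xi> x) * D x \<partial>lborel)
      = (\<integral>x. (\<Sum>j\<in>UNIV. f j x * (2 * \<xi> x * pd j \<xi> x) * D x) \<partial>lborel)"
    by (rule Bochner_Integration.integral_sum[symmetric]) (auto intro!: io sm simp: \<xi>(2))
  finally have ER: "(\<integral>x. E x \<partial>lborel) = (\<integral>x. R x \<partial>lborel)"
    unfolding R_def
    by (subst Bochner_Integration.integral_add | auto intro!: io sm sum.neutral Bochner_Integration.integrable_add simp: \<xi>(2))+
  \<comment> \<open>Half of \<open>E\<close> is absorbed by Young's inequality. Summed over three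
    values of \<open>i\<close>, the first term costs \<open>6 * C^2\<close> and the last one
    \<open>C^2\<close>, which makes 7; the divergence appears once and then three more times, which
    makes 4.\<close>
  define B where "B x = 7 * C\<^sup>2 * (\<Sum>j\<in>UNIV. (f j x)\<^sup>2) + 4 * (D x)\<^sup>2" for x
  have c01: "(\<xi> x)\<^sup>2 \<le> 1" for x using \<xi>(4,5) by (simp add: power_le_one)
  have pw: "R x \<le> 1/2 * E x + indicator (cball 0 4) x * B x" for x
  proof (cases "x \<in> cball 0 4")
    case True
    have a: "- (f j x * (2 * \<xi> x * pd i \<xi> x) * pd j (f i) x) \<le> 1/2 * ((\<xi> x)\<^sup>2 * (pd j (f i) x)\<^sup>2) + 2 * C\<^sup>2 * (f j x)\<^sup>2" for i j
    proof -
      have "- (f j x * (2 * \<xi> x * pd i \<xi> x) * pd j (f i) x) = (\<xi> x * pd j (f i) x) * (- (2 * (f j x * pd i \<xi> x)))"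
        by (simp add: algebra_simps)
      also have "\<dots> \<le> 1/2 * (\<xi> x * pd j (f i) x)\<^sup>2 + 1/2 * (2 * (f j x * pd i \<xi> x))\<^sup>2"
        using sum_squares_bound[of "\<xi> x * pd j (f i) x" "- (2 * (f j x * pd i \<xi> x))"] by simp
      also have "(2 * (f j x * pd i \<xi> x))\<^sup>2 = 4 * ((f j x)\<^sup>2 * (pd i \<xi> x)\<^sup>2)" by (simp add: power_mult_distrib)
      also have "(f j x)\<^sup>2 * (pd i \<xi> x)\<^sup>2 \<le> (f j x)\<^sup>2 * C\<^sup>2"
        using C(2)[OF True, of i] by (intro mult_left_mono) (auto simp: abs_le_square_iff[symmetric] C(1))
      finally show ?thesis by (simp add: power_mult_distrib algebra_simps)
    qed
    have b: "f j x * (2 * \<xi> x * pd j \<xi> x) * D x \<le> (\<xi> x)\<^sup>2 * (D x)\<^sup>2 + C\<^sup>2 * (f j x)\<^sup>2" for j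
    proof -
      have "f j x * (2 * \<xi> x * pd j \<xi> x) * D x = 2 * (\<xi> x * D x) * (f j x * pd j \<xi> x)" by simp
      also have "\<dots> \<le> (\<xi> x * D x)\<^sup>2 + (f j x * pd j \<xi> x)\<^sup>2"
        by (rule sum_squares_bound)
      also have "(f j x * pd j \<xi> x)\<^sup>2 \<le> C\<^sup>2 * (f j x)\<^sup>2"
        using C(2)[OF True, of j] unfolding power_mult_distrib mult.commute[of "C\<^sup>2"]
        by (intro mult_left_mono) (auto simp: abs_le_square_iff[symmetric] C(1))
      finally show ?thesis by (simp add: power_mult_distrib)
    qed
    have "R x \<le> (\<Sum>i\<in>UNIV. \<Sum>j\<in>UNIV. 1/2 * ((\<xi> x)\<^sup>2 * (pd j (f i) x)\<^sup>2) + 2 * C\<^sup>2 * (f j x)\<^sup>2)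
        + (\<xi> x)\<^sup>2 * (D x)\<^sup>2 + (\<Sum>j\<in>(UNIV::3 set). (\<xi> x)\<^sup>2 * (D x)\<^sup>2 + C\<^sup>2 * (f j x)\<^sup>2)"
      unfolding R_def by (intro add_mono sum_mono a b order_refl)
    also have "\<dots> = 1/2 * E x + 7 * C\<^sup>2 * (\<Sum>j\<in>UNIV. (f j x)\<^sup>2) + 4 * ((\<xi> x)\<^sup>2 * (D x)\<^sup>2)"
      unfolding E_def curl[of _ "_::3"]
      by (simp add: sum.distrib sum_distrib_left[symmetric] sum_divide_distrib[symmetric])
    also have "\<dots> \<le> 1/2 * E x + B x"
      using mult_right_mono[OF c01[of x], of "(D x)\<^sup>2"] by (simp add: B_def)
    finally show ?thesis using True by simp
  next
    case False
    then have "\<xi> x = 0" using \<xi>(2) by simp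
    then show ?thesis using False by (simp add: R_def E_def)
  qed
  have iE: "integrable lborel E"
    unfolding E_def[abs_def] by (rule io) (auto intro!: sm simp: \<xi>(2))
  have iR: "integrable lborel R"
    unfolding R_def[abs_def] by (rule io) (auto intro!: sm sum.neutral simp: \<xi>(2))
  have sB: "smooth_fun B" unfolding B_def[abs_def] by (auto intro!: sm)
  have iB: "integrable lborel (\<lambda>x. indicator (cball 0 4) x * B x)"
    by (rule integrable_ind_cont) (rule smooth_fun_continuous[OF sB])
  have "(\<integral>x. R x \<partial>lborel) \<le> (\<integral>x. 1/2 * E x + indicator (cball 0 4) x * B x \<partial>lborel)"
    by (rule integral_mono[OF iR]) (use pw iE iB in auto)
  also have "\<dots> = 1/2 * (\<integral>x. E x \<partial>lborel) + (\<integral>x. indicator (cball 0 4) x * B x \<partial>lborel)"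
    using iE iB by simp
  finally have EB: "(\<integral>x. E x \<partial>lborel) \<le> 2 * (\<integral>x. indicator (cball 0 4) x * B x \<partial>lborel)" using ER by simp
  have "(\<integral>x. indicator (cball 0 2) x * (\<Sum>i\<in>UNIV. \<Sum>j\<in>UNIV. (pd i (f j) x)\<^sup>2) \<partial>lborel) \<le> (\<integral>x. E x \<partial>lborel)"
  proof (rule integral_mono[OF _ iE])
    show "integrable lborel (\<lambda>x. indicator (cball 0 2) x * (\<Sum>i\<in>UNIV. \<Sum>j\<in>UNIV. (pd i (f j) x)\<^sup>2))"
      by (rule integrable_ind_cont, rule smooth_fun_continuous) (intro sm)
    show "indicator (cball 0 2) x * (\<Sum>i\<in>UNIV. \<Sum>j\<in>UNIV. (pd i (f j) x)\<^sup>2) \<le> E x" for x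
      using \<xi>(3)[of x] by (cases "norm x \<le> 2") (auto simp: E_def indicator_def intro!: mult_nonneg_nonneg sum_nonneg)
  qed
  also note EB
  also have "2 * (\<integral>x. indicator (cball 0 4) x * B x \<partial>lborel)
     = (\<integral>x. indicator (cball 0 4) x * (14 * C\<^sup>2 * (\<Sum>j\<in>UNIV. (f j x)\<^sup>2) + 8 * (\<Sum>j\<in>UNIV. pd j (f j) x)\<^sup>2) \<partial>lborel)"
    unfolding Bochner_Integration.integral_mult_right_zero[symmetric] B_def D_def
    by (rule Bochner_Integration.integral_cong) (auto simp: algebra_simps)
  finally show ?thesis .
qed


text \<open>The fields \<open>conv (ker \<delta> j) g\<close> are curl free because the kernel is,
  and their divergence is the mollification of \<open>g\<close>, a contraction. The Caccioppoli
  inequality thus replaces singular integral theory in bounding their gradient.\<close>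

lemma ker_estimates:
  "\<exists>C\<ge>0. \<forall>\<delta>>0. \<forall>g. L2_supp 12 g \<longrightarrow>
     (\<forall>j. (\<integral>x. indicator (cball 0 2) x * (conv (ker \<delta> j) g x)\<^sup>2 \<partial>lborel) \<le> C * (\<integral>x. (g x)\<^sup>2 \<partial>lborel)) \<and>
     (\<forall>i j. (\<integral>x. indicator (cball 0 2) x * (pd i (conv (ker \<delta> j) g) x)\<^sup>2 \<partial>lborel) \<le> C * (\<integral>x. (g x)\<^sup>2 \<partial>lborel))"
proof -
  \<comment> \<open>Radius 16: the outer ball of radius 4 in the Caccioppoli inequality plus the
    support radius 12 of \<open>g\<close>.\<close>
  obtain A where A: "A \<ge> 0" "\<And>\<delta> j. \<delta> > 0 \<Longrightarrow> (\<integral>\<^sup>+x. ennreal (indicator (cball 0 16) x * \<bar>ker \<delta> j x\<bar>) \<partial>lborel) \<le> ennreal A"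
    using ker_local_L1[of 16] by auto
  define \<xi> where "\<xi> = cutoff 4"
  have \<xi>: "smooth_fun \<xi>" "\<And>x. norm x > 4 \<Longrightarrow> \<xi> x = 0" "\<And>x. norm x \<le> 2 \<Longrightarrow> \<xi> x = 1"
      "\<And>x. 0 \<le> \<xi> x" "\<And>x. \<xi> x \<le> 1"
    by (auto simp: \<xi>_def smooth_cutoff cutoff_eq_0 cutoff_eq_1 cutoff_range)
  obtain c where c: "\<And>i. 0 \<le> c i \<and> (\<forall>x\<in>cball 0 4. \<bar>pd i \<xi> x\<bar> \<le> c i)"
    using smooth_bound_on_ball[OF smooth_fun_pd[OF \<xi>(1)], of 4] by metis
  define C where "C = (\<Sum>i\<in>UNIV. c i)"
  have C: "C \<ge> 0" "\<And>i x. x \<in> cball 0 4 \<Longrightarrow> \<bar>pd i \<xi> x\<bar> \<le> C"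
  proof -
    show "C \<ge> 0" unfolding C_def using c by (intro sum_nonneg) auto
    show "\<bar>pd i \<xi> x\<bar> \<le> C" if "x \<in> cball 0 4" for i x
    proof -
      have "\<bar>pd i \<xi> x\<bar> \<le> c i" using c that by auto
      also have "\<dots> \<le> C" unfolding C_def using c by (intro member_le_sum) auto
      finally show ?thesis .
    qed
  qed
  show ?thesis
  proof (intro exI[of _ "max (A\<^sup>2) (14 * C\<^sup>2 * (3 * A\<^sup>2) + 8)"] conjI allI impI)
    show "0 \<le> max (A\<^sup>2) (14 * C\<^sup>2 * (3 * A\<^sup>2) + 8)" by (simp add: max_def)
    fix \<delta> :: real and g assume \<delta>: "\<delta> > 0" and g: "L2_supp 12 g"
    note D = L2_suppD[OF g]
    define N where "N = (\<integral>x. (g x)\<^sup>2 \<partial>lborel)"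
    have N0: "N \<ge> 0" unfolding N_def by (rule Bochner_Integration.integral_nonneg) simp
    define f where "f j = conv (ker \<delta> j) g" for j
    have sf: "smooth_fun (f j)" for j unfolding f_def by (rule smooth_conv[OF smooth_ker D(4,3)])
    have pf: "pd i (f j) = conv (pd i (ker \<delta> j)) g" for i j
      unfolding f_def by (rule pd_conv[OF smooth_ker D(4,3)])
    have b4: "(\<integral>x. indicator (cball 0 4) x * (f j x)\<^sup>2 \<partial>lborel) \<le> A\<^sup>2 * N" for j
      unfolding f_def N_def by (rule conv_local_L2[OF smooth_ker g A(1)]) (use A(2)[OF \<delta>] in simp)
    have mono: "(\<integral>x. indicator (cball 0 2) x * h x \<partial>lborel) \<le> (\<integral>x. indicator (cball 0 4) x * h x \<partial>lborel)"
      if "smooth_fun h" "\<And>x. h x \<ge> 0" for h :: "R3 \<Rightarrow> real"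
      by (rule integral_mono[OF integrable_ind_cont integrable_ind_cont])
        (use that in \<open>auto intro: smooth_fun_continuous simp: indicator_def\<close>)
    show "(\<integral>x. indicator (cball 0 2) x * (conv (ker \<delta> j) g x)\<^sup>2 \<partial>lborel)
        \<le> max (A\<^sup>2) (14 * C\<^sup>2 * (3 * A\<^sup>2) + 8) * (\<integral>x. (g x)\<^sup>2 \<partial>lborel)" for j
    proof -
      have "(\<integral>x. indicator (cball 0 2) x * (f j x)\<^sup>2 \<partial>lborel) \<le> A\<^sup>2 * N"
        using order_trans[OF mono[OF smooth_power[OF sf]] b4[of j]] by simp
      also have "\<dots> \<le> max (A\<^sup>2) (14 * C\<^sup>2 * (3 * A\<^sup>2) + 8) * N" using N0 by (intro mult_right_mono) auto
      finally show ?thesis by (simp add: f_def N_def)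
    qed
    have div: "(\<Sum>j\<in>UNIV. pd j (f j) x) = conv (moll \<delta>) g x" for x
    proof -
      have "(\<Sum>j\<in>UNIV. pd j (f j) x) = (\<integral>y. (\<Sum>j\<in>UNIV. pd j (ker \<delta> j) (x - y) * g y) \<partial>lborel)"
        unfolding pf conv_def
        by (rule Bochner_Integration.integral_sum[symmetric])
          (rule integrable_conv[OF smooth_fun_continuous[OF smooth_fun_pd[OF smooth_ker]] D(4,3)])
      then show ?thesis by (simp add: sum_distrib_right[symmetric] ker_div conv_def)
    qed
    have sm: "smooth_fun (conv (moll \<delta>) g)" by (rule smooth_conv[OF smooth_moll D(4,3)])
    have "(\<integral>x. indicator (cball 0 2) x * (\<Sum>i\<in>UNIV. \<Sum>j\<in>UNIV. (pd i (f j) x)\<^sup>2) \<partial>lborel)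
      \<le> (\<integral>x. indicator (cball 0 4) x * (14 * C\<^sup>2 * (\<Sum>j\<in>UNIV. (f j x)\<^sup>2) + 8 * (\<Sum>j\<in>UNIV. pd j (f j) x)\<^sup>2) \<partial>lborel)"
      by (rule caccioppoli_curl_free[OF sf _ \<xi> C]) (auto simp: pf ker_curl_free)
    also have "\<dots> = (\<integral>x. (\<Sum>j\<in>UNIV. 14 * C\<^sup>2 * (indicator (cball 0 4) x * (f j x)\<^sup>2)) + 8 * (indicator (cball 0 4) x * (conv (moll \<delta>) g x)\<^sup>2) \<partial>lborel)"
      unfolding div by (rule Bochner_Integration.integral_cong) (auto simp: sum_distrib_left algebra_simps)
    also have "\<dots> = (\<Sum>j\<in>UNIV. 14 * C\<^sup>2 * (\<integral>x. indicator (cball 0 4) x * (f j x)\<^sup>2 \<partial>lborel))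
         + 8 * (\<integral>x. indicator (cball 0 4) x * (conv (moll \<delta>) g x)\<^sup>2 \<partial>lborel)"
    proof -
      have "integrable lborel (\<lambda>x. indicator (cball 0 4) x * (f j x)\<^sup>2)" for j
        by (rule integrable_ind_cont) (auto intro!: continuous_intros smooth_fun_continuous sf)
      moreover have "integrable lborel (\<lambda>x. indicator (cball 0 4) x * (conv (moll \<delta>) g x)\<^sup>2)"
        by (rule integrable_ind_cont) (auto intro!: continuous_intros smooth_fun_continuous sm)
      ultimately show ?thesis by simp
    qed
    also have "\<dots> \<le> (\<Sum>j\<in>(UNIV::3 set). 14 * C\<^sup>2 * (A\<^sup>2 * N)) + 8 * N"
    proof (intro add_mono sum_mono mult_left_mono b4)
      have "(\<integral>x. indicator (cball 0 4) x * (conv (moll \<delta>) g x)\<^sup>2 \<partial>lborel) \<le> (\<integral>x. (conv (moll \<delta>) g x)\<^sup>2 \<partial>lborel)"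
        by (rule integral_mono[OF integrable_ind_cont conv_moll_L2(1)[OF g \<delta>]])
          (auto intro!: continuous_intros smooth_fun_continuous sm simp: indicator_def)
      also have "\<dots> \<le> N" unfolding N_def by (rule conv_moll_L2(2)[OF g \<delta>])
      finally show "(\<integral>x. indicator (cball 0 4) x * (conv (moll \<delta>) g x)\<^sup>2 \<partial>lborel) \<le> N" .
    qed auto
    also have "\<dots> = (14 * C\<^sup>2 * (3 * A\<^sup>2) + 8) * N" by (simp add: algebra_simps)
    also have "\<dots> \<le> max (A\<^sup>2) (14 * C\<^sup>2 * (3 * A\<^sup>2) + 8) * N" using N0 by (intro mult_right_mono) auto
    finally have tot: "(\<integral>x. indicator (cball 0 2) x * (\<Sum>i\<in>UNIV. \<Sum>j\<in>UNIV. (pd i (f j) x)\<^sup>2) \<partial>lborel)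
       \<le> max (A\<^sup>2) (14 * C\<^sup>2 * (3 * A\<^sup>2) + 8) * N" .
    show "(\<integral>x. indicator (cball 0 2) x * (pd i (conv (ker \<delta> j) g) x)\<^sup>2 \<partial>lborel)
        \<le> max (A\<^sup>2) (14 * C\<^sup>2 * (3 * A\<^sup>2) + 8) * (\<integral>x. (g x)\<^sup>2 \<partial>lborel)" for i j
    proof -
      have "(\<integral>x. indicator (cball 0 2) x * (pd i (f j) x)\<^sup>2 \<partial>lborel)
         \<le> (\<integral>x. indicator (cball 0 2) x * (\<Sum>i\<in>UNIV. \<Sum>j\<in>UNIV. (pd i (f j) x)\<^sup>2) \<partial>lborel)"
      proof (rule integral_mono[OF integrable_ind_cont integrable_ind_cont])
        fix x
        have "(pd i (f j) x)\<^sup>2 \<le> (\<Sum>j\<in>UNIV. (pd i (f j) x)\<^sup>2)"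
          by (rule member_le_sum) auto
        also have "\<dots> \<le> (\<Sum>i\<in>UNIV. \<Sum>j\<in>UNIV. (pd i (f j) x)\<^sup>2)"
          by (rule member_le_sum[of i UNIV "\<lambda>i. \<Sum>j\<in>UNIV. (pd i (f j) x)\<^sup>2"]) (auto intro: sum_nonneg)
        finally show "indicator (cball 0 2) x * (pd i (f j) x)\<^sup>2
          \<le> indicator (cball 0 2) x * (\<Sum>i\<in>UNIV. \<Sum>j\<in>UNIV. (pd i (f j) x)\<^sup>2)"
          by (intro mult_left_mono) auto
      qed (auto intro!: smooth_fun_continuous smooth_power smooth_sum smooth_fun_pd sf)
      then show ?thesis using tot by (simp add: f_def N_def)
    qed
  qed
qed

section \<open>Convergence of mollifications\<close>

lemma L2_suppI:
  assumes "g \<in> borel_measurable borel" "integrable lborel (\<lambda>x. (g x)\<^sup>2)" "\<And>x. norm x > r \<Longrightarrow> g x = 0"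
  shows "L2_supp r g"
  using assms unfolding L2_supp_def by auto

text \<open>Fourth-power integrability, coded so that everything known about \<open>L2_supp\<close>
  applies both to \<open>g\<close> and to its square.\<close>

definition L4_supp :: "real \<Rightarrow> (R3 \<Rightarrow> real) \<Rightarrow> bool" where
  "L4_supp r g \<longleftrightarrow> L2_supp r g \<and> L2_supp r (\<lambda>x. (g x)\<^sup>2)"

lemma L4_suppD:
  assumes "L4_supp r g"
  shows "L2_supp r g" "L2_supp r (\<lambda>x. (g x)\<^sup>2)" "g \<in> borel_measurable borel"
    "integrable lborel (\<lambda>x. (g x) ^ 4)" "integrable lborel (\<lambda>x. (g x)\<^sup>2)" "\<And>x. norm x > r \<Longrightarrow> g x = 0"
  using assms L2_suppD[of r g] L2_suppD(2)[of r "\<lambda>x. (g x)\<^sup>2"] unfolding L4_supp_def by auto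

lemma L4_suppI:
  assumes m: "g \<in> borel_measurable borel" and i: "integrable lborel (\<lambda>x. (g x) ^ 4)" and z: "\<And>x. norm x > r \<Longrightarrow> g x = 0"
  shows "L4_supp r g"
proof -
  note [measurable] = m
  have "L2_supp r (\<lambda>x. (g x)\<^sup>2)" by (rule L2_suppI) (use i z in auto)
  moreover from L2_suppD(4)[OF this] have "L2_supp r g" by (intro L2_suppI m z)
  ultimately show ?thesis unfolding L4_supp_def by simp
qed

lemma L2_supp_mult:
  assumes f: "L4_supp r f" and g: "L4_supp r g" shows "L2_supp r (\<lambda>x. f x * g x)"
proof (rule L2_suppI)
  note F = L4_suppD[OF f] and G = L4_suppD[OF g]
  note [measurable] = F(3) G(3)
  show "(\<lambda>x. f x * g x) \<in> borel_measurable borel" by measurable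
  show "integrable lborel (\<lambda>x. (f x * g x)\<^sup>2)"
  proof (rule Bochner_Integration.integrable_bound[OF Bochner_Integration.integrable_add[OF F(4) G(4)]])
    show "AE x in lborel. norm ((f x * g x)\<^sup>2) \<le> norm (f x ^ 4 + g x ^ 4)"
    proof (rule AE_I2)
      fix x
      have "2 * (f x)\<^sup>2 * (g x)\<^sup>2 \<le> ((f x)\<^sup>2)\<^sup>2 + ((g x)\<^sup>2)\<^sup>2" by (rule sum_squares_bound)
      moreover have "0 \<le> (f x)\<^sup>2 * (g x)\<^sup>2" by simp
      ultimately have "(f x)\<^sup>2 * (g x)\<^sup>2 \<le> ((f x)\<^sup>2)\<^sup>2 + ((g x)\<^sup>2)\<^sup>2" by linarith
      then show "norm ((f x * g x)\<^sup>2) \<le> norm (f x ^ 4 + g x ^ 4)" by (simp add: power_mult_distrib)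
    qed
  qed measurable
qed (use L4_suppD(6)[OF f] in auto)

lemma power_add_le:
  fixes a b :: real assumes "p = 2 \<or> p = (4::nat)" shows "(a + b) ^ p \<le> 8 * (a ^ p + b ^ p)"
proof -
  have s: "(a + b)\<^sup>2 \<le> 2 * (a\<^sup>2 + b\<^sup>2)" for a b :: real
    using sum_squares_bound[of a b] by (simp add: power2_sum)
  have "(a + b) ^ 4 \<le> 8 * (a ^ 4 + b ^ 4)"
  proof -
    have "((a + b)\<^sup>2)\<^sup>2 \<le> (2 * (a\<^sup>2 + b\<^sup>2))\<^sup>2" by (rule power_mono[OF s]) simp
    also have "\<dots> = 4 * (a\<^sup>2 + b\<^sup>2)\<^sup>2" by (simp only: power_mult_distrib) simp
    also have "\<dots> \<le> 4 * (2 * ((a\<^sup>2)\<^sup>2 + (b\<^sup>2)\<^sup>2))" using s[of "a\<^sup>2" "b\<^sup>2"] by simp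
    finally show ?thesis by simp
  qed
  moreover have "(a + b)\<^sup>2 \<le> 8 * (a\<^sup>2 + b\<^sup>2)" by (rule order_trans[OF s]) (simp add: add_nonneg_nonneg)
  ultimately show ?thesis using assms by auto
qed

definition truncate_at :: "real \<Rightarrow> real \<Rightarrow> real" where "truncate_at L t = max (- L) (min L t)"

text \<open>Truncating the values of \<open>g\<close> costs little by dominated convergence. The
  bounded truncation is then the almost everywhere limit of continuous functions, which are
  truncated at the same height and cut off in space, so that dominated convergence applies once
  more.\<close>

lemma continuous_Lp_approx:
  fixes g :: "R3 \<Rightarrow> real"
  assumes p: "p = 2 \<or> p = (4::nat)" and m: "g \<in> borel_measurable borel" and i: "integrable lborel (\<lambda>x. g x ^ p)"
    and z: "\<And>x. norm x > r \<Longrightarrow> g x = 0" and r: "r > 0" and \<epsilon>: "\<epsilon> > 0"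
  shows "\<exists>V. continuous_on UNIV V \<and> (\<forall>x. norm x > 2 * r \<longrightarrow> V x = 0) \<and> integrable lborel (\<lambda>x. (g x - V x) ^ p) \<and>
     (\<integral>x. (g x - V (x::R3)) ^ p \<partial>lborel) \<le> \<epsilon>"
proof -
  note [measurable] = m
  have ev: "even p" using p by auto
  have p0: "p > 0" using p by auto
  have zp: "(0::real) ^ p = 0" using p0 by simp
  have cm[measurable]: "truncate_at L \<in> borel_measurable borel" for L unfolding truncate_at_def[abs_def] by measurable
  have ccont: "continuous_on UNIV (truncate_at L)" for L unfolding truncate_at_def[abs_def] by (intro continuous_intros)
  have "(\<lambda>n. \<integral>x. (g x - truncate_at (real n) (g x)) ^ p \<partial>lborel) \<longlonglongrightarrow> (\<integral>x. 0 \<partial>(lborel::R3 measure))"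
  proof (rule integral_dominated_convergence[where w="\<lambda>x. g x ^ p"])
    show "AE x in lborel. (\<lambda>n. (g x - truncate_at (real n) (g x)) ^ p) \<longlonglongrightarrow> 0"
    proof (rule AE_I2)
      fix x
      obtain n0 where n0: "\<bar>g x\<bar> \<le> real n0" using real_arch_simple by blast
      have "eventually (\<lambda>n. (g x - truncate_at (real n) (g x)) ^ p = 0) sequentially"
        using eventually_ge_at_top[of n0]
      proof eventually_elim
        case (elim n)
        then have "truncate_at (real n) (g x) = g x" using n0 by (auto simp: truncate_at_def)
        then show ?case using p0 by simp
      qed
      then show "(\<lambda>n. (g x - truncate_at (real n) (g x)) ^ p) \<longlonglongrightarrow> 0" by (rule tendsto_eventually)
    qed
    show "AE x in lborel. norm ((g x - truncate_at (real n) (g x)) ^ p) \<le> g x ^ p" for n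
    proof (rule AE_I2)
      fix x
      have "\<bar>g x - truncate_at (real n) (g x)\<bar> \<le> \<bar>g x\<bar>" by (auto simp: truncate_at_def)
      then have "\<bar>g x - truncate_at (real n) (g x)\<bar> ^ p \<le> \<bar>g x\<bar> ^ p" by (rule power_mono) simp
      then show "norm ((g x - truncate_at (real n) (g x)) ^ p) \<le> g x ^ p" by (simp only: real_norm_def power_abs power_even_abs[OF ev])
    qed
  qed (use i in auto)
  \<comment> \<open>Two errors of this size, each multiplied by the 8 of
    \<open>power_add_le\<close>, add up to \<open>\<epsilon>\<close>.\<close>
  then have "eventually (\<lambda>n. (\<integral>x. (g x - truncate_at (real n) (g x)) ^ p \<partial>lborel) < \<epsilon> / 16) sequentially"
    using \<epsilon> by (intro order_tendstoD) auto
  then obtain n where n: "(\<integral>x. (g x - truncate_at (real n) (g x)) ^ p \<partial>lborel) < \<epsilon> / 16" by (auto simp: eventually_sequentially)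
  define L where "L = real n"
  have L0: "L \<ge> 0" by (simp add: L_def)
  have cb: "\<bar>truncate_at L t\<bar> \<le> L" for t using L0 by (auto simp: truncate_at_def)
  have c0: "truncate_at L 0 = 0" using L0 by (auto simp: truncate_at_def)
  have i1: "integrable lborel (\<lambda>x. (g x - truncate_at L (g x)) ^ p)"
  proof (rule Bochner_Integration.integrable_bound[OF i])
    show "AE x in lborel. norm ((g x - truncate_at L (g x)) ^ p) \<le> norm (g x ^ p)"
    proof (rule AE_I2)
      fix x
      have "\<bar>g x - truncate_at L (g x)\<bar> \<le> \<bar>g x\<bar>" using L0 by (auto simp: truncate_at_def)
      then have "\<bar>g x - truncate_at L (g x)\<bar> ^ p \<le> \<bar>g x\<bar> ^ p" by (rule power_mono) simp
      then show "norm ((g x - truncate_at L (g x)) ^ p) \<le> norm (g x ^ p)" by (simp add: power_abs)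
    qed
  qed measurable
  have "g \<in> borel_measurable lebesgue" using m by (simp add: measurable_completion)
  \<comment> \<open>\<open>measurable_on\<close> provides the continuous functions converging to
    \<open>g\<close> off a negligible set.\<close>
  then have "g measurable_on UNIV" by (intro lebesgue_measurable_imp_measurable_on) (auto simp: lebesgue_on_UNIV_eq)
  then obtain N G where N: "negligible N" and G: "\<And>n. continuous_on UNIV (G n)" "\<And>x. x \<notin> N \<Longrightarrow> (\<lambda>n. G n x) \<longlonglongrightarrow> g x"
    unfolding measurable_on_def by auto
  have aeN: "AE x in lborel. x \<notin> N"
    using N unfolding negligible_iff_null_sets by (metis AE_completion_iff AE_not_in)
  \<comment> \<open>This cutoff is 1 on the ball of radius \<open>r\<close>, outside which
    \<open>g\<close> vanishes, so it confines the approximants without disturbing the limit.\<close>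
  define \<kappa> where "\<kappa> = cutoff (2 * r)"
  have \<kappa>: "continuous_on UNIV \<kappa>" unfolding \<kappa>_def by (rule smooth_fun_continuous[OF smooth_cutoff])
  define V where "V k x = truncate_at L (G k x) * \<kappa> x" for k x
  have Vc: "continuous_on UNIV (V k)" for k
    unfolding V_def by (intro continuous_on_mult \<kappa> continuous_on_compose2[OF ccont] G) auto
  have Vz: "V k x = 0" if "norm x > 2 * r" for k x
    using that r by (simp add: V_def \<kappa>_def cutoff_eq_0)
  have [measurable]: "V k \<in> borel_measurable borel" for k by (rule borel_measurable_continuous_onI[OF Vc])
  have Vb: "\<bar>V k x\<bar> \<le> L" for k x
  proof -
    have "\<bar>V k x\<bar> \<le> L * 1" unfolding V_def abs_mult
      by (intro mult_mono cb) (auto simp: \<kappa>_def abs_le_iff cutoff_range L0 intro: order_trans[OF _ cutoff_range(1)])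
    then show ?thesis by simp
  qed
  define w where "w x = (2 * L) ^ p * indicator (cball 0 (2 * r)) x" for x :: R3
  have iw: "integrable lborel w" unfolding w_def
    using emeasure_lborel_cball_finite[of "0::R3" "2*r"] by (intro integrable_mult_right integrable_real_indicator) auto
  have dom: "norm ((truncate_at L (g x) - V k x) ^ p) \<le> w x" for k x
  proof (cases "norm x \<le> 2 * r")
    case True
    have "\<bar>truncate_at L (g x) - V k x\<bar> \<le> 2 * L" using cb[of "g x"] Vb[of k x] by linarith
    then have "\<bar>truncate_at L (g x) - V k x\<bar> ^ p \<le> (2 * L) ^ p" by (rule power_mono) simp
    then show ?thesis using True by (simp add: w_def power_abs)
  next
    case False
    then show ?thesis using Vz[of x k] z[of x] r by (simp add: w_def c0 zp)
  qed
  have "(\<lambda>k. \<integral>x. (truncate_at L (g x) - V k x) ^ p \<partial>lborel) \<longlonglongrightarrow> (\<integral>x. 0 \<partial>(lborel::R3 measure))"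
  proof (rule integral_dominated_convergence[where w=w])
    show "AE x in lborel. (\<lambda>k. (truncate_at L (g x) - V k x) ^ p) \<longlonglongrightarrow> 0"
      using aeN
    proof eventually_elim
      case (elim x)
      have "(\<lambda>k. truncate_at L (G k x)) \<longlonglongrightarrow> truncate_at L (g x)"
        by (rule continuous_on_tendsto_compose[OF ccont G(2)[OF elim]]) simp_all
      then have "(\<lambda>k. (truncate_at L (g x) - V k x) ^ p) \<longlonglongrightarrow> (truncate_at L (g x) - truncate_at L (g x) * \<kappa> x) ^ p"
        unfolding V_def by (intro tendsto_intros)
      moreover have "truncate_at L (g x) * \<kappa> x = truncate_at L (g x)"
        using z[of x] r by (cases "norm x > r") (auto simp: c0 \<kappa>_def cutoff_eq_1)
      ultimately show ?case by (simp only: diff_self zp)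
    qed
    show "AE x in lborel. norm ((truncate_at L (g x) - V k x) ^ p) \<le> w x" for k
      by (rule AE_I2) (rule dom)
  qed (use iw in auto)
  then have "eventually (\<lambda>k. (\<integral>x. (truncate_at L (g x) - V k x) ^ p \<partial>lborel) < \<epsilon> / 16) sequentially"
    using \<epsilon> by (intro order_tendstoD) auto
  then obtain k where k: "(\<integral>x. (truncate_at L (g x) - V k x) ^ p \<partial>lborel) < \<epsilon> / 16" by (auto simp: eventually_sequentially)
  have i2: "integrable lborel (\<lambda>x. (truncate_at L (g x) - V k x) ^ p)"
  proof (rule Bochner_Integration.integrable_bound[OF iw])
    show "AE x in lborel. norm ((truncate_at L (g x) - V k x) ^ p) \<le> norm (w x)"
      by (rule AE_I2) (rule order_trans[OF dom], simp)
  qed measurable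
  have i3: "integrable lborel (\<lambda>x. 8 * ((g x - truncate_at L (g x)) ^ p + (truncate_at L (g x) - V k x) ^ p))"
    using i1 i2 by auto
  have pw: "(g x - V k x) ^ p \<le> 8 * ((g x - truncate_at L (g x)) ^ p + (truncate_at L (g x) - V k x) ^ p)" for x
    using power_add_le[OF p, of "g x - truncate_at L (g x)" "truncate_at L (g x) - V k x"] by simp
  have i4: "integrable lborel (\<lambda>x. (g x - V k x) ^ p)"
    by (rule Bochner_Integration.integrable_bound[OF i3])
      (simp, rule AE_I2, simp only: real_norm_def abs_of_nonneg[OF zero_le_even_power[OF ev]],
          rule order_trans[OF pw abs_ge_self])
  have "(\<integral>x. (g x - V k x) ^ p \<partial>lborel) \<le> (\<integral>x. 8 * ((g x - truncate_at L (g x)) ^ p + (truncate_at L (g x) - V k x) ^ p) \<partial>lborel)"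
    by (rule integral_mono[OF i4 i3 pw])
  also have "\<dots> = 8 * ((\<integral>x. (g x - truncate_at L (g x)) ^ p \<partial>lborel) + (\<integral>x. (truncate_at L (g x) - V k x) ^ p \<partial>lborel))"
    using i1 i2 by simp
  also have "\<dots> \<le> \<epsilon>" using n k by (simp add: L_def)
  finally show ?thesis using Vc Vz i4 by blast
qed

lemma conv_diff:
  assumes K: "smooth_fun K" and f: "L2_supp r f" and g: "L2_supp s g"
  shows "conv K (\<lambda>x. f x - g x) x = conv K f x - conv K g x"
  unfolding conv_def right_diff_distrib
  by (rule Bochner_Integration.integral_diff)
    (rule integrable_conv[OF smooth_fun_continuous[OF K]], (rule L2_suppD[OF f] L2_suppD[OF g], assumption?)+)+

text \<open>Mollification contracts, so \<open>g\<close> may be exchanged for a nearby continuous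
  \<open>V\<close> of bounded support, and for such \<open>V\<close> convergence is uniform by
  uniform continuity. The exponents are those for which contraction has been shown.\<close>

lemma moll_Lp_tendsto:
  assumes p: "p = 2 \<or> p = (4::nat)" and g: "L2_supp r g" and g4: "p = 4 \<Longrightarrow> L4_supp r g"
    and r: "r > 0" and \<epsilon>: "\<epsilon> > 0"
  shows "\<exists>d>0. \<forall>\<delta>. 0 < \<delta> \<and> \<delta> < d \<longrightarrow> (\<integral>x. (conv (moll \<delta>) g x - g x) ^ p \<partial>lborel) \<le> \<epsilon>
     \<and> integrable lborel (\<lambda>x. (conv (moll \<delta>) g x - g x) ^ p)"
proof -
  note D = L2_suppD[OF g]
  have ev: "even p" and p0: "p > 0" using p by auto
  have zp: "(0::real) ^ p = 0" using p0 by simp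
  have ip: "integrable lborel (\<lambda>x. g x ^ p)" using p D(2) L4_suppD(4)[OF g4] by auto
  \<comment> \<open>Splitting into three parts multiplies the errors by 64, 64 and 8, and 136 copies
    of \<open>\<epsilon> / 256\<close> stay below \<open>\<epsilon>\<close>.\<close>
  obtain V where V: "continuous_on UNIV V" "\<And>x. norm x > 2 * r \<Longrightarrow> V x = 0" "integrable lborel (\<lambda>x. (g x - V x) ^ p)"
    "(\<integral>x. (g x - V x) ^ p \<partial>lborel) \<le> \<epsilon> / 256"
    using continuous_Lp_approx[OF p D(1) ip D(3) r, of "\<epsilon> / 256"] \<epsilon> by auto
  note [measurable] = D(1) borel_measurable_continuous_onI[OF V(1)]
  define s where "s = 2 * r"
  have LV: "L2_supp s V"
    by (rule L2_suppI)
      (use V in \<open>auto simp: s_def intro!: integrable_continuous_bounded_support[where r="2*r"] continuous_intros\<close>)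
  have gs: "\<And>x. norm x > s \<Longrightarrow> g x = 0" using D(3) r by (simp add: s_def)
  have Lg: "L2_supp s g" by (rule L2_suppI) (use D gs in auto)
  have W: "L2_supp s (\<lambda>x. g x - V x)" and W4: "p = 4 \<Longrightarrow> L2_supp s (\<lambda>x. (g x - V x)\<^sup>2)"
  proof -
    show W4: "L2_supp s (\<lambda>x. (g x - V x)\<^sup>2)" if "p = 4"
      by (rule L2_suppI) (use V(2,3) gs that in \<open>auto simp: s_def\<close>)
    show "L2_supp s (\<lambda>x. g x - V x)"
    proof (rule L2_suppI)
      show "integrable lborel (\<lambda>x. (g x - V x)\<^sup>2)"
        using p V(3) L2_suppD(4)[OF W4] by auto
    qed (use V gs in \<open>auto simp: s_def\<close>)
  qed
  define vol where "vol = measure lborel (cball (0::R3) (s + 1))"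
  have vol: "vol \<ge> 0" by (simp add: vol_def)
  \<comment> \<open>The bound 1 allows \<open>\<omega> ^ p\<close> to be replaced by
    \<open>\<omega>\<close>; the other bound makes \<open>\<omega> * vol\<close> small.\<close>
  define \<omega> where "\<omega> = min 1 (\<epsilon> / (256 * (vol + 1)))"
  have \<omega>: "\<omega> > 0" using \<epsilon> vol by (simp add: \<omega>_def)
  have "uniformly_continuous_on (cball 0 (s + 1)) V"
    by (rule compact_uniformly_continuous) (use V(1) continuous_on_subset[of UNIV V] in auto)
  then obtain d0 where d0: "d0 > 0" "\<And>x y. x \<in> cball 0 (s + 1) \<Longrightarrow> y \<in> cball 0 (s + 1) \<Longrightarrow> dist y x < d0 \<Longrightarrow> dist (V y) (V x) < \<omega>"
    unfolding uniformly_continuous_on_def using \<omega> by metis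
  show ?thesis
  proof (intro exI[of _ "min 1 d0"] conjI allI impI)
    show "0 < min 1 d0" using d0 by simp
    fix \<delta> assume "0 < \<delta> \<and> \<delta> < min 1 d0"
    then have \<delta>: "\<delta> > 0" "\<delta> < 1" "\<delta> < d0" by auto
    define A where "A x = conv (moll \<delta>) (\<lambda>x. g x - V x) x" for x
    define B where "B x = conv (moll \<delta>) V x - V x" for x
    have e: "conv (moll \<delta>) g x - g x = (A x + B x) + (V x - g x)" for x
      unfolding A_def B_def conv_diff[OF smooth_moll Lg LV] by simp
    have iA: "integrable lborel (\<lambda>x. A x ^ p)" and A: "(\<integral>x. A x ^ p \<partial>lborel) \<le> \<epsilon> / 256"
    proof -
      have "(p = 2 \<and> integrable lborel (\<lambda>x. A x ^ p) \<and> (\<integral>x. A x ^ p \<partial>lborel) \<le> (\<integral>x. (g x - V x) ^ p \<partial>lborel))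
        \<or> (p = 4 \<and> integrable lborel (\<lambda>x. A x ^ p) \<and> (\<integral>x. A x ^ p \<partial>lborel) \<le> (\<integral>x. (g x - V x) ^ p \<partial>lborel))"
        using p conv_moll_L2[OF W \<delta>(1)] conv_moll_L4[OF W W4 \<delta>(1)] unfolding A_def by auto
      then show "integrable lborel (\<lambda>x. A x ^ p)" "(\<integral>x. A x ^ p \<partial>lborel) \<le> \<epsilon> / 256" using V(4) by auto
    qed
    have Bc: "continuous_on UNIV B" unfolding B_def[abs_def]
      by (intro continuous_on_diff V(1) smooth_fun_continuous[OF smooth_conv[OF smooth_moll L2_suppD(4,3)[OF LV]]])
    have Bz: "B x = 0" if "norm x > s + 1" for x
      using that conv_moll_outside[OF \<delta>(1) L2_suppD(3)[OF LV], where x=x] L2_suppD(3)[OF LV, of x] \<delta> by (simp add: B_def)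
    have Bb: "\<bar>B x\<bar> \<le> \<omega>" for x
    proof -
      have i1: "integrable lborel (\<lambda>y. moll \<delta> (x - y) * V y)"
        by (rule integrable_conv[OF smooth_fun_continuous[OF smooth_moll] L2_suppD(4,3)[OF LV]])
      have i2: "integrable lborel (\<lambda>y. moll \<delta> (x - y) * V x)" using integrable_moll_reflect[OF \<delta>(1)] by simp
      have "B x = (\<integral>y. moll \<delta> (x - y) * V y - moll \<delta> (x - y) * V x \<partial>lborel)"
        using i1 i2 by (simp add: B_def conv_def integral_moll_reflect[OF \<delta>(1)])
      also have "\<bar>\<dots>\<bar> \<le> (\<integral>y. moll \<delta> (x - y) * \<omega> \<partial>lborel)"
      proof (rule order_trans[OF integral_abs_bound integral_mono])
        show "integrable lborel (\<lambda>y. \<bar>moll \<delta> (x - y) * V y - moll \<delta> (x - y) * V x\<bar>)" using i1 i2 by simp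
        show "integrable lborel (\<lambda>y. moll \<delta> (x - y) * \<omega>)" using integrable_moll_reflect[OF \<delta>(1)] by simp
        fix y
        show "\<bar>moll \<delta> (x - y) * V y - moll \<delta> (x - y) * V x\<bar> \<le> moll \<delta> (x - y) * \<omega>"
        proof (cases "norm (x - y) > \<delta>")
          case False
          have "\<bar>V y - V x\<bar> \<le> \<omega>"
          proof (cases "norm x \<le> s + 1 \<and> norm y \<le> s + 1")
            case True
            then show ?thesis using d0(2)[of x y] False \<delta> by (simp add: dist_norm norm_minus_commute less_imp_le)
          next
            case F: False
            \<comment> \<open>The points are closer than 1, so if one of them leaves the ball of
              radius \<open>s + 1\<close>, both lie outside the support ball of
              \<open>V\<close>.\<close>
            then have "norm x > s \<and> norm y > s"
              using False \<delta> norm_triangle_ineq2[of x y] norm_triangle_ineq2[of y x] by (auto simp: norm_minus_commute)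
            then show ?thesis using L2_suppD(3)[OF LV] \<omega> by simp
          qed
          moreover have "\<bar>moll \<delta> (x - y) * V y - moll \<delta> (x - y) * V x\<bar> = moll \<delta> (x - y) * \<bar>V y - V x\<bar>"
            using moll_nonneg[OF \<delta>(1)] by (simp add: right_diff_distrib[symmetric] abs_mult)
          ultimately show ?thesis using moll_nonneg[OF \<delta>(1)] by (simp add: mult_left_mono)
        qed (simp add: moll_outside[OF \<delta>(1)])
      qed
      also have "\<dots> = \<omega>" by (simp add: integral_moll_reflect[OF \<delta>(1)])
      finally show ?thesis .
    qed
    have iB: "integrable lborel (\<lambda>x. B x ^ p)"
      by (rule integrable_continuous_bounded_support[where r="s+1"]) (use Bz Bc p0 in \<open>auto intro!: continuous_intros\<close>)
    have B: "(\<integral>x. B x ^ p \<partial>lborel) \<le> \<omega> * vol"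
    proof -
      have "(\<integral>x. B x ^ p \<partial>lborel) \<le> (\<integral>x. \<omega> * indicator (cball (0::R3) (s + 1)) x \<partial>lborel)"
      proof (rule integral_mono[OF iB])
        show "integrable lborel (\<lambda>x. \<omega> * indicator (cball (0::R3) (s + 1)) x)"
          using emeasure_lborel_cball_finite[of "0::R3" "s+1"] by (intro integrable_mult_right integrable_real_indicator) auto
        show "B x ^ p \<le> \<omega> * indicator (cball 0 (s + 1)) x" for x
        proof (cases "norm x > s + 1")
          case False
          have "B x ^ p = \<bar>B x\<bar> ^ p" using ev by (simp add: power_even_abs)
          also have "\<dots> \<le> \<omega> ^ p" by (rule power_mono[OF Bb]) simp
          also have "\<dots> \<le> \<omega> ^ 1" by (rule power_decreasing) (use p0 \<omega> in \<open>auto simp: \<omega>_def\<close>)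
          finally show ?thesis using False by simp
        qed (simp add: Bz zp)
      qed
      then show ?thesis by (simp add: vol_def)
    qed
    have Bf: "(\<integral>x. B x ^ p \<partial>lborel) \<le> \<epsilon> / 256"
    proof -
      have "\<omega> * vol \<le> \<epsilon> / (256 * (vol + 1)) * vol" using vol by (intro mult_right_mono) (auto simp: \<omega>_def)
      also have "\<dots> \<le> \<epsilon> / 256" using \<epsilon> vol by (simp add: field_simps)
      finally show ?thesis using B by simp
    qed
    have iS: "integrable lborel (\<lambda>x. 64 * (A x ^ p + B x ^ p) + 8 * (g x - V x) ^ p)"
      using iA iB V(3) by auto
    have pw: "(conv (moll \<delta>) g x - g x) ^ p \<le> 64 * (A x ^ p + B x ^ p) + 8 * (g x - V x) ^ p" for x
    proof -
      have "(conv (moll \<delta>) g x - g x) ^ p \<le> 8 * ((A x + B x) ^ p + (V x - g x) ^ p)"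
        unfolding e by (rule power_add_le[OF p])
      also have "\<dots> \<le> 8 * (8 * (A x ^ p + B x ^ p) + (V x - g x) ^ p)" using power_add_le[OF p, of "A x" "B x"] by simp
      also have "(V x - g x) ^ p = (g x - V x) ^ p" using ev by (metis minus_diff_eq power_minus_even)
      finally show ?thesis by simp
    qed
    have [measurable]: "conv (moll \<delta>) g \<in> borel_measurable borel"
      by (rule smooth_fun_measurable[OF smooth_conv[OF smooth_moll D(4,3)]])
    show iF: "integrable lborel (\<lambda>x. (conv (moll \<delta>) g x - g x) ^ p)"
      by (rule Bochner_Integration.integrable_bound[OF iS])
        (simp, rule AE_I2, simp only: real_norm_def abs_of_nonneg[OF zero_le_even_power[OF ev]],
          rule order_trans[OF pw abs_ge_self])
    have "(\<integral>x. (conv (moll \<delta>) g x - g x) ^ p \<partial>lborel) \<le> (\<integral>x. 64 * (A x ^ p + B x ^ p) + 8 * (g x - V x) ^ p \<partial>lborel)"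
      by (rule integral_mono[OF iF iS pw])
    also have "\<dots> = 64 * ((\<integral>x. A x ^ p \<partial>lborel) + (\<integral>x. B x ^ p \<partial>lborel)) + 8 * (\<integral>x. (g x - V x) ^ p \<partial>lborel)"
      using iA iB V(3) by simp
    also have "\<dots> \<le> 64 * (\<epsilon> / 256 + \<epsilon> / 256) + 8 * (\<epsilon> / 256)"
      using A Bf V(4) by (intro add_mono mult_left_mono) auto
    also have "\<dots> \<le> \<epsilon>" using \<epsilon> by simp
    finally show "(\<integral>x. (conv (moll \<delta>) g x - g x) ^ p \<partial>lborel) \<le> \<epsilon>" .
  qed
qed


text \<open>The mollified product converges to \<open>f * g\<close> in the square mean. For the
  product of the mollifications, \<open>u v - f g = (u - f) v + (v - g) f\<close>, and Young's
  inequality leaves fourth powers of the differences, which tend to zero, and of \<open>v\<close>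
  and \<open>f\<close>, which stay bounded by contraction.\<close>

lemma moll_commutator_L2:
  assumes f: "L4_supp r f" and g: "L4_supp r g" and r: "r > 0" and \<epsilon>: "\<epsilon> > 0"
  shows "\<exists>d>0. \<forall>\<delta>. 0 < \<delta> \<and> \<delta> < d \<longrightarrow>
    (\<integral>x. (conv (moll \<delta>) (\<lambda>y. f y * g y) x - conv (moll \<delta>) f x * conv (moll \<delta>) g x)\<^sup>2 \<partial>lborel) \<le> \<epsilon>"
proof -
  note F = L4_suppD[OF f] and G = L4_suppD[OF g]
  note FG = L2_supp_mult[OF f g]
  note [measurable] = F(3) G(3)
  define Q where "Q = (\<integral>x. f x ^ 4 \<partial>lborel) + (\<integral>x. g x ^ 4 \<partial>lborel)"
  have Q0: "(\<integral>x. f x ^ 4 \<partial>lborel) \<ge> 0" "(\<integral>x. g x ^ 4 \<partial>lborel) \<ge> 0"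
    by (auto intro!: Bochner_Integration.integral_nonneg)
  have Qn: "Q \<ge> 0" using Q0 by (simp add: Q_def)
  \<comment> \<open>Chosen before \<open>\<delta>\<close>: it makes the bounded part small, and the
    differences then only have to beat the factor \<open>1 / t\<close>.\<close>
  define t where "t = \<epsilon> / (512 * (Q + 1))"
  have t: "t > 0" using Qn \<epsilon> by (simp add: t_def)
  have tQ: "t * Q \<le> \<epsilon> / 512" using Qn \<epsilon> by (simp add: t_def field_simps)
  have "\<epsilon> * t / 512 > 0" "\<epsilon> / 64 > 0" using t \<epsilon> by auto
  from moll_Lp_tendsto[OF _ F(1) f r this(1), of 4] moll_Lp_tendsto[OF _ G(1) g r this(1), of 4]
    moll_Lp_tendsto[OF _ FG _ r this(2), of 2]
  obtain d1 d2 d3 where d: "d1 > 0" "d2 > 0" "d3 > 0"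
    and d1: "\<And>\<delta>. 0 < \<delta> \<Longrightarrow> \<delta> < d1 \<Longrightarrow> (\<integral>x. (conv (moll \<delta>) f x - f x) ^ 4 \<partial>lborel) \<le> \<epsilon> * t / 512
       \<and> integrable lborel (\<lambda>x. (conv (moll \<delta>) f x - f x) ^ 4)"
    and d2: "\<And>\<delta>. 0 < \<delta> \<Longrightarrow> \<delta> < d2 \<Longrightarrow> (\<integral>x. (conv (moll \<delta>) g x - g x) ^ 4 \<partial>lborel) \<le> \<epsilon> * t / 512
       \<and> integrable lborel (\<lambda>x. (conv (moll \<delta>) g x - g x) ^ 4)"
    and d3: "\<And>\<delta>. 0 < \<delta> \<Longrightarrow> \<delta> < d3 \<Longrightarrow> (\<integral>x. (conv (moll \<delta>) (\<lambda>y. f y * g y) x - f x * g x)\<^sup>2 \<partial>lborel) \<le> \<epsilon> / 64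
       \<and> integrable lborel (\<lambda>x. (conv (moll \<delta>) (\<lambda>y. f y * g y) x - f x * g x)\<^sup>2)"
    by auto
  show ?thesis
  proof (intro exI[of _ "min d1 (min d2 d3)"] conjI allI impI)
    show "0 < min d1 (min d2 d3)" using d by simp
    fix \<delta> assume "0 < \<delta> \<and> \<delta> < min d1 (min d2 d3)"
    then have \<delta>: "\<delta> > 0" "\<delta> < d1" "\<delta> < d2" "\<delta> < d3" by auto
    note e1 = d1[OF \<delta>(1,2)] and e2 = d2[OF \<delta>(1,3)] and e3 = d3[OF \<delta>(1,4)]
    define u where "u = conv (moll \<delta>) f"
    define v where "v = conv (moll \<delta>) g"
    define w where "w = conv (moll \<delta>) (\<lambda>y. f y * g y)"
    have sm: "smooth_fun u" "smooth_fun v" "smooth_fun w"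
      unfolding u_def v_def w_def
      by (rule smooth_conv[OF smooth_moll]; (rule L2_suppD[OF F(1)] L2_suppD[OF G(1)] L2_suppD[OF FG]; assumption?))+
    note v4 = conv_moll_L4[OF G(1,2) \<delta>(1), folded v_def]
    have young: "(a * b)\<^sup>2 \<le> a ^ 4 / t + t * b ^ 4" for a b
    proof -
      have "2 * (a * b)\<^sup>2 = 2 * (a\<^sup>2 / sqrt t) * (sqrt t * b\<^sup>2)" using t by (simp add: power_mult_distrib)
      also have "\<dots> \<le> (a\<^sup>2 / sqrt t)\<^sup>2 + (sqrt t * b\<^sup>2)\<^sup>2" by (rule sum_squares_bound)
      also have "\<dots> = a ^ 4 / t + t * b ^ 4" using t by (simp add: power_mult_distrib power_divide)
      finally show ?thesis by (smt (verit) zero_le_power2)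
    qed
    define R where "R x = 16 * (w x - f x * g x)\<^sup>2 +
      64 * ((u x - f x) ^ 4 / t + t * v x ^ 4) + 64 * ((v x - g x) ^ 4 / t + t * f x ^ 4)" for x
    have pw: "(w x - u x * v x)\<^sup>2 \<le> R x" for x
    proof -
      have "w x - u x * v x = (w x - f x * g x) + (- ((u x - f x) * v x) + - ((v x - g x) * f x))" by (simp add: algebra_simps)
      also have "\<dots>\<^sup>2 \<le> 8 * ((w x - f x * g x)\<^sup>2 + (- ((u x - f x) * v x) + - ((v x - g x) * f x))\<^sup>2)"
        by (rule power_add_le) simp
      also have "(- ((u x - f x) * v x) + - ((v x - g x) * f x))\<^sup>2 \<le> 8 * ((- ((u x - f x) * v x))\<^sup>2 + (- ((v x - g x) * f x))\<^sup>2)"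
        by (rule power_add_le) simp
      finally have "(w x - u x * v x)\<^sup>2 \<le> 8 * (w x - f x * g x)\<^sup>2 + 64 * ((u x - f x) * v x)\<^sup>2 + 64 * ((v x - g x) * f x)\<^sup>2"
        by simp
      also have "\<dots> \<le> R x" unfolding R_def
        by (intro add_mono mult_left_mono young mult_right_mono) auto
      finally show ?thesis .
    qed
    have iR: "integrable lborel R" unfolding R_def[abs_def] u_def v_def w_def
      using e1 e2 e3 v4(1) F(4) by (auto simp: v_def)
    have "(\<integral>x. (w x - u x * v x)\<^sup>2 \<partial>lborel) \<le> (\<integral>x. R x \<partial>lborel)"
    proof (rule integral_mono[OF _ iR pw])
      show "integrable lborel (\<lambda>x. (w x - u x * v x)\<^sup>2)"
        by (rule Bochner_Integration.integrable_bound[OF iR])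
          (auto intro!: AE_I2 order_trans[OF pw abs_ge_self] smooth_fun_measurable smooth_power smooth_diff smooth_mult sm)
    qed
    also have "\<dots> = 16 * (\<integral>x. (w x - f x * g x)\<^sup>2 \<partial>lborel) +
       64 * ((\<integral>x. (u x - f x) ^ 4 \<partial>lborel) / t + t * (\<integral>x. v x ^ 4 \<partial>lborel)) + 64 * ((\<integral>x. (v x - g x) ^ 4 \<partial>lborel) / t + t * (\<integral>x. f x ^ 4 \<partial>lborel))"
      unfolding R_def using e1 e2 e3 v4(1) F(4) by (simp add: u_def v_def w_def)
    also have "\<dots> \<le> 16 * (\<epsilon> / 64) + 64 * (\<epsilon> / 512 + t * (\<integral>x. g x ^ 4 \<partial>lborel)) + 64 * (\<epsilon> / 512 + t * (\<integral>x. f x ^ 4 \<partial>lborel))"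
    proof (intro add_mono mult_left_mono order_refl)
      show "(\<integral>x. (w x - f x * g x)\<^sup>2 \<partial>lborel) \<le> \<epsilon> / 64" using e3 by (simp add: w_def)
      show "(\<integral>x. (u x - f x) ^ 4 \<partial>lborel) / t \<le> \<epsilon> / 512" using e1 t by (simp add: u_def field_simps)
      show "(\<integral>x. (v x - g x) ^ 4 \<partial>lborel) / t \<le> \<epsilon> / 512" using e2 t by (simp add: v_def field_simps)
      show "(\<integral>x. v x ^ 4 \<partial>lborel) \<le> (\<integral>x. g x ^ 4 \<partial>lborel)" by (rule v4(2))
    qed (use t in auto)
    also have "\<dots> = \<epsilon> / 2 + 64 * (t * Q)" by (simp add: Q_def algebra_simps)
    also have "\<dots> \<le> \<epsilon>" using tQ \<epsilon> by simp
    finally show "(\<integral>x. (conv (moll \<delta>) (\<lambda>y. f y * g y) x - conv (moll \<delta>) f x * conv (moll \<delta>) g x)\<^sup>2 \<partial>lborel) \<le> \<epsilon>"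
      by (simp add: u_def v_def w_def)
  qed
qed

section \<open>The energy estimate\<close>

lemma weighted_young: "0 < \<mu> \<Longrightarrow> x * y \<le> (x\<^sup>2 / \<mu> + \<mu> * y\<^sup>2) / (2::real)"
proof -
  assume m: "0 < \<mu>"
  have "2 * (x / sqrt \<mu>) * (sqrt \<mu> * y) \<le> (x / sqrt \<mu>)\<^sup>2 + (sqrt \<mu> * y)\<^sup>2" by (rule sum_squares_bound)
  then show ?thesis using m by (simp add: power_mult_distrib power_divide)
qed

text \<open>To be read with \<open>D\<close> and \<open>d\<close> the derivatives of
  \<open>u\<close> and \<open>v\<close>, \<open>p\<close> that of the cutoff, and \<open>H\<close>
  the commutator. Every term containing \<open>D\<close> also has a factor \<open>t\<close>, so
  Young's inequality charges it to \<open>\<phi> * D\<^sup>2\<close> alone. The weight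
  \<open>\<mu>\<close> divides the cubic terms between second and fourth powers.\<close>

lemma energy_pointwise:
  fixes t D p \<phi> u w H F d V b \<mu> :: real
  assumes t: "0 \<le> t" "t \<le> 1" "\<phi> = t * t" and p: "\<bar>p\<bar> \<le> b * t" and d: "\<bar>d\<bar> \<le> t * V" and V: "V \<ge> 0" and b: "b \<ge> 1"
    and \<mu>: "0 < \<mu>" "\<mu> \<le> 1"
  shows "- p * u * D - D * d + H * (p * u + \<phi> * D) + 1/2 * p * w * u\<^sup>2 + F * d
    \<le> 1/2 * (\<phi> * D\<^sup>2) + 2 * H\<^sup>2 + 2 * b\<^sup>2 * u\<^sup>2 + b / (4 * \<mu>) * w\<^sup>2 + b * \<mu> / 4 * u ^ 4 + 2 / \<mu> * V\<^sup>2 + \<mu> / 2 * F\<^sup>2"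
proof -
  define E where "E = t * \<bar>D\<bar>"
  have E0: "E \<ge> 0" using t by (simp add: E_def)
  have E2: "E\<^sup>2 = \<phi> * D\<^sup>2" by (simp add: E_def t(3) power_mult_distrib power2_eq_square)
  \<comment> \<open>The share 1/6 is claimed three times, so exactly half of
    \<open>\<phi> * D\<^sup>2\<close> is spent.\<close>
  have y: "x * y \<le> x\<^sup>2 / 6 + 3/2 * y\<^sup>2" for x y :: real
    using weighted_young[of 3 x y] by simp
  have pb: "\<bar>p\<bar> \<le> b" using p t b mult_left_le[of t b] by linarith
  have dV: "\<bar>d\<bar> \<le> V" using d t V mult_left_le[of t V] mult.commute[of t V] by linarith
  have 1: "- p * u * D \<le> E\<^sup>2 / 6 + 3/2 * (b\<^sup>2 * u\<^sup>2)"
  proof -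
    have "- p * u * D \<le> \<bar>p\<bar> * (\<bar>u\<bar> * \<bar>D\<bar>)" using abs_ge_self[of "- p * u * D"] by (simp add: abs_mult)
    also have "\<dots> \<le> (b * t) * (\<bar>u\<bar> * \<bar>D\<bar>)" by (intro mult_right_mono p) simp
    also have "\<dots> = E * (b * \<bar>u\<bar>)" by (simp add: E_def)
    also have "\<dots> \<le> E\<^sup>2 / 6 + 3/2 * (b * \<bar>u\<bar>)\<^sup>2" by (rule y)
    finally show ?thesis by (simp add: power_mult_distrib)
  qed
  have 2: "- (D * d) \<le> E\<^sup>2 / 6 + 3/2 * V\<^sup>2"
  proof -
    have "- (D * d) \<le> \<bar>D\<bar> * \<bar>d\<bar>" using abs_ge_self[of "- (D * d)"] by (simp add: abs_mult)
    also have "\<dots> \<le> \<bar>D\<bar> * (t * V)" by (intro mult_left_mono d) simp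
    also have "\<dots> = E * V" by (simp add: E_def)
    also have "\<dots> \<le> E\<^sup>2 / 6 + 3/2 * V\<^sup>2" by (rule y)
    finally show ?thesis .
  qed
  have 3: "H * (p * u) \<le> H\<^sup>2 / 2 + b\<^sup>2 * u\<^sup>2 / 2"
  proof -
    have "H * (p * u) \<le> \<bar>H\<bar> * (\<bar>p\<bar> * \<bar>u\<bar>)" using abs_ge_self[of "H * (p * u)"] by (simp add: abs_mult)
    also have "\<dots> \<le> \<bar>H\<bar> * (b * \<bar>u\<bar>)" by (intro mult_left_mono mult_right_mono pb) auto
    also have "\<dots> \<le> (\<bar>H\<bar>\<^sup>2 / 1 + 1 * (b * \<bar>u\<bar>)\<^sup>2) / 2" by (rule weighted_young) simp
    finally show ?thesis by (simp add: power_mult_distrib add_divide_distrib)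
  qed
  have 4: "H * (\<phi> * D) \<le> E\<^sup>2 / 6 + 3/2 * H\<^sup>2"
  proof -
    have "H * (\<phi> * D) \<le> \<bar>H\<bar> * (t * E)" using abs_ge_self[of "H * (\<phi> * D)"] t by (simp add: abs_mult E_def)
    also have "\<dots> \<le> \<bar>H\<bar> * (1 * E)" using t E0 by (intro mult_left_mono mult_right_mono) auto
    also have "\<dots> = E * \<bar>H\<bar>" by simp
    also have "\<dots> \<le> E\<^sup>2 / 6 + 3/2 * \<bar>H\<bar>\<^sup>2" by (rule y)
    finally show ?thesis by simp
  qed
  have 5: "1/2 * p * w * u\<^sup>2 \<le> b / (4 * \<mu>) * w\<^sup>2 + b * \<mu> / 4 * u ^ 4"
  proof -
    have "1/2 * p * w * u\<^sup>2 \<le> 1/2 * (\<bar>p\<bar> * (\<bar>w\<bar> * u\<^sup>2))" using abs_ge_self[of "1/2 * p * w * u\<^sup>2"] by (simp add: abs_mult)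
    also have "\<dots> \<le> 1/2 * (b * (\<bar>w\<bar> * u\<^sup>2))" by (intro mult_left_mono mult_right_mono pb) auto
    also have "\<dots> \<le> 1/2 * (b * ((\<bar>w\<bar>\<^sup>2 / \<mu> + \<mu> * (u\<^sup>2)\<^sup>2) / 2))"
      using b by (intro mult_left_mono weighted_young \<mu>) auto
    also have "\<dots> = b / (4 * \<mu>) * w\<^sup>2 + b * \<mu> / 4 * u ^ 4" using \<mu> by (simp add: field_simps)
    finally show ?thesis .
  qed
  have 6: "F * d \<le> V\<^sup>2 / \<mu> / 2 + \<mu> / 2 * F\<^sup>2"
  proof -
    have "F * d \<le> \<bar>d\<bar> * \<bar>F\<bar>" using abs_ge_self[of "F * d"] by (simp add: abs_mult mult.commute)
    also have "\<dots> \<le> V * \<bar>F\<bar>" by (intro mult_right_mono dV) auto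
    also have "\<dots> \<le> (V\<^sup>2 / \<mu> + \<mu> * \<bar>F\<bar>\<^sup>2) / 2" by (rule weighted_young[OF \<mu>(1)])
    finally show ?thesis by (simp add: field_simps)
  qed
  have 7: "V\<^sup>2 \<le> V\<^sup>2 / \<mu>" using \<mu> mult_left_le[of \<mu> "V\<^sup>2"] by (simp add: pos_le_divide_eq)
  have "a1 + a2 + (a3 + a4) + a5 + a6 \<le> 1/2 * e + 2 * h2 + 2 * bu + w2 + u4 + 2 * vm + f2"
    if "a1 \<le> e/6 + 3/2 * bu" "a2 \<le> e/6 + 3/2 * v2" "a3 \<le> h2/2 + bu/2" "a4 \<le> e/6 + 3/2 * h2"
      "a5 \<le> w2 + u4" "a6 \<le> vm/2 + f2" "v2 \<le> vm"
    for a1 a2 a3 a4 a5 a6 e bu v2 h2 w2 u4 vm f2 :: real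
    using that by linarith
  from this[OF 1 2 3 4 5 6 7] show ?thesis unfolding E2 by (simp add: distrib_left mult.assoc)
qed

text \<open>Testing the equation with \<open>w\<^sub>j = \<Sum>\<^sub>k \<partial>\<^sub>k (\<theta>\<^sup>4 a\<^sub>k\<^sub>j)\<close>, which is divergence free and compactly
  supported because \<open>a\<close> is antisymmetric, removes the pressure; \<open>w\<close> differs from \<open>\<theta>\<^sup>4 u\<close> only by
  \<open>v\<close>, which contains no derivative of \<open>u\<close>.\<close>
locale stream_potential =
  fixes u :: "3 \<Rightarrow> R3 \<Rightarrow> real" and a :: "3 \<Rightarrow> 3 \<Rightarrow> R3 \<Rightarrow> real" and h :: "3 \<Rightarrow> R3 \<Rightarrow> real"
    and F :: "3 \<Rightarrow> 3 \<Rightarrow> R3 \<Rightarrow> real" and \<theta> :: "R3 \<Rightarrow> real"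
  assumes smooth_u: "smooth_fun (u j)" and smooth_a: "smooth_fun (a k j)" and smooth_h: "smooth_fun (h j)"
    and smooth_F: "smooth_fun (F i j)" and smooth_\<theta>: "smooth_fun \<theta>"
    and \<theta>_supp: "norm x > 2 \<Longrightarrow> \<theta> x = 0" and \<theta>_range: "0 \<le> \<theta> x" "\<theta> x \<le> 1"
    and antisym: "a k j x = - a j k x"
    and div_a: "(\<Sum>k\<in>UNIV. pd k (a k j) x) = u j x - h j x"
    and div_u: "norm x < 3 \<Longrightarrow> (\<Sum>i\<in>UNIV. pd i (u i) x) = 0"
    and curl_eq: "norm x < 3 \<Longrightarrow>
      pd k (\<lambda>x. \<Sum>i\<in>UNIV. pd i (pd i (u j)) x - pd i (F i j) x) x
        = pd j (\<lambda>x. \<Sum>i\<in>UNIV. pd i (pd i (u k)) x - pd i (F i k) x) x"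
begin

text \<open>Derivatives of \<open>v\<close> contain second derivatives of the cutoff, and these must
  be dominated by the square root of the cutoff for absorption. The fourth power achieves it: two
  derivatives still leave the factor \<open>\<theta>\<^sup>2\<close>.\<close>

definition "\<phi> x = (\<theta> x) ^ 4"
definition "v j x = (\<Sum>k\<in>UNIV. pd k \<phi> x * a k j x) - \<phi> x * h j x"
definition "w j x = \<phi> x * u j x + v j x"
definition "G j x = (\<Sum>i\<in>UNIV. pd i (pd i (u j)) x - pd i (F i j) x)"
definition "H i j x = F i j x - u i x * u j x"

lemma smooth_\<phi>: "smooth_fun \<phi>" unfolding \<phi>_def[abs_def] by (intro smooth_power smooth_\<theta>)

lemma pd_\<phi>: "pd i \<phi> x = 4 * (\<theta> x) ^ 3 * pd i \<theta> x"
  unfolding \<phi>_def[abs_def] using pd_smooth_power[OF smooth_\<theta>, of i 3] by (simp add: fun_eq_iff numeral_eq_Suc)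

lemma \<phi>_supp: "norm x > 2 \<Longrightarrow> \<phi> x = 0" by (simp add: \<phi>_def \<theta>_supp)
lemma pd_\<phi>_supp: "norm x > 2 \<Longrightarrow> pd i \<phi> x = 0" by (simp add: pd_\<phi> \<theta>_supp)

lemmas smooths = smooth_u smooth_a smooth_h smooth_F smooth_\<theta> smooth_\<phi> smooth_fun_pd smooth_mult
  smooth_add smooth_diff smooth_sum smooth_minus smooth_power smooth_const smooth_divide

lemma smooth_v: "smooth_fun (v j)" unfolding v_def[abs_def] by (intro smooths)
lemma smooth_w: "smooth_fun (w j)" unfolding w_def[abs_def] by (intro smooths smooth_v)
lemma smooth_G: "smooth_fun (G j)" unfolding G_def[abs_def] by (intro smooths)
lemma smooth_H: "smooth_fun (H i j)" unfolding H_def[abs_def] by (intro smooths)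

lemma v_supp: "norm x > 2 \<Longrightarrow> v j x = 0" by (simp add: v_def \<phi>_supp pd_\<phi>_supp)
lemma w_supp: "norm x > 2 \<Longrightarrow> w j x = 0" by (simp add: w_def v_supp \<phi>_supp)
lemma pd_v_supp: "norm x > 2 \<Longrightarrow> pd i (v j) x = 0" by (rule pd_outside[of 2]) (auto simp: v_supp)
lemma pd_w_supp: "norm x > 2 \<Longrightarrow> pd i (w j) x = 0" by (rule pd_outside[of 2]) (auto simp: w_supp)

lemma integrable_supp: "smooth_fun f \<Longrightarrow> (\<And>x. norm x > 2 \<Longrightarrow> f x = 0) \<Longrightarrow> integrable lborel f"
  using integrable_continuous_bounded_support[OF smooth_fun_continuous] .

lemma w_eq: "w j x = (\<Sum>k\<in>UNIV. pd k (\<lambda>x. \<phi> x * a k j x) x)"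
proof -
  have "(\<Sum>k\<in>UNIV. pd k (\<lambda>x. \<phi> x * a k j x) x) = (\<Sum>k\<in>UNIV. pd k \<phi> x * a k j x) + \<phi> x * (\<Sum>k\<in>UNIV. pd k (a k j) x)"
    by (simp add: pd_smooth_mult[OF smooth_\<phi> smooth_a] sum.distrib sum_distrib_left)
  then show ?thesis by (simp add: w_def v_def div_a algebra_simps)
qed

text \<open>Integration by parts pairs the antisymmetric \<open>a\<close> with the derivatives of
  \<open>G\<close>, which are symmetric in their two indices on the support of \<open>\<phi>\<close>
  because \<open>G\<close> has zero curl there. Exchanging \<open>j\<close> and \<open>k\<close>
  changes the sign of each term. This is where the pressure disappears.\<close>

lemma integral_G_w: "(\<Sum>j\<in>UNIV. \<integral>x. G j x * w j x \<partial>lborel) = 0"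
proof -
  define T where "T j k = (\<integral>x. pd k (G j) x * (\<phi> x * a k j x) \<partial>lborel)" for j k
  have "(\<integral>x. G j x * w j x \<partial>lborel) = - (\<Sum>k\<in>UNIV. T j k)" for j
  proof -
    have "(\<integral>x. G j x * w j x \<partial>lborel) = (\<integral>x. (\<Sum>k\<in>UNIV. pd k (\<lambda>x. \<phi> x * a k j x) x * G j x) \<partial>lborel)"
      by (simp add: w_eq sum_distrib_left mult.commute)
    also have "\<dots> = (\<Sum>k\<in>UNIV. \<integral>x. pd k (\<lambda>x. \<phi> x * a k j x) x * G j x \<partial>lborel)"
      by (rule Bochner_Integration.integral_sum, rule integrable_supp)
        (auto intro!: smooths smooth_G simp: pd_smooth_mult[OF smooth_\<phi> smooth_a] \<phi>_supp pd_\<phi>_supp)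
    also have "\<dots> = (\<Sum>k\<in>UNIV. - T j k)"
    proof (rule sum.cong[OF refl])
      fix k
      have "(\<integral>x. pd k (\<lambda>x. \<phi> x * a k j x) x * G j x \<partial>lborel) = - (\<integral>x. (\<phi> x * a k j x) * pd k (G j) x \<partial>lborel)"
        by (rule integral_by_parts[where r=2]) (auto intro!: smooths smooth_G simp: \<phi>_supp)
      then show "(\<integral>x. pd k (\<lambda>x. \<phi> x * a k j x) x * G j x \<partial>lborel) = - T j k"
        by (simp add: T_def mult.commute)
    qed
    finally show ?thesis by (simp add: sum_negf)
  qed
  moreover have "T j k = - T k j" for j k
  proof -
    have "pd k (G j) x * (\<phi> x * a k j x) = - (pd j (G k) x * (\<phi> x * a j k x))" for x
    proof (cases "norm x < 3")
      case True
      then show ?thesis using curl_eq[OF True, of k j] antisym[of k j x] by (simp add: G_def[abs_def])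
    qed (simp add: \<phi>_supp)
    then show ?thesis unfolding T_def by simp
  qed
  then have "(\<Sum>j\<in>UNIV. \<Sum>k\<in>UNIV. T j k) = (\<Sum>j\<in>UNIV. \<Sum>k\<in>UNIV. - T k j)" by (intro sum.cong refl)
  then have "(\<Sum>j\<in>UNIV. \<Sum>k\<in>UNIV. T j k) = 0"
    using sum.swap[of "\<lambda>j k. T k j" UNIV UNIV] by (simp add: sum_negf)
  ultimately show ?thesis by (simp add: sum_negf)
qed

lemma weak_momentum:
  "(\<integral>x. (\<Sum>j\<in>UNIV. \<Sum>i\<in>UNIV. pd i (u j) x * pd i (w j) x - F i j x * pd i (w j) x) \<partial>lborel) = 0"
proof -
  have bp: "(\<integral>x. pd i f x * w j x \<partial>lborel) = - (\<integral>x. f x * pd i (w j) x \<partial>lborel)" if "smooth_fun f" for f i j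
    by (rule integral_by_parts[where r=2]) (auto intro!: that smooth_w simp: w_supp)
  have i1: "integrable lborel (\<lambda>x. f x * w j x)" "integrable lborel (\<lambda>x. f x * pd i (w j) x)" if "smooth_fun f" for f i j
    by (rule integrable_supp; auto intro!: smooths smooth_w that simp: w_supp pd_w_supp)+
  have "(\<integral>x. G j x * w j x \<partial>lborel)
     = - (\<integral>x. (\<Sum>i\<in>UNIV. pd i (u j) x * pd i (w j) x - F i j x * pd i (w j) x) \<partial>lborel)" for j
  proof -
    have "(\<integral>x. G j x * w j x \<partial>lborel) = (\<integral>x. (\<Sum>i\<in>UNIV. pd i (pd i (u j)) x * w j x - pd i (F i j) x * w j x) \<partial>lborel)"
      by (simp add: G_def sum_distrib_right left_diff_distrib)
    also have "\<dots> = (\<Sum>i\<in>UNIV. (\<integral>x. pd i (pd i (u j)) x * w j x \<partial>lborel) - (\<integral>x. pd i (F i j) x * w j x \<partial>lborel))"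
      using i1[of "pd _ (pd _ (u j))" j] i1[of "pd _ (F _ j)" j] by (simp add: smooths)
    also have "\<dots> = - (\<Sum>i\<in>UNIV. (\<integral>x. pd i (u j) x * pd i (w j) x \<partial>lborel) - (\<integral>x. F i j x * pd i (w j) x \<partial>lborel))"
      by (simp add: bp smooths sum_subtractf sum_negf)
    also have "\<dots> = - (\<integral>x. (\<Sum>i\<in>UNIV. pd i (u j) x * pd i (w j) x - F i j x * pd i (w j) x) \<partial>lborel)"
      using i1(2)[of "pd _ (u j)" _ j] i1(2)[of "F _ j" _ j] by (simp add: smooths)
    finally show ?thesis .
  qed
  then have "(\<Sum>j\<in>UNIV. \<integral>x. (\<Sum>i\<in>UNIV. pd i (u j) x * pd i (w j) x - F i j x * pd i (w j) x) \<partial>lborel) = 0"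
    using integral_G_w by (simp add: sum_negf)
  moreover have "integrable lborel (\<lambda>x. \<Sum>i\<in>UNIV. pd i (u j) x * pd i (w j) x - F i j x * pd i (w j) x)" for j
    by (rule integrable_supp) (auto intro!: smooths smooth_w simp: pd_w_supp)
  ultimately show ?thesis by simp
qed

text \<open>The integrand is half the divergence of \<open>\<phi>\<close> times \<open>u\<close>
  times the square of \<open>u\<close>, up to a multiple of the divergence of \<open>u\<close>,
  which is zero where \<open>\<phi>\<close> is supported.\<close>

lemma convection:
  "(\<integral>x. (\<Sum>j\<in>UNIV. \<Sum>i\<in>UNIV. 1/2 * pd i \<phi> x * u i x * (u j x)\<^sup>2 + \<phi> x * (u i x * u j x * pd i (u j) x)) \<partial>lborel) = 0"
proof -
  have p: "pd i (\<lambda>x. \<phi> x * (u i x * (u j x)\<^sup>2)) x = pd i \<phi> x * (u i x * (u j x)\<^sup>2)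
     + \<phi> x * (pd i (u i) x * (u j x)\<^sup>2 + u i x * (2 * u j x * pd i (u j) x))" for i j x
  proof -
    have "pd i (\<lambda>x. (u j x)\<^sup>2) = (\<lambda>x. 2 * u j x * pd i (u j) x)"
      using pd_smooth_power[OF smooth_u, of i j 1] by (simp add: numeral_2_eq_2)
    then show ?thesis
      unfolding pd_smooth_mult[OF smooth_\<phi> smooth_mult[OF smooth_u smooth_power[OF smooth_u]]]
        pd_smooth_mult[OF smooth_u smooth_power[OF smooth_u]] by simp
  qed
  have pt: "(\<Sum>j\<in>UNIV. \<Sum>i\<in>UNIV. pd i (\<lambda>x. \<phi> x * (u i x * (u j x)\<^sup>2)) x)
     = 2 * (\<Sum>j\<in>UNIV. \<Sum>i\<in>UNIV. 1/2 * pd i \<phi> x * u i x * (u j x)\<^sup>2 + \<phi> x * (u i x * u j x * pd i (u j) x))" for x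
  proof -
    have "(\<Sum>i\<in>UNIV. \<phi> x * (pd i (u i) x * (u j x)\<^sup>2)) = 0" for j
    proof (cases "norm x < 3")
      case True
      have "(\<Sum>i\<in>UNIV. \<phi> x * (pd i (u i) x * (u j x)\<^sup>2)) = \<phi> x * (u j x)\<^sup>2 * (\<Sum>i\<in>UNIV. pd i (u i) x)"
        by (simp add: sum_distrib_left mult_ac)
      then show ?thesis by (simp add: div_u[OF True])
    qed (simp add: \<phi>_supp)
    then show ?thesis
      unfolding p distrib_left sum.distrib by (simp add: sum_distrib_left mult_ac)
  qed
  have "(\<integral>x. (\<Sum>j\<in>UNIV. \<Sum>i\<in>UNIV. pd i (\<lambda>x. \<phi> x * (u i x * (u j x)\<^sup>2)) x) \<partial>lborel)
      = (\<Sum>j\<in>UNIV. \<Sum>i\<in>UNIV. \<integral>x. pd i (\<lambda>x. \<phi> x * (u i x * (u j x)\<^sup>2)) x \<partial>lborel)"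
    by (subst Bochner_Integration.integral_sum | auto intro!: integrable_supp Bochner_Integration.integrable_sum smooths
        simp: pd_outside[of 2] \<phi>_supp)+
  also have "\<dots> = 0"
    by (intro sum.neutral ballI integral_pd_zero[where r=2]) (auto intro!: smooths simp: \<phi>_supp)
  finally show ?thesis unfolding pt by simp
qed

text \<open>What remains of the energy balance besides the weighted gradient. Writing
  \<open>F\<close> as \<open>u i * u j\<close> plus the commutator \<open>H\<close> lets
  \<open>convection\<close> remove the cubic term with a derivative on \<open>u\<close>, leaving the
  one with a derivative on the cutoff.\<close>

definition "R i j x = - pd i \<phi> x * u j x * pd i (u j) x - pd i (u j) x * pd i (v j) x
    + H i j x * (pd i \<phi> x * u j x + \<phi> x * pd i (u j) x) + 1/2 * pd i \<phi> x * u i x * (u j x)\<^sup>2 + F i j x * pd i (v j) x"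

lemma energy_identity:
  "(\<integral>x. (\<Sum>j\<in>UNIV. \<Sum>i\<in>UNIV. \<phi> x * (pd i (u j) x)\<^sup>2) \<partial>lborel) = (\<integral>x. (\<Sum>j\<in>UNIV. \<Sum>i\<in>UNIV. R i j x) \<partial>lborel)"
proof -
  define A where "A x = (\<Sum>j\<in>UNIV. \<Sum>i\<in>UNIV. pd i (u j) x * pd i (w j) x - F i j x * pd i (w j) x)" for x
  define B where "B x = (\<Sum>j\<in>UNIV. \<Sum>i\<in>UNIV. 1/2 * pd i \<phi> x * u i x * (u j x)\<^sup>2 + \<phi> x * (u i x * u j x * pd i (u j) x))" for x
  define S where "S x = (\<Sum>j\<in>UNIV. \<Sum>i\<in>UNIV. R i j x)" for x
  have pw: "pd i (w j) x = pd i \<phi> x * u j x + \<phi> x * pd i (u j) x + pd i (v j) x" for i j x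
    unfolding w_def[abs_def] by (subst pd_smooth_add, auto intro!: smooths smooth_v simp: pd_smooth_mult[OF smooth_\<phi> smooth_u])
  have "(\<Sum>j\<in>UNIV. \<Sum>i\<in>UNIV. \<phi> x * (pd i (u j) x)\<^sup>2) = A x + B x + S x" for x
    unfolding A_def B_def S_def R_def sum.distrib[symmetric] pw H_def
    by (intro sum.cong refl) (simp add: algebra_simps power2_eq_square)
  then have "(\<integral>x. (\<Sum>j\<in>UNIV. \<Sum>i\<in>UNIV. \<phi> x * (pd i (u j) x)\<^sup>2) \<partial>lborel) = (\<integral>x. A x + B x + S x \<partial>lborel)" by simp
  also have "\<dots> = (\<integral>x. A x \<partial>lborel) + (\<integral>x. B x \<partial>lborel) + (\<integral>x. S x \<partial>lborel)"
  proof -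
    have "integrable lborel A" unfolding A_def[abs_def]
      by (rule integrable_supp) (auto intro!: smooths smooth_w simp: pd_w_supp)
    moreover have "integrable lborel B" unfolding B_def[abs_def]
      by (rule integrable_supp) (auto intro!: smooths simp: \<phi>_supp pd_\<phi>_supp)
    moreover have "integrable lborel S" unfolding S_def[abs_def] R_def
      by (rule integrable_supp) (auto intro!: smooths smooth_v smooth_H simp: \<phi>_supp pd_\<phi>_supp pd_v_supp)
    ultimately show ?thesis by simp
  qed
  finally show ?thesis using weak_momentum convection unfolding A_def B_def S_def by simp
qed

text \<open>\<open>energy_pointwise\<close> integrated, with half of the left side absorbed. The
  commutator keeps its own bound \<open>NH\<close>, since it is small with \<open>\<delta>\<close>
  whereas the other bounds are uniform in \<open>\<delta>\<close>.\<close>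

lemma energy_bound:
  assumes b: "b \<ge> 1" "\<And>i x. \<bar>pd i \<phi> x\<bar> \<le> b * (\<theta> x)\<^sup>2" "\<And>i k x. \<bar>pd i (pd k \<phi>) x\<bar> \<le> b * (\<theta> x)\<^sup>2"
    and \<mu>: "0 < \<mu>" "\<mu> \<le> 1"
    and N2: "\<And>j. (\<integral>x. indicator (cball 0 2) x * (u j x)\<^sup>2 \<partial>lborel) \<le> N2"
      "\<And>k j. (\<integral>x. indicator (cball 0 2) x * (a k j x)\<^sup>2 \<partial>lborel) \<le> N2"
      "\<And>i k j. (\<integral>x. indicator (cball 0 2) x * (pd i (a k j) x)\<^sup>2 \<partial>lborel) \<le> N2"
      "\<And>j. (\<integral>x. indicator (cball 0 2) x * (h j x)\<^sup>2 \<partial>lborel) \<le> N2"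
      "\<And>i j. (\<integral>x. indicator (cball 0 2) x * (pd i (h j) x)\<^sup>2 \<partial>lborel) \<le> N2"
    and N4: "\<And>j. (\<integral>x. indicator (cball 0 2) x * (u j x) ^ 4 \<partial>lborel) \<le> N4"
      "\<And>i j. (\<integral>x. indicator (cball 0 2) x * (F i j x)\<^sup>2 \<partial>lborel) \<le> N4"
    and NH: "\<And>i j. (\<integral>x. indicator (cball 0 2) x * (F i j x - u i x * u j x)\<^sup>2 \<partial>lborel) \<le> NH"
  shows "(\<integral>x. (\<Sum>j\<in>UNIV. \<Sum>i\<in>UNIV. \<phi> x * (pd i (u j) x)\<^sup>2) \<partial>lborel) \<le> 2400 * b\<^sup>2 * (NH + N2 / \<mu> + \<mu> * N4)"
proof -
  define I where "I = (indicator (cball 0 2) :: R3 \<Rightarrow> real)"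
  \<comment> \<open>A majorant of \<open>pd i (v j)\<close> once the factor
    \<open>(\<theta> x)\<^sup>2\<close> has been taken out.\<close>
  define V where "V i j x = b * ((\<Sum>k\<in>UNIV. \<bar>a k j x\<bar> + \<bar>pd i (a k j) x\<bar>) + \<bar>h j x\<bar> + \<bar>pd i (h j) x\<bar>)" for i j x
  define V2 where "V2 i j x = (\<Sum>k\<in>UNIV. (a k j x)\<^sup>2 + (pd i (a k j) x)\<^sup>2) + (h j x)\<^sup>2 + (pd i (h j) x)\<^sup>2" for i j x
  have V0: "V i j x \<ge> 0" for i j x unfolding V_def using b(1) by (intro mult_nonneg_nonneg add_nonneg_nonneg sum_nonneg) auto
  have VV: "(V i j x)\<^sup>2 \<le> 8 * b\<^sup>2 * V2 i j x" for i j x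
  proof -
    \<comment> \<open>The uneven weights anticipate the factor 6 that Cauchy-Schwarz costs on the
      sum over \<open>k\<close>, so that all squares end up with the coefficient 8.\<close>
    have sq3: "(s + h1 + h2)\<^sup>2 \<le> 8 / 6 * s\<^sup>2 + 8 * h1\<^sup>2 + 8 * h2\<^sup>2" for s h1 h2 :: real
    proof -
      have "(s + (h1 + h2))\<^sup>2 = s\<^sup>2 + 2 * s * (h1 + h2) + (h1 + h2)\<^sup>2" by (simp add: power2_sum)
      moreover have "2 * (s * (h1 + h2)) \<le> s\<^sup>2 / 3 + 3 * (h1 + h2)\<^sup>2" using weighted_young[of 3 s "h1 + h2"] by simp
      moreover have "(h1 + h2)\<^sup>2 \<le> 2 * (h1\<^sup>2 + h2\<^sup>2)" using sum_squares_bound[of h1 h2] by (simp add: power2_sum)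
      ultimately show ?thesis by (simp add: add.assoc)
    qed
    have cs: "(\<Sum>k\<in>(UNIV::3 set). p k + q k)\<^sup>2 \<le> 6 * (\<Sum>k\<in>UNIV. (p k)\<^sup>2 + (q k)\<^sup>2)" for p q :: "3 \<Rightarrow> real"
    proof -
      have "(\<Sum>k\<in>(UNIV::3 set). (p k + q k) * 1)\<^sup>2 \<le> (\<Sum>k\<in>UNIV. (p k + q k)\<^sup>2) * (\<Sum>k\<in>(UNIV::3 set). 1\<^sup>2)"
        by (rule Cauchy_Schwarz_ineq_sum)
      also have "\<dots> = 3 * (\<Sum>k\<in>UNIV. (p k + q k)\<^sup>2)" by simp
      also have "\<dots> \<le> 3 * (\<Sum>k\<in>UNIV. 2 * ((p k)\<^sup>2 + (q k)\<^sup>2))"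
      proof (intro mult_left_mono sum_mono)
        show "(p k + q k)\<^sup>2 \<le> 2 * ((p k)\<^sup>2 + (q k)\<^sup>2)" for k
          using sum_squares_bound[of "p k" "q k"] by (simp add: power2_sum)
      qed simp
      finally show ?thesis by (simp add: sum_distrib_left)
    qed
    have "(V i j x)\<^sup>2 = b\<^sup>2 * ((\<Sum>k\<in>UNIV. \<bar>a k j x\<bar> + \<bar>pd i (a k j) x\<bar>) + \<bar>h j x\<bar> + \<bar>pd i (h j) x\<bar>)\<^sup>2"
      by (simp add: V_def power_mult_distrib)
    also have "\<dots> \<le> b\<^sup>2 * (8 / 6 * (\<Sum>k\<in>UNIV. \<bar>a k j x\<bar> + \<bar>pd i (a k j) x\<bar>)\<^sup>2 + 8 * \<bar>h j x\<bar>\<^sup>2 + 8 * \<bar>pd i (h j) x\<bar>\<^sup>2)"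
      by (intro mult_left_mono sq3) simp
    also have "\<dots> \<le> b\<^sup>2 * (8 / 6 * (6 * (\<Sum>k\<in>UNIV. \<bar>a k j x\<bar>\<^sup>2 + \<bar>pd i (a k j) x\<bar>\<^sup>2)) + 8 * \<bar>h j x\<bar>\<^sup>2 + 8 * \<bar>pd i (h j) x\<bar>\<^sup>2)"
      by (intro mult_left_mono add_mono cs order_refl) auto
    also have "\<dots> = 8 * b\<^sup>2 * V2 i j x" by (simp add: V2_def algebra_simps)
    finally show ?thesis .
  qed
  have dv: "\<bar>pd i (v j) x\<bar> \<le> (\<theta> x)\<^sup>2 * V i j x" for i j x
  proof -
    have e: "pd i (v j) x = (\<Sum>k\<in>UNIV. pd i (pd k \<phi>) x * a k j x + pd k \<phi> x * pd i (a k j) x) - (pd i \<phi> x * h j x + \<phi> x * pd i (h j) x)"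
      unfolding v_def[abs_def]
      by (subst pd_smooth_diff, (auto intro!: smooths)[2], subst pd_smooth_sum)
        (auto intro!: smooths simp: pd_smooth_mult smooths)
    have \<phi>b: "\<bar>\<phi> x\<bar> \<le> b * (\<theta> x)\<^sup>2"
    proof -
      have "\<phi> x = (\<theta> x)\<^sup>2 * (\<theta> x)\<^sup>2" by (simp add: \<phi>_def)
      also have "\<dots> \<le> b * (\<theta> x)\<^sup>2"
        using b(1) \<theta>_range[of x] by (intro mult_right_mono) (auto intro: order_trans[OF power_le_one])
      finally show ?thesis by (simp add: \<phi>_def)
    qed
    have "\<bar>pd i (v j) x\<bar> \<le> (\<Sum>k\<in>UNIV. \<bar>pd i (pd k \<phi>) x\<bar> * \<bar>a k j x\<bar> + \<bar>pd k \<phi> x\<bar> * \<bar>pd i (a k j) x\<bar>)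
        + (\<bar>pd i \<phi> x\<bar> * \<bar>h j x\<bar> + \<bar>\<phi> x\<bar> * \<bar>pd i (h j) x\<bar>)"
      unfolding e
      by (rule order_trans[OF abs_triangle_ineq4 add_mono[OF order_trans[OF sum_abs sum_mono]]])
        (auto simp: abs_mult[symmetric] abs_triangle_ineq)
    also have "\<dots> \<le> (\<Sum>k\<in>UNIV. (b * (\<theta> x)\<^sup>2) * \<bar>a k j x\<bar> + (b * (\<theta> x)\<^sup>2) * \<bar>pd i (a k j) x\<bar>)
        + ((b * (\<theta> x)\<^sup>2) * \<bar>h j x\<bar> + (b * (\<theta> x)\<^sup>2) * \<bar>pd i (h j) x\<bar>)"
      by (intro add_mono sum_mono mult_right_mono b \<phi>b) auto
    also have "\<dots> = (\<theta> x)\<^sup>2 * V i j x" by (simp add: V_def sum.distrib sum_distrib_left algebra_simps)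
    finally show ?thesis .
  qed
  define Q where "Q i j x = 2 * (H i j x)\<^sup>2 + 2 * b\<^sup>2 * (u j x)\<^sup>2 + b / (4 * \<mu>) * (u i x)\<^sup>2 + b * \<mu> / 4 * (u j x) ^ 4
      + 16 * b\<^sup>2 / \<mu> * V2 i j x + \<mu> / 2 * (F i j x)\<^sup>2" for i j x
  have sQ: "smooth_fun (Q i j)" for i j unfolding Q_def[abs_def] V2_def by (intro smooths smooth_H)
  have Rb: "R i j x \<le> 1/2 * (\<phi> x * (pd i (u j) x)\<^sup>2) + I x * Q i j x" for i j x
  proof (cases "norm x \<le> 2")
    case True
    have "R i j x \<le> 1/2 * (\<phi> x * (pd i (u j) x)\<^sup>2) + 2 * (H i j x)\<^sup>2 + 2 * b\<^sup>2 * (u j x)\<^sup>2 + b / (4 * \<mu>) * (u i x)\<^sup>2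
        + b * \<mu> / 4 * (u j x) ^ 4 + 2 / \<mu> * (V i j x)\<^sup>2 + \<mu> / 2 * (F i j x)\<^sup>2"
      unfolding R_def
      by (rule energy_pointwise[where t="(\<theta> x)\<^sup>2", OF _ _ _ b(2) dv V0 b(1) \<mu>])
        (use \<theta>_range[of x] in \<open>auto simp: \<phi>_def power_le_one\<close>)
    also have "\<dots> \<le> 1/2 * (\<phi> x * (pd i (u j) x)\<^sup>2) + Q i j x"
      using mult_left_mono[OF VV[of i j x], of "2 / \<mu>"] \<mu> by (simp add: Q_def)
    finally show ?thesis using True by (simp add: I_def)
  next
    case False
    then show ?thesis by (simp add: R_def \<phi>_supp pd_\<phi>_supp pd_v_supp I_def)
  qed
  define X where "X = (\<integral>x. (\<Sum>j\<in>UNIV. \<Sum>i\<in>UNIV. \<phi> x * (pd i (u j) x)\<^sup>2) \<partial>lborel)"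
  have iX: "integrable lborel (\<lambda>x. \<Sum>j\<in>UNIV. \<Sum>i\<in>UNIV. \<phi> x * (pd i (u j) x)\<^sup>2)"
    by (rule integrable_supp) (auto intro!: smooths simp: \<phi>_supp)
  have iI: "integrable lborel (\<lambda>x. I x * f x)" if "smooth_fun f" for f
    unfolding I_def by (rule integrable_ind_cont[OF smooth_fun_continuous[OF that]])
  have "X = (\<integral>x. (\<Sum>j\<in>UNIV. \<Sum>i\<in>UNIV. R i j x) \<partial>lborel)" unfolding X_def by (rule energy_identity)
  also have "\<dots> \<le> (\<integral>x. 1/2 * (\<Sum>j\<in>UNIV. \<Sum>i\<in>UNIV. \<phi> x * (pd i (u j) x)\<^sup>2) + (\<Sum>j\<in>UNIV. \<Sum>i\<in>UNIV. I x * Q i j x) \<partial>lborel)"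
  proof (rule integral_mono)
    show "integrable lborel (\<lambda>x. \<Sum>j\<in>UNIV. \<Sum>i\<in>UNIV. R i j x)" unfolding R_def
      by (rule integrable_supp) (auto intro!: smooths smooth_v smooth_H simp: \<phi>_supp pd_\<phi>_supp pd_v_supp)
    show "integrable lborel (\<lambda>x. 1/2 * (\<Sum>j\<in>UNIV. \<Sum>i\<in>UNIV. \<phi> x * (pd i (u j) x)\<^sup>2) + (\<Sum>j\<in>UNIV. \<Sum>i\<in>UNIV. I x * Q i j x))"
      using iX iI[OF sQ] by auto
    show "(\<Sum>j\<in>UNIV. \<Sum>i\<in>UNIV. R i j x) \<le> 1/2 * (\<Sum>j\<in>UNIV. \<Sum>i\<in>UNIV. \<phi> x * (pd i (u j) x)\<^sup>2) + (\<Sum>j\<in>UNIV. \<Sum>i\<in>UNIV. I x * Q i j x)" for x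
      unfolding sum_distrib_left sum.distrib[symmetric] by (intro sum_mono Rb)
  qed
  also have "\<dots> = 1/2 * X + (\<Sum>j\<in>UNIV. \<Sum>i\<in>UNIV. \<integral>x. I x * Q i j x \<partial>lborel)"
    using iX iI[OF sQ] unfolding X_def by simp
  finally have "X \<le> 2 * (\<Sum>j\<in>UNIV. \<Sum>i\<in>UNIV. \<integral>x. I x * Q i j x \<partial>lborel)" by simp
  also have "\<dots> \<le> 2 * (\<Sum>j\<in>(UNIV::3 set). \<Sum>i\<in>(UNIV::3 set). 2 * NH + 2 * b\<^sup>2 * N2 + b / (4 * \<mu>) * N2 + b * \<mu> / 4 * N4
      + 16 * b\<^sup>2 / \<mu> * (8 * N2) + \<mu> / 2 * N4)"
  proof (intro mult_left_mono sum_mono)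
    fix i j :: 3
    \<comment> \<open>Two squares for each of three values of \<open>k\<close>, and two more for
      \<open>h\<close>, make 8.\<close>
    have n: "(\<integral>x. I x * V2 i j x \<partial>lborel) \<le> 8 * N2"
    proof -
      have "(\<integral>x. I x * V2 i j x \<partial>lborel) = (\<Sum>k\<in>UNIV. (\<integral>x. I x * (a k j x)\<^sup>2 \<partial>lborel) + (\<integral>x. I x * (pd i (a k j) x)\<^sup>2 \<partial>lborel))
         + (\<integral>x. I x * (h j x)\<^sup>2 \<partial>lborel) + (\<integral>x. I x * (pd i (h j) x)\<^sup>2 \<partial>lborel)"
        unfolding V2_def distrib_left sum_distrib_left
        using iI[of "\<lambda>x. (a _ j x)\<^sup>2"] iI[of "\<lambda>x. (pd i (a _ j) x)\<^sup>2"] iI[of "\<lambda>x. (h j x)\<^sup>2"] iI[of "\<lambda>x. (pd i (h j) x)\<^sup>2"]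
        by (simp add: smooths)
      also have "\<dots> \<le> (\<Sum>k\<in>(UNIV::3 set). N2 + N2) + N2 + N2"
        unfolding I_def by (intro add_mono sum_mono N2)
      finally show ?thesis by simp
    qed
    have "(\<integral>x. I x * Q i j x \<partial>lborel) = 2 * (\<integral>x. I x * (H i j x)\<^sup>2 \<partial>lborel) + 2 * b\<^sup>2 * (\<integral>x. I x * (u j x)\<^sup>2 \<partial>lborel)
      + b / (4 * \<mu>) * (\<integral>x. I x * (u i x)\<^sup>2 \<partial>lborel) + b * \<mu> / 4 * (\<integral>x. I x * (u j x) ^ 4 \<partial>lborel)
      + 16 * b\<^sup>2 / \<mu> * (\<integral>x. I x * V2 i j x \<partial>lborel) + \<mu> / 2 * (\<integral>x. I x * (F i j x)\<^sup>2 \<partial>lborel)"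
    proof -
      have "(\<integral>x. I x * Q i j x \<partial>lborel) = (\<integral>x. 2 * (I x * (H i j x)\<^sup>2) + 2 * b\<^sup>2 * (I x * (u j x)\<^sup>2) + b / (4 * \<mu>) * (I x * (u i x)\<^sup>2)
        + b * \<mu> / 4 * (I x * (u j x) ^ 4) + 16 * b\<^sup>2 / \<mu> * (I x * V2 i j x) + \<mu> / 2 * (I x * (F i j x)\<^sup>2) \<partial>lborel)"
        by (rule Bochner_Integration.integral_cong) (auto simp: Q_def algebra_simps)
      moreover have "smooth_fun (V2 i j)" unfolding V2_def[abs_def] by (intro smooths)
      ultimately show ?thesis
        using iI[of "\<lambda>x. (H i j x)\<^sup>2"] iI[of "\<lambda>x. (u j x)\<^sup>2"] iI[of "\<lambda>x. (u i x)\<^sup>2"] iI[of "\<lambda>x. (u j x) ^ 4"]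
          iI[of "V2 i j"] iI[of "\<lambda>x. (F i j x)\<^sup>2"] smooth_H[of i j]
        by (simp add: smooths)
    qed
    also have "\<dots> \<le> 2 * NH + 2 * b\<^sup>2 * N2 + b / (4 * \<mu>) * N2 + b * \<mu> / 4 * N4 + 16 * b\<^sup>2 / \<mu> * (8 * N2) + \<mu> / 2 * N4"
      using N2 N4 NH n b(1) \<mu> unfolding I_def H_def by (intro add_mono mult_left_mono) auto
    finally show "(\<integral>x. I x * Q i j x \<partial>lborel) \<le> \<dots>" .
  qed simp
  also have "\<dots> = 18 * (2 * NH + 2 * b\<^sup>2 * N2 + b / (4 * \<mu>) * N2 + b * \<mu> / 4 * N4 + 16 * b\<^sup>2 / \<mu> * (8 * N2) + \<mu> / 2 * N4)"
    by simp
  also have "\<dots> \<le> 18 * (130 * b\<^sup>2 * NH + 2 * (b\<^sup>2 * (N2 / \<mu>)) + 1 * (b\<^sup>2 * (N2 / \<mu>)) + 1 * (b\<^sup>2 * (\<mu> * N4)) + 128 * (b\<^sup>2 * (N2 / \<mu>)) + 1 * (b\<^sup>2 * (\<mu> * N4)))"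
  proof (intro mult_left_mono add_mono)
    have nn: "0 \<le> NH" "0 \<le> N2" "0 \<le> N4"
      by (rule order_trans[OF Bochner_Integration.integral_nonneg NH] order_trans[OF Bochner_Integration.integral_nonneg N2(1)]
          order_trans[OF Bochner_Integration.integral_nonneg N4(2)]; simp)+
    have b2: "1 \<le> b\<^sup>2" "b \<le> b\<^sup>2" using b(1) by (auto simp: power2_eq_square one_le_mult_iff intro: order_trans[OF _ mult_left_mono[of 1 b b]])
    have m: "N2 \<le> N2 / \<mu>" using \<mu> nn mult_left_le[of \<mu> N2] by (simp add: pos_le_divide_eq)
    show "2 * NH \<le> 130 * b\<^sup>2 * NH" using b2 nn by (intro mult_right_mono) auto
    show "2 * b\<^sup>2 * N2 \<le> 2 * (b\<^sup>2 * (N2 / \<mu>))" using mult_left_mono[OF m, of "2 * b\<^sup>2"] by (simp add: mult.assoc)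
    have "b / 4 * (N2 / \<mu>) \<le> b\<^sup>2 * (N2 / \<mu>)" using b2 b(1) nn \<mu> by (intro mult_right_mono) auto
    then show "b / (4 * \<mu>) * N2 \<le> 1 * (b\<^sup>2 * (N2 / \<mu>))" by simp
    have "b / 4 * (\<mu> * N4) \<le> b\<^sup>2 * (\<mu> * N4)" using b2 b(1) nn \<mu> by (intro mult_right_mono) auto
    then show "b * \<mu> / 4 * N4 \<le> 1 * (b\<^sup>2 * (\<mu> * N4))" by simp
    show "16 * b\<^sup>2 / \<mu> * (8 * N2) \<le> 128 * (b\<^sup>2 * (N2 / \<mu>))" by simp
    have "1 / 2 * (\<mu> * N4) \<le> b\<^sup>2 * (\<mu> * N4)" using b2 b(1) nn \<mu> by (intro mult_right_mono) auto
    then show "\<mu> / 2 * N4 \<le> 1 * (b\<^sup>2 * (\<mu> * N4))" by simp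
  qed simp
  \<comment> \<open>The largest coefficient is \<open>18 * 131 = 2358\<close>.\<close>
  also have "\<dots> \<le> 2400 * b\<^sup>2 * (NH + N2 / \<mu> + \<mu> * N4)"
  proof -
    have nn: "0 \<le> NH" "0 \<le> N2" "0 \<le> N4"
      by (rule order_trans[OF Bochner_Integration.integral_nonneg NH] order_trans[OF Bochner_Integration.integral_nonneg N2(1)]
          order_trans[OF Bochner_Integration.integral_nonneg N4(2)]; simp)+
    have "0 \<le> b\<^sup>2 * NH" "0 \<le> b\<^sup>2 * (N2 / \<mu>)" "0 \<le> b\<^sup>2 * (\<mu> * N4)" using nn \<mu> by auto
    moreover have "18 * (130 * A + 2 * B + 1 * B + 1 * C + 128 * B + 1 * C) \<le> 2400 * (A + B + C)"
      if "0 \<le> A" "0 \<le> B" "0 \<le> C" for A B C :: real using that by simp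
    ultimately have "18 * (130 * (b\<^sup>2 * NH) + 2 * (b\<^sup>2 * (N2 / \<mu>)) + 1 * (b\<^sup>2 * (N2 / \<mu>)) + 1 * (b\<^sup>2 * (\<mu> * N4))
      + 128 * (b\<^sup>2 * (N2 / \<mu>)) + 1 * (b\<^sup>2 * (\<mu> * N4))) \<le> 2400 * (b\<^sup>2 * NH + b\<^sup>2 * (N2 / \<mu>) + b\<^sup>2 * (\<mu> * N4))"
      by blast
    then show ?thesis by (simp only: distrib_left mult.assoc)
  qed
  finally show ?thesis unfolding X_def .
qed

end

section \<open>Mollified weak solutions\<close>

text \<open>For a weak solution this equals minus the pressure paired with
  \<open>pd j \<psi>\<close>. Inserting \<open>pd k \<psi>\<close> therefore gives an expression
  symmetric in \<open>j\<close> and \<open>k\<close>.\<close>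

definition momentum :: "(3 \<Rightarrow> R3 \<Rightarrow> real) \<Rightarrow> 3 \<Rightarrow> (R3 \<Rightarrow> real) \<Rightarrow> real" where
  "momentum U j \<psi> = (\<integral>x. U j x * laplacian \<psi> x \<partial>lborel) + (\<Sum>i\<in>UNIV. \<integral>x. U i x * U j x * pd i \<psi> x \<partial>lborel)"

text \<open>The momentum equation with the pressure eliminated by taking the curl.\<close>
definition weak_NS :: "(3 \<Rightarrow> R3 \<Rightarrow> real) \<Rightarrow> bool" where
  "weak_NS U \<longleftrightarrow> (\<forall>j. U j \<in> borel_measurable borel) \<and>
     (\<forall>j R. integrable lborel (\<lambda>x. indicator (cball 0 R) x * (U j x) ^ 4)) \<and>
     (\<forall>\<psi>. test_fun \<psi> \<longrightarrow> (\<Sum>i\<in>UNIV. \<integral>x. U i x * pd i \<psi> x \<partial>lborel) = 0) \<and>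
     (\<forall>\<psi> j k. test_fun \<psi> \<longrightarrow> momentum U j (pd k \<psi>) = momentum U k (pd j \<psi>))"

text \<open>The radius 12 is the support radius of the cutoff \<open>chi\<close> used below.\<close>

definition mass2 :: "(3 \<Rightarrow> R3 \<Rightarrow> real) \<Rightarrow> real" where
  "mass2 U = (\<Sum>j\<in>UNIV. \<integral>x. indicator (cball 0 12) x * (U j x)\<^sup>2 \<partial>lborel)"

definition mass4 :: "(3 \<Rightarrow> R3 \<Rightarrow> real) \<Rightarrow> real" where
  "mass4 U = (\<Sum>j\<in>UNIV. \<integral>x. indicator (cball 0 12) x * (U j x) ^ 4 \<partial>lborel)"

lemma mass_nonneg: "0 \<le> mass2 U" "0 \<le> mass4 U"
  unfolding mass2_def mass4_def by (auto intro!: sum_nonneg Bochner_Integration.integral_nonneg)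

lemma conv_kernel_sum:
  fixes K :: "3 \<Rightarrow> R3 \<Rightarrow> real"
  assumes "\<And>i. smooth_fun (K i)" "L2_supp r g"
  shows "conv (\<lambda>x. \<Sum>i\<in>UNIV. K i x) g x = (\<Sum>i\<in>UNIV. conv (K i) g x)"
  unfolding conv_def sum_distrib_right
  by (rule Bochner_Integration.integral_sum)
    (rule integrable_conv[OF smooth_fun_continuous[OF assms(1)] L2_suppD(4,3)[OF assms(2)]])

text \<open>A kernel supported in the unit ball sees, from a point of norm below 3, only arguments
  of norm below 4, where the cut-off field agrees with the original one.\<close>

lemma conv_local:
  assumes "\<And>z. norm z > 1 \<Longrightarrow> \<kappa> z = 0" "\<And>y. norm y < 4 \<Longrightarrow> g y = f y" "norm x < 3"
  shows "conv \<kappa> g x = (\<integral>y. \<kappa> (x - y) * f y \<partial>lborel)"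
  unfolding conv_def
proof (rule Bochner_Integration.integral_cong)
  fix y
  show "\<kappa> (x - y) * g y = \<kappa> (x - y) * f y"
  proof (cases "norm (x - y) > 1")
    case False
    then have "norm y < 4" using assms(3) norm_triangle_ineq2[of y x] by (simp add: norm_minus_commute)
    then show ?thesis using assms(2) by simp
  qed (simp add: assms)
qed simp

section \<open>The mollified system and its stream potential\<close>

definition "chi = cutoff 12"

lemma chi: "smooth_fun chi" "norm x > 12 \<Longrightarrow> chi x = 0" "norm x \<le> 6 \<Longrightarrow> chi x = 1" "0 \<le> chi x" "chi x \<le> 1"
  by (auto simp: chi_def smooth_cutoff cutoff_eq_0 cutoff_eq_1 cutoff_range)

lemma pd_chi_outside: "norm x > 12 \<Longrightarrow> pd i chi x = 0"
  by (rule pd_outside[of 12]) (auto simp: chi)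

text \<open>A fixed number, so that constants formed from it are uniform over all solutions.\<close>

definition "pd_chi_bound = (SOME C. C \<ge> 0 \<and> (\<forall>i x. \<bar>pd i chi x\<bar> \<le> C))"

lemma finite_bound:
  fixes f :: "3 \<Rightarrow> R3 \<Rightarrow> real"
  assumes "\<And>i. smooth_fun (f i)" "\<And>i x. norm x > r \<Longrightarrow> f i x = 0"
  shows "\<exists>C\<ge>0. \<forall>i x. \<bar>f i x\<bar> \<le> C"
proof -
  obtain c where c: "\<And>i. 0 \<le> c i \<and> (\<forall>x\<in>cball 0 r. \<bar>f i x\<bar> \<le> c i)"
    using smooth_bound_on_ball[OF assms(1), of r] by metis
  have "\<bar>f i x\<bar> \<le> (\<Sum>i\<in>UNIV. c i)" for i x
  proof -
    have "\<bar>f i x\<bar> \<le> c i" using c[of i] assms(2)[of x i] by (cases "norm x > r") auto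
    also have "\<dots> \<le> (\<Sum>i\<in>UNIV. c i)" using c by (intro member_le_sum) auto
    finally show ?thesis .
  qed
  then show ?thesis using c by (intro exI[of _ "\<Sum>i\<in>UNIV. c i"]) (auto intro: sum_nonneg)
qed

lemma pd_chi_bound: "pd_chi_bound \<ge> 0" "\<bar>pd i chi x\<bar> \<le> pd_chi_bound"
proof -
  have "\<exists>C\<ge>0. \<forall>i x. \<bar>pd i chi x\<bar> \<le> C"
    by (rule finite_bound[where r=12]) (auto intro: smooth_fun_pd chi pd_chi_outside)
  from someI_ex[OF this, folded pd_chi_bound_def]
  show "pd_chi_bound \<ge> 0" "\<bar>pd i chi x\<bar> \<le> pd_chi_bound" by auto
qed

locale mollified_NS =
  fixes U :: "3 \<Rightarrow> R3 \<Rightarrow> real" and \<delta> :: real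
  assumes NS: "weak_NS U" and \<delta>: "0 < \<delta>" "\<delta> \<le> 1"
begin

definition "g j x = chi x * U j x"
text \<open>The divergence of the cut-off field \<open>chi U\<close>. Convolved with the kernel it
  becomes \<open>h\<close>, the error made by cutting off.\<close>

definition "m x = (\<Sum>k\<in>UNIV. pd k chi x * U k x)"
definition "u j = conv (moll \<delta>) (g j)"
definition "F i j = conv (moll \<delta>) (\<lambda>x. g i x * g j x)"
text \<open>The Biot-Savart vector potential, written as the antisymmetric matrix it represents. Its
  divergence is the mollified field minus the kernel applied to the divergence of
  \<open>g\<close>.\<close>

definition "a k j x = conv (ker \<delta> k) (g j) x - conv (ker \<delta> j) (g k) x"
definition "h j = conv (ker \<delta> j) m"
abbreviation "Q2 \<equiv> mass2 U"
abbreviation "Q4 \<equiv> mass4 U"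

lemma U_meas [measurable]: "U j \<in> borel_measurable borel" using NS unfolding weak_NS_def by auto
lemma chi_meas [measurable]: "chi \<in> borel_measurable borel" by (rule smooth_fun_measurable[OF chi(1)])
lemma pd_chi_meas [measurable]: "pd k chi \<in> borel_measurable borel" by (rule smooth_fun_measurable[OF smooth_fun_pd[OF chi(1)]])

lemma L4_U: "L4_supp 12 (\<lambda>x. indicator (cball 0 12) x * U j x)"
proof (rule L4_suppI)
  have "(\<lambda>x. (indicator (cball 0 12) x * U j x) ^ 4) = (\<lambda>x. indicator (cball 0 12) x * (U j x) ^ 4)"
    by (auto simp: fun_eq_iff indicator_def)
  then show "integrable lborel (\<lambda>x. (indicator (cball 0 12) x * U j x) ^ 4)"
    using NS unfolding weak_NS_def by simp
  show "(\<lambda>x. indicator (cball 0 12) x * U j x) \<in> borel_measurable borel"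
    by (intro borel_measurable_times borel_measurable_indicator U_meas) simp
qed auto

lemma ind_sq: "(indicator (cball 0 12) x * U j x)\<^sup>2 = indicator (cball 0 12) x * (U j x)\<^sup>2"
  "(indicator (cball 0 12) x * U j x) ^ 4 = indicator (cball 0 12) x * (U j x) ^ 4"
  by (auto simp: indicator_def)

lemma iU2: "integrable lborel (\<lambda>x. indicator (cball 0 12) x * (U j x)\<^sup>2)"
  and iU4: "integrable lborel (\<lambda>x. indicator (cball 0 12) x * (U j x) ^ 4)"
  using L4_suppD(4,5)[OF L4_U[of j]] by (auto simp: ind_sq)

lemma g_eq: "g j x = chi x * (indicator (cball 0 12) x * U j x)"
  unfolding g_def using chi(2)[of x] by (cases "norm x > 12") auto

lemma L4_g: "L4_supp 12 (g j)"
proof (rule L4_suppI)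
  show "g j \<in> borel_measurable borel" unfolding g_def by measurable
  show "integrable lborel (\<lambda>x. (g j x) ^ 4)"
  proof (rule Bochner_Integration.integrable_bound[OF iU4[of j]])
    show "AE x in lborel. norm ((g j x) ^ 4) \<le> norm (indicator (cball 0 12) x * (U j x) ^ 4)"
      unfolding g_eq ind_sq(2)[symmetric] using chi(4,5)
      by (intro AE_I2) (simp add: power_mult_distrib abs_mult mult_left_le_one_le power_le_one)
  qed (simp add: g_def)
qed (simp add: g_def chi)

lemmas L2_g = L4_suppD(1)[OF L4_g]

lemma m_sq: "(m x)\<^sup>2 \<le> 3 * pd_chi_bound\<^sup>2 * (\<Sum>k\<in>UNIV. indicator (cball 0 12) x * (U k x)\<^sup>2)"
proof (cases "norm x \<le> 12")
  case True
  have "(m x)\<^sup>2 \<le> (\<Sum>k\<in>UNIV. (pd k chi x)\<^sup>2) * (\<Sum>k\<in>UNIV. (U k x)\<^sup>2)"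
    unfolding m_def by (rule Cauchy_Schwarz_ineq_sum)
  also have "\<dots> \<le> (\<Sum>k\<in>(UNIV::3 set). pd_chi_bound\<^sup>2) * (\<Sum>k\<in>UNIV. (U k x)\<^sup>2)"
    using pd_chi_bound by (intro mult_right_mono sum_mono sum_nonneg) (auto simp: abs_le_square_iff[symmetric])
  finally show ?thesis using True by simp
next
  case False
  then show ?thesis by (simp add: m_def pd_chi_outside)
qed

lemma L2_m: "L2_supp 12 m"
proof (rule L2_suppI)
  show "m \<in> borel_measurable borel" unfolding m_def by measurable
  have i: "integrable lborel (\<lambda>x. 3 * pd_chi_bound\<^sup>2 * (\<Sum>k\<in>UNIV. indicator (cball 0 12) x * (U k x)\<^sup>2))"
    using iU2 by (intro integrable_mult_right Bochner_Integration.integrable_sum) auto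
  show "integrable lborel (\<lambda>x. (m x)\<^sup>2)"
  proof (rule Bochner_Integration.integrable_bound[OF i])
    show "AE x in lborel. norm ((m x)\<^sup>2) \<le> norm (3 * pd_chi_bound\<^sup>2 * (\<Sum>k\<in>UNIV. indicator (cball 0 12) x * (U k x)\<^sup>2))"
      using order_trans[OF m_sq abs_ge_self] by (intro AE_I2) simp
  qed (simp add: m_def)
qed (simp add: m_def pd_chi_outside)

lemma m_bound: "(\<integral>x. (m x)\<^sup>2 \<partial>lborel) \<le> 3 * pd_chi_bound\<^sup>2 * Q2"
proof -
  have i: "integrable lborel (\<lambda>x. 3 * pd_chi_bound\<^sup>2 * (\<Sum>k\<in>UNIV. indicator (cball 0 12) x * (U k x)\<^sup>2))"
    using iU2 by (intro integrable_mult_right Bochner_Integration.integrable_sum) auto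
  have "(\<integral>x. (m x)\<^sup>2 \<partial>lborel) \<le> (\<integral>x. 3 * pd_chi_bound\<^sup>2 * (\<Sum>k\<in>UNIV. indicator (cball 0 12) x * (U k x)\<^sup>2) \<partial>lborel)"
    by (rule integral_mono[OF L2_suppD(2)[OF L2_m] i m_sq])
  also have "\<dots> = 3 * pd_chi_bound\<^sup>2 * Q2" unfolding mass2_def
    by (subst integral_mult_right_zero, subst Bochner_Integration.integral_sum) (auto simp: iU2)
  finally show ?thesis .
qed

lemma Q_nonneg: "0 \<le> (\<integral>x. indicator (cball 0 12) x * (U j x)\<^sup>2 \<partial>lborel)" "0 \<le> (\<integral>x. indicator (cball 0 12) x * (U j x) ^ 4 \<partial>lborel)"
  by (auto intro!: Bochner_Integration.integral_nonneg)

lemma g_bounds: "(\<integral>x. (g j x)\<^sup>2 \<partial>lborel) \<le> Q2" "(\<integral>x. (g j x) ^ 4 \<partial>lborel) \<le> Q4"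
proof -
  have "(\<integral>x. (g j x)\<^sup>2 \<partial>lborel) \<le> (\<integral>x. indicator (cball 0 12) x * (U j x)\<^sup>2 \<partial>lborel)"
    unfolding g_eq ind_sq(1)[symmetric]
    by (rule integral_mono[OF _ L4_suppD(5)[OF L4_U]])
      (use L4_suppD(5)[OF L4_g[of j]] chi(4,5) in \<open>auto simp: g_eq power_mult_distrib mult_left_le_one_le power_le_one\<close>)
  also have "\<dots> \<le> Q2" unfolding mass2_def
    by (rule member_le_sum[of j UNIV "\<lambda>j. \<integral>x. indicator (cball 0 12) x * (U j x)\<^sup>2 \<partial>lborel"]) (auto simp: Q_nonneg)
  finally show "(\<integral>x. (g j x)\<^sup>2 \<partial>lborel) \<le> Q2" .
  have "(\<integral>x. (g j x) ^ 4 \<partial>lborel) \<le> (\<integral>x. indicator (cball 0 12) x * (U j x) ^ 4 \<partial>lborel)"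
    unfolding g_eq ind_sq(2)[symmetric]
    by (rule integral_mono[OF _ L4_suppD(4)[OF L4_U]])
      (use L4_suppD(4)[OF L4_g[of j]] chi(4,5) in \<open>auto simp: g_eq power_mult_distrib mult_left_le_one_le power_le_one\<close>)
  also have "\<dots> \<le> Q4" unfolding mass4_def
    by (rule member_le_sum[of j UNIV "\<lambda>j. \<integral>x. indicator (cball 0 12) x * (U j x) ^ 4 \<partial>lborel"]) (auto simp: Q_nonneg)
  finally show "(\<integral>x. (g j x) ^ 4 \<partial>lborel) \<le> Q4" .
qed

lemmas L2_gg = L2_supp_mult[OF L4_g L4_g]

lemma moll1: "norm z > 1 \<Longrightarrow> moll \<delta> z = 0" using moll_outside[of \<delta> z] \<delta> by simp
lemma pd_moll1: "norm z > 1 \<Longrightarrow> pd i (moll \<delta>) z = 0" by (rule pd_outside[of 1]) (auto simp: moll1)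
lemma pd2_moll1: "norm z > 1 \<Longrightarrow> pd k (pd i (moll \<delta>)) z = 0" by (rule pd_outside[of 1]) (auto simp: pd_moll1)

lemma g_local: "norm y < 4 \<Longrightarrow> g j y = U j y" by (simp add: g_def chi)
lemma gg_local: "norm y < 4 \<Longrightarrow> g i y * g j y = U i y * U j y" by (simp add: g_local)

lemma test_moll: "test_fun (\<lambda>y. moll \<delta> (x - y))"
proof (rule test_funI[where r="norm x + 1"])
  show "moll \<delta> (x - y) = 0" if "norm y > norm x + 1" for y
    by (rule moll1) (use that norm_triangle_ineq2[of y x] in \<open>simp add: norm_minus_commute\<close>)
qed (rule smooth_reflect[OF smooth_moll])

lemma smooth_u: "smooth_fun (u j)" unfolding u_def by (rule smooth_conv[OF smooth_moll L2_suppD(4,3)[OF L2_g]])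
lemma smooth_F: "smooth_fun (F i j)" unfolding F_def by (rule smooth_conv[OF smooth_moll L2_suppD(4,3)[OF L2_gg]])
lemma smooth_kg: "smooth_fun (conv (ker \<delta> k) (g j))" by (rule smooth_conv[OF smooth_ker L2_suppD(4,3)[OF L2_g]])
lemma smooth_a: "smooth_fun (a k j)" unfolding a_def[abs_def] by (intro smooth_diff smooth_kg)
lemma smooth_h: "smooth_fun (h j)" unfolding h_def by (rule smooth_conv[OF smooth_ker L2_suppD(4,3)[OF L2_m]])

lemma pd_u: "pd i (u j) = conv (pd i (moll \<delta>)) (g j)" unfolding u_def by (rule pd_conv[OF smooth_moll L2_suppD(4,3)[OF L2_g]])
lemma pd_F: "pd k (F i j) = conv (pd k (moll \<delta>)) (\<lambda>x. g i x * g j x)" unfolding F_def by (rule pd_conv[OF smooth_moll L2_suppD(4,3)[OF L2_gg]])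
lemma pd_kg: "pd i (conv (ker \<delta> k) (g j)) = conv (pd i (ker \<delta> k)) (g j)" by (rule pd_conv[OF smooth_ker L2_suppD(4,3)[OF L2_g]])

lemma div_u: assumes "norm x < 3" shows "(\<Sum>i\<in>UNIV. pd i (u i) x) = 0"
proof -
  have "(\<Sum>i\<in>UNIV. pd i (u i) x) = (\<Sum>i\<in>UNIV. \<integral>y. pd i (moll \<delta>) (x - y) * U i y \<partial>lborel)"
    unfolding pd_u by (intro sum.cong refl conv_local pd_moll1 g_local assms)
  also have "\<dots> = - (\<Sum>i\<in>UNIV. \<integral>y. U i y * pd i (\<lambda>y. moll \<delta> (x - y)) y \<partial>lborel)"
    unfolding pd_reflect[OF smooth_moll] by (simp add: sum_negf mult.commute)
  also have "\<dots> = 0" using NS test_moll[of x] unfolding weak_NS_def by simp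
  finally show ?thesis .
qed

text \<open>All derivatives are moved to the mollifier, and
  \<open>y \<mapsto> moll \<delta> (x - y)\<close> is the test function. Reflection flips the sign
  of third derivatives but not of second ones, which gives the overall minus. The bound on
  \<open>x\<close> keeps the mollifier where \<open>chi\<close> is 1.\<close>

lemma curl_eq_aux:
  assumes x: "norm x < 3"
  shows "pd k (\<lambda>x. \<Sum>i\<in>UNIV. pd i (pd i (u j)) x - pd i (F i j) x) x = - momentum U j (pd k (\<lambda>y. moll \<delta> (x - y)))"
proof -
  let ?\<eta> = "moll \<delta>"
  note sm = smooth_fun_pd smooth_moll
  have p2: "pd i (pd i (u j)) = conv (pd i (pd i ?\<eta>)) (g j)" for i
    unfolding pd_u by (rule pd_conv[OF smooth_fun_pd[OF smooth_moll] L2_suppD(4,3)[OF L2_g]])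
  have p3: "pd k (conv (pd i (pd i ?\<eta>)) (g j)) = conv (pd k (pd i (pd i ?\<eta>))) (g j)" for i
    by (rule pd_conv[OF smooth_fun_pd[OF smooth_fun_pd[OF smooth_moll]] L2_suppD(4,3)[OF L2_g]])
  have p4: "pd k (conv (pd i ?\<eta>) (\<lambda>x. g i x * g j x)) = conv (pd k (pd i ?\<eta>)) (\<lambda>x. g i x * g j x)" for i
    by (rule pd_conv[OF smooth_fun_pd[OF smooth_moll] L2_suppD(4,3)[OF L2_gg]])
  have s2: "smooth_fun (conv (pd i (pd i ?\<eta>)) (g j))" for i
    by (rule smooth_conv[OF smooth_fun_pd[OF smooth_fun_pd[OF smooth_moll]] L2_suppD(4,3)[OF L2_g]])
  have s2': "smooth_fun (conv (pd i ?\<eta>) (\<lambda>x. g i x * g j x))" for i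
    by (rule smooth_conv[OF smooth_fun_pd[OF smooth_moll] L2_suppD(4,3)[OF L2_gg]])
  have c3: "pd k (pd i (pd i ?\<eta>)) = pd i (pd i (pd k ?\<eta>))" for i
    by (metis pd_commute smooth_fun_pd smooth_moll)
  have L: "pd k (\<lambda>x. \<Sum>i\<in>UNIV. pd i (pd i (u j)) x - pd i (F i j) x) x
      = conv (\<lambda>x. \<Sum>i\<in>UNIV. pd i (pd i (pd k ?\<eta>)) x) (g j) x - (\<Sum>i\<in>UNIV. conv (pd i (pd k ?\<eta>)) (\<lambda>x. g i x * g j x) x)"
  proof -
    have "pd k (\<lambda>x. \<Sum>i\<in>UNIV. pd i (pd i (u j)) x - pd i (F i j) x)
       = (\<lambda>x. \<Sum>i\<in>UNIV. pd k (\<lambda>x. pd i (pd i (u j)) x - pd i (F i j) x) x)"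
      unfolding p2 pd_F by (rule pd_smooth_sum) (intro smooth_diff s2 s2')
    moreover have "pd k (\<lambda>x. pd i (pd i (u j)) x - pd i (F i j) x) x
      = conv (pd i (pd i (pd k ?\<eta>))) (g j) x - conv (pd i (pd k ?\<eta>)) (\<lambda>x. g i x * g j x) x" for i x
      unfolding p2 pd_F pd_smooth_diff[OF s2 s2'] p3 p4 c3 pd_commute[OF smooth_moll, of k i] by simp
    ultimately show ?thesis
      by (simp add: sum_subtractf conv_kernel_sum[OF _ L2_g] sm)
  qed
  have o3: "norm z > 1 \<Longrightarrow> pd i (pd i (pd k ?\<eta>)) z = 0" for i z
    by (rule pd_outside[of 1]) (auto simp: pd2_moll1)
  have "conv (\<lambda>x. \<Sum>i\<in>UNIV. pd i (pd i (pd k ?\<eta>)) x) (g j) x = (\<integral>y. (\<Sum>i\<in>UNIV. pd i (pd i (pd k ?\<eta>)) (x - y)) * U j y \<partial>lborel)"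
    by (rule conv_local) (auto simp: o3 g_local x)
  moreover have "conv (pd i (pd k ?\<eta>)) (\<lambda>x. g i x * g j x) x = (\<integral>y. pd i (pd k ?\<eta>) (x - y) * (U i y * U j y) \<partial>lborel)" for i
    by (rule conv_local) (auto simp: pd2_moll1 gg_local x)
  moreover have r1: "pd k (\<lambda>y. ?\<eta> (x - y)) = (\<lambda>y. - pd k ?\<eta> (x - y))" by (rule pd_reflect[OF smooth_moll])
  have r2: "pd i (pd k (\<lambda>y. ?\<eta> (x - y))) = (\<lambda>y. pd i (pd k ?\<eta>) (x - y))" for i
    unfolding r1 by (subst pd_smooth_minus) (auto simp: pd_reflect sm intro!: smooth_reflect)
  have r3: "pd i (\<lambda>y. pd i (pd k ?\<eta>) (x - y)) = (\<lambda>y. - pd i (pd i (pd k ?\<eta>)) (x - y))" for i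
    by (rule pd_reflect) (intro sm)
  have "momentum U j (pd k (\<lambda>y. ?\<eta> (x - y))) = - (\<integral>y. (\<Sum>i\<in>UNIV. pd i (pd i (pd k ?\<eta>)) (x - y)) * U j y \<partial>lborel)
      + (\<Sum>i\<in>UNIV. \<integral>y. pd i (pd k ?\<eta>) (x - y) * (U i y * U j y) \<partial>lborel)"
    unfolding momentum_def laplacian_def by (simp add: r2 r3 sum_negf mult.commute mult.left_commute)
  ultimately show ?thesis unfolding L by simp
qed

lemma curl_eq:
  assumes x: "norm x < 3"
  shows "pd k (\<lambda>x. \<Sum>i\<in>UNIV. pd i (pd i (u j)) x - pd i (F i j) x) x
    = pd j (\<lambda>x. \<Sum>i\<in>UNIV. pd i (pd i (u k)) x - pd i (F i k) x) x"
  unfolding curl_eq_aux[OF x] using NS test_moll[of x] unfolding weak_NS_def by simp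

text \<open>The divergence equation tested with \<open>y \<mapsto> chi y * ker \<delta> j (x - y)\<close>.\<close>
lemma div_a: "(\<Sum>k\<in>UNIV. pd k (a k j) x) = u j x - h j x"
proof -
  let ?K = "ker \<delta>"
  have p: "pd k (a k j) x = conv (pd k (?K k)) (g j) x - conv (pd k (?K j)) (g k) x" for k
    unfolding a_def[abs_def] pd_smooth_diff[OF smooth_kg smooth_kg] pd_kg by simp
  have e: "(\<lambda>x. \<Sum>k\<in>UNIV. pd k (?K k) x) = moll \<delta>" by (simp add: fun_eq_iff ker_div)
  have 1: "(\<Sum>k\<in>UNIV. conv (pd k (?K k)) (g j) x) = u j x"
    by (subst conv_kernel_sum[OF _ L2_g, symmetric]) (auto simp: e u_def intro: smooth_fun_pd smooth_ker)
  define \<psi> where "\<psi> y = chi y * ?K j (x - y)" for y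
  have s\<psi>: "smooth_fun \<psi>" unfolding \<psi>_def[abs_def] by (intro smooth_mult chi smooth_reflect smooth_ker)
  have "test_fun \<psi>" by (rule test_funI[OF s\<psi>, of 12]) (simp add: \<psi>_def chi)
  then have z: "(\<Sum>k\<in>UNIV. \<integral>y. U k y * pd k \<psi> y \<partial>lborel) = 0" using NS unfolding weak_NS_def by simp
  have cmi: "integrable lborel (\<lambda>y. ?K j (x - y) * (pd k chi y * U k y))" for k
  proof (rule integrable_conv[OF smooth_fun_continuous[OF smooth_ker], where r=12])
    have "(\<lambda>y. pd k chi y * U k y) = (\<lambda>y. pd k chi y * (indicator (cball 0 12) y * U k y))"
      using pd_chi_outside[of _ k] by (auto simp: fun_eq_iff indicator_def not_le)
    moreover have "integrable lborel (\<lambda>y. pd k chi y * (indicator (cball 0 12) y * U k y))"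
    proof (rule Bochner_Integration.integrable_bound[OF integrable_mult_right[OF integrable_norm[OF L2_suppD(4)[OF L4_suppD(1)[OF L4_U[of k]]]], of pd_chi_bound]])
      show "AE y in lborel. norm (pd k chi y * (indicator (cball 0 12) y * U k y)) \<le> norm (pd_chi_bound * norm (indicator (cball 0 12) y * U k y))"
        using pd_chi_bound by (intro AE_I2) (auto simp: abs_mult intro!: mult_right_mono)
    qed (intro borel_measurable_times pd_chi_meas borel_measurable_indicator U_meas, simp_all)
    ultimately show "integrable lborel (\<lambda>y. pd k chi y * U k y)" by simp
  qed (simp add: pd_chi_outside)
  have gi: "integrable lborel (\<lambda>y. pd k (?K j) (x - y) * g k y)" for k
    by (rule integrable_conv[OF smooth_fun_continuous[OF smooth_fun_pd[OF smooth_ker]] L2_suppD(4,3)[OF L2_g]])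
  have "(\<integral>y. U k y * pd k \<psi> y \<partial>lborel) = (\<integral>y. ?K j (x - y) * (pd k chi y * U k y) \<partial>lborel) - conv (pd k (?K j)) (g k) x" for k
  proof -
    have "pd k \<psi> y = pd k chi y * ?K j (x - y) - chi y * pd k (?K j) (x - y)" for y
      unfolding \<psi>_def[abs_def] pd_smooth_mult[OF chi(1) smooth_reflect[OF smooth_ker]] pd_reflect[OF smooth_ker] by simp
    then have "(\<integral>y. U k y * pd k \<psi> y \<partial>lborel) = (\<integral>y. ?K j (x - y) * (pd k chi y * U k y) - pd k (?K j) (x - y) * g k y \<partial>lborel)"
      by (intro Bochner_Integration.integral_cong refl) (simp only: g_def, simp add: algebra_simps)
    then show ?thesis using cmi gi by (simp add: conv_def)
  qed
  then have "(\<Sum>k\<in>UNIV. conv (pd k (?K j)) (g k) x) = (\<Sum>k\<in>UNIV. \<integral>y. ?K j (x - y) * (pd k chi y * U k y) \<partial>lborel)"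
    using z by (simp add: sum_subtractf)
  also have "\<dots> = h j x" unfolding h_def conv_def m_def sum_distrib_left using cmi by simp
  finally show ?thesis unfolding p sum_subtractf 1 by simp
qed

end

section \<open>The local gradient estimate\<close>

definition "tht = cutoff 2"

lemma tht: "smooth_fun tht" "norm x > 2 \<Longrightarrow> tht x = 0" "norm x \<le> 1 \<Longrightarrow> tht x = 1" "0 \<le> tht x" "tht x \<le> 1"
  by (auto simp: tht_def smooth_cutoff cutoff_eq_0 cutoff_eq_1 cutoff_range)

text \<open>Each derivative removes at most one factor \<open>tht\<close>, so two derivatives of the
  fourth power retain at least two, and \<open>tht\<close> is at most 1.\<close>

lemma tht_power_bounds:
  "\<exists>b\<ge>1. (\<forall>i x. \<bar>pd i (\<lambda>x. (tht x) ^ 4) x\<bar> \<le> b * (tht x)\<^sup>2) \<and> (\<forall>i k x. \<bar>pd i (pd k (\<lambda>x. (tht x) ^ 4)) x\<bar> \<le> b * (tht x)\<^sup>2)"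
proof -
  have o1: "norm x > 2 \<Longrightarrow> pd i tht x = 0" for i x by (rule pd_outside[of 2]) (auto simp: tht)
  have o2: "norm x > 2 \<Longrightarrow> pd i (pd k tht) x = 0" for i k x by (rule pd_outside[of 2]) (auto simp: o1)
  obtain c where c: "c \<ge> 0" "\<And>i x. \<bar>pd i tht x\<bar> \<le> c"
    using finite_bound[of "\<lambda>i. pd i tht" 2] o1 smooth_fun_pd[OF tht(1)] by auto
  have "\<exists>C\<ge>0. \<forall>i x. \<bar>pd i (pd k tht) x\<bar> \<le> C" for k
    by (rule finite_bound[of _ 2]) (auto intro: smooth_fun_pd tht simp: o2)
  then obtain e where e: "\<And>k. e k \<ge> 0" "\<And>i k x. \<bar>pd i (pd k tht) x\<bar> \<le> e k" by metis
  define E where "E = (\<Sum>k\<in>UNIV. e k)"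
  have E: "\<bar>pd i (pd k tht) x\<bar> \<le> E" for i k x
    using e member_le_sum[of k UNIV e] unfolding E_def by (meson finite UNIV_I order_trans)
  have E0: "E \<ge> 0" unfolding E_def using e by (intro sum_nonneg) auto
  have p1: "pd i (\<lambda>x. (tht x) ^ 4) = (\<lambda>x. 4 * (tht x) ^ 3 * pd i tht x)" for i
    using pd_smooth_power[OF tht(1), of i 3] by (simp add: numeral_eq_Suc)
  have p13: "pd i (\<lambda>x. (tht x) ^ 3) = (\<lambda>x. 3 * (tht x)\<^sup>2 * pd i tht x)" for i
    using pd_smooth_power[OF tht(1), of i 2] by (simp add: numeral_eq_Suc)
  have p2: "pd i (pd k (\<lambda>x. (tht x) ^ 4)) x = 12 * (tht x)\<^sup>2 * (pd i tht x * pd k tht x) + 4 * (tht x) ^ 3 * pd i (pd k tht) x" for i k x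
    unfolding p1
    by (subst pd_smooth_mult)
      (auto intro!: smooth_mult smooth_power smooth_fun_pd tht simp: pd_smooth_cmult[OF smooth_power[OF tht(1)]] p13)
  have t3: "(tht x) ^ 3 \<le> (tht x)\<^sup>2" for x using tht(4,5) by (intro power_decreasing) auto
  have t0: "0 \<le> (tht x) ^ 3" for x using tht(4) by simp
  define b where "b = 1 + 4 * c + 12 * c\<^sup>2 + 4 * E"
  show ?thesis
  proof (intro exI[of _ b] conjI allI)
    show "b \<ge> 1" unfolding b_def using c E0 by simp
    fix i k x
    have "\<bar>pd i (\<lambda>x. (tht x) ^ 4) x\<bar> = 4 * (tht x) ^ 3 * \<bar>pd i tht x\<bar>" unfolding p1 using t0 by (simp add: abs_mult)
    also have "\<dots> \<le> 4 * (tht x)\<^sup>2 * c" using c t3[of x] t0[of x] by (intro mult_mono) auto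
    also have "\<dots> = (4 * c) * (tht x)\<^sup>2" by simp
    also have "\<dots> \<le> b * (tht x)\<^sup>2" unfolding b_def using c E0 by (intro mult_right_mono) auto
    finally show "\<bar>pd i (\<lambda>x. (tht x) ^ 4) x\<bar> \<le> b * (tht x)\<^sup>2" .
    have "\<bar>pd i (pd k (\<lambda>x. (tht x) ^ 4)) x\<bar> \<le> 12 * (tht x)\<^sup>2 * (\<bar>pd i tht x\<bar> * \<bar>pd k tht x\<bar>) + 4 * (tht x) ^ 3 * \<bar>pd i (pd k tht) x\<bar>"
      unfolding p2 using t0[of x]
      by (intro order_trans[OF abs_triangle_ineq]) (simp add: abs_mult)
    also have "\<dots> \<le> 12 * (tht x)\<^sup>2 * (c * c) + 4 * (tht x)\<^sup>2 * E"
      using c t3[of x] t0[of x] E E0 by (intro add_mono mult_mono mult_nonneg_nonneg) auto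
    also have "\<dots> = (12 * c\<^sup>2 + 4 * E) * (tht x)\<^sup>2" by (simp add: algebra_simps power2_eq_square)
    also have "\<dots> \<le> b * (tht x)\<^sup>2" unfolding b_def using c by (intro mult_right_mono) auto
    finally show "\<bar>pd i (pd k (\<lambda>x. (tht x) ^ 4)) x\<bar> \<le> b * (tht x)\<^sup>2" .
  qed
qed


lemma integral_ind_le:
  fixes f :: "R3 \<Rightarrow> real"
  assumes "integrable lborel f" "\<And>x. 0 \<le> f x"  and c: "continuous_on UNIV f"
  shows "(\<integral>x. indicator (cball 0 R) x * f x \<partial>lborel) \<le> (\<integral>x. f (x::R3) \<partial>lborel)"
  by (rule integral_mono[OF integrable_ind_cont[OF c] assms(1)]) (use assms(2) in \<open>auto simp: indicator_def\<close>)

text \<open>For the mollified field the derivative on \<open>\<psi>\<close> is integrated by parts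
  and the energy bound applies, with \<open>t\<close> the Young weight between gradient and test
  function. Letting \<open>\<delta>\<close> tend to zero removes the commutator. As \<open>C\<close>
  does not depend on \<open>U\<close>, the estimate can be used for every rescaling.\<close>

lemma local_gradient_estimate:
  "\<exists>C\<ge>0. \<forall>U \<psi> i j \<mu> t. weak_NS U \<longrightarrow> smooth_fun \<psi> \<longrightarrow> (\<forall>x. norm x > 1 \<longrightarrow> \<psi> x = 0) \<longrightarrow> 0 < \<mu> \<longrightarrow> \<mu> \<le> 1 \<longrightarrow> 0 < t \<longrightarrow>
     \<bar>\<integral>x. U j x * pd i \<psi> x \<partial>lborel\<bar> \<le> (C * (mass2 U / \<mu> + \<mu> * mass4 U) / t + t * (\<integral>x. (\<psi> x)\<^sup>2 \<partial>lborel)) / 2"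
proof -
  obtain C0 where C0: "C0 \<ge> 0"
    and ker1: "\<And>\<delta> g j. \<delta> > 0 \<Longrightarrow> L2_supp 12 g \<Longrightarrow>
       (\<integral>x. indicator (cball 0 2) x * (conv (ker \<delta> j) g x)\<^sup>2 \<partial>lborel) \<le> C0 * (\<integral>x. (g x)\<^sup>2 \<partial>lborel)"
    and ker2: "\<And>\<delta> g i j. \<delta> > 0 \<Longrightarrow> L2_supp 12 g \<Longrightarrow>
       (\<integral>x. indicator (cball 0 2) x * (pd i (conv (ker \<delta> j) g) x)\<^sup>2 \<partial>lborel) \<le> C0 * (\<integral>x. (g x)\<^sup>2 \<partial>lborel)"
    using ker_estimates by blast
  obtain b where b: "b \<ge> 1" "\<And>i x. \<bar>pd i (\<lambda>x. (tht x) ^ 4) x\<bar> \<le> b * (tht x)\<^sup>2"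
    "\<And>i k x. \<bar>pd i (pd k (\<lambda>x. (tht x) ^ 4)) x\<bar> \<le> b * (tht x)\<^sup>2"
    using tht_power_bounds by blast
  \<comment> \<open>One constant for all quadratic quantities: 1 for \<open>u\<close>,
    \<open>4 * C0\<close> for the difference defining \<open>a\<close>, and the last summand for
    \<open>h\<close>.\<close>
  define K where "K = 1 + 4 * C0 + C0 * (3 * pd_chi_bound\<^sup>2)"
  have K: "K \<ge> 1" "4 * C0 \<le> K" "C0 * (3 * pd_chi_bound\<^sup>2) \<le> K" using C0 by (auto simp: K_def)
  define C where "C = 2400 * b\<^sup>2 * K"
  have C: "C \<ge> 0" using K by (simp add: C_def)
  show ?thesis
  proof (intro exI[of _ C] conjI allI impI C)
    fix U \<psi> i j and \<mu> t :: real
    assume NS: "weak_NS U" and \<psi>: "smooth_fun \<psi>" "\<forall>x. norm x > 1 \<longrightarrow> \<psi> x = 0" and \<mu>: "0 < \<mu>" "\<mu> \<le> 1" and t: "0 < t"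
    define Q2 where "Q2 = mass2 U"
    define Q4 where "Q4 = mass4 U"
    have Q: "Q2 \<ge> 0" "Q4 \<ge> 0" by (auto simp: Q2_def Q4_def mass_nonneg)
    define P where "P = (\<integral>x. (\<psi> x)\<^sup>2 \<partial>lborel)"
    define P' where "P' = (\<integral>x. (pd i \<psi> x)\<^sup>2 \<partial>lborel)"
    have P': "P' \<ge> 0" unfolding P'_def by (rule Bochner_Integration.integral_nonneg) simp
    have pd\<psi>: "pd i \<psi> x = 0" if "norm x > 1" for x by (rule pd_outside[of 1]) (use \<psi> that in auto)
    have io: "integrable lborel f" if "smooth_fun f" "\<And>x. norm x > 1 \<Longrightarrow> f x = 0" for f
      using integrable_continuous_bounded_support[OF smooth_fun_continuous[OF that(1)] that(2)] .
    have i\<psi>: "integrable lborel (\<lambda>x. (\<psi> x)\<^sup>2)" "integrable lborel (\<lambda>x. (pd i \<psi> x)\<^sup>2)"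
      by (rule io; use \<psi> pd\<psi> in \<open>auto intro: smooth_power smooth_fun_pd\<close>)+
    \<comment> \<open>The cut-off field \<open>g\<close> depends on \<open>U\<close> only; the
      instance with radius 1 makes it available before \<open>\<delta>\<close> is chosen.\<close>
    interpret M1: mollified_NS U 1 by unfold_locales (use NS in auto)
    have gg: "L4_supp 12 (mollified_NS.g U k)" for k by (rule M1.L4_g)
    have Ug: "(\<integral>x. U j x * pd i \<psi> x \<partial>lborel) = (\<integral>x. M1.g j x * pd i \<psi> x \<partial>lborel)"
    proof (rule Bochner_Integration.integral_cong)
      fix x
      show "U j x * pd i \<psi> x = M1.g j x * pd i \<psi> x"
        by (cases "norm x > 1") (simp_all add: pd\<psi> M1.g_local)
    qed simp
    \<comment> \<open>Everything that vanishes with \<open>\<delta>\<close> is collected in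
      \<open>\<epsilon>\<close>, whose coefficient depends on \<open>\<psi>\<close>,
      \<open>t\<close> and \<open>b\<close> only.\<close>
    have main: "\<bar>\<integral>x. U j x * pd i \<psi> x \<partial>lborel\<bar>
        \<le> (C * (Q2 / \<mu> + \<mu> * Q4) / t + t * P) / 2 + \<epsilon> * (2400 * b\<^sup>2 / t / 2 + (1 + P') / 2)" if \<epsilon>: "\<epsilon> > 0" for \<epsilon>
    proof -
      define Pd where "Pd k l d \<longleftrightarrow> d > 0 \<and> (\<forall>\<delta>. 0 < \<delta> \<and> \<delta> < d \<longrightarrow>
        (\<integral>x. (conv (moll \<delta>) (\<lambda>y. M1.g k y * M1.g l y) x - conv (moll \<delta>) (M1.g k) x * conv (moll \<delta>) (M1.g l) x)\<^sup>2 \<partial>lborel) \<le> \<epsilon>)" for k l d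
      have "\<exists>d. Pd k l d" for k l
        unfolding Pd_def by (rule moll_commutator_L2[OF gg gg _ \<epsilon>]) simp
      then obtain d where Pd: "\<And>k l. Pd k l (d k l)" by metis
      have d: "d k l > 0" "0 < \<delta> \<Longrightarrow> \<delta> < d k l \<Longrightarrow>
        (\<integral>x. (conv (moll \<delta>) (\<lambda>y. M1.g k y * M1.g l y) x - conv (moll \<delta>) (M1.g k) x * conv (moll \<delta>) (M1.g l) x)\<^sup>2 \<partial>lborel) \<le> \<epsilon>" for k l \<delta>
        using Pd[of k l] unfolding Pd_def by blast+
      \<comment> \<open>The square of \<open>\<epsilon>\<close> compensates for the division by
        \<open>\<epsilon>\<close> in the Young inequality of step 2 below.\<close>
      have "\<exists>d>0. \<forall>\<delta>. 0 < \<delta> \<and> \<delta> < d \<longrightarrow> (\<integral>x. (conv (moll \<delta>) (M1.g j) x - M1.g j x) ^ 2 \<partial>lborel) \<le> \<epsilon>\<^sup>2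
         \<and> integrable lborel (\<lambda>x. (conv (moll \<delta>) (M1.g j) x - M1.g j x) ^ 2)"
        by (rule moll_Lp_tendsto[OF _ L4_suppD(1)[OF gg]]) (use \<epsilon> in auto)
      then obtain d' where d': "d' > 0" "\<And>\<delta>. 0 < \<delta> \<Longrightarrow> \<delta> < d' \<Longrightarrow> (\<integral>x. (conv (moll \<delta>) (M1.g j) x - M1.g j x)\<^sup>2 \<partial>lborel) \<le> \<epsilon>\<^sup>2
         \<and> integrable lborel (\<lambda>x. (conv (moll \<delta>) (M1.g j) x - M1.g j x)\<^sup>2)"
        by blast
      \<comment> \<open>The smallest of the nine commutator thresholds.\<close>
      define D where "D = Min (range (\<lambda>(k, l). d k l))"
      have Dd: "D \<le> d k l" for k l unfolding D_def by (rule Min_le) (auto intro: image_eqI[of _ _ "(k, l)"])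
      have D0: "D > 0" unfolding D_def by (subst Min_gr_iff) (auto simp: d)
      define \<delta> where "\<delta> = min 1 (min (D / 2) (d' / 2))"
      have \<delta>: "0 < \<delta>" "\<delta> \<le> 1" "\<delta> < d'" using D0 d' by (auto simp: \<delta>_def)
      have \<delta>d: "\<delta> < d k l" for k l using Dd[of k l] D0 by (auto simp: \<delta>_def)
      interpret M: mollified_NS U \<delta> by unfold_locales (use NS \<delta> in auto)
      interpret S: stream_potential M.u M.a M.h M.F tht
        by unfold_locales
          (auto simp: M.smooth_u M.smooth_a M.smooth_h M.smooth_F tht M.div_u M.div_a M.a_def intro: M.curl_eq)
      have g2: "(\<integral>x. (M.g k x)\<^sup>2 \<partial>lborel) \<le> Q2" and g4: "(\<integral>x. (M.g k x) ^ 4 \<partial>lborel) \<le> Q4" for k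
        using M.g_bounds unfolding Q2_def Q4_def by auto
      have le_K: "x \<le> K * Q2" if "x \<le> c * Q2" "c \<le> K" for x c
        by (rule order_trans[OF that(1) mult_right_mono[OF that(2) Q(1)]])
      have kg1: "(\<integral>x. indicator (cball 0 2) x * (conv (ker \<delta> k) (M.g l) x)\<^sup>2 \<partial>lborel) \<le> C0 * Q2" for k l
        by (rule order_trans[OF ker1[OF \<delta>(1) M.L2_g] mult_left_mono[OF g2 C0]])
      have kg2: "(\<integral>x. indicator (cball 0 2) x * (pd p (conv (ker \<delta> k) (M.g l)) x)\<^sup>2 \<partial>lborel) \<le> C0 * Q2" for p k l
        by (rule order_trans[OF ker2[OF \<delta>(1) M.L2_g] mult_left_mono[OF g2 C0]])
      have diff: "(\<integral>x. indicator (cball 0 2) x * (f x - h x)\<^sup>2 \<partial>lborel) \<le> 4 * C0 * Q2"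
        if f: "smooth_fun f" "(\<integral>x. indicator (cball 0 2) x * (f x)\<^sup>2 \<partial>lborel) \<le> C0 * Q2"
          and h: "smooth_fun h" "(\<integral>x. indicator (cball 0 2) x * (h x)\<^sup>2 \<partial>lborel) \<le> C0 * Q2" for f h :: "R3 \<Rightarrow> real"
      proof -
        have ii: "integrable lborel (\<lambda>x. indicator (cball 0 2) x * (q x)\<^sup>2)" if "smooth_fun q" for q :: "R3 \<Rightarrow> real"
          by (rule integrable_ind_cont[OF smooth_fun_continuous[OF smooth_power[OF that]]])
        have "(\<integral>x. indicator (cball 0 2) x * (f x - h x)\<^sup>2 \<partial>lborel)
            \<le> (\<integral>x. 2 * (indicator (cball 0 2) x * (f x)\<^sup>2) + 2 * (indicator (cball 0 2) x * (h x)\<^sup>2) \<partial>lborel)"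
        proof (rule integral_mono)
          show "integrable lborel (\<lambda>x. indicator (cball 0 2) x * (f x - h x)\<^sup>2)"
            by (rule ii[OF smooth_diff[OF f(1) h(1)]])
          show "integrable lborel (\<lambda>x. 2 * (indicator (cball 0 2) x * (f x)\<^sup>2) + 2 * (indicator (cball 0 2) x * (h x)\<^sup>2))"
            using ii[OF f(1)] ii[OF h(1)] by simp
          show "indicator (cball 0 2) x * (f x - h x)\<^sup>2 \<le> 2 * (indicator (cball 0 2) x * (f x)\<^sup>2) + 2 * (indicator (cball 0 2) x * (h x)\<^sup>2)" for x
            using sum_squares_bound[of "f x" "- h x"] by (cases "norm x \<le> 2") (auto simp: power2_diff)
        qed
        also have "\<dots> = 2 * (\<integral>x. indicator (cball 0 2) x * (f x)\<^sup>2 \<partial>lborel) + 2 * (\<integral>x. indicator (cball 0 2) x * (h x)\<^sup>2 \<partial>lborel)"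
          using ii[OF f(1)] ii[OF h(1)] by simp
        finally show ?thesis using f(2) h(2) by simp
      qed
      have X: "(\<integral>x. (\<Sum>j\<in>UNIV. \<Sum>i\<in>UNIV. S.\<phi> x * (pd i (M.u j) x)\<^sup>2) \<partial>lborel) \<le> 2400 * b\<^sup>2 * (\<epsilon> + K * Q2 / \<mu> + \<mu> * Q4)"
      proof (rule S.energy_bound[OF b(1) _ _ \<mu>])
        show "\<bar>pd i S.\<phi> x\<bar> \<le> b * (tht x)\<^sup>2" "\<bar>pd i (pd k S.\<phi>) x\<bar> \<le> b * (tht x)\<^sup>2" for i k x
          unfolding S.\<phi>_def[abs_def] by (rule b(2), rule b(3))
        show "(\<integral>x. indicator (cball 0 2) x * (M.u k x)\<^sup>2 \<partial>lborel) \<le> K * Q2" for k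
        proof (rule le_K[of _ 1])
          have "(\<integral>x. indicator (cball 0 2) x * (M.u k x)\<^sup>2 \<partial>lborel) \<le> (\<integral>x. (M.u k x)\<^sup>2 \<partial>lborel)"
            by (rule integral_ind_le) (auto intro: smooth_fun_continuous smooth_power M.smooth_u conv_moll_L2(1)[OF M.L2_g \<delta>(1), folded M.u_def])
          also have "\<dots> \<le> Q2" using conv_moll_L2(2)[OF M.L2_g \<delta>(1), of k] g2[of k] by (simp add: M.u_def)
          finally show "(\<integral>x. indicator (cball 0 2) x * (M.u k x)\<^sup>2 \<partial>lborel) \<le> 1 * Q2" by simp
        qed (rule K)
        show "(\<integral>x. indicator (cball 0 2) x * (M.a k l x)\<^sup>2 \<partial>lborel) \<le> K * Q2" for k l
          unfolding M.a_def by (rule le_K[OF diff K(2)]) (rule M.smooth_kg kg1)+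
        show "(\<integral>x. indicator (cball 0 2) x * (pd p (M.a k l) x)\<^sup>2 \<partial>lborel) \<le> K * Q2" for p k l
          unfolding M.a_def[abs_def] pd_smooth_diff[OF M.smooth_kg M.smooth_kg]
          by (rule le_K[OF diff K(2)]) (rule smooth_fun_pd M.smooth_kg kg2)+
        have mm: "C0 * (\<integral>x. (M.m x)\<^sup>2 \<partial>lborel) \<le> C0 * (3 * pd_chi_bound\<^sup>2) * Q2"
          using mult_left_mono[OF M.m_bound C0] by (simp add: Q2_def mult.assoc)
        show "(\<integral>x. indicator (cball 0 2) x * (M.h k x)\<^sup>2 \<partial>lborel) \<le> K * Q2" for k
          unfolding M.h_def by (rule le_K[OF order_trans[OF ker1[OF \<delta>(1) M.L2_m] mm] K(3)])
        show "(\<integral>x. indicator (cball 0 2) x * (pd p (M.h k) x)\<^sup>2 \<partial>lborel) \<le> K * Q2" for p k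
          unfolding M.h_def by (rule le_K[OF order_trans[OF ker2[OF \<delta>(1) M.L2_m] mm] K(3)])
        show "(\<integral>x. indicator (cball 0 2) x * (M.u k x) ^ 4 \<partial>lborel) \<le> Q4" for k
        proof -
          have "(\<integral>x. indicator (cball 0 2) x * (M.u k x) ^ 4 \<partial>lborel) \<le> (\<integral>x. (M.u k x) ^ 4 \<partial>lborel)"
            by (rule integral_ind_le) (auto intro: smooth_fun_continuous smooth_power M.smooth_u conv_moll_L4(1)[OF L4_suppD(1,2)[OF M.L4_g] \<delta>(1), folded M.u_def])
          also have "\<dots> \<le> Q4" using conv_moll_L4(2)[OF L4_suppD(1,2)[OF M.L4_g] \<delta>(1), of k] g4[of k] by (simp add: M.u_def)
          finally show ?thesis .
        qed
        show "(\<integral>x. indicator (cball 0 2) x * (M.F k l x)\<^sup>2 \<partial>lborel) \<le> Q4" for k l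
        proof -
          have "(\<integral>x. indicator (cball 0 2) x * (M.F k l x)\<^sup>2 \<partial>lborel) \<le> (\<integral>x. (M.F k l x)\<^sup>2 \<partial>lborel)"
            by (rule integral_ind_le) (auto intro: smooth_fun_continuous smooth_power M.smooth_F conv_moll_L2(1)[OF M.L2_gg \<delta>(1), folded M.F_def])
          also have "\<dots> \<le> (\<integral>x. (M.g k x * M.g l x)\<^sup>2 \<partial>lborel)" using conv_moll_L2(2)[OF M.L2_gg \<delta>(1), of k l] by (simp add: M.F_def)
          also have "\<dots> \<le> (\<integral>x. (M.g k x) ^ 4 / 2 + (M.g l x) ^ 4 / 2 \<partial>lborel)"
          proof (rule integral_mono[OF L2_suppD(2)[OF M.L2_gg]])
            show "integrable lborel (\<lambda>x. (M.g k x) ^ 4 / 2 + (M.g l x) ^ 4 / 2)" using L4_suppD(4)[OF M.L4_g] by simp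
            show "(M.g k x * M.g l x)\<^sup>2 \<le> (M.g k x) ^ 4 / 2 + (M.g l x) ^ 4 / 2" for x
              using sum_squares_bound[of "(M.g k x)\<^sup>2" "(M.g l x)\<^sup>2"] by (simp add: power_mult_distrib)
          qed
          also have "\<dots> = (\<integral>x. (M.g k x) ^ 4 \<partial>lborel) / 2 + (\<integral>x. (M.g l x) ^ 4 \<partial>lborel) / 2"
            using L4_suppD(4)[OF M.L4_g] by simp
          also have "\<dots> \<le> Q4" using g4[of k] g4[of l] by simp
          finally show ?thesis .
        qed
        show "(\<integral>x. indicator (cball 0 2) x * (M.F k l x - M.u k x * M.u l x)\<^sup>2 \<partial>lborel) \<le> \<epsilon>" for k l
        proof -
          have sm: "smooth_fun (\<lambda>x. (M.F k l x - M.u k x * M.u l x)\<^sup>2)"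
            by (intro smooth_power smooth_diff smooth_mult M.smooth_F M.smooth_u)
          have "(\<integral>x. indicator (cball 0 2) x * (M.F k l x - M.u k x * M.u l x)\<^sup>2 \<partial>lborel) \<le> (\<integral>x. (M.F k l x - M.u k x * M.u l x)\<^sup>2 \<partial>lborel)"
          proof (rule integral_ind_le[OF _ _ smooth_fun_continuous[OF sm]])
            show "integrable lborel (\<lambda>x. (M.F k l x - M.u k x * M.u l x)\<^sup>2)"
            proof (rule integrable_continuous_bounded_support[OF smooth_fun_continuous[OF sm], of 13])
              fix x :: R3 assume x: "norm x > 13"
              have "M.F k l x = 0" unfolding M.F_def
                by (rule conv_moll_outside[OF \<delta>(1) L2_suppD(3)[OF M.L2_gg]]) (use x \<delta> in auto)
              moreover have "M.u k x = 0" unfolding M.u_def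
                by (rule conv_moll_outside[OF \<delta>(1) L2_suppD(3)[OF M.L2_g]]) (use x \<delta> in auto)
              ultimately show "(M.F k l x - M.u k x * M.u l x)\<^sup>2 = 0" by simp
            qed
          qed simp
          also have "\<dots> \<le> \<epsilon>" using d(2)[OF \<delta>(1) \<delta>d] by (simp add: M.F_def M.u_def)
          finally show ?thesis .
        qed
      qed
      define X where "X = (\<integral>x. (\<Sum>j\<in>UNIV. \<Sum>i\<in>UNIV. S.\<phi> x * (pd i (M.u j) x)\<^sup>2) \<partial>lborel)"
      have X1: "(\<integral>x. indicator (cball 0 1) x * (pd i (M.u j) x)\<^sup>2 \<partial>lborel) \<le> X"
        unfolding X_def
      proof (rule integral_mono)
        show "integrable lborel (\<lambda>x. indicator (cball 0 1) x * (pd i (M.u j) x)\<^sup>2)"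
          by (rule integrable_ind_cont) (intro smooth_fun_continuous smooth_power smooth_fun_pd M.smooth_u)
        show "integrable lborel (\<lambda>x. \<Sum>j\<in>UNIV. \<Sum>i\<in>UNIV. S.\<phi> x * (pd i (M.u j) x)\<^sup>2)"
          by (rule S.integrable_supp) (auto intro!: S.smooths simp: S.\<phi>_supp)
        fix x
        have \<phi>0: "S.\<phi> y \<ge> 0" for y using tht(4)[of y] by (simp add: S.\<phi>_def)
        have "indicator (cball 0 1) x * (pd i (M.u j) x)\<^sup>2 \<le> S.\<phi> x * (pd i (M.u j) x)\<^sup>2"
          using \<phi>0[of x] tht(3)[of x] by (cases "norm x \<le> 1") (auto simp: S.\<phi>_def)
        also have "\<dots> \<le> (\<Sum>i\<in>UNIV. S.\<phi> x * (pd i (M.u j) x)\<^sup>2)"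
          using \<phi>0 by (intro member_le_sum[of i UNIV "\<lambda>i. S.\<phi> x * (pd i (M.u j) x)\<^sup>2"]) auto
        also have "\<dots> \<le> (\<Sum>j\<in>UNIV. \<Sum>i\<in>UNIV. S.\<phi> x * (pd i (M.u j) x)\<^sup>2)"
          using \<phi>0 by (intro member_le_sum[of j UNIV "\<lambda>j. \<Sum>i\<in>UNIV. S.\<phi> x * (pd i (M.u j) x)\<^sup>2"]) (auto intro!: sum_nonneg)
        finally show "indicator (cball 0 1) x * (pd i (M.u j) x)\<^sup>2 \<le> (\<Sum>j\<in>UNIV. \<Sum>i\<in>UNIV. S.\<phi> x * (pd i (M.u j) x)\<^sup>2)" .
      qed
      have young: "\<bar>p * q\<bar> \<le> p\<^sup>2 / (2 * s) + s / 2 * q\<^sup>2" if "s > 0" for p q s :: real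
        using weighted_young[OF that, of "\<bar>p\<bar>" "\<bar>q\<bar>"] by (simp add: abs_mult add_divide_distrib)
      have 1: "\<bar>\<integral>x. M.u j x * pd i \<psi> x \<partial>lborel\<bar> \<le> X / (2 * t) + t / 2 * P"
      proof -
        have "(\<integral>x. M.u j x * pd i \<psi> x \<partial>lborel) = - (\<integral>x. pd i (M.u j) x * \<psi> x \<partial>lborel)"
          using integral_by_parts[OF M.smooth_u \<psi>(1), of 1 j i] \<psi>(2) by simp
        then have "\<bar>\<integral>x. M.u j x * pd i \<psi> x \<partial>lborel\<bar> \<le> (\<integral>x. \<bar>pd i (M.u j) x * \<psi> x\<bar> \<partial>lborel)"
          using integral_abs_bound[of lborel "\<lambda>x. pd i (M.u j) x * \<psi> x"] by simp
        also have "\<dots> \<le> (\<integral>x. (indicator (cball 0 1) x * (pd i (M.u j) x)\<^sup>2) / (2 * t) + t / 2 * (\<psi> x)\<^sup>2 \<partial>lborel)"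
        proof (rule integral_mono)
          show "integrable lborel (\<lambda>x. \<bar>pd i (M.u j) x * \<psi> x\<bar>)"
            by (rule integrable_abs, rule io) (use \<psi> in \<open>auto intro: smooth_mult smooth_fun_pd M.smooth_u\<close>)
          show "integrable lborel (\<lambda>x. (indicator (cball 0 1) x * (pd i (M.u j) x)\<^sup>2) / (2 * t) + t / 2 * (\<psi> x)\<^sup>2)"
            using i\<psi>(1) integrable_ind_cont[OF smooth_fun_continuous[OF smooth_power[OF smooth_fun_pd[OF M.smooth_u]]], of 1 i j 2] by simp
          show "\<bar>pd i (M.u j) x * \<psi> x\<bar> \<le> (indicator (cball 0 1) x * (pd i (M.u j) x)\<^sup>2) / (2 * t) + t / 2 * (\<psi> x)\<^sup>2" for x
            using young[OF t, of "pd i (M.u j) x" "\<psi> x"] \<psi>(2) by (cases "norm x \<le> 1") auto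
        qed
        also have "\<dots> = (\<integral>x. indicator (cball 0 1) x * (pd i (M.u j) x)\<^sup>2 \<partial>lborel) / (2 * t) + t / 2 * P"
          using i\<psi>(1) integrable_ind_cont[OF smooth_fun_continuous[OF smooth_power[OF smooth_fun_pd[OF M.smooth_u]]], of 1 i j 2]
          by (simp add: P_def)
        also have "\<dots> \<le> X / (2 * t) + t / 2 * P" using X1 t by (intro add_mono divide_right_mono) auto
        finally show ?thesis .
      qed
      note dd = d'(2)[OF \<delta>(1,3)]
      have ig: "integrable lborel (\<lambda>x. M.g j x * pd i \<psi> x)" and iu: "integrable lborel (\<lambda>x. M.u j x * pd i \<psi> x)"
      proof -
        show "integrable lborel (\<lambda>x. M.u j x * pd i \<psi> x)"
          by (rule io) (auto intro!: smooth_mult smooth_fun_pd \<psi> M.smooth_u simp: pd\<psi>)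
        show "integrable lborel (\<lambda>x. M.g j x * pd i \<psi> x)"
        proof (rule Bochner_Integration.integrable_bound[OF Bochner_Integration.integrable_add[OF L4_suppD(5)[OF M.L4_g[of j]] i\<psi>(2)]])
          show "(\<lambda>x. M.g j x * pd i \<psi> x) \<in> borel_measurable lborel"
            using L4_suppD(3)[OF M.L4_g[of j]] smooth_fun_measurable[OF smooth_fun_pd[OF \<psi>(1)]] by simp
          show "AE x in lborel. norm (M.g j x * pd i \<psi> x) \<le> norm ((M.g j x)\<^sup>2 + (pd i \<psi> x)\<^sup>2)"
          proof (rule AE_I2)
            fix x
            have "\<bar>M.g j x * pd i \<psi> x\<bar> \<le> (M.g j x)\<^sup>2 + (pd i \<psi> x)\<^sup>2"
              using young[of 1 "M.g j x" "pd i \<psi> x"] zero_le_power2[of "M.g j x"] zero_le_power2[of "pd i \<psi> x"] by linarith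
            then show "norm (M.g j x * pd i \<psi> x) \<le> norm ((M.g j x)\<^sup>2 + (pd i \<psi> x)\<^sup>2)" by simp
          qed
        qed
      qed
      have 2: "\<bar>(\<integral>x. M.g j x * pd i \<psi> x \<partial>lborel) - (\<integral>x. M.u j x * pd i \<psi> x \<partial>lborel)\<bar> \<le> \<epsilon> * ((1 + P') / 2)"
      proof -
        have "(\<integral>x. M.g j x * pd i \<psi> x \<partial>lborel) - (\<integral>x. M.u j x * pd i \<psi> x \<partial>lborel) = - (\<integral>x. (M.u j x - M.g j x) * pd i \<psi> x \<partial>lborel)"
          using ig iu by (simp add: left_diff_distrib)
        then have "\<bar>(\<integral>x. M.g j x * pd i \<psi> x \<partial>lborel) - (\<integral>x. M.u j x * pd i \<psi> x \<partial>lborel)\<bar> \<le> (\<integral>x. \<bar>(M.u j x - M.g j x) * pd i \<psi> x\<bar> \<partial>lborel)"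
          using integral_abs_bound[of lborel "\<lambda>x. (M.u j x - M.g j x) * pd i \<psi> x"] by simp
        also have "\<dots> \<le> (\<integral>x. (M.u j x - M.g j x)\<^sup>2 / (2 * \<epsilon>) + \<epsilon> / 2 * (pd i \<psi> x)\<^sup>2 \<partial>lborel)"
        proof (rule integral_mono)
          show "integrable lborel (\<lambda>x. \<bar>(M.u j x - M.g j x) * pd i \<psi> x\<bar>)" using ig iu by (simp add: left_diff_distrib)
          show "integrable lborel (\<lambda>x. (M.u j x - M.g j x)\<^sup>2 / (2 * \<epsilon>) + \<epsilon> / 2 * (pd i \<psi> x)\<^sup>2)"
            using dd i\<psi>(2) by (simp add: M.u_def)
        qed (rule young[OF \<epsilon>])
        also have "\<dots> = (\<integral>x. (M.u j x - M.g j x)\<^sup>2 \<partial>lborel) / (2 * \<epsilon>) + \<epsilon> / 2 * P'"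
          using dd i\<psi>(2) by (simp add: M.u_def P'_def)
        also have "\<dots> \<le> \<epsilon>\<^sup>2 / (2 * \<epsilon>) + \<epsilon> / 2 * P'" using dd \<epsilon> by (intro add_mono divide_right_mono) (auto simp: M.u_def)
        also have "\<dots> = \<epsilon> * ((1 + P') / 2)" using \<epsilon> by (simp add: power2_eq_square field_simps)
        finally show ?thesis .
      qed
      have "X / (2 * t) \<le> 2400 * b\<^sup>2 * (\<epsilon> + K * Q2 / \<mu> + \<mu> * Q4) / (2 * t)"
        using X t unfolding X_def by (intro divide_right_mono) auto
      also have "\<dots> \<le> 2400 * b\<^sup>2 * (\<epsilon> + K * Q2 / \<mu> + K * (\<mu> * Q4)) / (2 * t)"
        using t Q \<mu> K(1) mult_right_mono[of 1 K "\<mu> * Q4"] by (intro divide_right_mono mult_left_mono add_mono order_refl) auto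
      also have "\<dots> = C * (Q2 / \<mu> + \<mu> * Q4) / t / 2 + \<epsilon> * (2400 * b\<^sup>2 / t / 2)"
        using t \<mu> by (simp add: C_def field_simps)
      finally have 3: "X / (2 * t) \<le> C * (Q2 / \<mu> + \<mu> * Q4) / t / 2 + \<epsilon> * (2400 * b\<^sup>2 / t / 2)" .
      have "\<bar>\<integral>x. U j x * pd i \<psi> x \<partial>lborel\<bar> \<le> (X / (2 * t) + t / 2 * P) + \<epsilon> * ((1 + P') / 2)"
        using 1 2 unfolding Ug by linarith
      also have "\<dots> \<le> (C * (Q2 / \<mu> + \<mu> * Q4) / t / 2 + \<epsilon> * (2400 * b\<^sup>2 / t / 2) + t / 2 * P) + \<epsilon> * ((1 + P') / 2)"
        using 3 by simp
      finally show ?thesis by (simp add: add_divide_distrib distrib_left)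
    qed
    have "\<bar>\<integral>x. U j x * pd i \<psi> x \<partial>lborel\<bar> \<le> (C * (Q2 / \<mu> + \<mu> * Q4) / t + t * P) / 2"
    proof (rule field_le_epsilon)
      fix e :: real assume e: "e > 0"
      define L where "L = 2400 * b\<^sup>2 / t / 2 + (1 + P') / 2"
      have L: "L > 0" unfolding L_def using t P' by (intro add_nonneg_pos) auto
      show "\<bar>\<integral>x. U j x * pd i \<psi> x \<partial>lborel\<bar> \<le> (C * (Q2 / \<mu> + \<mu> * Q4) / t + t * P) / 2 + e"
        using main[of "e / L", folded L_def] L e by simp
    qed
    then show "\<bar>\<integral>x. U j x * pd i \<psi> x \<partial>lborel\<bar> \<le> (C * (mass2 U / \<mu> + \<mu> * mass4 U) / t + t * (\<integral>x. (\<psi> x)\<^sup>2 \<partial>lborel)) / 2"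
      by (simp add: Q2_def Q4_def P_def)
  qed
qed

section \<open>Rescaling\<close>

definition rescale :: "real \<Rightarrow> (3 \<Rightarrow> R3 \<Rightarrow> real) \<Rightarrow> 3 \<Rightarrow> R3 \<Rightarrow> real" where
  "rescale l U j x = l * U j (l *\<^sub>R x)"

lemma integral_scale:
  assumes "(f :: R3 \<Rightarrow> real) \<in> borel_measurable borel" "l > 0"
  shows "(\<integral>x. f (l *\<^sub>R x) \<partial>lborel) = (\<integral>x. f x \<partial>lborel) / l ^ 3"
  using integral_affine[OF assms(1), of l 0] assms(2) by simp

lemma pd_dilate: "smooth_fun f \<Longrightarrow> pd i (\<lambda>x. f (c *\<^sub>R x)) = (\<lambda>x. c * pd i f (c *\<^sub>R x))"
  using pd_affine[of f i 1 c 0] by simp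

lemma smooth_dilate: "smooth_fun f \<Longrightarrow> smooth_fun (\<lambda>x. f (c *\<^sub>R x))"
  using smooth_affine[of f 1 c 0] by simp

lemma test_fun_smooth: "test_fun f \<Longrightarrow> smooth_fun f" by (simp add: test_fun_def)

lemma test_dilate:
  assumes "test_fun f" "c > 0" shows "test_fun (\<lambda>x. f (c *\<^sub>R x))"
proof -
  obtain r where r: "r > 0" "\<And>x. norm x > r \<Longrightarrow> f x = 0" using test_fun_bounded_support[OF assms(1)] by blast
  show ?thesis
  proof (rule test_funI[OF smooth_dilate[OF test_fun_smooth[OF assms(1)]]])
    show "f (c *\<^sub>R x) = 0" if "norm x > r / c" for x
      by (rule r(2)) (use that assms(2) in \<open>simp add: field_simps\<close>)
  qed
qed

lemma weak_NS_meas: "weak_NS U \<Longrightarrow> U j \<in> borel_measurable borel" unfolding weak_NS_def by auto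

lemma mass_rescale:
  assumes U: "U j \<in> borel_measurable borel" and l: "l > 0"
  shows "(\<integral>x. indicator (cball 0 R) x * (rescale l U j x) ^ 4 \<partial>lborel) = l * (\<integral>x. indicator (cball 0 (l * R)) x * (U j x) ^ 4 \<partial>lborel)"
    and "integrable lborel (\<lambda>x. indicator (cball 0 (l * R)) x * (U j x) ^ 4) \<Longrightarrow> integrable lborel (\<lambda>x. indicator (cball 0 R) x * (rescale l U j x) ^ 4)"
proof -
  define f where "f x = indicator (cball 0 (l * R)) x * (U j x) ^ 4" for x
  have [measurable]: "f \<in> borel_measurable borel" unfolding f_def
    by (intro borel_measurable_times borel_measurable_indicator borel_measurable_power U) simp
  have e: "indicator (cball 0 R) x * (rescale l U j x) ^ 4 = l ^ 4 * f (l *\<^sub>R x)" for x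
    using l by (auto simp: f_def rescale_def indicator_def power_mult_distrib)
  show "(\<integral>x. indicator (cball 0 R) x * (rescale l U j x) ^ 4 \<partial>lborel) = l * (\<integral>x. indicator (cball 0 (l * R)) x * (U j x) ^ 4 \<partial>lborel)"
  proof -
    have "(\<lambda>x. indicator (cball 0 (l * R)) x * (U j x) ^ 4) = f" by (simp add: fun_eq_iff f_def)
    then show ?thesis
      unfolding e using integral_scale[of f l] l by (simp add: power4_eq_xxxx power3_eq_cube)
  qed
  assume "integrable lborel (\<lambda>x. indicator (cball 0 (l * R)) x * (U j x) ^ 4)"
  then have "integrable lborel f" unfolding f_def .
  then have "integrable lborel (\<lambda>x. f (l *\<^sub>R x))" using integrable_affine[of f l 0] l by simp
  then show "integrable lborel (\<lambda>x. indicator (cball 0 R) x * (rescale l U j x) ^ 4)" unfolding e by simp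
qed

text \<open>The viscous term gains \<open>l\<close> from the field and \<open>l^3\<close> from three
  derivatives, the convective one \<open>l^2\<close> from each source, and the change of variables
  divides both by \<open>l^3\<close>. Both parts of \<open>momentum\<close> thus scale by the same
  factor \<open>l\<close>.\<close>

lemma weak_NS_rescale:
  assumes NS: "weak_NS U" and l: "l > 0" shows "weak_NS (rescale l U)"
  unfolding weak_NS_def
proof (intro conjI allI impI)
  note Um[measurable] = weak_NS_meas[OF NS]
  show "rescale l U j \<in> borel_measurable borel" for j unfolding rescale_def[abs_def] by measurable
  show "integrable lborel (\<lambda>x. indicator (cball 0 R) x * (rescale l U j x) ^ 4)" for j R
    by (rule mass_rescale(2)[OF Um l]) (use NS in \<open>simp add: weak_NS_def\<close>)
  fix \<psi> :: "R3 \<Rightarrow> real" assume \<psi>: "test_fun \<psi>"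
  define \<zeta> where "\<zeta> x = \<psi> ((1 / l) *\<^sub>R x)" for x
  have t\<zeta>: "test_fun \<zeta>" unfolding \<zeta>_def[abs_def] using l by (intro test_dilate \<psi>) auto
  note s\<zeta> = test_fun_smooth[OF t\<zeta>]
  have \<psi>\<zeta>: "\<psi> = (\<lambda>x. \<zeta> (l *\<^sub>R x))" using l by (auto simp: \<zeta>_def fun_eq_iff)
  note sm = smooth_fun_pd s\<zeta> smooth_dilate smooth_cmult
  have p1: "pd i \<psi> = (\<lambda>x. l * pd i \<zeta> (l *\<^sub>R x))" for i unfolding \<psi>\<zeta> by (rule pd_dilate[OF s\<zeta>])
  have p2: "pd i (pd k \<psi>) = (\<lambda>x. l\<^sup>2 * pd i (pd k \<zeta>) (l *\<^sub>R x))" for i k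
    unfolding p1 by (subst pd_smooth_cmult) (auto intro!: sm simp: pd_dilate[OF smooth_fun_pd[OF s\<zeta>]] power2_eq_square)
  have p3: "pd m (pd i (pd k \<psi>)) = (\<lambda>x. l ^ 3 * pd m (pd i (pd k \<zeta>)) (l *\<^sub>R x))" for m i k
    unfolding p2 by (subst pd_smooth_cmult) (auto intro!: sm simp: pd_dilate[OF smooth_fun_pd[OF smooth_fun_pd[OF s\<zeta>]]] power2_eq_square power3_eq_cube)
  have [measurable]: "pd i \<zeta> \<in> borel_measurable borel" "pd i (pd k \<zeta>) \<in> borel_measurable borel" "pd m (pd i (pd k \<zeta>)) \<in> borel_measurable borel" for i k m
    by (intro smooth_fun_measurable sm)+
  show "(\<Sum>i\<in>UNIV. \<integral>x. rescale l U i x * pd i \<psi> x \<partial>lborel) = 0"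
  proof -
    have "(\<integral>x. rescale l U i x * pd i \<psi> x \<partial>lborel) = l\<^sup>2 / l ^ 3 * (\<integral>x. U i x * pd i \<zeta> x \<partial>lborel)" for i
    proof -
      have "(\<integral>x. rescale l U i x * pd i \<psi> x \<partial>lborel) = (\<integral>x. l\<^sup>2 * (U i (l *\<^sub>R x) * pd i \<zeta> (l *\<^sub>R x)) \<partial>lborel)"
        by (rule Bochner_Integration.integral_cong) (auto simp: rescale_def p1 power2_eq_square)
      also have "\<dots> = l\<^sup>2 * ((\<integral>x. U i x * pd i \<zeta> x \<partial>lborel) / l ^ 3)"
        using integral_scale[of "\<lambda>x. U i x * pd i \<zeta> x" l] l by simp
      finally show ?thesis by simp
    qed
    then have "(\<Sum>i\<in>UNIV. \<integral>x. rescale l U i x * pd i \<psi> x \<partial>lborel) = l\<^sup>2 / l ^ 3 * (\<Sum>i\<in>UNIV. \<integral>x. U i x * pd i \<zeta> x \<partial>lborel)"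
      by (simp add: sum_distrib_left)
    also have "(\<Sum>i\<in>UNIV. \<integral>x. U i x * pd i \<zeta> x \<partial>lborel) = 0" using NS t\<zeta> unfolding weak_NS_def by blast
    finally show ?thesis by simp
  qed
  have mom: "momentum (rescale l U) j (pd k \<psi>) = l * momentum U j (pd k \<zeta>)" for j k
  proof -
    have "(\<integral>x. rescale l U j x * laplacian (pd k \<psi>) x \<partial>lborel) = (\<integral>x. l ^ 4 * (U j (l *\<^sub>R x) * laplacian (pd k \<zeta>) (l *\<^sub>R x)) \<partial>lborel)"
      by (rule Bochner_Integration.integral_cong) (auto simp: rescale_def laplacian_def p3 sum_distrib_left power4_eq_xxxx power3_eq_cube mult_ac)
    also have "\<dots> = l ^ 4 * ((\<integral>x. U j x * laplacian (pd k \<zeta>) x \<partial>lborel) / l ^ 3)"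
    proof -
      have "(\<lambda>x. U j x * laplacian (pd k \<zeta>) x) \<in> borel_measurable borel" unfolding laplacian_def by simp
      from integral_scale[OF this l] show ?thesis by simp
    qed
    finally have 1: "(\<integral>x. rescale l U j x * laplacian (pd k \<psi>) x \<partial>lborel) = l * (\<integral>x. U j x * laplacian (pd k \<zeta>) x \<partial>lborel)"
      using l by (simp add: power4_eq_xxxx power3_eq_cube)
    have 2: "(\<integral>x. rescale l U i x * rescale l U j x * pd i (pd k \<psi>) x \<partial>lborel) = l * (\<integral>x. U i x * U j x * pd i (pd k \<zeta>) x \<partial>lborel)" for i
    proof -
      have "(\<integral>x. rescale l U i x * rescale l U j x * pd i (pd k \<psi>) x \<partial>lborel)
         = (\<integral>x. l ^ 4 * (U i (l *\<^sub>R x) * U j (l *\<^sub>R x) * pd i (pd k \<zeta>) (l *\<^sub>R x)) \<partial>lborel)"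
        by (rule Bochner_Integration.integral_cong) (auto simp: rescale_def p2 power4_eq_xxxx power2_eq_square)
      also have "\<dots> = l ^ 4 * ((\<integral>x. U i x * U j x * pd i (pd k \<zeta>) x \<partial>lborel) / l ^ 3)"
        using integral_scale[of "\<lambda>x. U i x * U j x * pd i (pd k \<zeta>) x" l] l by simp
      finally show ?thesis using l by (simp add: power4_eq_xxxx power3_eq_cube)
    qed
    show ?thesis unfolding momentum_def 1 2 by (simp add: distrib_left sum_distrib_left)
  qed
  show "momentum (rescale l U) j (pd k \<psi>) = momentum (rescale l U) k (pd j \<psi>)" for j k
    unfolding mom using NS t\<zeta> unfolding weak_NS_def by simp
qed

section \<open>Vanishing of the weak gradient and of the solution\<close>

text \<open>Growth \<open>o(R^(1/3))\<close> of the fourth-power mass, with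
  \<open>R = 12 * n ^ 3\<close> so that no cube roots appear; 12 is the radius in
  \<open>mass4\<close>.\<close>

definition slow_growth :: "(3 \<Rightarrow> R3 \<Rightarrow> real) \<Rightarrow> bool" where
  "slow_growth U \<longleftrightarrow> (\<forall>\<epsilon>>0. \<exists>L. \<forall>n\<ge>L. \<forall>j. (\<integral>x. indicator (cball 0 (12 * n ^ 3)) x * (U j x) ^ 4 \<partial>lborel) \<le> \<epsilon> * n)"

text \<open>Young's inequality against the constant 1 on the ball, where \<open>\<nu>\<close> will
  be of the order of the square root of the bound on \<open>mass4\<close>.\<close>

lemma mass2_le:
  assumes "weak_NS U" "\<nu> > 0"
  shows "mass2 U \<le> 3 * measure lborel (cball (0::R3) 12) * \<nu> / 2 + mass4 U / (2 * \<nu>)"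
proof -
  have i4: "integrable lborel (\<lambda>x. indicator (cball 0 12) x * (U j x) ^ 4)" for j using assms unfolding weak_NS_def by auto
  have i0: "integrable lborel (\<lambda>x. \<nu> / 2 * indicator (cball (0::R3) 12) x)"
    using emeasure_lborel_cball_finite[of "0::R3" 12] by (intro integrable_mult_right integrable_real_indicator) auto
  have "(\<integral>x. indicator (cball 0 12) x * (U j x)\<^sup>2 \<partial>lborel) \<le> \<nu> / 2 * measure lborel (cball (0::R3) 12)
      + (\<integral>x. indicator (cball 0 12) x * (U j x) ^ 4 \<partial>lborel) / (2 * \<nu>)" for j
  proof -
    have pw: "indicator (cball 0 12) x * (U j x)\<^sup>2 \<le> \<nu> / 2 * indicator (cball 0 12) x + indicator (cball 0 12) x * (U j x) ^ 4 / (2 * \<nu>)" for x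
      using weighted_young[OF assms(2), of "(U j x)\<^sup>2" 1] by (auto simp: indicator_def add_divide_distrib)
    have i2: "integrable lborel (\<lambda>x. \<nu> / 2 * indicator (cball 0 12) x + indicator (cball 0 12) x * (U j x) ^ 4 / (2 * \<nu>))"
      using i0 i4[of j] by simp
    have "(\<integral>x. indicator (cball 0 12) x * (U j x)\<^sup>2 \<partial>lborel) \<le> (\<integral>x. \<nu> / 2 * indicator (cball 0 12) x + indicator (cball 0 12) x * (U j x) ^ 4 / (2 * \<nu>) \<partial>lborel)"
    proof (rule integral_mono[OF _ i2 pw])
      show "integrable lborel (\<lambda>x. indicator (cball 0 12) x * (U j x)\<^sup>2)"
      proof (rule Bochner_Integration.integrable_bound[OF i2])
        show "AE x in lborel. norm (indicator (cball 0 12) x * (U j x)\<^sup>2) \<le> norm (\<nu> / 2 * indicator (cball 0 12) x + indicator (cball 0 12) x * (U j x) ^ 4 / (2 * \<nu>))"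
          by (rule AE_I2) (use order_trans[OF pw abs_ge_self] in simp)
        show "(\<lambda>x. indicator (cball 0 12) x * (U j x)\<^sup>2) \<in> borel_measurable lborel"
          using weak_NS_meas[OF assms(1)] by (simp add: borel_measurable_times borel_measurable_indicator)
      qed
    qed
    also have "\<dots> = \<nu> / 2 * measure lborel (cball (0::R3) 12) + (\<integral>x. indicator (cball 0 12) x * (U j x) ^ 4 \<partial>lborel) / (2 * \<nu>)"
      using i0 i4[of j] by simp
    finally show ?thesis .
  qed
  then have "mass2 U \<le> (\<Sum>j\<in>(UNIV::3 set). \<nu> / 2 * measure lborel (cball (0::R3) 12) + (\<integral>x. indicator (cball 0 12) x * (U j x) ^ 4 \<partial>lborel) / (2 * \<nu>))"
    unfolding mass2_def by (rule sum_mono)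
  also have "\<dots> = 3 * measure lborel (cball (0::R3) 12) * \<nu> / 2 + mass4 U / (2 * \<nu>)"
    by (simp add: sum.distrib mass4_def sum_divide_distrib)
  finally show ?thesis .
qed

lemma weak_gradient_zero:
  assumes NS: "weak_NS U" and gr: "slow_growth U" and \<psi>: "test_fun \<psi>"
  shows "(\<integral>x. U j x * pd i \<psi> x \<partial>lborel) = 0"
proof -
  obtain C where C: "C \<ge> 0" and est: "\<And>U \<psi> i j \<mu> t. weak_NS U \<Longrightarrow> smooth_fun \<psi> \<Longrightarrow> (\<forall>x. norm x > 1 \<longrightarrow> \<psi> x = 0) \<Longrightarrow> 0 < \<mu> \<Longrightarrow> \<mu> \<le> 1 \<Longrightarrow> 0 < t \<Longrightarrow>
     \<bar>\<integral>x. U j x * pd i \<psi> x \<partial>lborel\<bar> \<le> (C * (mass2 U / \<mu> + \<mu> * mass4 U) / t + t * (\<integral>x. (\<psi> x)\<^sup>2 \<partial>lborel)) / 2"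
    using local_gradient_estimate by blast
  obtain r where r: "r > 0" "\<And>x. norm x > r \<Longrightarrow> \<psi> x = 0" using test_fun_bounded_support[OF \<psi>] by blast
  note s\<psi> = test_fun_smooth[OF \<psi>]
  note [measurable] = weak_NS_meas[OF NS] smooth_fun_measurable[OF s\<psi>] smooth_fun_measurable[OF smooth_fun_pd[OF s\<psi>]]
  define P where "P = (\<integral>x. (\<psi> x)\<^sup>2 \<partial>lborel)"
  define c where "c = 3 * measure lborel (cball (0::R3) 12) / 2 + 1/2"
  have c: "c \<ge> 0" by (simp add: c_def)
  define I where "I = (\<integral>x. U j x * pd i \<psi> x \<partial>lborel)"
  have P: "P \<ge> 0" unfolding P_def by (rule Bochner_Integration.integral_nonneg) simp
  have main: "\<bar>I\<bar> \<le> \<sigma> * (C * (c + 1) + P) / 2" if \<sigma>: "0 < \<sigma>" "\<sigma> \<le> 1" for \<sigma>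
  proof -
    \<comment> \<open>The local estimate will be of order \<open>s\<close>; distributed over the two
      terms by \<open>t\<close>, it leaves its square root \<open>\<sigma>\<close>.\<close>
    define s where "s = \<sigma>\<^sup>2"
    have s: "0 < s" "s \<le> 1" using \<sigma> by (auto simp: s_def power_le_one)
    have "s\<^sup>2 / 3 > 0" using s by simp
    then obtain L where L: "\<And>n j. n \<ge> L \<Longrightarrow> (\<integral>x. indicator (cball 0 (12 * n ^ 3)) x * (U j x) ^ 4 \<partial>lborel) \<le> s\<^sup>2 / 3 * n"
      using gr unfolding slow_growth_def by blast
    \<comment> \<open>Taking \<open>n\<close> beyond \<open>r\<close> makes \<open>l\<close> exceed
      \<open>r\<close>, so the dilated test function is supported in the unit ball.\<close>
    define n where "n = max L (max 1 r)"
    have n: "n \<ge> L" "n \<ge> 1" "n \<ge> r" by (auto simp: n_def)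
    define l where "l = n ^ 3"
    have l: "l > 0" "l \<ge> r" 
    proof -
      show "l > 0" using n by (simp add: l_def)
      have "n ^ 1 \<le> n ^ 3" using n by (intro power_increasing) auto
      then show "l \<ge> r" using n by (simp add: l_def)
    qed
    define V where "V = rescale l U"
    have V: "weak_NS V" unfolding V_def by (rule weak_NS_rescale[OF NS l(1)])
    define \<zeta> where "\<zeta> x = \<psi> (l *\<^sub>R x)" for x
    have s\<zeta>: "smooth_fun \<zeta>" unfolding \<zeta>_def[abs_def] by (rule smooth_dilate[OF s\<psi>])
    have z\<zeta>: "\<forall>x. norm x > 1 \<longrightarrow> \<zeta> x = 0"
    proof (intro allI impI)
      fix x :: R3 assume "norm x > 1"
      then have "l * 1 < l * norm x" using l by (intro mult_strict_left_mono) auto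
      moreover have "norm (l *\<^sub>R x) = l * norm x" using l by simp
      ultimately have "norm (l *\<^sub>R x) > r" using l by linarith
      then show "\<zeta> x = 0" unfolding \<zeta>_def by (rule r(2))
    qed
    have IV: "(\<integral>x. V j x * pd i \<zeta> x \<partial>lborel) = I / l"
    proof -
      have "(\<integral>x. V j x * pd i \<zeta> x \<partial>lborel) = (\<integral>x. l\<^sup>2 * (U j (l *\<^sub>R x) * pd i \<psi> (l *\<^sub>R x)) \<partial>lborel)"
        unfolding \<zeta>_def[abs_def] pd_dilate[OF s\<psi>] V_def rescale_def
        by (rule Bochner_Integration.integral_cong) (auto simp: power2_eq_square)
      also have "\<dots> = l\<^sup>2 * (I / l ^ 3)"
        using integral_scale[of "\<lambda>x. U j x * pd i \<psi> x" l] l by (simp add: I_def)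
      finally show ?thesis using l by (simp add: power2_eq_square power3_eq_cube)
    qed
    have PV: "(\<integral>x. (\<zeta> x)\<^sup>2 \<partial>lborel) = P / l ^ 3"
      using integral_scale[of "\<lambda>x. (\<psi> x)\<^sup>2" l] l by (simp add: \<zeta>_def P_def)
    have m4: "mass4 V \<le> s\<^sup>2 * n ^ 4"
    proof -
      have "mass4 V = (\<Sum>j\<in>UNIV. l * (\<integral>x. indicator (cball 0 (l * 12)) x * (U j x) ^ 4 \<partial>lborel))"
        unfolding mass4_def V_def by (simp add: mass_rescale(1)[OF weak_NS_meas[OF NS] l(1)])
      also have "\<dots> \<le> (\<Sum>j\<in>(UNIV::3 set). l * (s\<^sup>2 / 3 * n))"
        using L[OF n(1)] l by (intro sum_mono mult_left_mono) (auto simp: l_def mult.commute)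
      also have "\<dots> = s\<^sup>2 * n ^ 4" by (simp add: l_def power4_eq_xxxx power3_eq_cube)
      finally show ?thesis .
    qed
    have sn: "s * n\<^sup>2 > 0" using s n by simp
    have m2: "mass2 V \<le> c * (s * n\<^sup>2)"
    proof -
      have "mass2 V \<le> 3 * measure lborel (cball (0::R3) 12) * (s * n\<^sup>2) / 2 + mass4 V / (2 * (s * n\<^sup>2))"
        by (rule mass2_le[OF V sn])
      also have "mass4 V / (2 * (s * n\<^sup>2)) \<le> s\<^sup>2 * n ^ 4 / (2 * (s * n\<^sup>2))"
        using m4 sn by (intro divide_right_mono) auto
      also have "s\<^sup>2 * n ^ 4 / (2 * (s * n\<^sup>2)) = s * n\<^sup>2 / 2"
        using s n by (simp add: power4_eq_xxxx power2_eq_square)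
      finally show ?thesis by (simp add: c_def algebra_simps)
    qed
    \<comment> \<open>Balances both terms on the right at the size \<open>\<sigma> / l\<close>,
      which matches the factor \<open>1 / l\<close> on the left.\<close>
    define t where "t = l\<^sup>2 * \<sigma>"
    have t: "t > 0" using l \<sigma> by (simp add: t_def)
    have "\<bar>I / l\<bar> \<le> (C * (mass2 V / (1 / n) + (1 / n) * mass4 V) / t + t * (P / l ^ 3)) / 2"
      using est[OF V s\<zeta> z\<zeta>, of "1 / n" t j i] n t unfolding IV PV by simp
    also have "\<dots> \<le> (C * (c * (s * n\<^sup>2) / (1 / n) + (1 / n) * (s\<^sup>2 * n ^ 4)) / t + t * (P / l ^ 3)) / 2"
      using m2 m4 C n t by (intro divide_right_mono add_mono mult_left_mono order_refl) auto
    also have "c * (s * n\<^sup>2) / (1 / n) + (1 / n) * (s\<^sup>2 * n ^ 4) = (c + s) * s * l"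
      using n by (simp add: l_def power4_eq_xxxx power3_eq_cube power2_eq_square field_simps)
    also have "(C * ((c + s) * s * l) / t + t * (P / l ^ 3)) / 2 = (C * (c + s) * \<sigma> + \<sigma> * P) / 2 / l"
      using l \<sigma> by (simp add: t_def s_def power2_eq_square power3_eq_cube field_simps)
    finally have "\<bar>I\<bar> / l \<le> (C * (c + s) * \<sigma> + \<sigma> * P) / 2 / l" using l by simp
    then have "\<bar>I\<bar> \<le> (C * (c + s) * \<sigma> + \<sigma> * P) / 2" using l by (simp only: divide_le_cancel)
    also have "\<dots> \<le> (C * (c + 1) * \<sigma> + \<sigma> * P) / 2"
      using s C \<sigma> by (intro divide_right_mono add_mono mult_right_mono mult_left_mono) auto
    finally show ?thesis by (simp add: algebra_simps)
  qed
  have "\<bar>I\<bar> \<le> 0"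
  proof (rule field_le_epsilon)
    fix e :: real assume e: "e > 0"
    define K where "K = (C * (c + 1) + P) / 2 + 1"
    have K: "K > 0" unfolding K_def using C c P by (intro add_nonneg_pos divide_nonneg_nonneg add_nonneg_nonneg mult_nonneg_nonneg) auto
    define \<sigma> where "\<sigma> = min 1 (e / K)"
    have "\<sigma> > 0" "\<sigma> \<le> 1" using e K by (auto simp: \<sigma>_def)
    from main[OF this] have "\<bar>I\<bar> \<le> \<sigma> * (K - 1)" by (simp add: K_def)
    also have "\<dots> \<le> \<sigma> * K" using \<open>\<sigma> > 0\<close> by simp
    also have "\<dots> \<le> e / K * K" using K by (intro mult_right_mono) (auto simp: \<sigma>_def)
    finally show "\<bar>I\<bar> \<le> 0 + e" using K by simp
  qed
  then show ?thesis by (simp add: I_def)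
qed

text \<open>A vanishing weak gradient makes mollifications constant on large balls. A constant field
  has fourth-power mass of order \<open>n^3\<close> on the ball of radius \<open>n\<close>, while
  the growth bound allows only order \<open>n\<close> on an even larger ball. So all mollifications
  vanish, and they converge to \<open>U\<close>.\<close>

lemma liouville:
  assumes NS: "weak_NS U" and gr: "slow_growth U"
  shows "AE x in lborel. U j x = 0"
proof -
  define g where "g \<rho> x = indicator (cball 0 \<rho>) x * U j x" for \<rho> x
  have L4: "L4_supp \<rho> (g \<rho>)" for \<rho>
  proof (rule L4_suppI)
    have "(\<lambda>x. (g \<rho> x) ^ 4) = (\<lambda>x. indicator (cball 0 \<rho>) x * (U j x) ^ 4)" by (auto simp: fun_eq_iff indicator_def g_def)
    then show "integrable lborel (\<lambda>x. (g \<rho> x) ^ 4)" using NS unfolding weak_NS_def by simp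
    show "g \<rho> \<in> borel_measurable borel" unfolding g_def
      by (intro borel_measurable_times borel_measurable_indicator weak_NS_meas[OF NS]) simp
  qed (auto simp: g_def)
  note L2 = L4_suppD(1)[OF L4]
  \<comment> \<open>The margin 1 keeps the mollifier inside the ball where \<open>g \<rho>\<close>
    agrees with the component of \<open>U\<close>, so that the derivative is the weak gradient
    tested with a reflected mollifier.\<close>
  have const: "conv (moll \<delta>) (g \<rho>) x = conv (moll \<delta>) (g \<rho>) 0" if \<delta>: "0 < \<delta>" "\<delta> \<le> 1" and x: "norm x < \<rho> - 1" for \<delta> \<rho> x
  proof -
    define u where "u = conv (moll \<delta>) (g \<rho>)"
    have su: "smooth_fun u" unfolding u_def by (rule smooth_conv[OF smooth_moll L2_suppD(4,3)[OF L2]])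
    have pz: "pd i u y = 0" if y: "norm y < \<rho> - 1" for i y
    proof -
      have "pd i u y = conv (pd i (moll \<delta>)) (g \<rho>) y" unfolding u_def by (simp add: pd_conv[OF smooth_moll L2_suppD(4,3)[OF L2]])
      also have "\<dots> = (\<integral>z. pd i (moll \<delta>) (y - z) * U j z \<partial>lborel)"
        unfolding conv_def
      proof (rule Bochner_Integration.integral_cong)
        fix z
        show "pd i (moll \<delta>) (y - z) * g \<rho> z = pd i (moll \<delta>) (y - z) * U j z"
        proof (cases "norm (y - z) > \<delta>")
          case True
          then have "pd i (moll \<delta>) (y - z) = 0" by (intro pd_outside[of \<delta>]) (auto simp: moll_outside[OF \<delta>(1)])
          then show ?thesis by simp
        next
          case False
          then have "norm z \<le> \<rho>" using y \<delta> norm_triangle_ineq2[of z y] by (simp add: norm_minus_commute)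
          then show ?thesis by (simp add: g_def)
        qed
      qed simp
      also have "\<dots> = - (\<integral>z. U j z * pd i (\<lambda>z. moll \<delta> (y - z)) z \<partial>lborel)"
        unfolding pd_reflect[OF smooth_moll] by (simp add: mult.commute)
      also have "\<dots> = 0"
      proof -
        have "test_fun (\<lambda>z. moll \<delta> (y - z))"
        proof (rule test_funI[OF smooth_reflect[OF smooth_moll], where r="norm y + \<delta>"])
          show "moll \<delta> (y - z) = 0" if "norm z > norm y + \<delta>" for z
            by (rule moll_outside[OF \<delta>(1)]) (use that norm_triangle_ineq2[of z y] in \<open>simp add: norm_minus_commute\<close>)
        qed
        from weak_gradient_zero[OF NS gr this] show ?thesis by simp
      qed
      finally show ?thesis .
    qed
    have "\<rho> - 1 > 0" using x norm_ge_zero[of x] by linarith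
    have "u x = u 0"
    proof (rule has_derivative_zero_unique[of "ball 0 (\<rho> - 1)" u])
      show "(u has_derivative (\<lambda>h. 0)) (at y within ball 0 (\<rho> - 1))" if "y \<in> ball 0 (\<rho> - 1)" for y
        using has_derivative_at_withinI[OF smooth_has_derivative[OF su, of y]] pz[of y] that by simp
    qed (use x \<open>\<rho> - 1 > 0\<close> in auto)
    then show ?thesis by (simp add: u_def)
  qed
  have zero0: "conv (moll \<delta>) (g \<rho>) 0 = 0" if \<delta>: "0 < \<delta>" "\<delta> \<le> 1" and \<rho>: "\<rho> > 1" for \<delta> \<rho>
  proof -
    define c where "c = conv (moll \<delta>) (g \<rho>) 0"
    \<comment> \<open>At the origin the mollifier only meets the unit ball, so the constant does not
      depend on the truncation radius.\<close>
    have c_ind: "conv (moll \<delta>) (g \<rho>') 0 = c" if "\<rho>' \<ge> 1" for \<rho>'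
      unfolding c_def conv_def
    proof (rule Bochner_Integration.integral_cong)
      fix y :: R3
      show "moll \<delta> (0 - y) * g \<rho>' y = moll \<delta> (0 - y) * g \<rho> y"
        using moll_outside[OF \<delta>(1), of "- y"] that \<rho> \<delta> by (cases "norm y > \<delta>") (auto simp: g_def)
    qed simp
    define v where "v = measure lborel (cball (0::R3) 1)"
    have v: "v > 0" by (simp add: v_def content_cball_pos)
    have "c ^ 4 \<le> 0"
    proof (rule field_le_epsilon)
      fix e :: real assume e: "e > 0"
      then have "e * v > 0" using v by simp
      then obtain L where L: "\<And>n. n \<ge> L \<Longrightarrow> (\<integral>x. indicator (cball 0 (12 * n ^ 3)) x * (U j x) ^ 4 \<partial>lborel) \<le> e * v * n"
        using gr unfolding slow_growth_def by blast
      define n where "n = max L 1"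
      have n: "n \<ge> L" "n \<ge> 1" by (auto simp: n_def)
      define \<rho>' where "\<rho>' = 12 * n ^ 3"
      have n3: "n \<le> n ^ 3" using n power_increasing[of 1 3 n] by simp
      have \<rho>': "\<rho>' \<ge> 12 * n" using n3 by (simp add: \<rho>'_def)
      define u where "u = conv (moll \<delta>) (g \<rho>')"
      have uc: "u x = c" if "norm x \<le> n" for x
      proof -
        have "norm x < \<rho>' - 1" using that \<rho>' n by linarith
        moreover have "\<rho>' \<ge> 1" using \<rho>' n by linarith
        ultimately show ?thesis unfolding u_def using const[OF \<delta>] c_ind by metis
      qed
      have "c ^ 4 * measure lborel (cball (0::R3) n) = (\<integral>x. c ^ 4 * indicator (cball (0::R3) n) x \<partial>lborel)" by simp
      also have "\<dots> \<le> (\<integral>x. (u x) ^ 4 \<partial>lborel)"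
      proof (rule integral_mono)
        show "integrable lborel (\<lambda>x. c ^ 4 * indicator (cball (0::R3) n) x)"
          using emeasure_lborel_cball_finite[of "0::R3" n] by (intro integrable_mult_right integrable_real_indicator) auto
        show "integrable lborel (\<lambda>x. (u x) ^ 4)" unfolding u_def by (rule conv_moll_L4(1)[OF L4_suppD(1,2)[OF L4] \<delta>(1)])
        show "c ^ 4 * indicator (cball 0 n) x \<le> (u x) ^ 4" for x using uc[of x] by (cases "norm x \<le> n") auto
      qed
      also have "\<dots> \<le> (\<integral>x. (g \<rho>' x) ^ 4 \<partial>lborel)" unfolding u_def by (rule conv_moll_L4(2)[OF L4_suppD(1,2)[OF L4] \<delta>(1)])
      also have "\<dots> = (\<integral>x. indicator (cball 0 \<rho>') x * (U j x) ^ 4 \<partial>lborel)"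
        by (rule Bochner_Integration.integral_cong) (auto simp: g_def indicator_def)
      also have "\<dots> \<le> e * v * n" unfolding \<rho>'_def by (rule L[OF n(1)])
      also have "e * v * n \<le> e * measure lborel (cball (0::R3) n)"
      proof -
        have "measure lborel (cball (0::R3) n) = n ^ 3 * v"
          using n by (simp add: v_def content_cball)
        then show ?thesis using n3 e v by (simp add: mult.assoc mult.commute)
      qed
      finally have "c ^ 4 * measure lborel (cball (0::R3) n) \<le> e * measure lborel (cball (0::R3) n)" .
      moreover have "measure lborel (cball (0::R3) n) > 0" using n by (simp add: content_cball_pos)
      ultimately show "c ^ 4 \<le> 0 + e" by simp
    qed
    then have "c = 0" using zero_le_even_power[of 4 c] by simp
    then show ?thesis by (simp add: c_def)
  qed
  have AEn: "AE x in lborel. norm x < real m + 1 \<longrightarrow> U j x = 0" for m :: nat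
  proof -
    define \<rho> where "\<rho> = real m + 2"
    have "(\<integral>x. indicator (ball 0 (\<rho> - 1)) x * (g \<rho> x)\<^sup>2 \<partial>lborel) \<le> 0"
    proof (rule field_le_epsilon)
      fix e :: real assume e: "e > 0"
      obtain d where d: "d > 0" "\<And>\<delta>. 0 < \<delta> \<Longrightarrow> \<delta> < d \<Longrightarrow> (\<integral>x. (conv (moll \<delta>) (g \<rho>) x - g \<rho> x) ^ 2 \<partial>lborel) \<le> e
         \<and> integrable lborel (\<lambda>x. (conv (moll \<delta>) (g \<rho>) x - g \<rho> x) ^ 2)"
        using moll_Lp_tendsto[OF _ L2 _ _ e, of 2 \<rho>] by (auto simp: \<rho>_def)
      define \<delta> where "\<delta> = min 1 (d / 2)"
      have \<delta>: "0 < \<delta>" "\<delta> \<le> 1" "\<delta> < d" using d by (auto simp: \<delta>_def)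
      have "(\<integral>x. indicator (ball 0 (\<rho> - 1)) x * (g \<rho> x)\<^sup>2 \<partial>lborel) \<le> (\<integral>x. (conv (moll \<delta>) (g \<rho>) x - g \<rho> x) ^ 2 \<partial>lborel)"
      proof (rule integral_mono)
        show "integrable lborel (\<lambda>x. indicator (ball 0 (\<rho> - 1)) x * (g \<rho> x)\<^sup>2)"
          using integrable_mult_indicator[of "ball 0 (\<rho> - 1)" lborel "\<lambda>x. (g \<rho> x)\<^sup>2"] L2_suppD(2)[OF L2] by simp
        show "integrable lborel (\<lambda>x. (conv (moll \<delta>) (g \<rho>) x - g \<rho> x) ^ 2)" using d(2)[OF \<delta>(1,3)] by simp
        show "indicator (ball 0 (\<rho> - 1)) x * (g \<rho> x)\<^sup>2 \<le> (conv (moll \<delta>) (g \<rho>) x - g \<rho> x) ^ 2" for x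
        proof (cases "norm x < \<rho> - 1")
          case True
          have "conv (moll \<delta>) (g \<rho>) x = 0" using const[OF \<delta>(1,2) True] zero0[OF \<delta>(1,2), of \<rho>] by (simp add: \<rho>_def)
          then show ?thesis using True by simp
        qed simp
      qed
      then show "(\<integral>x. indicator (ball 0 (\<rho> - 1)) x * (g \<rho> x)\<^sup>2 \<partial>lborel) \<le> 0 + e" using d(2)[OF \<delta>(1,3)] by simp
    qed
    moreover have i: "integrable lborel (\<lambda>x. indicator (ball 0 (\<rho> - 1)) x * (g \<rho> x)\<^sup>2)"
      using integrable_mult_indicator[of "ball 0 (\<rho> - 1)" lborel "\<lambda>x. (g \<rho> x)\<^sup>2"] L2_suppD(2)[OF L2] by simp
    ultimately have "(\<integral>x. indicator (ball 0 (\<rho> - 1)) x * (g \<rho> x)\<^sup>2 \<partial>lborel) = 0"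
      by (intro antisym Bochner_Integration.integral_nonneg) auto
    then have "AE x in lborel. indicator (ball 0 (\<rho> - 1)) x * (g \<rho> x)\<^sup>2 = 0"
      using integral_nonneg_eq_0_iff_AE[OF i] by simp
    then show ?thesis by eventually_elim (auto simp: \<rho>_def g_def)
  qed
  have "AE x in lborel. \<forall>m::nat. norm x < real m + 1 \<longrightarrow> U j x = 0" by (subst AE_all_countable) (use AEn in blast)
  then show ?thesis
  proof eventually_elim
    case (elim x)
    obtain m :: nat where "norm x \<le> real m" using real_arch_simple by blast
    then show ?case using elim by (metis less_add_one order_le_less_trans)
  qed
qed

section \<open>Lorentz spaces and the main theorem\<close>

text \<open>The factor \<open>16 = 2^4\<close> comes from replacing a value by the upper end of its
  dyadic layer; the rest sums the geometric series with exponent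
  \<open>4 - 9/2 = -1/2\<close>.\<close>

definition layer_const :: real where "layer_const = 16 * (1 / (1 - 2 powr (-1/2)))"

lemma two_powr_half: "0 < 2 powr (-1/2 :: real)" "2 powr (-1/2 :: real) < 1"
  by (auto simp: powr_less_one)

lemma layer_const_pos: "layer_const > 0"
  using two_powr_half by (simp add: layer_const_def)

text \<open>The layer between \<open>r k\<close> and \<open>2 * r k\<close> contributes at most
  \<open>16 * (r k)^4\<close> times \<open>A * (r k) powr (-9/2)\<close>. Because 9/2 exceeds 4,
  these terms decay geometrically towards high levels.\<close>

lemma dyadic_layers:
  fixes V :: "R3 \<Rightarrow> real"
  assumes V: "V \<in> borel_measurable lebesgue" and s: "s > 0" and A: "A \<ge> 0"
    and d: "\<And>\<alpha>. \<alpha> \<ge> s \<Longrightarrow> emeasure lebesgue {x. V x > \<alpha>} \<le> ennreal (A * \<alpha> powr (-9/2))"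
  shows "(\<integral>\<^sup>+x. ennreal ((V x) ^ 4) * indicator {x. V x > s} x \<partial>lebesgue) \<le> ennreal (A * layer_const * s powr (-1/2))"
proof -
  define r where "r k = 2 ^ k * s" for k :: nat
  define S where "S k = {x. V x > r k}" for k
  have rs: "r k \<ge> s" "r k > 0" for k using s by (auto simp: r_def)
  have S[measurable]: "S k \<in> sets lebesgue" for k
    using borel_measurable_less[of "\<lambda>_. r k" lebesgue V] V unfolding S_def by (simp add: pred_def)
  have pw: "ennreal ((V x) ^ 4) * indicator {x. V x > s} x \<le> (\<Sum>k. ennreal (16 * (r k) ^ 4) * indicator (S k) x)" for x
  proof (cases "V x > s")
    case True
    define P where "P n \<longleftrightarrow> V x \<le> r (Suc n)" for n
    have "\<exists>n. P n"
    proof -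
      obtain n where n: "V x / s < 2 ^ n" using real_arch_pow[of 2 "V x / s"] by auto
      then have "V x \<le> r n" using s by (simp add: r_def field_simps)
      also have "\<dots> \<le> r (Suc n)" using s by (simp add: r_def)
      finally show ?thesis unfolding P_def by blast
    qed
    define n where "n = (LEAST n. P n)"
    have Pn: "P n" unfolding n_def by (rule LeastI_ex[OF \<open>\<exists>n. P n\<close>])
    have xS: "x \<in> S n"
    proof (cases n)
      case 0 then show ?thesis using True by (simp add: S_def r_def)
    next
      case (Suc m)
      then have "\<not> P m" using not_less_Least[of m P] by (simp add: n_def)
      then show ?thesis by (simp add: S_def P_def Suc not_le)
    qed
    have "(V x) ^ 4 \<le> (r (Suc n)) ^ 4" using Pn True s unfolding P_def by (intro power_mono) auto
    also have "\<dots> = 16 * (r n) ^ 4" by (simp add: r_def power_mult_distrib)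
    finally have "ennreal ((V x) ^ 4) \<le> ennreal (16 * (r n) ^ 4)" by (rule ennreal_leI)
    then have "ennreal ((V x) ^ 4) * indicator {x. V x > s} x \<le> ennreal (16 * (r n) ^ 4) * indicator (S n) x"
      using True xS by simp
    also have "\<dots> \<le> (\<Sum>k. ennreal (16 * (r k) ^ 4) * indicator (S k) x)"
    proof -
      define f where "f k = ennreal (16 * (r k) ^ 4) * indicator (S k) x" for k
      have "sum f {n} \<le> suminf f" by (rule sum_le_suminf) auto
      then have "f n \<le> suminf f" by simp
      then show ?thesis unfolding f_def .
    qed
    finally show ?thesis .
  qed simp
  have "(\<integral>\<^sup>+x. ennreal ((V x) ^ 4) * indicator {x. V x > s} x \<partial>lebesgue)
     \<le> (\<integral>\<^sup>+x. (\<Sum>k. ennreal (16 * (r k) ^ 4) * indicator (S k) x) \<partial>lebesgue)"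
    by (rule nn_integral_mono) (rule pw)
  also have "\<dots> = (\<Sum>k. \<integral>\<^sup>+x. ennreal (16 * (r k) ^ 4) * indicator (S k) x \<partial>lebesgue)"
    by (rule nn_integral_suminf) measurable
  also have "\<dots> \<le> (\<Sum>k. ennreal (16 * A * s powr (-1/2) * (2 powr (-1/2)) ^ k))"
  proof (rule suminf_le)
    fix k
    have "(\<integral>\<^sup>+x. ennreal (16 * (r k) ^ 4) * indicator (S k) x \<partial>lebesgue) = ennreal (16 * (r k) ^ 4) * emeasure lebesgue (S k)"
      by (rule nn_integral_cmult_indicator) (rule S)
    also have "\<dots> \<le> ennreal (16 * (r k) ^ 4) * ennreal (A * (r k) powr (-9/2))"
      unfolding S_def by (intro mult_left_mono d rs) simp
    also have "\<dots> = ennreal (16 * (r k) ^ 4 * (A * (r k) powr (-9/2)))"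
      using A rs by (intro ennreal_mult'[symmetric]) auto
    also have "16 * (r k) ^ 4 * (A * (r k) powr (-9/2)) = 16 * A * s powr (-1/2) * (2 powr (-1/2)) ^ k"
    proof -
      have "(r k) ^ 4 * (r k) powr (-9/2) = (r k) powr 4 * (r k) powr (-9/2)" using rs(2)[of k] by (simp add: powr_numeral)
      also have "\<dots> = (r k) powr (-1/2)" unfolding powr_add[symmetric] by simp
      also have "\<dots> = (2 ^ k) powr (-1/2) * s powr (-1/2)" unfolding r_def using s by (subst powr_mult) auto
      also have "(2 ^ k) powr (-1/2 :: real) = (2 powr (-1/2)) ^ k"
        by (simp add: powr_realpow[symmetric] powr_powr mult.commute)
      finally show ?thesis by (simp add: mult_ac)
    qed
    finally show "(\<integral>\<^sup>+x. ennreal (16 * (r k) ^ 4) * indicator (S k) x \<partial>lebesgue) \<le> ennreal (16 * A * s powr (-1/2) * (2 powr (-1/2)) ^ k)" .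
  qed auto
  also have "\<dots> = ennreal (A * layer_const * s powr (-1/2))"
  proof -
    have sm: "summable (\<lambda>k. (2 powr (-1/2 :: real)) ^ k)" using two_powr_half by (intro summable_geometric) simp
    have "(\<Sum>k. ennreal (16 * A * s powr (-1/2) * (2 powr (-1/2)) ^ k)) = ennreal (\<Sum>k. 16 * A * s powr (-1/2) * (2 powr (-1/2)) ^ k)"
      using A sm by (intro suminf_ennreal2 summable_mult) auto
    also have "(\<Sum>k. 16 * A * s powr (-1/2) * (2 powr (-1/2 :: real)) ^ k) = 16 * A * s powr (-1/2) * (1 / (1 - 2 powr (-1/2)))"
      using two_powr_half by (subst suminf_mult[OF sm], subst suminf_geometric) auto
    finally show ?thesis by (simp add: layer_const_def mult_ac)
  qed
  finally show ?thesis .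
qed

section \<open>Consequences of membership in the Lorentz space\<close>

lemma lorentz_distfun_antimono:
  assumes U: "lorentz r q U" and "0 < \<alpha>" "\<alpha> \<le> \<alpha>'"
  shows "enn2real (distfun U \<alpha>') \<le> enn2real (distfun U \<alpha>)"
proof -
  have "U \<in> borel_measurable lebesgue" using U unfolding lorentz_def by simp
  then have "{x. norm (U x) > \<alpha>} \<in> sets lebesgue"
    using borel_measurable_less[of "\<lambda>_. \<alpha>" lebesgue "\<lambda>x. norm (U x)"] by (simp add: pred_def)
  then have "distfun U \<alpha>' \<le> distfun U \<alpha>"
    unfolding distfun_def by (rule emeasure_mono[rotated]) (use assms(3) in auto)
  then show ?thesis
    using U assms(2) unfolding lorentz_def by (intro enn2real_mono) auto
qed

text \<open>The distribution function decreases, so the Lorentz integrand has an explicit lower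
  bound on the interval from \<open>\<alpha> / 2\<close> to \<open>\<alpha>\<close>. One interval
  gives the uniform bound; the intervals ending at powers of 1/2 are disjoint and give
  summability.\<close>

lemma lorentz_dyadic_bound:
  fixes U :: "R3 \<Rightarrow> R3"
  assumes U: "lorentz (9/2) q U" and q: "q > 0"
  defines "d \<equiv> (\<lambda>\<alpha>. enn2real (distfun U \<alpha>))"
  shows "\<exists>J. (\<forall>\<alpha>>0. (\<alpha> / 2 * d \<alpha> powr (2/9)) powr q / 2 \<le> J) \<and>
     summable (\<lambda>n. (((1/2) ^ n) / 2 * d ((1/2) ^ n) powr (2/9)) powr q / 2)"
proof -
  have mono: "d \<alpha>' \<le> d \<alpha>" if "0 < \<alpha>" "\<alpha> \<le> \<alpha>'" for \<alpha> \<alpha>'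
    unfolding d_def by (rule lorentz_distfun_antimono[OF U that])
  define \<Phi> where "\<Phi> s = (s * d s powr (2/9)) powr q / s" for s
  define J where "J = (\<integral>\<^sup>+\<alpha>\<in>{0<..}. ennreal (\<Phi> \<alpha>) \<partial>lborel)"
  have J: "J < \<infinity>" using U unfolding lorentz_def J_def \<Phi>_def d_def by simp
  \<comment> \<open>Each factor of the integrand is replaced by its least favourable value on the
    interval; times the length \<open>\<alpha> / 2\<close> this is the term of the series.\<close>
  define c where "c \<alpha> = (\<alpha> / 2 * d \<alpha> powr (2/9)) powr q / \<alpha>" for \<alpha>
  have c\<Phi>: "c \<alpha> \<le> \<Phi> s" if "\<alpha> / 2 < s" "s < \<alpha>" for \<alpha> s
  proof -
    have a: "\<alpha> > 0" using that by simp
    have s: "s > 0" using that a by simp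
    have "d \<alpha> powr (2/9) \<le> d s powr (2/9)"
      using mono[of s \<alpha>] s that by (intro powr_mono2) (auto simp: d_def)
    then have "\<alpha> / 2 * d \<alpha> powr (2/9) \<le> s * d s powr (2/9)" using that a by (intro mult_mono) auto
    then have "(\<alpha> / 2 * d \<alpha> powr (2/9)) powr q \<le> (s * d s powr (2/9)) powr q"
      using q a by (intro powr_mono2) auto
    then show ?thesis unfolding c_def \<Phi>_def using s that a by (intro frac_le) auto
  qed
  have c0: "c \<alpha> \<ge> 0" if "\<alpha> > 0" for \<alpha> using that by (simp add: c_def)
  have cint: "ennreal ((\<alpha> / 2 * d \<alpha> powr (2/9)) powr q / 2) = (\<integral>\<^sup>+s. ennreal (c \<alpha>) * indicator {\<alpha>/2<..<\<alpha>} s \<partial>lborel)" if "\<alpha> > 0" for \<alpha>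
  proof -
    have "(\<integral>\<^sup>+s. ennreal (c \<alpha>) * indicator {\<alpha>/2<..<\<alpha>} s \<partial>lborel) = ennreal (c \<alpha>) * ennreal (\<alpha> - \<alpha> / 2)"
      using that by (subst nn_integral_cmult_indicator) auto
    also have "\<dots> = ennreal (c \<alpha> * (\<alpha> - \<alpha> / 2))" using c0[OF that] by (rule ennreal_mult'[symmetric])
    also have "c \<alpha> * (\<alpha> - \<alpha> / 2) = (\<alpha> / 2 * d \<alpha> powr (2/9)) powr q / 2" using that by (simp add: c_def field_simps)
    finally show ?thesis by simp
  qed
  have single: "(\<alpha> / 2 * d \<alpha> powr (2/9)) powr q / 2 \<le> enn2real J" if a: "\<alpha> > 0" for \<alpha>
  proof -
    have "ennreal ((\<alpha> / 2 * d \<alpha> powr (2/9)) powr q / 2) \<le> J"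
      unfolding cint[OF a] J_def
      by (rule nn_integral_mono) (use c\<Phi> a in \<open>auto simp: indicator_def intro!: ennreal_leI\<close>)
    then have "ennreal ((\<alpha> / 2 * d \<alpha> powr (2/9)) powr q / 2) \<le> ennreal (enn2real J)" using J by simp
    then show ?thesis by (subst (asm) ennreal_le_iff) auto
  qed
  define x where "x n = (1/2 :: real) ^ n" for n :: nat
  have x0: "x n > 0" for n by (simp add: x_def)
  have "(\<Sum>n. ennreal ((x n / 2 * d (x n) powr (2/9)) powr q / 2)) \<le> J"
  proof -
    have "(\<Sum>n. ennreal ((x n / 2 * d (x n) powr (2/9)) powr q / 2))
       = (\<Sum>n. \<integral>\<^sup>+s. ennreal (c (x n)) * indicator {x n/2<..<x n} s \<partial>lborel)"
      by (simp only: cint[OF x0])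
    also have "\<dots> = (\<integral>\<^sup>+s. (\<Sum>n. ennreal (c (x n)) * indicator {x n/2<..<x n} s) \<partial>lborel)"
      by (rule nn_integral_suminf[symmetric]) auto
    also have "\<dots> \<le> J" unfolding J_def
    proof (rule nn_integral_mono)
      fix s :: real
      show "(\<Sum>n. ennreal (c (x n)) * indicator {x n/2<..<x n} s) \<le> ennreal (\<Phi> s) * indicator {0<..} s"
      proof (cases "\<exists>n. s \<in> {x n/2<..<x n}")
        case True
        then obtain n where n: "x n / 2 < s" "s < x n" by auto
        \<comment> \<open>Disjointness leaves at most one nonzero term at each
          \<open>s\<close>.\<close>
        have u: "s \<notin> {x m/2<..<x m}" if "m \<noteq> n" for m
        proof -
          have step: "x b \<le> x a / 2" if "a < b" for a b
          proof -
            have "x b \<le> x (Suc a)" unfolding x_def using that by (intro power_decreasing) auto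
            then show ?thesis by (simp add: x_def)
          qed
          show ?thesis using step[of m n] step[of n m] n that by (cases "m < n") auto
        qed
        have "(\<Sum>m. ennreal (c (x m)) * indicator {x m/2<..<x m} s) = (\<Sum>m\<in>{n}. ennreal (c (x m)) * indicator {x m/2<..<x m} s)"
          by (rule suminf_finite) (use u in auto)
        also have "\<dots> = ennreal (c (x n))" using n by simp
        also have "\<dots> \<le> ennreal (\<Phi> s)" by (rule ennreal_leI[OF c\<Phi>[OF n]])
        also have "\<dots> = ennreal (\<Phi> s) * indicator {0<..} s" using n x0[of n] by simp
        finally show ?thesis .
      next
        case False
        then have "(\<Sum>n. ennreal (c (x n)) * indicator {x n/2<..<x n} s) = (\<Sum>n. 0)"
          by (intro suminf_cong) auto
        then show ?thesis by simp
      qed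
    qed
    finally show ?thesis .
  qed
  then have "(\<Sum>n. ennreal ((x n / 2 * d (x n) powr (2/9)) powr q / 2)) \<noteq> top" using J by auto
  then have "summable (\<lambda>n. (x n / 2 * d (x n) powr (2/9)) powr q / 2)"
    by (intro summable_suminf_not_top) auto
  then show ?thesis using single unfolding x_def by blast
qed

lemma distfun_from_product:
  assumes U: "lorentz (9/2) q U" and a: "\<alpha> > 0" and e: "\<alpha> * enn2real (distfun U \<alpha>) powr (2/9) \<le> e"
  shows "distfun U \<alpha> \<le> ennreal (e powr (9/2) * \<alpha> powr (-9/2))"
proof -
  define d where "d = enn2real (distfun U \<alpha>)"
  have fin: "distfun U \<alpha> < \<infinity>" using U a unfolding lorentz_def by simp
  have d0: "d \<ge> 0" by (simp add: d_def)
  have "d = (d powr (2/9)) powr (9/2)" using d0 by (simp add: powr_powr)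
  also have "\<dots> \<le> (e / \<alpha>) powr (9/2)"
    using e a by (intro powr_mono2) (auto simp: d_def field_simps)
  also have "\<dots> = e powr (9/2) * \<alpha> powr (-9/2)"
  proof -
    have "e \<ge> 0" using e a by (meson mult_nonneg_nonneg less_imp_le order_trans powr_ge_zero)
    then show ?thesis using a by (simp add: powr_divide powr_minus_divide)
  qed
  finally have "ennreal d \<le> ennreal (e powr (9/2) * \<alpha> powr (-9/2))" by (rule ennreal_leI)
  moreover have "distfun U \<alpha> = ennreal d" using fin by (simp add: d_def)
  ultimately show ?thesis by (simp only:)
qed

text \<open>The embedding of the Lorentz space into weak \<open>L^(9/2)\<close>.\<close>

lemma lorentz_weak_bound:
  assumes U: "lorentz (9/2) q U" and q: "q > 0"
  shows "\<exists>B\<ge>0. \<forall>\<alpha>>0. distfun U \<alpha> \<le> ennreal (B * \<alpha> powr (-9/2))"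
proof -
  define d where "d \<alpha> = enn2real (distfun U \<alpha>)" for \<alpha>
  obtain J where J: "\<And>\<alpha>. \<alpha> > 0 \<Longrightarrow> (\<alpha> / 2 * d \<alpha> powr (2/9)) powr q / 2 \<le> J"
    using lorentz_dyadic_bound[OF U q] unfolding d_def by blast
  define e where "e = 2 * (2 * J) powr (1 / q)"
  have "\<alpha> * d \<alpha> powr (2/9) \<le> e" if a: "\<alpha> > 0" for \<alpha>
  proof -
    define y where "y = \<alpha> / 2 * d \<alpha> powr (2/9)"
    have y: "y \<ge> 0" using a by (simp add: y_def)
    have "y = (y powr q) powr (1 / q)" using q y by (simp add: powr_powr)
    also have "\<dots> \<le> (2 * J) powr (1 / q)" using J[OF a] q by (intro powr_mono2) (auto simp: y_def)
    finally show ?thesis by (simp add: e_def y_def)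
  qed
  then show ?thesis using distfun_from_product[OF U, of _ e]
    by (intro exI[of _ "e powr (9/2)"]) (auto simp: d_def)
qed

text \<open>Terms of a convergent series tend to zero, which handles the dyadic levels; here the
  finiteness of \<open>q\<close> is essential, since the weak space gives mere boundedness.
  Monotonicity of the distribution function fills the gaps.\<close>

lemma lorentz_small_levels:
  assumes U: "lorentz (9/2) q U" and q: "q > 0" and e: "\<epsilon> > 0"
  shows "\<exists>\<beta>>0. \<forall>\<alpha>. 0 < \<alpha> \<longrightarrow> \<alpha> < \<beta> \<longrightarrow> distfun U \<alpha> \<le> ennreal (\<epsilon> * \<alpha> powr (-9/2))"
proof -
  define d where "d \<alpha> = enn2real (distfun U \<alpha>)" for \<alpha>
  have mono: "d \<alpha>' \<le> d \<alpha>" if "0 < \<alpha>" "\<alpha> \<le> \<alpha>'" for \<alpha> \<alpha>'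
    unfolding d_def by (rule lorentz_distfun_antimono[OF U that])
  define x where "x n = (1/2 :: real) ^ n" for n :: nat
  have x0: "x n > 0" for n by (simp add: x_def)
  have "summable (\<lambda>n. (x n / 2 * d (x n) powr (2/9)) powr q / 2)"
    using lorentz_dyadic_bound[OF U q] unfolding d_def x_def by blast
  then have lim: "(\<lambda>n. (x n / 2 * d (x n) powr (2/9)) powr q / 2) \<longlonglongrightarrow> 0" by (rule summable_LIMSEQ_zero)
  \<comment> \<open>The 4 pays for two factors 2: the half in the dyadic term, and the comparison of
    \<open>\<alpha>\<close> with the next lower power of 1/2.\<close>
  define \<eta> where "\<eta> = \<epsilon> powr (2/9) / 4"
  have \<eta>: "\<eta> > 0" using e by (simp add: \<eta>_def)
  have "\<eta> powr q / 2 > 0" using \<eta> by simp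
  from order_tendstoD(2)[OF lim this]
  obtain N where N: "\<And>n. n \<ge> N \<Longrightarrow> (x n / 2 * d (x n) powr (2/9)) powr q / 2 < \<eta> powr q / 2"
    unfolding eventually_sequentially by blast
  have small: "x n * d (x n) powr (2/9) \<le> 2 * \<eta>" if "n \<ge> N" for n
  proof (rule ccontr)
    assume "\<not> ?thesis"
    then have "\<eta> \<le> x n / 2 * d (x n) powr (2/9)" by simp
    then have "\<eta> powr q \<le> (x n / 2 * d (x n) powr (2/9)) powr q" using \<eta> q by (intro powr_mono2) auto
    then show False using N[OF that] by simp
  qed
  have main: "\<alpha> * d \<alpha> powr (2/9) \<le> \<epsilon> powr (2/9)" if a: "0 < \<alpha>" "\<alpha> < x N" for \<alpha>
  proof -
    define P where "P n \<longleftrightarrow> x n \<le> \<alpha>" for n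
    have "\<exists>n. P n"
    proof -
      obtain n where "(1/2 :: real) ^ n < \<alpha>" using real_arch_pow_inv[OF a(1), of "1/2"] by auto
      then show ?thesis unfolding P_def x_def by (auto intro: less_imp_le)
    qed
    define n where "n = (LEAST n. P n)"
    have Pn: "P n" unfolding n_def by (rule LeastI_ex[OF \<open>\<exists>n. P n\<close>])
    have nN: "n > N"
    proof (rule ccontr)
      assume "\<not> n > N"
      then have "x N \<le> x n" unfolding x_def by (intro power_decreasing) auto
      then show False using Pn a by (simp add: P_def)
    qed
    then obtain m where m: "n = Suc m" by (cases n) auto
    then have "\<not> P m" using not_less_Least[of m P] by (simp add: n_def)
    then have "\<alpha> \<le> 2 * x n" by (simp add: P_def m x_def)
    moreover have "d \<alpha> powr (2/9) \<le> d (x n) powr (2/9)"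
      using mono[OF x0[of n], of \<alpha>] Pn by (intro powr_mono2) (auto simp: P_def d_def)
    ultimately have "\<alpha> * d \<alpha> powr (2/9) \<le> 2 * x n * d (x n) powr (2/9)"
      using a x0[of n] by (intro mult_mono) auto
    also have "\<dots> \<le> 4 * \<eta>" using small[of n] nN by simp
    finally show ?thesis by (simp add: \<eta>_def)
  qed
  show ?thesis
  proof (intro exI[of _ "x N"] conjI allI impI x0)
    fix \<alpha> assume "0 < \<alpha>" "\<alpha> < x N"
    from distfun_from_product[OF U this(1) main[OF this, unfolded d_def]]
    show "distfun U \<alpha> \<le> ennreal (\<epsilon> * \<alpha> powr (-9/2))" using e by (simp add: powr_powr)
  qed
qed

text \<open>Only this consequence of the Lorentz hypothesis is used. Levels are split at a small \<open>t\<close>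
  comparable to \<open>n\<^sup>-\<^sup>2\<close> and at a fixed \<open>\<beta>\<close> below which the distribution function is small.\<close>
lemma lorentz_growth:
  assumes U: "lorentz (9/2) q U" and q: "q > 0" and e: "\<epsilon> > 0"
  shows "\<exists>L. \<forall>n\<ge>L. (\<integral>\<^sup>+x. indicator (cball 0 (12 * n ^ 3)) x * ennreal (norm (U x) ^ 4) \<partial>lebesgue) \<le> ennreal (\<epsilon> * n)"
proof -
  have Um[measurable]: "U \<in> borel_measurable lebesgue" using U unfolding lorentz_def by simp
  note c = layer_const_pos
  define V where "V x = norm (U x)" for x
  have Vm[measurable]: "V \<in> borel_measurable lebesgue" unfolding V_def by measurable
  have dist: "emeasure lebesgue {x. V x > \<alpha>} = distfun U \<alpha>" for \<alpha> by (simp add: distfun_def V_def)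
  \<comment> \<open>The ball of radius \<open>12 * n ^ 3\<close> has volume
    \<open>\<kappa> * n ^ 9\<close>, so levels below \<open>t = \<tau> / n\<^sup>2\<close>
    contribute at most \<open>\<kappa> * \<tau> ^ 4 * n\<close>.\<close>
  define \<kappa> where "\<kappa> = unit_ball_vol 3 * 12 ^ 3"
  have \<kappa>: "\<kappa> > 0" by (simp add: \<kappa>_def)
  define \<tau> where "\<tau> = min 1 (\<epsilon> / (3 * \<kappa>))"
  have \<tau>: "\<tau> > 0" "\<tau> \<le> 1" using e \<kappa> by (auto simp: \<tau>_def)
  have \<tau>4: "\<kappa> * \<tau> ^ 4 \<le> \<epsilon> / 3"
  proof -
    have "\<tau> ^ 4 \<le> \<tau> ^ 1" using \<tau> by (intro power_decreasing) auto
    then have "\<kappa> * \<tau> ^ 4 \<le> \<kappa> * (\<epsilon> / (3 * \<kappa>))" using \<kappa> by (intro mult_left_mono) (auto simp: \<tau>_def)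
    then show ?thesis using \<kappa> by simp
  qed
  \<comment> \<open>With \<open>t powr (-1/2) = \<tau> powr (-1/2) * n\<close>, the middle levels
    contribute exactly \<open>\<epsilon> / 3 * n\<close>.\<close>
  define e' where "e' = \<epsilon> / 3 / (layer_const * \<tau> powr (-1/2))"
  have e': "e' > 0" using e c \<tau> by (simp add: e'_def)
  obtain \<beta> where \<beta>: "\<beta> > 0" "\<And>\<alpha>. 0 < \<alpha> \<Longrightarrow> \<alpha> < \<beta> \<Longrightarrow> distfun U \<alpha> \<le> ennreal (e' * \<alpha> powr (-9/2))"
    using lorentz_small_levels[OF U q e'] by blast
  obtain B where B: "B \<ge> 0" "\<And>\<alpha>. \<alpha> > 0 \<Longrightarrow> distfun U \<alpha> \<le> ennreal (B * \<alpha> powr (-9/2))"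
    using lorentz_weak_bound[OF U q] by blast
  define M where "M = B * layer_const * \<beta> powr (-1/2)"
  have M: "M \<ge> 0" using B c by (simp add: M_def)
  show ?thesis
  proof (intro exI[of _ "max 1 (3 * M / \<epsilon>)"] allI impI)
    fix n assume "max 1 (3 * M / \<epsilon>) \<le> n"
    then have n: "n \<ge> 1" "M \<le> \<epsilon> / 3 * n" using e by (auto simp: field_simps)
    define t where "t = \<tau> / n\<^sup>2"
    have t: "t > 0" using \<tau> n by (simp add: t_def)
    \<comment> \<open>Truncation at \<open>\<beta>\<close> empties all higher level sets, so the
      bound known below \<open>\<beta>\<close> holds at every level from \<open>t\<close> on, as
      \<open>dyadic_layers\<close> demands.\<close>
    define V' where "V' x = min (V x) \<beta>" for x
    have V'm: "V' \<in> borel_measurable lebesgue" unfolding V'_def[abs_def] by measurable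
    define C where "C = cball (0::R3) (12 * n ^ 3)"
    have Cm: "C \<in> sets lebesgue" by (simp add: C_def)
    have S1: "{x. V' x > t} \<in> sets lebesgue" "{x. V x > \<beta>} \<in> sets lebesgue"
      using borel_measurable_less[of "\<lambda>_. t" lebesgue V'] borel_measurable_less[of "\<lambda>_. \<beta>" lebesgue V] V'm Vm by (auto simp: pred_def)
    have 1: "(\<integral>\<^sup>+x. ennreal (t ^ 4) * indicator C x \<partial>lebesgue) \<le> ennreal (\<epsilon> / 3 * n)"
    proof -
      have "emeasure lebesgue C = ennreal (unit_ball_vol 3 * (12 * n ^ 3) ^ 3)"
        unfolding C_def using n emeasure_cball[of "12 * n ^ 3" "0::R3"] by simp
      then have "(\<integral>\<^sup>+x. ennreal (t ^ 4) * indicator C x \<partial>lebesgue) = ennreal (t ^ 4) * ennreal (unit_ball_vol 3 * (12 * n ^ 3) ^ 3)"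
        using Cm by (simp add: nn_integral_cmult_indicator)
      also have "\<dots> = ennreal (t ^ 4 * (unit_ball_vol 3 * (12 * n ^ 3) ^ 3))"
        by (rule ennreal_mult'[symmetric]) simp
      also have "t ^ 4 * (unit_ball_vol 3 * (12 * n ^ 3) ^ 3) = \<kappa> * \<tau> ^ 4 * n"
      proof -
        have "(n\<^sup>2) ^ 4 * n = (n ^ 3) ^ 3" by (simp add: power_mult[symmetric] power_Suc2[symmetric] del: power_Suc)
        then have "(n ^ 3) ^ 3 / (n\<^sup>2) ^ 4 = n" using n by (simp add: nonzero_divide_eq_eq mult.commute)
        moreover have "t ^ 4 * (unit_ball_vol 3 * (12 * n ^ 3) ^ 3) = \<kappa> * \<tau> ^ 4 * ((n ^ 3) ^ 3 / (n\<^sup>2) ^ 4)"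
          by (simp add: t_def \<kappa>_def power_divide power_mult_distrib)
        ultimately show ?thesis by simp
      qed
      also have "ennreal (\<kappa> * \<tau> ^ 4 * n) \<le> ennreal (\<epsilon> / 3 * n)" using \<tau>4 n by (intro ennreal_leI mult_right_mono) auto
      finally show ?thesis .
    qed
    have 2: "(\<integral>\<^sup>+x. ennreal ((V' x) ^ 4) * indicator {x. V' x > t} x \<partial>lebesgue) \<le> ennreal (\<epsilon> / 3 * n)"
    proof -
      have "(\<integral>\<^sup>+x. ennreal ((V' x) ^ 4) * indicator {x. V' x > t} x \<partial>lebesgue) \<le> ennreal (e' * layer_const * t powr (-1/2))"
      proof (rule dyadic_layers[OF V'm t])
        show "emeasure lebesgue {x. V' x > \<alpha>} \<le> ennreal (e' * \<alpha> powr (-9/2))" if "\<alpha> \<ge> t" for \<alpha>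
        proof (cases "\<alpha> < \<beta>")
          case True
          then have "{x. V' x > \<alpha>} = {x. V x > \<alpha>}" by (auto simp: V'_def)
          then show ?thesis using \<beta>(2)[of \<alpha>] True that t by (simp add: dist)
        next
          case False
          then have "{x. V' x > \<alpha>} = {}" by (auto simp: V'_def)
          then show ?thesis by simp
        qed
      qed (use e' in auto)
      also have "t powr (-1/2) = \<tau> powr (-1/2) * n"
      proof -
        have "n\<^sup>2 = n powr 2" using n by simp
        then have "(n\<^sup>2) powr (-1/2) = n powr (-1)" by (simp only: powr_powr) simp
        also have "\<dots> = 1 / n" using n by (simp add: powr_minus_divide)
        finally have "(n\<^sup>2) powr (-1/2) = 1 / n" .
        then show ?thesis unfolding t_def using \<tau> n by (simp add: powr_divide)
      qed
      also have "e' * layer_const * (\<tau> powr (-1/2) * n) = \<epsilon> / 3 * n"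
        using c \<tau> by (simp add: e'_def)
      finally show ?thesis .
    qed
    have 3: "(\<integral>\<^sup>+x. ennreal ((V x) ^ 4) * indicator {x. V x > \<beta>} x \<partial>lebesgue) \<le> ennreal (\<epsilon> / 3 * n)"
    proof -
      have "(\<integral>\<^sup>+x. ennreal ((V x) ^ 4) * indicator {x. V x > \<beta>} x \<partial>lebesgue) \<le> ennreal M"
        unfolding M_def by (rule dyadic_layers[OF Vm \<beta>(1) B(1)]) (use B(2) \<beta>(1) in \<open>auto simp: dist\<close>)
      also have "\<dots> \<le> ennreal (\<epsilon> / 3 * n)" by (rule ennreal_leI[OF n(2)])
      finally show ?thesis .
    qed
    have pw: "indicator C x * ennreal (V x ^ 4) \<le> ennreal (t ^ 4) * indicator C x + ennreal ((V' x) ^ 4) * indicator {x. V' x > t} x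
      + ennreal ((V x) ^ 4) * indicator {x. V x > \<beta>} x" for x
    proof -
      consider "V x \<le> t" | "V x > \<beta>" | "t < V x" "V x \<le> \<beta>" by linarith
      then show ?thesis
      proof cases
        case 1
        then have "V x ^ 4 \<le> t ^ 4" by (intro power_mono) (auto simp: V_def)
        then have "indicator C x * ennreal (V x ^ 4) \<le> ennreal (t ^ 4) * indicator C x"
          by (auto simp: indicator_def intro!: ennreal_leI)
        then show ?thesis by (simp add: add.assoc add_increasing2)
      next
        case 2
        then have "indicator C x * ennreal (V x ^ 4) \<le> ennreal ((V x) ^ 4) * indicator {x. V x > \<beta>} x" by (simp add: indicator_def)
        then show ?thesis by (simp add: add_increasing)
      next
        case 3
        then have "indicator C x * ennreal (V x ^ 4) \<le> ennreal ((V' x) ^ 4) * indicator {x. V' x > t} x"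
          using t by (auto simp: indicator_def V'_def min_def)
        then show ?thesis by (simp add: add.assoc add_increasing add_increasing2)
      qed
    qed
    have "(\<integral>\<^sup>+x. indicator C x * ennreal (V x ^ 4) \<partial>lebesgue) \<le>
      (\<integral>\<^sup>+x. (ennreal (t ^ 4) * indicator C x + ennreal ((V' x) ^ 4) * indicator {x. V' x > t} x)
      + ennreal ((V x) ^ 4) * indicator {x. V x > \<beta>} x \<partial>lebesgue)" by (rule nn_integral_mono) (rule pw)
    also have "\<dots> = (\<integral>\<^sup>+x. ennreal (t ^ 4) * indicator C x \<partial>lebesgue) + (\<integral>\<^sup>+x. ennreal ((V' x) ^ 4) * indicator {x. V' x > t} x \<partial>lebesgue)
      + (\<integral>\<^sup>+x. ennreal ((V x) ^ 4) * indicator {x. V x > \<beta>} x \<partial>lebesgue)"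
    proof -
      have m: "(\<lambda>x. ennreal (t ^ 4) * indicator C x) \<in> borel_measurable lebesgue"
        "(\<lambda>x. ennreal ((V' x) ^ 4) * indicator {x. V' x > t} x) \<in> borel_measurable lebesgue"
        "(\<lambda>x. ennreal ((V x) ^ 4) * indicator {x. V x > \<beta>} x) \<in> borel_measurable lebesgue"
        using V'm Cm S1 by measurable
      show ?thesis by (simp only: nn_integral_add[OF borel_measurable_add[OF m(1,2)] m(3)] nn_integral_add[OF m(1,2)])
    qed
    also have "\<dots> \<le> ennreal (\<epsilon> / 3 * n) + ennreal (\<epsilon> / 3 * n) + ennreal (\<epsilon> / 3 * n)" by (intro add_mono 1 2 3)
    also have "\<dots> = ennreal (\<epsilon> * n)" using e n by (simp add: ennreal_plus[symmetric] del: ennreal_plus)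
    finally show "(\<integral>\<^sup>+x. indicator (cball 0 (12 * n ^ 3)) x * ennreal (norm (U x) ^ 4) \<partial>lebesgue) \<le> ennreal (\<epsilon> * n)"
      by (simp add: C_def V_def)
  qed
qed

section \<open>Borel representatives and the conclusion\<close>

lemma integral_lebesgue_borel_AE:
  fixes f h :: "R3 \<Rightarrow> real"
  assumes "f \<in> borel_measurable lebesgue" "h \<in> borel_measurable borel" "AE x in lborel. f x = h x"
  shows "(\<integral>x. f x \<partial>lebesgue) = (\<integral>x. h x \<partial>lborel)"
proof -
  have "(\<integral>x. f x \<partial>lebesgue) = (\<integral>x. h x \<partial>lebesgue)"
    by (rule integral_cong_AE) (use assms in \<open>auto simp: measurable_completion AE_completion\<close>)
  also have "\<dots> = (\<integral>x. h x \<partial>lborel)" using assms(2) by (simp add: integral_completion)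
  finally show ?thesis .
qed

theorem theorem1:
  fixes U :: "R3 \<Rightarrow> R3" and P :: "(R3 \<Rightarrow> real) \<Rightarrow> real" and q :: real
  assumes "stationary_NS_weak U P"
    and "9/2 \<le> q"
    and "lorentz (9/2) q U"
  shows "AE x in lebesgue. U x = 0"
proof -
  have q: "q > 0" using assms(2) by simp
  have Um: "U \<in> borel_measurable lebesgue" using assms(3) unfolding lorentz_def by simp
  have Uj: "(\<lambda>x. U x $ j) \<in> borel_measurable lebesgue" for j
    by (rule measurable_compose[OF Um]) (intro borel_measurable_continuous_onI continuous_intros)
  \<comment> \<open>The solution is only Lebesgue measurable, whereas convolution and Tonelli
    arguments above use Borel functions; changing it on a null set affects neither integrals nor the
    conclusion.\<close>
  have "\<exists>v. v \<in> borel_measurable borel \<and> (AE x in lborel. U x $ j = v x)" for j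
    using completion_ex_borel_measurable_real[OF Uj[of j]] by auto
  then obtain V where Vm: "\<And>j. V j \<in> borel_measurable borel" and VU: "\<And>j. AE x in lborel. U x $ j = V j x" by metis
  note [measurable] = Vm
  have growth: "(\<integral>\<^sup>+x. ennreal (indicator (cball 0 R) x * (V j x) ^ 4) \<partial>lborel)
      \<le> (\<integral>\<^sup>+x. indicator (cball 0 R) x * ennreal (norm (U x) ^ 4) \<partial>lebesgue)" for R j
  proof -
    have "(\<integral>\<^sup>+x. ennreal (indicator (cball 0 R) x * (V j x) ^ 4) \<partial>lborel) = (\<integral>\<^sup>+x. ennreal (indicator (cball 0 R) x * (V j x) ^ 4) \<partial>lebesgue)"
      by (simp add: nn_integral_completion)
    also have "\<dots> \<le> (\<integral>\<^sup>+x. indicator (cball 0 R) x * ennreal (norm (U x) ^ 4) \<partial>lebesgue)"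
    proof (rule nn_integral_mono_AE)
      show "AE x in lebesgue. ennreal (indicator (cball 0 R) x * (V j x) ^ 4) \<le> indicator (cball 0 R) x * ennreal (norm (U x) ^ 4)"
        using AE_completion[OF VU[of j]]
      proof eventually_elim
        case (elim x)
        have "(V j x) ^ 4 \<le> norm (U x) ^ 4"
          using power_mono[OF component_le_norm_cart[of "U x" j], of 4] elim by (simp add: power_even_abs)
        then show ?case by (auto simp: indicator_def intro!: ennreal_leI)
      qed
    qed
    finally show ?thesis .
  qed
  have m4: "(\<lambda>x. indicator (cball 0 R) x * (V j x) ^ 4) \<in> borel_measurable lborel" for R j
    by (intro borel_measurable_times borel_measurable_indicator borel_measurable_power) (auto simp: Vm)
  have i4: "integrable lborel (\<lambda>x. indicator (cball 0 R) x * (V j x) ^ 4)" for R j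
  proof (rule integrableI_nonneg[OF m4])
    \<comment> \<open>The growth bound with constant 1 already gives local integrability, since
      every ball lies in one of radius \<open>12 * n ^ 3\<close>.\<close>
    obtain L where L: "\<And>n. n \<ge> L \<Longrightarrow> (\<integral>\<^sup>+x. indicator (cball 0 (12 * n ^ 3)) x * ennreal (norm (U x) ^ 4) \<partial>lebesgue) \<le> ennreal (1 * n)"
      using lorentz_growth[OF assms(3) q, of 1] by auto
    define n where "n = max L (max 1 R)"
    have n: "n \<ge> L" "n \<ge> 1" "n \<ge> R" by (auto simp: n_def)
    have "n ^ 1 \<le> n ^ 3" using n by (intro power_increasing) auto
    then have "R \<le> 12 * n ^ 3" using n by simp
    then have "(\<integral>\<^sup>+x. ennreal (indicator (cball 0 R) x * (V j x) ^ 4) \<partial>lborel) \<le> (\<integral>\<^sup>+x. ennreal (indicator (cball 0 (12 * n ^ 3)) x * (V j x) ^ 4) \<partial>lborel)"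
      by (intro nn_integral_mono) (auto simp: indicator_def)
    also have "\<dots> \<le> ennreal (1 * n)" by (rule order_trans[OF growth L[OF n(1)]])
    also have "\<dots> < \<infinity>" by simp
    finally show "(\<integral>\<^sup>+x. ennreal (indicator (cball 0 R) x * (V j x) ^ 4) \<partial>lborel) < \<infinity>" .
  qed simp
  have sg: "slow_growth V" unfolding slow_growth_def
  proof (intro allI impI)
    fix \<epsilon> :: real assume e: "\<epsilon> > 0"
    obtain L where L: "\<And>n. n \<ge> L \<Longrightarrow> (\<integral>\<^sup>+x. indicator (cball 0 (12 * n ^ 3)) x * ennreal (norm (U x) ^ 4) \<partial>lebesgue) \<le> ennreal (\<epsilon> * n)"
      using lorentz_growth[OF assms(3) q e] by blast
    show "\<exists>L. \<forall>n\<ge>L. \<forall>j. (\<integral>x. indicator (cball 0 (12 * n ^ 3)) x * (V j x) ^ 4 \<partial>lborel) \<le> \<epsilon> * n"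
    proof (intro exI[of _ "max L 0"] allI impI)
      fix n j assume n: "max L 0 \<le> n"
      have "ennreal (\<integral>x. indicator (cball 0 (12 * n ^ 3)) x * (V j x) ^ 4 \<partial>lborel) = (\<integral>\<^sup>+x. ennreal (indicator (cball 0 (12 * n ^ 3)) x * (V j x) ^ 4) \<partial>lborel)"
        by (rule nn_integral_eq_integral[symmetric, OF i4]) simp
      also have "\<dots> \<le> ennreal (\<epsilon> * n)" by (rule order_trans[OF growth L]) (use n in simp)
      finally show "(\<integral>x. indicator (cball 0 (12 * n ^ 3)) x * (V j x) ^ 4 \<partial>lborel) \<le> \<epsilon> * n"
        using e n by (subst (asm) ennreal_le_iff) auto
    qed
  qed
  have conv1: "(\<integral>x. U x $ i * f x \<partial>lebesgue) = (\<integral>x. V i x * f x \<partial>lborel)" if "smooth_fun f" for i f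
  proof (rule integral_lebesgue_borel_AE)
    have fm: "f \<in> borel_measurable borel" by (rule smooth_fun_measurable[OF that])
    show "(\<lambda>x. U x $ i * f x) \<in> borel_measurable lebesgue" using Uj fm by (intro borel_measurable_times) (auto simp: measurable_completion)
    show "(\<lambda>x. V i x * f x) \<in> borel_measurable borel" using fm by measurable
    show "AE x in lborel. U x $ i * f x = V i x * f x" using VU[of i] by eventually_elim simp
  qed
  have conv2: "(\<integral>x. U x $ i * U x $ j * f x \<partial>lebesgue) = (\<integral>x. V i x * V j x * f x \<partial>lborel)" if "smooth_fun f" for i j f
  proof (rule integral_lebesgue_borel_AE)
    have fm: "f \<in> borel_measurable borel" by (rule smooth_fun_measurable[OF that])
    show "(\<lambda>x. U x $ i * U x $ j * f x) \<in> borel_measurable lebesgue" using Uj fm by (intro borel_measurable_times) (auto simp: measurable_completion)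
    show "(\<lambda>x. V i x * V j x * f x) \<in> borel_measurable borel" using fm by measurable
    show "AE x in lborel. U x $ i * U x $ j * f x = V i x * V j x * f x" using VU[of i] VU[of j] by eventually_elim simp
  qed
  have slap: "smooth_fun (laplacian f)" if "smooth_fun f" for f
    unfolding laplacian_def[abs_def] using that by (auto intro!: smooth_sum smooth_fun_pd)
  have mom: "momentum V j \<psi> = - P (pd j \<psi>)" if t: "test_fun \<psi>" for j \<psi>
  proof -
    note s = test_fun_smooth[OF t]
    have "(\<integral>x. U x $ j * (- laplacian \<psi> x) \<partial>lebesgue) - (\<Sum>i\<in>UNIV. \<integral>x. U x $ i * U x $ j * pd i \<psi> x \<partial>lebesgue) - P (pd j \<psi>) = 0"
      using assms(1) t unfolding stationary_NS_weak_def by blast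
    then show ?thesis
      using conv1[OF slap[OF s], of j] conv2[OF smooth_fun_pd[OF s], of _ j] by (simp add: momentum_def)
  qed
  have "weak_NS V" unfolding weak_NS_def
  proof (intro conjI allI impI Vm i4)
    fix \<psi> :: "R3 \<Rightarrow> real" assume t: "test_fun \<psi>"
    note s = test_fun_smooth[OF t]
    have "(\<Sum>i\<in>UNIV. \<integral>x. U x $ i * pd i \<psi> x \<partial>lebesgue) = 0"
      using assms(1) t unfolding stationary_NS_weak_def by blast
    then show "(\<Sum>i\<in>UNIV. \<integral>x. V i x * pd i \<psi> x \<partial>lborel) = 0" by (simp add: conv1[OF smooth_fun_pd[OF s]])
    obtain r where r: "\<And>x. norm x > r \<Longrightarrow> \<psi> x = 0" using test_fun_bounded_support[OF t] by blast
    have tp: "test_fun (pd k \<psi>)" for k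
      by (rule test_funI[OF smooth_fun_pd[OF s] pd_outside[of r]]) (auto simp: r)
    \<comment> \<open>Both sides are minus the pressure applied to the same mixed second derivative
      of \<open>\<psi>\<close>.\<close>
    show "momentum V j (pd k \<psi>) = momentum V k (pd j \<psi>)" for j k
      unfolding mom[OF tp] pd_commute[OF s, of j k] by simp
  qed
  note V0 = liouville[OF this sg]
  have "AE x in lborel. U x $ j = 0" for j
    using VU[of j] V0[of j] by eventually_elim simp
  then have "AE x in lborel. \<forall>j. U x $ j = 0" by (subst AE_all_countable) simp
  then have "AE x in lborel. U x = 0" by (simp add: vec_eq_iff)
  then show ?thesis by (rule AE_completion)
qed

end
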